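(* Let $\kappa\colon\mathbb{R}^n\to\mathbb{R}^n$ be a bounded smooth diffeomorphism that maps each of the sets $\partial\overline{\mathbb{R}^n_+}=\{x_n=0\}$ and $\mathbb{R}^n_+=\{x_n>0\}$ to itself. Let $m\in\mathbb{Z}$, $\tau>0$, $\tau\notin\mathbb{N}$, and let $p\in C^\tau S^m_{1,0}(\mathbb{R}^n\times\mathbb{R}^n)$ satisfy the transmission condition at $x_n=0$. Then the transformed symbol $\widetilde p\in C^\tau S^m_{1,0}(\mathbb{R}^n\times\mathbb{R}^n)$, given by $$\widetilde p(x,D_x)=\kappa^{-1,*}\,p(x,D_x)\,\kappa^*,\qquad \kappa^*f=f\circ\kappa,\quad \kappa^{-1,*}f=f\circ\kappa^{-1},$$ (as operators on $\mathcal{S}(\mathbb{R}^n)$) also satisfies the transmission condition at $x_n=0$.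
   Context: A smooth diffeomorphism $\kappa$ of $\mathbb{R}^n$ is a bounded smooth diffeomorphism if all derivatives (of order at least one) of $\kappa$ and $\kappa^{-1}$ are bounded. $C^\tau(\mathbb{R}^d)$ is the space of complex-valued functions with finite norm $\sum_{|\beta|\le[\tau]}\|\partial^\beta f\|_{L^\infty}+\sum_{|\beta|=[\tau]}\sup_{z\ne y}\frac{|\partial^\beta f(z)-\partial^\beta f(y)|}{|z-y|^{\tau-[\tau]}}$. $\langle\xi\rangle=(1+|\xi|^2)^{1/2}$. $C^\tau S^m_{1,0}(\mathbb{R}^n\times\mathbb{R}^n)$ is the set of $p\colon\mathbb{R}^n\times\mathbb{R}^n\to\mathbb{C}$ smooth in $\xi$ and $C^\tau$ in $x$ with $\|\partial_\xi^\alpha p(\cdot,\xi)\|_{C^\tau(\mathbb{R}^n)}\le C_\alpha\langle\xi\rangle^{m-|\alpha|}$ for all $\xi$ and all multi-indices $\alpha$. $(p(x,D_x)u)(x)=(2\pi)^{-n}\int e^{ix\cdot\xi}p(x,\xi)\widehat u(\xi)\,d\xi$ for $u\in\mathcal{S}(\mathbb{R}^n)$. For $\kappa$ and $p$ as in the claim (even without the transmission condition), a symbol $\widetilde p\in C^\tau S^m_{1,0}(\mathbb{R}^n\times\mathbb{R}^n)$ with $\widetilde p(x,D_x)=\kappa^{-1,*}p(x,D_x)\kappa^*$ exists. Transmission condition: write $x=(x',x_n)$, $\xi=(\xi',\xi_n)$, $D_\xi=-i\partial_\xi$. For $m\in\mathbb{Z}$, $p\in C^\tau S^m_{1,0}(\mathbb{R}^n\times\mathbb{R}^n)$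 satisfies the (global) transmission condition at $x_n=0$ if there are functions $s_{k,\alpha}(x',\xi')$, smooth in $\xi'\in\mathbb{R}^{n-1}$ and in $C^\tau$ with respect to $x'\in\mathbb{R}^{n-1}$, such that for any $\alpha\in\mathbb{N}^n$ and $l\in\mathbb{N}$ (with $0\in\mathbb{N}$) there is a constant $C_{l,\alpha}$ with $$\Big\|\xi_n^lD_\xi^\alpha p(\cdot,0,\xi)-\sum_{k=-l}^{m-|\alpha|}s_{k,\alpha}(\cdot,\xi')\xi_n^{k+l}\Big\|_{C^\tau(\mathbb{R}^{n-1})}\le C_{l,\alpha}\langle\xi'\rangle^{m+l+1-|\alpha|}|\xi_n|^{-1}\quad\text{when }|\xi_n|\ge\langle\xi'\rangle,$$ where $p(\cdot,0,\xi)$ denotes $x'\mapsto p((x',0),\xi)$. *)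

theory Defs
  imports "HOL-Analysis.Analysis"
begin

text \<open>
  Vectors in \<open>R^n\<close> have type \<open>real^'n\<close> (synonym \<open>'n rn\<close>, which keeps sort constraints
  short) with \<open>n = CARD('n)\<close>; the linear order on the
  index type is only used to name the last coordinate and to fix the order in which
  partial derivatives are iterated.

  To cover \<open>n = 1\<close>, where \<open>R^(n-1)\<close> is a single point, \<open>R^(n-1)\<close> is not a vector type of
  its own but the hyperplane of \<open>R^n\<close> on which the last coordinate vanishes. Thus \<open>x'\<close> is
  identified with \<open>(x',0)\<close>. More generally, \<open>coord_space I\<close> is the Euclidean space with
  coordinates in \<open>I\<close>, and every notion relative to \<open>I\<close> below depends only on the values of
  the function on \<open>coord_space I\<close> and on partial derivatives in the directions in \<open>I\<close>.
\<close>

type_synonym 'n rn = "(real, 'n) vec"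

definition last_coord :: "'n::{finite,linorder}" where
  "last_coord = Max UNIV"

definition coord_space :: "'n::finite set \<Rightarrow> ('n rn) set" where
  "coord_space I = {x. \<forall>i. i \<notin> I \<longrightarrow> x $ i = 0}"

abbreviation tan_coords :: "'n::{finite,linorder} set" where
  "tan_coords \<equiv> - {last_coord}"

definition tan_part :: "'n::{finite,linorder} rn \<Rightarrow> 'n rn" where
  "tan_part x = (\<chi> i. if i = last_coord then 0 else x $ i)"

definition pdiff :: "'n::finite \<Rightarrow> ('n rn \<Rightarrow> 'b::real_normed_vector) \<Rightarrow> 'n rn \<Rightarrow> 'b" where
  "pdiff i f x = vector_derivative (\<lambda>t. f (x + t *\<^sub>R axis i 1)) (at 0)"

definition pdiffable_at :: "'n::finite \<Rightarrow> ('n rn \<Rightarrow> 'b::real_normed_vector) \<Rightarrow> 'n rn \<Rightarrow> bool" where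
  "pdiffable_at i f x \<longleftrightarrow> (\<lambda>t. f (x + t *\<^sub>R axis i 1)) differentiable (at 0)"

type_synonym 'n multiindex = "'n \<Rightarrow> nat"

definition mi_order :: "'n::finite multiindex \<Rightarrow> nat" where
  "mi_order \<alpha> = (\<Sum>i\<in>UNIV. \<alpha> i)"

text \<open>The operator \<open>\<partial>\<^sub>1^\<alpha>\<^sub>1 \<dots> \<partial>\<^sub>n^\<alpha>\<^sub>n\<close>; it is only applied to functions for which
  the order of differentiation is immaterial.\<close>

definition mdiff :: "'n::{finite,linorder} multiindex \<Rightarrow>
    ('n rn \<Rightarrow> 'b::real_normed_vector) \<Rightarrow> 'n rn \<Rightarrow> 'b" where
  "mdiff \<alpha> f = foldr (\<lambda>i. pdiff i ^^ \<alpha> i) (sorted_list_of_set UNIV) f"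

primrec Ck_on :: "'n::finite set \<Rightarrow> nat \<Rightarrow> ('n rn \<Rightarrow> 'b::real_normed_vector) \<Rightarrow> bool" where
  "Ck_on I 0 f \<longleftrightarrow> continuous_on (coord_space I) f"
| "Ck_on I (Suc k) f \<longleftrightarrow> continuous_on (coord_space I) f \<and>
     (\<forall>i\<in>I. (\<forall>x\<in>coord_space I. pdiffable_at i f x) \<and> Ck_on I k (pdiff i f))"

definition smooth_on :: "'n::finite set \<Rightarrow> ('n rn \<Rightarrow> 'b::real_normed_vector) \<Rightarrow> bool" where
  "smooth_on I f \<longleftrightarrow> (\<forall>k. Ck_on I k f)"

text \<open>
  The \<open>C^\<tau>\<close> norm on \<open>coord_space I\<close>, with value \<open>\<infinity>\<close> for functions outside \<open>C^[\<tau>]\<close>. The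
  derivatives that occur are continuous, so their \<open>L^\<infinity>\<close> norms are plain suprema. The
  supremum of the empty set is 0 in \<open>ennreal\<close>, which is the right value of the Hoelder
  seminorm on a one-point space.
\<close>

definition holder_norm :: "'n::{finite,linorder} set \<Rightarrow> real \<Rightarrow> ('n rn \<Rightarrow> complex) \<Rightarrow> ennreal" where
  "holder_norm I \<tau> f =
     (let r = nat \<lfloor>\<tau>\<rfloor> in
      if Ck_on I r f then
        (\<Sum>\<beta> | (\<forall>i. i \<notin> I \<longrightarrow> \<beta> i = 0) \<and> mi_order \<beta> \<le> r.
           SUP x\<in>coord_space I. ennreal (cmod (mdiff \<beta> f x))) +
        (\<Sum>\<beta> | (\<forall>i. i \<notin> I \<longrightarrow> \<beta> i = 0) \<and> mi_order \<beta> = r.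
           SUP (z, y)\<in>{(z, y). z \<in> coord_space I \<and> y \<in> coord_space I \<and> z \<noteq> y}.
             ennreal (cmod (mdiff \<beta> f z - mdiff \<beta> f y) / norm (z - y) powr (\<tau> - real r)))
      else \<infinity>)"

definition holder_space :: "'n::{finite,linorder} set \<Rightarrow> real \<Rightarrow> ('n rn \<Rightarrow> complex) set" where
  "holder_space I \<tau> = {f. holder_norm I \<tau> f < \<infinity>}"

definition jap :: "'n::finite rn \<Rightarrow> real" where
  "jap \<xi> = sqrt (1 + (norm \<xi>)\<^sup>2)"

text \<open>The class \<open>C^\<tau> S^m_{1,0}\<close>; the arguments of a symbol are \<open>x\<close> and \<open>\<xi>\<close>, in this order.\<close>

definition symbol_class ::
    "real \<Rightarrow> real \<Rightarrow> ('n::{finite,linorder} rn \<Rightarrow> 'n rn \<Rightarrow> complex) set" where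
  "symbol_class \<tau> m = {p.
     (\<forall>x. smooth_on UNIV (p x)) \<and>
     (\<forall>\<xi>. (\<lambda>x. p x \<xi>) \<in> holder_space UNIV \<tau>) \<and>
     (\<forall>\<alpha>. \<exists>C. \<forall>\<xi>. holder_norm UNIV \<tau> (\<lambda>x. mdiff \<alpha> (p x) \<xi>)
        \<le> ennreal (C * jap \<xi> powr (m - real (mi_order \<alpha>))))}"

definition schwartz :: "('n::{finite,linorder} rn \<Rightarrow> complex) set" where
  "schwartz = {u. smooth_on UNIV u \<and>
     (\<forall>\<alpha> \<beta>. bounded (range (\<lambda>x. (\<Prod>i\<in>UNIV. (x $ i) ^ \<alpha> i) *\<^sub>R mdiff \<beta> u x)))}"

definition fourier :: "('n::finite rn \<Rightarrow> complex) \<Rightarrow> 'n rn \<Rightarrow> complex" where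
  "fourier u \<xi> = (LINT x|lborel. cis (- (x \<bullet> \<xi>)) * u x)"

definition psdo :: "('n::finite rn \<Rightarrow> 'n rn \<Rightarrow> complex) \<Rightarrow>
    ('n rn \<Rightarrow> complex) \<Rightarrow> 'n rn \<Rightarrow> complex" where
  "psdo p u x = (LINT \<xi>|lborel. cis (x \<bullet> \<xi>) * p x \<xi> * fourier u \<xi>) / (2 * pi) ^ CARD('n)"

definition D_mdiff :: "'n::{finite,linorder} multiindex \<Rightarrow> ('n rn \<Rightarrow> complex) \<Rightarrow> 'n rn \<Rightarrow> complex" where
  "D_mdiff \<alpha> f \<xi> = (- \<i>) ^ mi_order \<alpha> * mdiff \<alpha> f \<xi>"

definition transmission_condition ::
    "real \<Rightarrow> int \<Rightarrow> ('n::{finite,linorder} rn \<Rightarrow> 'n rn \<Rightarrow> complex) \<Rightarrow> bool" where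
  "transmission_condition \<tau> m p \<longleftrightarrow>
     (\<exists>s :: int \<Rightarrow> 'n multiindex \<Rightarrow> 'n rn \<Rightarrow> 'n rn \<Rightarrow> complex.
        (\<forall>k \<alpha>.
          (\<forall>x'\<in>coord_space tan_coords. smooth_on tan_coords (s k \<alpha> x')) \<and>
          (\<forall>\<xi>'\<in>coord_space tan_coords. (\<lambda>x'. s k \<alpha> x' \<xi>') \<in> holder_space tan_coords \<tau>)) \<and>
        (\<forall>\<alpha> (l::nat). \<exists>C. \<forall>\<xi>. \<bar>\<xi> $ last_coord\<bar> \<ge> jap (tan_part \<xi>) \<longrightarrow>
          holder_norm tan_coords \<tau>
            (\<lambda>x'. of_real (\<xi> $ last_coord) ^ l * D_mdiff \<alpha> (p x') \<xi>
               - (\<Sum>k = - int l..m - int (mi_order \<alpha>).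
                    s k \<alpha> x' (tan_part \<xi>) * of_real (\<xi> $ last_coord) powi (k + int l)))
          \<le> ennreal (C * jap (tan_part \<xi>) powi (m + int l + 1 - int (mi_order \<alpha>))
                       * inverse \<bar>\<xi> $ last_coord\<bar>)))"

definition bounded_smooth_diffeo :: "('n::{finite,linorder} rn \<Rightarrow> 'n rn) \<Rightarrow> bool" where
  "bounded_smooth_diffeo \<kappa> \<longleftrightarrow>
     bij \<kappa> \<and> smooth_on UNIV \<kappa> \<and> smooth_on UNIV (inv \<kappa>) \<and>
     (\<forall>\<alpha>. mi_order \<alpha> \<ge> 1 \<longrightarrow>
        bounded (range (mdiff \<alpha> \<kappa>)) \<and> bounded (range (mdiff \<alpha> (inv \<kappa>))))"

end

theory Submission
  imports Defs "HOL-Probability.Probability"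
begin

text \<open>
  Write \<open>e\<close> for the last unit vector. The transmission condition for \<open>p\<close> says exactly that, for
  every \<open>\<alpha>\<close>, the function \<open>t \<mapsto> D_\<xi>^\<alpha> p(x', 0, t e)\<close> has an asymptotic expansion in integer powers of
  \<open>t\<close>, the same for \<open>t \<rightarrow> \<infinity>\<close> and \<open>t \<rightarrow> -\<infinity>\<close>, with coefficients and remainders in \<open>C^\<tau>\<close>: one direction
  is \<open>\<xi>' = 0\<close>, and in the other Taylor's formula in \<open>\<xi>'\<close> produces functions \<open>s_(k,\<alpha>)\<close> that are
  polynomials in \<open>\<xi>'\<close>.

  The expansions are transported by testing the operator identity on
  \<open>u(v) = w^G exp(i t v_n) E(|w|^2 / 2)\<close>, where \<open>w = |t|^(1/2) (v - y)\<close>, \<open>y\<close> is a boundary point, and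
  \<open>E\<close> is a rapidly decreasing function that equals 1 to high order at 0. After Taylor expansion of
  the symbols about the frequency and Fourier inversion, the left side becomes
  \<open>D^G p_tilde(y, t e)\<close>. The right side becomes a finite sum of terms \<open>t^i g(y) D^L p(k(y), a(y) t e)\<close>
  with \<open>k = \<kappa>^-1\<close> and \<open>a = \<partial>_n \<kappa>_n \<circ> k\<close>. This uses that \<open>\<kappa>_n(k(y) + z) - a(y) z_n\<close> vanishes to second
  order at \<open>z = 0\<close>, so that the phase stays tame on the scale \<open>|t|^(-1/2)\<close>. The expansion of \<open>D^L p\<close>
  survives the substitution \<open>a(y) t\<close>, because Landau's inequality also makes the \<open>t\<close>-derivatives of its
  remainder small. All errors are \<open>O(|t|^-l)\<close> for arbitrary \<open>l\<close>.
\<close>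


section \<open>Partial derivatives\<close>

text \<open>Regularity in \<open>x\<close> is limited, so the usual asymptotics for a change of
  variables is avoided: \<open>y\<close> occurs only as a parameter, every estimate is one in a
  Hoelder ball in \<open>y\<close>, and all differentiations take place in \<xi> and
  \<open>w\<close>. The scale |t|^(-1/2) is forced from two sides. The product of \<open>t\<close>
  with a second order term stays bounded only for displacements up to |t|^(-1/2). The dual
  frequencies then have size |t|^(1/2), so each further term in the Taylor expansion of a symbol
  gains |t|^(-1) from the derivative and pays |t|^(1/2). Letting \<open>y\<close> enter the
  frequency as a(y) t costs a factor |t| for each derivative in \<open>y\<close> and one for the
  Hoelder quotient, altogether |t|^(r+1). This finite loss is harmless since all expansions are
  available to arbitrary order. Expansions of different orders arrive with unrelated coefficients,
  whereas the transmission condition asks for one family \<open>s\<close>; they are glued by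
  uniqueness of the coefficients of powers of \<open>t\<close>. Fourier inversion is needed at the
  origin only, where the flat cutoff is invisible, so both sides are finite sums of derivatives plus
  a remainder.\<close>

abbreviation pds :: "'n::finite list \<Rightarrow> ('n rn \<Rightarrow> 'b::real_normed_vector) \<Rightarrow> 'n rn \<Rightarrow> 'b" where
  "pds L f \<equiv> foldr pdiff L f"

lemma norm_diff_le_of_vector_derivative:
  fixes g :: "real \<Rightarrow> 'b::real_normed_vector"
  assumes "\<And>t. t \<in> closed_segment a b \<Longrightarrow> (g has_vector_derivative g' t) (at t)"
    and "\<And>t. t \<in> closed_segment a b \<Longrightarrow> norm (g' t) \<le> B"
  shows "norm (g b - g a) \<le> B * \<bar>b - a\<bar>"
proof -
  have "norm (g b - g a) \<le> B * norm (b - a)"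
  proof (rule differentiable_bound[where S = "closed_segment a b" and f' = "\<lambda>t h. h *\<^sub>R g' t"])
    fix t assume t: "t \<in> closed_segment a b"
    show "(g has_derivative (\<lambda>h. h *\<^sub>R g' t)) (at t within closed_segment a b)"
      using assms(1)[OF t] unfolding has_vector_derivative_def by (rule has_derivative_at_withinI)
    show "onorm (\<lambda>h. h *\<^sub>R g' t) \<le> B"
      using assms(2)[OF t] by (intro onorm_le) (simp add: mult.commute[of B] mult_left_mono)
  qed auto
  then show ?thesis by simp
qed

lemma pdiffable_at_iff:
  "pdiffable_at i f x \<longleftrightarrow> ((\<lambda>t. f (x + t *\<^sub>R axis i 1)) has_vector_derivative pdiff i f x) (at 0)"
  unfolding pdiffable_at_def pdiff_def using vector_derivative_works by blast

lemma pdiff_eqI: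
  assumes "((\<lambda>t. f (x + t *\<^sub>R axis i 1)) has_vector_derivative d) (at 0)"
  shows "pdiff i f x = d"
  using assms unfolding pdiff_def by (rule vector_derivative_at)

lemma pdiffable_atI:
  assumes "((\<lambda>t. f (x + t *\<^sub>R axis i 1)) has_vector_derivative d) (at 0)"
  shows "pdiffable_at i f x"
  using assms pdiff_eqI[OF assms] pdiffable_at_iff by metis

lemma pdiffable_at_line:
  assumes "pdiffable_at i f (x + t *\<^sub>R axis i 1)"
  shows "((\<lambda>t. f (x + t *\<^sub>R axis i 1)) has_vector_derivative pdiff i f (x + t *\<^sub>R axis i 1)) (at t)"
proof -
  have "((\<lambda>u. f ((x + t *\<^sub>R axis i 1) + u *\<^sub>R axis i 1)) has_vector_derivative
      pdiff i f (x + t *\<^sub>R axis i 1)) (at (t - t))"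
    using assms pdiffable_at_iff by auto
  then have "((\<lambda>u. f ((x + t *\<^sub>R axis i 1) + u *\<^sub>R axis i 1)) \<circ> (\<lambda>s. s - t) has_vector_derivative
      1 *\<^sub>R pdiff i f (x + t *\<^sub>R axis i 1)) (at t)"
    by (intro vector_diff_chain_at) (auto intro!: derivative_eq_intros)
  then show ?thesis by (simp add: o_def algebra_simps)
qed

text \<open>Chosen as the condition from which total differentiability is derived in
  \<open>pd1_has_derivative\<close>; all chain rules below rest on it.\<close>

definition pd1 :: "('n::finite rn \<Rightarrow> 'b::real_normed_vector) \<Rightarrow> bool" where
  "pd1 f \<longleftrightarrow> (\<forall>i x. pdiffable_at i f x) \<and> (\<forall>i. continuous_on UNIV (pdiff i f))"

lemma has_derivative_imp_pdiff:
  assumes "(f has_derivative f') (at x)"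
  shows "pdiffable_at i f x" "pdiff i f x = f' (axis i 1)"
proof -
  have 1: "((\<lambda>t. x + t *\<^sub>R axis i 1) has_derivative (\<lambda>t. t *\<^sub>R axis i 1)) (at 0)"
    by (auto intro!: derivative_eq_intros)
  have "((\<lambda>t. f (x + t *\<^sub>R axis i 1)) has_derivative (\<lambda>t. f' (t *\<^sub>R axis i 1))) (at 0)"
    using has_derivative_compose[OF 1, of f f'] assms by simp
  then have "((\<lambda>t. f (x + t *\<^sub>R axis i 1)) has_vector_derivative f' (axis i 1)) (at 0)"
    unfolding has_vector_derivative_def
    using linear.scaleR[OF has_derivative_linear[OF assms]] by simp
  then show "pdiffable_at i f x" "pdiff i f x = f' (axis i 1)"
    by (auto intro: pdiffable_atI pdiff_eqI)
qed

text \<open>The increment \<open>h\<close> is assembled one coordinate at a time. Each new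
  coordinate contributes a mean value estimate along its axis, and continuity of that partial
  derivative at \<open>x\<close> makes the error small.\<close>

lemma pd1_has_derivative:
  fixes f :: "'n::finite rn \<Rightarrow> 'b::real_normed_vector"
  assumes "pd1 f"
  shows "(f has_derivative (\<lambda>h. \<Sum>i\<in>UNIV. h $ i *\<^sub>R pdiff i f x)) (at x)"
proof -
  have diff: "pdiffable_at i f x" and cont: "continuous_on UNIV (pdiff i f)" for i x
    using assms unfolding pd1_def by auto
  define res where "res S h = (\<Sum>i\<in>S. (h $ i) *\<^sub>R axis i (1::real))" for S :: "'n set" and h :: "'n rn"
  have res_norm: "norm (res S h) \<le> real (card S) * norm h" for S h
  proof -
    have "norm (res S h) \<le> (\<Sum>i\<in>S. norm ((h $ i) *\<^sub>R axis i (1::real)))"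
      unfolding res_def by (rule norm_sum)
    also have "\<dots> \<le> (\<Sum>i\<in>S. norm h)"
      by (intro sum_mono) (simp add: norm_axis_1 component_le_norm_cart norm_bound_component_le_cart)
    finally show ?thesis by simp
  qed
  have key: "\<forall>e>0. \<exists>d>0. \<forall>h. norm h < d \<longrightarrow>
      norm (f (x + res S h) - f x - (\<Sum>i\<in>S. h $ i *\<^sub>R pdiff i f x)) \<le> e * norm h" for S
  proof (induction S rule: infinite_finite_induct)
    case (insert j S)
    show ?case
    proof (intro allI impI)
      fix e :: real assume e: "e > 0"
      then have e2: "e/2 > 0" by simp
      from insert(3)[rule_format, OF e2] obtain d1 where d1: "d1 > 0"
        "\<And>h. norm h < d1 \<Longrightarrow> norm (f (x + res S h) - f x - (\<Sum>i\<in>S. h $ i *\<^sub>R pdiff i f x)) \<le> e/2 * norm h"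
        by blast
      have "isCont (pdiff j f) x" using cont[of j] by (simp add: continuous_on_eq_continuous_at)
      then obtain d2 where d2: "d2 > 0" "\<And>y. dist y x < d2 \<Longrightarrow> dist (pdiff j f y) (pdiff j f x) < e/2"
        using e2 unfolding continuous_at_eps_delta by blast
      \<comment> \<open>All points on the new axis segment lie within
        \<open>(card S + 1) * norm h\<close> of \<open>x\<close>, hence inside the ball of radius
        \<open>d2\<close>.\<close>
      define d where "d = min d1 (d2 / (real (card S) + 2))"
      have "d > 0" unfolding d_def using d1(1) d2(1) by auto
      moreover have "norm (f (x + res (insert j S) h) - f x - (\<Sum>i\<in>insert j S. h $ i *\<^sub>R pdiff i f x)) \<le> e * norm h"
        if h: "norm h < d" for h
      proof -
        let ?y = "x + res S h"
        have rj: "res (insert j S) h = res S h + (h $ j) *\<^sub>R axis j 1"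
          unfolding res_def using insert by (simp add: add.commute)
        define g where "g t = f (?y + t *\<^sub>R axis j 1) - t *\<^sub>R pdiff j f x" for t
        have "norm (g (h $ j) - g 0) \<le> (e/2) * \<bar>h $ j - 0\<bar>"
        proof (rule norm_diff_le_of_vector_derivative[where g' = "\<lambda>t. pdiff j f (?y + t *\<^sub>R axis j 1) - pdiff j f x"])
          fix t assume t: "t \<in> closed_segment 0 (h $ j)"
          show "(g has_vector_derivative pdiff j f (?y + t *\<^sub>R axis j 1) - pdiff j f x) (at t)"
            unfolding g_def using pdiffable_at_line[OF diff]
            by (auto intro!: derivative_eq_intros)
          have "\<bar>t\<bar> \<le> \<bar>h $ j\<bar>" using t by (auto simp: closed_segment_eq_real_ivl split: if_splits)
          then have tn: "\<bar>t\<bar> \<le> norm h" using component_le_norm_cart[of h j] by linarith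
          have "dist (?y + t *\<^sub>R axis j 1) x = norm (res S h + t *\<^sub>R axis j 1)"
            by (simp add: dist_norm)
          also have "\<dots> \<le> norm (res S h) + norm (t *\<^sub>R axis j (1::real) :: 'n rn)" by (rule norm_triangle_ineq)
          also have "\<dots> \<le> (real (card S) + 1) * norm h"
            using res_norm[of S h] tn by (simp add: norm_axis_1 algebra_simps)
          also have "\<dots> \<le> (real (card S) + 2) * norm h" by (intro mult_right_mono) auto
          also have "\<dots> < d2" using h unfolding d_def by (auto simp: field_simps)
          finally show "norm (pdiff j f (?y + t *\<^sub>R axis j 1) - pdiff j f x) \<le> e/2"
            using d2(2)[of "?y + t *\<^sub>R axis j 1"] by (simp add: dist_norm)
        qed
        also have "\<dots> \<le> (e/2) * norm h" using e component_le_norm_cart[of h j] by (intro mult_left_mono) auto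
        finally have 1: "norm (g (h $ j) - g 0) \<le> (e/2) * norm h" .
        have 2: "norm (f (x + res S h) - f x - (\<Sum>i\<in>S. h $ i *\<^sub>R pdiff i f x)) \<le> e/2 * norm h"
          using d1(2) h unfolding d_def by auto
        have "f (x + res (insert j S) h) - f x - (\<Sum>i\<in>insert j S. h $ i *\<^sub>R pdiff i f x)
          = (g (h $ j) - g 0) + (f (x + res S h) - f x - (\<Sum>i\<in>S. h $ i *\<^sub>R pdiff i f x))"
          using insert unfolding rj g_def by (simp add: algebra_simps)
        then have "norm (f (x + res (insert j S) h) - f x - (\<Sum>i\<in>insert j S. h $ i *\<^sub>R pdiff i f x))
          \<le> norm (g (h $ j) - g 0) + norm (f (x + res S h) - f x - (\<Sum>i\<in>S. h $ i *\<^sub>R pdiff i f x))"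
          by (simp only: norm_triangle_ineq)
        also have "\<dots> \<le> e/2 * norm h + e/2 * norm h" by (rule add_mono[OF 1 2])
        finally show ?thesis by simp
      qed
      ultimately show "\<exists>d>0. \<forall>h. norm h < d \<longrightarrow>
        norm (f (x + res (insert j S) h) - f x - (\<Sum>i\<in>insert j S. h $ i *\<^sub>R pdiff i f x)) \<le> e * norm h"
        by blast
    qed
  qed (auto simp: res_def gt_ex)
  have full: "res UNIV h = h" for h
    unfolding res_def by (simp add: vec_eq_iff axis_def if_distrib[of "\<lambda>c. _ * c"] cong: if_cong)
  show ?thesis
    unfolding has_derivative_at_alt
  proof (intro conjI allI impI)
    show "bounded_linear (\<lambda>h. \<Sum>i\<in>UNIV. h $ i *\<^sub>R pdiff i f x)"
      by (intro bounded_linear_sum bounded_linear_scaleR_const bounded_linear_vec_nth)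
    fix e :: real assume "e > 0"
    from key[of UNIV, rule_format, OF this] obtain d where d: "d > 0"
      "\<And>h. norm h < d \<Longrightarrow> norm (f (x + h) - f x - (\<Sum>i\<in>UNIV. h $ i *\<^sub>R pdiff i f x)) \<le> e * norm h"
      unfolding full by blast
    show "\<exists>d>0. \<forall>y. norm (y - x) < d \<longrightarrow>
      norm (f y - f x - (\<Sum>i\<in>UNIV. (y - x) $ i *\<^sub>R pdiff i f x)) \<le> e * norm (y - x)"
      using d(1) d(2)[of "y - x" for y] by (intro exI[of _ d] conjI) simp_all
  qed
qed

lemma pd1_continuous: "pd1 f \<Longrightarrow> continuous_on UNIV f"
  unfolding continuous_on_eq_continuous_at[OF open_UNIV]
  using has_derivative_continuous[OF pd1_has_derivative] by blast

text \<open>The second difference \<open>Dl\<close> is symmetric in the two directions, and divided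
  by \<open>h * h\<close> it approximates either mixed derivative by two nested mean value
  estimates.\<close>

lemma pdiff_commute:
  fixes f :: "'n::finite rn \<Rightarrow> 'b::real_normed_vector"
  assumes "pd1 f" "\<And>i. pd1 (pdiff i f)"
  shows "pdiff i (pdiff j f) x = pdiff j (pdiff i f) x"
proof -
  have diff: "pdiffable_at i f x" for i x
    using assms(1) unfolding pd1_def by auto
  have diff2: "pdiffable_at i (pdiff j f) x" and cont2: "continuous_on UNIV (pdiff i (pdiff j f))" for i j x
    using assms(2) unfolding pd1_def by auto
  define Dl where "Dl i j h = f (x + h *\<^sub>R axis i 1 + h *\<^sub>R axis j 1) - f (x + h *\<^sub>R axis i 1)
      - f (x + h *\<^sub>R axis j 1) + f x" for i j and h :: real
  have sym: "Dl i j h = Dl j i h" for i j h unfolding Dl_def by (simp add: algebra_simps)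
  have est: "\<exists>d>0. \<forall>h. 0 < h \<and> h < d \<longrightarrow> norm (Dl i j h - (h * h) *\<^sub>R pdiff i (pdiff j f) x) \<le> e * (h * h)"
    if e: "e > 0" for e i j
  proof -
    let ?D = "pdiff i (pdiff j f) x"
    have "isCont (pdiff i (pdiff j f)) x" using cont2 by (simp add: continuous_on_eq_continuous_at)
    then obtain d where d: "d > 0" "\<And>y. dist y x < d \<Longrightarrow> dist (pdiff i (pdiff j f) y) ?D < e"
      using e unfolding continuous_at_eps_delta by blast
    have "norm (Dl i j h - (h * h) *\<^sub>R ?D) \<le> e * (h * h)" if h: "0 < h" "h < d/2" for h
    proof -
      \<comment> \<open>Subtracting the expected value makes the derivative in \<open>t\<close>
        small; that derivative is estimated by the inner mean value argument for \<open>k\<close> in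
        the direction \<open>i\<close>.\<close>
      define g where "g t = f ((x + h *\<^sub>R axis i 1) + t *\<^sub>R axis j 1) - f (x + t *\<^sub>R axis j 1) - (t * h) *\<^sub>R ?D" for t
      have "norm (g h - g 0) \<le> (e * h) * \<bar>h - 0\<bar>"
      proof (rule norm_diff_le_of_vector_derivative)
        fix t assume t: "t \<in> closed_segment 0 h"
        then have t: "0 \<le> t" "t \<le> h" using h by (auto simp: closed_segment_eq_real_ivl)
        let ?g' = "pdiff j f ((x + h *\<^sub>R axis i 1) + t *\<^sub>R axis j 1) - pdiff j f (x + t *\<^sub>R axis j 1) - h *\<^sub>R ?D"
        show "(g has_vector_derivative ?g') (at t)"
          unfolding g_def
          by (intro has_vector_derivative_diff pdiffable_at_line[OF diff]) (auto intro!: derivative_eq_intros)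
        define k where "k s = pdiff j f ((x + t *\<^sub>R axis j 1) + s *\<^sub>R axis i 1) - s *\<^sub>R ?D" for s
        have "norm (k h - k 0) \<le> e * \<bar>h - 0\<bar>"
        proof (rule norm_diff_le_of_vector_derivative)
          fix s assume s: "s \<in> closed_segment 0 h"
          then have s: "0 \<le> s" "s \<le> h" using h by (auto simp: closed_segment_eq_real_ivl)
          show "(k has_vector_derivative pdiff i (pdiff j f) ((x + t *\<^sub>R axis j 1) + s *\<^sub>R axis i 1) - ?D) (at s)"
            unfolding k_def using pdiffable_at_line[OF diff2]
            by (auto intro!: derivative_eq_intros)
          have "dist ((x + t *\<^sub>R axis j 1) + s *\<^sub>R axis i 1) x = norm (t *\<^sub>R axis j (1::real) + s *\<^sub>R axis i 1 :: 'n rn)"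
            by (simp add: dist_norm algebra_simps)
          also have "\<dots> \<le> norm (t *\<^sub>R axis j (1::real) :: 'n rn) + norm (s *\<^sub>R axis i (1::real) :: 'n rn)"
            by (rule norm_triangle_ineq)
          also have "\<dots> < d" using s t h by (simp add: norm_axis_1)
          finally show "norm (pdiff i (pdiff j f) ((x + t *\<^sub>R axis j 1) + s *\<^sub>R axis i 1) - ?D) \<le> e"
            using d(2)[of "(x + t *\<^sub>R axis j 1) + s *\<^sub>R axis i 1"] by (simp add: dist_norm)
        qed
        then show "norm ?g' \<le> e * h" unfolding k_def using h by (simp add: algebra_simps)
      qed
      then show ?thesis unfolding g_def Dl_def using h by (simp add: algebra_simps)
    qed
    then show ?thesis using d(1) by (intro exI[of _ "d/2"]) auto
  qed
  show ?thesis
  proof (rule ccontr)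
    assume ne: "pdiff i (pdiff j f) x \<noteq> pdiff j (pdiff i f) x"
    define e where "e = norm (pdiff i (pdiff j f) x - pdiff j (pdiff i f) x) / 3"
    have e: "e > 0" unfolding e_def using ne by simp
    from est[OF e, of i j] obtain d1 where d1: "d1 > 0"
      "\<And>h. 0 < h \<Longrightarrow> h < d1 \<Longrightarrow> norm (Dl i j h - (h * h) *\<^sub>R pdiff i (pdiff j f) x) \<le> e * (h * h)" by blast
    from est[OF e, of j i] obtain d2 where d2: "d2 > 0"
      "\<And>h. 0 < h \<Longrightarrow> h < d2 \<Longrightarrow> norm (Dl j i h - (h * h) *\<^sub>R pdiff j (pdiff i f) x) \<le> e * (h * h)" by blast
    define h where "h = min d1 d2 / 2"
    have h: "0 < h" "h < d1" "h < d2" unfolding h_def using d1 d2 by auto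
    have "norm ((h * h) *\<^sub>R (pdiff i (pdiff j f) x - pdiff j (pdiff i f) x))
      = norm ((Dl j i h - (h * h) *\<^sub>R pdiff j (pdiff i f) x) - (Dl i j h - (h * h) *\<^sub>R pdiff i (pdiff j f) x))"
      using sym[of i j h] by (simp add: algebra_simps)
    also have "\<dots> \<le> e * (h * h) + e * (h * h)"
      by (rule order_trans[OF norm_triangle_ineq4 add_mono[OF d2(2)[OF h(1,3)] d1(2)[OF h(1,2)]]])
    finally have "(h * h) * (3 * e) \<le> 2 * e * (h * h)" unfolding e_def by simp
    moreover have "0 < e * (h * h)" using e h(1) by simp
    ultimately show False by (simp add: algebra_simps)
  qed
qed

section \<open>Functions of class C^k and smooth functions on the whole space\<close>

lemma coord_space_UNIV [simp]: "coord_space UNIV = UNIV"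
  by (auto simp: coord_space_def)

abbreviation Ck :: "nat \<Rightarrow> ('n::finite rn \<Rightarrow> 'b::real_normed_vector) \<Rightarrow> bool" where
  "Ck \<equiv> Ck_on UNIV"

lemma Ck_continuous: "Ck k f \<Longrightarrow> continuous_on UNIV f"
  by (cases k) auto

lemma Ck_SucD: "Ck (Suc k) f \<Longrightarrow> Ck k f"
  by (induction k arbitrary: f) auto

lemma Ck_mono: "Ck k f \<Longrightarrow> j \<le> k \<Longrightarrow> Ck j f"
  by (induction k) (auto simp: le_Suc_eq dest: Ck_SucD simp del: Ck_on.simps(2))

lemma Ck_Suc_pd1: "Ck (Suc k) f \<Longrightarrow> pd1 f"
  unfolding pd1_def using Ck_continuous by fastforce

lemma Ck_Suc_iff: "Ck (Suc k) f \<longleftrightarrow> (\<forall>i x. pdiffable_at i f x) \<and> (\<forall>i. Ck k (pdiff i f))"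
proof
  assume a: "(\<forall>i x. pdiffable_at i f x) \<and> (\<forall>i. Ck k (pdiff i f))"
  then have "pd1 f" unfolding pd1_def using Ck_continuous by blast
  then have c: "continuous_on UNIV f" by (rule pd1_continuous)
  from a have a1: "\<And>i x. pdiffable_at i f x" and a2: "\<And>i. Ck k (pdiff i f)" by blast+
  show "Ck (Suc k) f"
    unfolding Ck_on.simps coord_space_UNIV
    by (intro conjI ballI c a1 a2)
next
  assume "Ck (Suc k) f"
  then have "continuous_on UNIV f \<and> (\<forall>i\<in>UNIV. (\<forall>x\<in>UNIV. pdiffable_at i f x) \<and> Ck k (pdiff i f))"
    unfolding Ck_on.simps coord_space_UNIV .
  then show "(\<forall>i x. pdiffable_at i f x) \<and> (\<forall>i. Ck k (pdiff i f))" by blast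
qed

lemma Ck_pds: "Ck (k + length L) f \<Longrightarrow> Ck k (pds L f)"
proof (induction L arbitrary: k)
  case (Cons i L)
  have "Ck (Suc k) (pds L f)" by (rule Cons.IH) (use Cons.prems in \<open>simp only: length_Cons add_Suc add_Suc_right\<close>)
  then show ?case unfolding Ck_Suc_iff by simp
qed simp

lemma pdiff_pds_commute:
  assumes "Ck (Suc (length L)) f"
  shows "pdiff i (pds L f) = pds L (pdiff i f)"
  using assms
proof (induction L)
  case (Cons j L)
  have "Ck 2 (pds L f)"
    by (rule Ck_pds, rule Ck_mono[OF Cons.prems]) simp
  then have "pdiff i (pdiff j (pds L f)) = pdiff j (pdiff i (pds L f))"
    using Ck_Suc_iff[of 1 "pds L f"] Ck_Suc_pd1[of 1 "pds L f"] Ck_Suc_pd1[of 0]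
    by (intro ext pdiff_commute) (auto simp only: numeral_2_eq_2 One_nat_def)
  moreover have "Ck (Suc (length L)) f" by (rule Ck_mono[OF Cons.prems]) simp
  ultimately show ?case by (simp only: foldr.simps o_apply Cons.IH)
qed simp

lemma pds_append: "pds (L @ L') f = pds L (pds L' f)"
  by simp

text \<open>The innermost letter of \<open>L\<close> is located in \<open>L'\<close> and moved to
  the innermost place there by \<open>pdiff_pds_commute\<close>; the remaining words are shorter and
  again permutations of each other.\<close>

lemma pds_perm:
  assumes "mset L = mset L'" "Ck (length L) f"
  shows "pds L f = pds L' f"
  using assms
proof (induction L arbitrary: L' f rule: rev_induct)
  case (snoc i L)
  have "i \<in> set L'" using mset_eq_setD[OF snoc.prems(1)] by auto
  then obtain A B where L': "L' = A @ i # B" by (meson split_list)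
  have ml: "mset L = mset (A @ B)" using snoc.prems(1) unfolding L' by simp
  have len: "length L = length A + length B" using arg_cong[OF ml, of size] unfolding size_mset by simp
  have C: "Ck (length L) (pdiff i f)" using snoc.prems(2) unfolding length_append_singleton Ck_Suc_iff by blast
  have C': "Ck (Suc (length B)) f" by (rule Ck_mono[OF snoc.prems(2)]) (simp add: len)
  have "pds (L @ [i]) f = pds (A @ B) (pdiff i f)" using snoc.IH[OF ml C] by simp
  also have "\<dots> = pds A (pds B (pdiff i f))" by simp
  also have "\<dots> = pds L' f" unfolding L' using pdiff_pds_commute[OF C', of i] by simp
  finally show ?case .
qed simp

abbreviation smooth :: "('n::finite rn \<Rightarrow> 'b::real_normed_vector) \<Rightarrow> bool" where
  "smooth \<equiv> smooth_on UNIV"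

lemma smooth_Ck: "smooth f \<longleftrightarrow> (\<forall>k. Ck k f)"
  by (simp add: smooth_on_def)

lemma smooth_pds: "smooth f \<Longrightarrow> smooth (pds L f)"
  unfolding smooth_Ck using Ck_pds by blast

lemma smooth_pdiff: "smooth f \<Longrightarrow> smooth (pdiff i f)"
  using smooth_pds[of f "[i]"] by simp

lemma smooth_pd1: "smooth f \<Longrightarrow> pd1 f"
  unfolding smooth_Ck using Ck_Suc_pd1 by blast

lemma smooth_pdiffable: "smooth f \<Longrightarrow> pdiffable_at i f x"
  using smooth_pd1 unfolding pd1_def by blast

lemma smooth_pds_perm: "smooth f \<Longrightarrow> mset L = mset L' \<Longrightarrow> pds L f = pds L' f"
  using pds_perm unfolding smooth_Ck by blast

text \<open>Proves smoothness from a class of functions closed under differentiation, such as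
  polynomials times a fixed exponential, without formulas for the higher derivatives.\<close>

lemma smooth_coinduct:
  assumes "R f"
    and "\<And>g. R g \<Longrightarrow> continuous_on UNIV g \<and> (\<forall>i. (\<forall>x. pdiffable_at i g x) \<and> R (pdiff i g))"
  shows "smooth f"
proof -
  have "R g \<Longrightarrow> Ck k g" for k g
  proof (induction k arbitrary: g)
    case 0 then show ?case using assms(2) by simp
  next
    case (Suc k) then show ?case unfolding Ck_Suc_iff using assms(2) by blast
  qed
  then show ?thesis using assms(1) unfolding smooth_Ck by blast
qed

definition mi_list :: "'n::{finite,linorder} multiindex \<Rightarrow> 'n list" where
  "mi_list \<alpha> = concat (map (\<lambda>i. replicate (\<alpha> i) i) (sorted_list_of_set UNIV))"

text \<open>Multi-indices are confined to the notions of the theorem. The proof iterates derivatives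
  along words, which suits induction on the order; the two translations go through
  multisets.\<close>

definition list_mi :: "'n list \<Rightarrow> 'n multiindex" where
  "list_mi L i = count (mset L) i"

lemma mdiff_eq_pds: "mdiff \<alpha> f = pds (mi_list \<alpha>) f"
proof -
  have rep: "pds (replicate k i) g = (pdiff i ^^ k) g" for k i and g :: "'a rn \<Rightarrow> 'b"
    by (induction k) auto
  have "foldr (\<lambda>i. pdiff i ^^ \<alpha> i) xs f = pds (concat (map (\<lambda>i. replicate (\<alpha> i) i) xs)) f" for xs
    by (induction xs) (auto simp: rep)
  then show ?thesis unfolding mdiff_def mi_list_def by simp
qed

lemma count_mi_list: "count (mset (mi_list \<alpha>)) i = \<alpha> i"
proof -
  have "count (mset (concat (map (\<lambda>i. replicate (\<alpha> i) i) xs))) i = (if i \<in> set xs then \<alpha> i else 0)"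
    if "distinct xs" for xs using that by (induction xs) auto
  then show ?thesis unfolding mi_list_def by simp
qed

lemma mset_mi_list: "mset (mi_list (list_mi (L :: 'n::{finite,linorder} list))) = mset L"
  by (rule multiset_eqI) (simp add: count_mi_list list_mi_def)

lemma length_mi_list: "length (mi_list \<alpha>) = mi_order \<alpha>"
proof -
  have "length (mi_list \<alpha>) = (\<Sum>i\<in>UNIV. count (mset (mi_list \<alpha>)) i)"
    using size_multiset_overloaded_eq[of "mset (mi_list \<alpha>)"]
    by (simp add: sum.mono_neutral_left count_eq_zero_iff)
  then show ?thesis by (simp add: count_mi_list mi_order_def)
qed

lemma mi_order_list_mi: "mi_order (list_mi (L :: 'n::{finite,linorder} list)) = length L"
  using arg_cong[OF mset_mi_list[of L], where f = size] by (simp add: length_mi_list)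

lemma set_mi_list: "set (mi_list \<alpha>) = {i. \<alpha> i \<noteq> 0}"
proof -
  have "i \<in> set (mi_list \<alpha>) \<longleftrightarrow> \<alpha> i \<noteq> 0" for i
    using count_mi_list[of \<alpha> i] count_eq_zero_iff[of "mset (mi_list \<alpha>)" i] by simp
  then show ?thesis by blast
qed

lemma mdiff_list_mi: "Ck (length (L :: 'n::{finite,linorder} list)) f \<Longrightarrow> mdiff (list_mi L) f = pds L f"
  unfolding mdiff_eq_pds by (rule pds_perm) (auto simp: mset_mi_list length_mi_list mi_order_list_mi)

section \<open>Hoelder bounds\<close>

text \<open>Serves the chain rule in \<open>hol_subst\<close>: there the second order remainder in a
  parameter is dominated by the square of the parameter increment, although nothing is known about
  its own differentiability.\<close>

lemma has_vector_derivative_zero_of_bound: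
  fixes psi :: "real \<Rightarrow> 'b::real_normed_vector" and b :: "real \<Rightarrow> real"
  assumes "(b has_vector_derivative b') (at x)" "b x = 0" "\<And>t. norm (psi t) \<le> K * (b t)\<^sup>2"
  shows "(psi has_vector_derivative 0) (at x)"
proof -
  have b: "(b has_real_derivative b') (at x)"
    using assms(1) by (simp add: has_real_derivative_iff_has_vector_derivative)
  have "((\<lambda>t. K * (b t)\<^sup>2) has_real_derivative 0) (at x)"
    by (rule derivative_eq_intros b | simp add: assms(2))+
  then have l: "((\<lambda>h. (K * (b (x + h))\<^sup>2 - K * (b x)\<^sup>2) / h) \<longlongrightarrow> 0) (at 0)"
    by (simp add: DERIV_def)
  have psi0: "psi x = 0" using assms(3)[of x] assms(2) by simp
  have "((\<lambda>h. norm (psi (x + h) - psi x - h *\<^sub>R 0) / norm h) \<longlongrightarrow> 0) (at 0)"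
  proof (rule Lim_null_comparison[OF _ tendsto_rabs_zero[OF l]])
    show "\<forall>\<^sub>F h in at 0. norm (norm (psi (x + h) - psi x - h *\<^sub>R 0) / norm h)
        \<le> \<bar>(K * (b (x + h))\<^sup>2 - K * (b x)\<^sup>2) / h\<bar>"
    proof (intro always_eventually allI)
      fix h :: real
      have "norm (psi (x + h)) / \<bar>h\<bar> \<le> \<bar>K * (b (x + h))\<^sup>2\<bar> / \<bar>h\<bar>"
        by (intro divide_right_mono order_trans[OF assms(3) abs_ge_self]) simp
      then show "norm (norm (psi (x + h) - psi x - h *\<^sub>R 0) / norm h)
        \<le> \<bar>(K * (b (x + h))\<^sup>2 - K * (b x)\<^sup>2) / h\<bar>"
        using psi0 assms(2) by (simp add: abs_divide)
    qed
  qed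
  then show ?thesis
    unfolding has_vector_derivative_def has_derivative_at by (auto intro: bounded_linear_zero)
qed

section \<open>Rules for partial derivatives\<close>

lemma pdiff_const: "pdiffable_at i (\<lambda>x. c) x" "pdiff i (\<lambda>x. c) = (\<lambda>x. 0)"
  by (auto intro!: pdiffable_atI pdiff_eqI ext derivative_eq_intros)

lemma pdiffable_add:
  "pdiffable_at i f x \<Longrightarrow> pdiffable_at i g x \<Longrightarrow> pdiffable_at i (\<lambda>x. f x + g x) x"
  by (rule pdiffable_atI) (auto simp: pdiffable_at_iff intro: has_vector_derivative_add)

lemma pdiff_add:
  "pdiffable_at i f x \<Longrightarrow> pdiffable_at i g x \<Longrightarrow> pdiff i (\<lambda>x. f x + g x) x = pdiff i f x + pdiff i g x"
  by (rule pdiff_eqI) (auto simp: pdiffable_at_iff intro: has_vector_derivative_add)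

lemma pdiffable_diff:
  "pdiffable_at i f x \<Longrightarrow> pdiffable_at i g x \<Longrightarrow> pdiffable_at i (\<lambda>x. f x - g x) x"
  by (rule pdiffable_atI) (auto simp: pdiffable_at_iff intro: has_vector_derivative_diff)

lemma pdiff_diff:
  "pdiffable_at i f x \<Longrightarrow> pdiffable_at i g x \<Longrightarrow> pdiff i (\<lambda>x. f x - g x) x = pdiff i f x - pdiff i g x"
  by (rule pdiff_eqI) (auto simp: pdiffable_at_iff intro: has_vector_derivative_diff)

lemma pdiffable_mult:
  fixes f g :: "'n::finite rn \<Rightarrow> 'b::real_normed_algebra"
  shows "pdiffable_at i f x \<Longrightarrow> pdiffable_at i g x \<Longrightarrow> pdiffable_at i (\<lambda>x. f x * g x) x"
  using has_vector_derivative_mult[of "\<lambda>t. f (x + t *\<^sub>R axis i 1)" _ 0 UNIV "\<lambda>t. g (x + t *\<^sub>R axis i 1)"]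
  by (intro pdiffable_atI) (auto simp: pdiffable_at_iff)

lemma pdiff_mult:
  fixes f g :: "'n::finite rn \<Rightarrow> 'b::real_normed_algebra"
  shows "pdiffable_at i f x \<Longrightarrow> pdiffable_at i g x \<Longrightarrow>
    pdiff i (\<lambda>x. f x * g x) x = f x * pdiff i g x + pdiff i f x * g x"
  using has_vector_derivative_mult[of "\<lambda>t. f (x + t *\<^sub>R axis i 1)" _ 0 UNIV "\<lambda>t. g (x + t *\<^sub>R axis i 1)"]
  by (intro pdiff_eqI) (auto simp: pdiffable_at_iff)

lemma pdiffable_sum:
  "(\<And>k. k \<in> S \<Longrightarrow> pdiffable_at i (f k) x) \<Longrightarrow> pdiffable_at i (\<lambda>x. \<Sum>k\<in>S. f k x) x"
  by (rule pdiffable_atI[OF has_vector_derivative_sum]) (auto simp: pdiffable_at_iff)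

lemma pdiff_sum:
  "(\<And>k. k \<in> S \<Longrightarrow> pdiffable_at i (f k) x) \<Longrightarrow> pdiff i (\<lambda>x. \<Sum>k\<in>S. f k x) x = (\<Sum>k\<in>S. pdiff i (f k) x)"
  by (rule pdiff_eqI) (auto simp: pdiffable_at_iff intro: has_vector_derivative_sum)

lemma pdiffable_linear:
  assumes "bounded_linear h" "pdiffable_at i f x"
  shows "pdiffable_at i (\<lambda>x. h (f x)) x"
  using assms(2) bounded_linear.has_vector_derivative[OF assms(1)]
  by (intro pdiffable_atI) (auto simp: pdiffable_at_iff)

lemma pdiff_linear:
  assumes "bounded_linear h" "pdiffable_at i f x"
  shows "pdiff i (\<lambda>x. h (f x)) x = h (pdiff i f x)"
  using assms(2) bounded_linear.has_vector_derivative[OF assms(1)]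
  by (intro pdiff_eqI) (auto simp: pdiffable_at_iff)

lemma pdiffable_exp:
  fixes f :: "'n::finite rn \<Rightarrow> complex"
  shows "pdiffable_at i f x \<Longrightarrow> pdiffable_at i (\<lambda>x. exp (f x)) x"
  using field_vector_diff_chain_at[OF _ DERIV_exp, of "\<lambda>t. f (x + t *\<^sub>R axis i 1)" _ 0]
  by (intro pdiffable_atI) (auto simp: pdiffable_at_iff o_def)

lemma pdiff_exp:
  fixes f :: "'n::finite rn \<Rightarrow> complex"
  shows "pdiffable_at i f x \<Longrightarrow> pdiff i (\<lambda>x. exp (f x)) x = pdiff i f x * exp (f x)"
  using field_vector_diff_chain_at[OF _ DERIV_exp, of "\<lambda>t. f (x + t *\<^sub>R axis i 1)" _ 0]
  by (intro pdiff_eqI) (auto simp: pdiffable_at_iff o_def)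

lemma pd1_curve:
  assumes "pd1 f" "\<And>j. ((\<lambda>t. c t $ j) has_vector_derivative c' j) (at t0)"
  shows "((\<lambda>t. f (c t)) has_vector_derivative (\<Sum>j\<in>UNIV. c' j *\<^sub>R pdiff j f (c t0))) (at t0)"
proof -
  have "(c has_derivative (\<lambda>h. \<chi> j. h *\<^sub>R c' j)) (at t0)"
    using assms(2) unfolding has_vector_derivative_def
    by (subst has_derivative_componentwise_within) (auto simp: Basis_vec_def inner_axis)
  from has_derivative_compose[OF this pd1_has_derivative[OF assms(1)]]
  show ?thesis unfolding has_vector_derivative_def
    by (simp add: scaleR_sum_right)
qed

lemma pd1_comp:
  fixes k :: "'n::finite rn \<Rightarrow> 'm::finite rn"
  assumes "pd1 f" "\<And>j. pdiffable_at i (\<lambda>x. k x $ j) x"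
  shows "pdiffable_at i (\<lambda>x. f (k x)) x"
    "pdiff i (\<lambda>x. f (k x)) x = (\<Sum>j\<in>UNIV. pdiff i (\<lambda>x. k x $ j) x *\<^sub>R pdiff j f (k x))"
proof -
  have "((\<lambda>t. f (k (x + t *\<^sub>R axis i 1))) has_vector_derivative
     (\<Sum>j\<in>UNIV. pdiff i (\<lambda>x. k x $ j) x *\<^sub>R pdiff j f (k (x + 0 *\<^sub>R axis i 1)))) (at 0)"
    using assms(2) by (intro pd1_curve assms(1)) (simp add: pdiffable_at_iff)
  then show "pdiffable_at i (\<lambda>x. f (k x)) x"
    "pdiff i (\<lambda>x. f (k x)) x = (\<Sum>j\<in>UNIV. pdiff i (\<lambda>x. k x $ j) x *\<^sub>R pdiff j f (k x))"
    by (auto intro: pdiffable_atI pdiff_eqI)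
qed

lemma pd1_lipschitz:
  fixes f :: "'n::finite rn \<Rightarrow> 'b::real_normed_vector"
  assumes "pd1 f" "\<And>i x. norm (pdiff i f x) \<le> B"
  shows "norm (f x - f y) \<le> real CARD('n) * B * norm (x - y)"
proof (rule differentiable_bound[where S = UNIV])
  fix z :: "'n rn"
  show "(f has_derivative (\<lambda>h. \<Sum>i\<in>UNIV. h $ i *\<^sub>R pdiff i f z)) (at z within UNIV)"
    using pd1_has_derivative[OF assms(1)] by simp
  show "onorm (\<lambda>h. \<Sum>i\<in>UNIV. h $ i *\<^sub>R pdiff i f z) \<le> real CARD('n) * B"
  proof (rule onorm_le)
    fix h :: "'n rn"
    have B: "0 \<le> B" using assms(2)[of undefined z] norm_ge_zero order_trans by blast
    have "norm (h $ i *\<^sub>R pdiff i f z) \<le> norm h * B" for i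
      unfolding norm_scaleR by (rule mult_mono) (use assms(2) B component_le_norm_cart[of h i] in auto)
    then have "norm (\<Sum>i\<in>UNIV. h $ i *\<^sub>R pdiff i f z) \<le> (\<Sum>i\<in>(UNIV :: 'n set). norm h * B)"
      by (intro order_trans[OF norm_sum] sum_mono)
    then show "norm (\<Sum>i\<in>UNIV. h $ i *\<^sub>R pdiff i f z) \<le> real CARD('n) * B * norm h"
      by (simp add: algebra_simps)
  qed
qed auto

text \<open>A ball of the Hoelder space C^(r + sg): one constant bounds the function, its
  derivatives up to order \<open>r\<close> and the Hoelder quotients of the top order. A predicate
  with an explicit radius, recursive in \<open>r\<close>, lets constants be tracked through
  products, compositions and integrals.\<close>

primrec hol :: "nat \<Rightarrow> real \<Rightarrow> real \<Rightarrow> ('n::finite rn \<Rightarrow> complex) \<Rightarrow> bool" where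
  "hol 0 sg B f \<longleftrightarrow> (\<forall>x. cmod (f x) \<le> B) \<and> (\<forall>x y. cmod (f x - f y) \<le> B * norm (x - y) powr sg)"
| "hol (Suc r) sg B f \<longleftrightarrow> (\<forall>x. cmod (f x) \<le> B) \<and> (\<forall>i. (\<forall>x. pdiffable_at i f x) \<and> hol r sg B (pdiff i f))"

lemma hol_0D: "hol 0 sg B f \<Longrightarrow> cmod (f x - f y) \<le> B * norm (x - y) powr sg"
  by simp

lemma hol_SucD:
  assumes "hol (Suc r) sg B f"
  shows "pdiffable_at i f x" "hol r sg B (pdiff i f)"
  using assms by auto

lemma hol_SucI:
  assumes "\<And>x. cmod (f x) \<le> B" "\<And>i x. pdiffable_at i f x" "\<And>i. hol r sg B (pdiff i f)"
  shows "hol (Suc r) sg B f"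
  using assms by auto

lemma hol_bound: "hol r sg B f \<Longrightarrow> cmod (f x) \<le> B"
  by (cases r) auto

lemma hol_nonneg: "hol r sg B f \<Longrightarrow> 0 \<le> B"
  using hol_bound norm_ge_zero order_trans by blast

lemma hol_mono: "hol r sg B f \<Longrightarrow> B \<le> B' \<Longrightarrow> hol r sg B' f"
proof (induction r arbitrary: f)
  case 0
  have "cmod (f x - f y) \<le> B' * norm (x - y) powr sg" for x y
    using 0 by (intro order_trans[OF hol_0D[OF 0(1)]] mult_right_mono) auto
  then show ?case using 0 by (auto intro: order_trans)
next
  case (Suc r) then show ?case by (auto intro: order_trans)
qed

lemma hol_const: "hol r sg (cmod c) (\<lambda>x :: 'n::finite rn. c)"
proof (induction r arbitrary: c)
  case (Suc r)
  have "hol r sg (cmod c) (\<lambda>x :: 'n rn. 0)" by (rule hol_mono[OF Suc[of 0]]) simp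
  then show ?case by (simp add: pdiff_const)
qed auto

lemma hol_add: "hol r sg A f \<Longrightarrow> hol r sg B g \<Longrightarrow> hol r sg (A + B) (\<lambda>x. f x + g x)"
proof (induction r arbitrary: f g)
  case 0
  show ?case unfolding hol.simps
  proof (intro conjI allI)
    fix x y
    show "cmod (f x + g x) \<le> A + B"
      by (intro order_trans[OF norm_triangle_ineq] add_mono hol_bound[OF 0(1)] hol_bound[OF 0(2)])
    have "cmod (f x + g x - (f y + g y)) \<le> cmod (f x - f y) + cmod (g x - g y)"
      unfolding add_diff_add by (rule norm_triangle_ineq)
    also have "\<dots> \<le> A * norm (x - y) powr sg + B * norm (x - y) powr sg"
      by (intro add_mono hol_0D[OF 0(1)] hol_0D[OF 0(2)])
    finally show "cmod (f x + g x - (f y + g y)) \<le> (A + B) * norm (x - y) powr sg"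
      by (simp add: distrib_right)
  qed
next
  case (Suc r)
  have pe: "pdiff i (\<lambda>x. f x + g x) = (\<lambda>x. pdiff i f x + pdiff i g x)" for i
    by (intro ext pdiff_add hol_SucD[OF Suc.prems(1)] hol_SucD[OF Suc.prems(2)])
  show ?case
  proof (rule hol_SucI)
    show "cmod (f x + g x) \<le> A + B" for x
      by (intro order_trans[OF norm_triangle_ineq] add_mono hol_bound[OF Suc.prems(1)] hol_bound[OF Suc.prems(2)])
    show "hol r sg (A + B) (pdiff i (\<lambda>x. f x + g x))" for i
      unfolding pe by (intro Suc.IH hol_SucD[OF Suc.prems(1)] hol_SucD[OF Suc.prems(2)])
  qed (intro pdiffable_add hol_SucD[OF Suc.prems(1)] hol_SucD[OF Suc.prems(2)])
qed

lemma hol_cmult: "hol r sg A f \<Longrightarrow> hol r sg (cmod c * A) (\<lambda>x. c * f x)"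
proof (induction r arbitrary: f)
  case 0
  then show ?case
    by (auto simp: norm_mult mult_left_mono mult.assoc right_diff_distrib[symmetric])
next
  case (Suc r)
  have "pdiff i (\<lambda>x. c * f x) = (\<lambda>x. c * pdiff i f x)" for i
    by (intro ext pdiff_linear[OF bounded_linear_mult_right] hol_SucD[OF Suc.prems])
  then show ?case using Suc
    by (auto simp: norm_mult mult_left_mono intro: pdiffable_linear[OF bounded_linear_mult_right])
qed

lemma hol_minus: "hol r sg A f \<Longrightarrow> hol r sg A (\<lambda>x. - f x)"
  using hol_cmult[of r sg A f "-1"] by simp

lemma hol_diff: "hol r sg A f \<Longrightarrow> hol r sg B g \<Longrightarrow> hol r sg (A + B) (\<lambda>x. f x - g x)"
  using hol_add[OF _ hol_minus, of r sg A f B g] by simp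

lemma hol_sum:
  "(\<And>i. i \<in> S \<Longrightarrow> hol r sg (A i) (f i)) \<Longrightarrow> hol r sg (\<Sum>i\<in>S. A i) (\<lambda>x. \<Sum>i\<in>S. f i x)"
proof (induction S rule: infinite_finite_induct)
  case (insert i S) then show ?case by (auto intro: hol_add)
qed (use hol_const[of r sg 0] in auto)

lemma powr_tendsto_zero_norm:
  assumes "0 < sg" shows "((\<lambda>y :: 'n::finite rn. B * norm (x - y) powr sg) \<longlongrightarrow> 0) (at x)"
proof -
  have "((\<lambda>y. norm (x - y)) \<longlongrightarrow> 0) (at x)"
    using tendsto_norm[OF tendsto_diff[OF tendsto_const tendsto_ident_at, of x x UNIV]] by simp
  then have "((\<lambda>y. norm (x - y) powr sg) \<longlongrightarrow> 0 powr sg) (at x)"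
    using assms by (intro tendsto_powr2) (auto intro: always_eventually)
  from tendsto_mult_left[OF this, of B] show ?thesis using assms by simp
qed

locale holder_exponent =
  fixes sg :: real
  assumes sg: "0 < sg" "sg \<le> 1"
begin

lemma hol_continuous:
  assumes "hol r sg B f" shows "continuous_on UNIV f"
  using assms
proof (induction r arbitrary: f)
  case 0
  have "isCont f x" for x
  proof -
    have "((\<lambda>y. f y - f x) \<longlongrightarrow> 0) (at x)"
    proof (rule Lim_null_comparison[OF _ powr_tendsto_zero_norm[OF sg(1), of B x]])
      show "\<forall>\<^sub>F y in at x. cmod (f y - f x) \<le> B * norm (x - y) powr sg"
        using 0 by (intro always_eventually allI) (simp add: norm_minus_commute[of x])
    qed
    then show ?thesis by (simp add: isCont_def LIM_zero_iff)
  qed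
  then show ?case by (simp add: continuous_on_eq_continuous_at)
next
  case (Suc r)
  then show ?case by (intro pd1_continuous) (auto simp: pd1_def)
qed

lemma hol_pd1: "hol (Suc r) sg B f \<Longrightarrow> pd1 f"
  unfolding pd1_def using hol_continuous[OF hol_SucD(2)] hol_SucD(1) by blast

lemma hol_Ck: "hol r sg B f \<Longrightarrow> Ck r f"
proof (induction r arbitrary: f)
  case 0 then show ?case using hol_continuous[of 0] by simp
next
  case (Suc r)
  then have "(\<forall>i x. pdiffable_at i f x) \<and> (\<forall>i. Ck r (pdiff i f))" by auto
  then show ?case unfolding Ck_Suc_iff .
qed

text \<open>For d \<le> 1 the Lipschitz bound suffices because d \<le> \<open>d powr sg\<close>; for
  larger distances the bound 2 B on the oscillation does.\<close>

lemma lip_to_holder: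
  assumes "a \<le> 2 * B" "a \<le> A * d" "0 \<le> d" "0 \<le> A" "0 \<le> B"
  shows "a \<le> (A + 2 * B) * d powr sg"
proof (cases "d \<le> 1")
  case True
  have "d \<le> d powr sg"
  proof (cases "d = 0")
    case False
    then show ?thesis using powr_mono'[of sg 1 d] True assms(3) sg by simp
  qed auto
  then have "A * d \<le> A * d powr sg" using assms by (intro mult_left_mono)
  moreover have "0 \<le> 2 * B * d powr sg" using assms by simp
  ultimately show ?thesis using assms(2) unfolding distrib_right by linarith
next
  case False
  then have "1 \<le> d powr sg" using sg by (simp add: ge_one_powr_ge_zero)
  then have "2 * B * 1 \<le> 2 * B * d powr sg" using assms by (intro mult_left_mono) auto
  moreover have "0 \<le> A * d powr sg" using assms by simp
  ultimately show ?thesis using assms(1) unfolding distrib_right by linarith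
qed

text \<open>The summand \<open>CARD('n)\<close> is the Lipschitz constant obtained from bounded
  partial derivatives, the summand 2 comes from the oscillation at large distances.\<close>

lemma hol_down:
  fixes f :: "'n::finite rn \<Rightarrow> complex"
  assumes "hol (Suc r) sg B f"
  shows "hol r sg ((real CARD('n) + 2) * B) f"
  using assms
proof (induction r arbitrary: f)
  case 0
  have B: "0 \<le> B" using hol_nonneg[OF 0] .
  have bd: "\<And>x. cmod (f x) \<le> B" and bd': "\<And>i x. cmod (pdiff i f x) \<le> B" using 0 by auto
  have "cmod (f x - f y) \<le> (real CARD('n) * B + 2 * B) * norm (x - y) powr sg" for x y
  proof (rule lip_to_holder)
    show "cmod (f x - f y) \<le> 2 * B"
      using norm_triangle_ineq4[of "f x" "f y"] bd[of x] bd[of y] by linarith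
    show "cmod (f x - f y) \<le> real CARD('n) * B * norm (x - y)"
      by (rule pd1_lipschitz[OF hol_pd1[OF 0] bd'])
  qed (use B in auto)
  moreover have "cmod (f x) \<le> (real CARD('n) + 2) * B" for x
    using bd[of x] mult_right_mono[of 1 "real CARD('n) + 2" B] B by simp
  ultimately show ?case by (simp add: distrib_right)
next
  case (Suc r)
  have B: "0 \<le> B" using hol_nonneg[OF Suc.prems] .
  have "cmod (f x) \<le> (real CARD('n) + 2) * B" for x
    using hol_bound[OF Suc.prems, of x] mult_right_mono[of 1 "real CARD('n) + 2" B] B by simp
  moreover have "hol r sg ((real CARD('n) + 2) * B) (pdiff i f)" for i
    using Suc.prems by (intro Suc.IH) simp
  ultimately show ?case using Suc.prems by simp
qed

lemma hol_mult: "\<exists>C>0. \<forall>A B f g. hol r sg A f \<longrightarrow> hol r sg B g \<longrightarrow>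
    hol r sg (C * (A * B)) (\<lambda>x :: 'n::finite rn. f x * g x)"
proof (induction r)
  case 0
  have "hol 0 sg (2 * (A * B)) (\<lambda>x :: 'n rn. f x * g x)" if f: "hol 0 sg A f" and g: "hol 0 sg B g" for A B f g
    unfolding hol.simps
  proof (intro conjI allI)
    have AB: "0 \<le> A" "0 \<le> B" using hol_nonneg[OF f] hol_nonneg[OF g] by auto
    fix x y
    have "cmod (f x * g x) \<le> A * B"
      using f g AB by (auto simp: norm_mult intro!: mult_mono)
    then show "cmod (f x * g x) \<le> 2 * (A * B)" using mult_nonneg_nonneg[OF AB] by linarith
    have "f x * g x - f y * g y = f x * (g x - g y) + (f x - f y) * g y" by (simp add: algebra_simps)
    then have "cmod (f x * g x - f y * g y) \<le> cmod (f x * (g x - g y)) + cmod ((f x - f y) * g y)"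
      by (simp only: norm_triangle_ineq)
    also have "\<dots> \<le> A * (B * norm (x - y) powr sg) + (A * norm (x - y) powr sg) * B"
      unfolding norm_mult using f g AB by (intro add_mono mult_mono) auto
    finally show "cmod (f x * g x - f y * g y) \<le> 2 * (A * B) * norm (x - y) powr sg"
      by (simp add: algebra_simps)
  qed
  then show ?case by (intro exI[of _ 2]) auto
next
  case (Suc r)
  then obtain C where C: "C > 0" "\<And>A B f g. hol r sg A f \<Longrightarrow> hol r sg B g \<Longrightarrow>
    hol r sg (C * (A * B)) (\<lambda>x :: 'n rn. f x * g x)" by blast
  define D where "D = real CARD('n) + 2"
  \<comment> \<open>The two terms of the product rule each cost C D, where \<open>D\<close> lowers
    the order of the undifferentiated factor by \<open>hol_down\<close>; the 1 covers the supremum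
    of the product.\<close>
  have "hol (Suc r) sg ((2 * C * D + 1) * (A * B)) (\<lambda>x :: 'n rn. f x * g x)"
    if f: "hol (Suc r) sg A f" and g: "hol (Suc r) sg B g" for A B f g
  proof -
    have AB: "0 \<le> A" "0 \<le> B" using hol_nonneg[OF f] hol_nonneg[OF g] by auto
    have pe: "pdiff i (\<lambda>x. f x * g x) = (\<lambda>x. f x * pdiff i g x + pdiff i f x * g x)" for i
      by (intro ext pdiff_mult hol_SucD[OF f] hol_SucD[OF g])
    have "hol r sg (C * (D * A * B) + C * (A * (D * B))) (pdiff i (\<lambda>x. f x * g x))" for i
      unfolding pe using f g hol_down[OF f] hol_down[OF g]
      by (intro hol_add C(2)) (auto simp: D_def)
    then have "hol r sg ((2 * C * D + 1) * (A * B)) (pdiff i (\<lambda>x. f x * g x))" for i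
      by (rule hol_mono) (use AB in \<open>simp add: algebra_simps\<close>)
    moreover have "cmod (f x * g x) \<le> (2 * C * D + 1) * (A * B)" for x
    proof -
      have "cmod (f x * g x) \<le> A * B"
        using hol_bound[OF f] hol_bound[OF g] AB by (auto simp: norm_mult intro!: mult_mono)
      also have "\<dots> \<le> (2 * C * D + 1) * (A * B)"
        using AB C(1) mult_right_mono[of 1 "2 * C * D + 1" "A * B"] by (simp add: D_def)
      finally show ?thesis .
    qed
    ultimately show ?thesis using f g by (auto intro!: pdiffable_mult)
  qed
  moreover have "2 * C * D + 1 > 0" using C(1) by (simp add: D_def add_pos_nonneg)
  ultimately show ?case by blast
qed

end

section \<open>Integrals and Taylor's formula with bounds in Hoelder balls\<close>

lemma has_vector_derivative_integral:
  fixes f :: "'a \<Rightarrow> real \<Rightarrow> 'b::{banach,second_countable_topology}"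
  assumes B: "integrable M B"
    and der: "\<And>w t. w \<in> space M \<Longrightarrow> \<bar>t\<bar> < 1 \<Longrightarrow> (f w has_vector_derivative f' w t) (at t)"
    and bd: "\<And>w t. w \<in> space M \<Longrightarrow> \<bar>t\<bar> < 1 \<Longrightarrow> norm (f' w t) \<le> B w"
    and int: "\<And>t. \<bar>t\<bar> < 1 \<Longrightarrow> integrable M (\<lambda>w. f w t)"
  shows "integrable M (\<lambda>w. f' w 0)"
    "((\<lambda>t. \<integral>w. f w t \<partial>M) has_vector_derivative (\<integral>w. f' w 0 \<partial>M)) (at 0)"
proof -
  define R where "R h w = (f w h - f w 0 - h *\<^sub>R f' w 0) /\<^sub>R h" for h w
  \<comment> \<open>The sequence starts at 1/2, so that it stays inside |t| < 1, where the
    hypotheses hold.\<close>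
  define X where "X n = inverse (real (Suc (Suc n)))" for n
  have X: "X \<longlonglongrightarrow> 0" "\<And>n. X n \<noteq> 0" "\<And>n. \<bar>X n\<bar> < 1"
    unfolding X_def using LIMSEQ_Suc[OF LIMSEQ_inverse_real_of_nat] by (auto simp: inverse_less_1_iff)
  have lim: "((\<lambda>h. R h w) \<longlongrightarrow> 0) (at 0)" if w: "w \<in> space M" for w
  proof -
    have "((\<lambda>h. norm (f w h - f w 0 - h *\<^sub>R f' w 0) / norm h) \<longlongrightarrow> 0) (at 0)"
      using der[OF w, of 0] unfolding has_vector_derivative_def has_derivative_at by simp
    then have "((\<lambda>h. norm (R h w)) \<longlongrightarrow> 0) (at 0)"
      unfolding R_def by (simp add: divide_inverse mult.commute)
    then show ?thesis by (rule tendsto_norm_zero_cancel)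
  qed
  have Xf: "filterlim X (at 0) sequentially" using X by (simp add: filterlim_at)
  \<comment> \<open>The derivative is measurable as a pointwise limit of difference quotients along
    \<open>X\<close>.\<close>
  have meas: "(\<lambda>w. f' w 0) \<in> borel_measurable M"
  proof (rule borel_measurable_LIMSEQ_metric)
    show "(\<lambda>w. (f w (X n) - f w 0) /\<^sub>R X n) \<in> borel_measurable M" for n
      using borel_measurable_integrable[OF int] X(3) by simp
    fix w assume w: "w \<in> space M"
    from filterlim_compose[OF lim[OF w] Xf]
    have "(\<lambda>n. (f w (X n) - f w 0) /\<^sub>R X n - f' w 0) \<longlonglongrightarrow> 0"
      unfolding R_def using X(2) by (simp add: scaleR_diff_right)
    then show "(\<lambda>n. (f w (X n) - f w 0) /\<^sub>R X n) \<longlonglongrightarrow> f' w 0"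
      by (simp add: LIM_zero_iff)
  qed
  show intp: "integrable M (\<lambda>w. f' w 0)"
    by (rule Bochner_Integration.integrable_bound[OF B meas])
      (use bd[of _ 0] in \<open>auto intro!: AE_I2 order_trans[OF _ abs_ge_self]\<close>)
  have Rb: "norm (R h w) \<le> 2 * B w" if w: "w \<in> space M" and h: "h \<noteq> 0" "\<bar>h\<bar> < 1" for h w
  proof -
    have "norm (f w h - f w 0) \<le> B w * \<bar>h - 0\<bar>"
      using h by (intro norm_diff_le_of_vector_derivative[OF der[OF w] bd[OF w]])
        (auto simp: closed_segment_eq_real_ivl split: if_splits)
    moreover have "norm (h *\<^sub>R f' w 0) \<le> B w * \<bar>h\<bar>"
      using mult_left_mono[OF bd[OF w, of 0], of "\<bar>h\<bar>"] by (simp add: mult.commute)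
    ultimately have "norm (f w h - f w 0 - h *\<^sub>R f' w 0) \<le> 2 * B w * \<bar>h\<bar>"
      using norm_triangle_ineq4[of "f w h - f w 0" "h *\<^sub>R f' w 0"] by simp
    then show ?thesis unfolding R_def norm_scaleR using h
      by (simp add: divide_inverse[symmetric] mult.commute[of "inverse _"] pos_divide_le_eq)
  qed
  have "((\<lambda>h. \<integral>w. R h w \<partial>M) \<longlongrightarrow> 0) (at 0)"
    unfolding tendsto_at_iff_sequentially
  proof (intro allI impI)
    fix Y :: "nat \<Rightarrow> real" assume Y: "\<forall>i. Y i \<in> UNIV - {0}" "Y \<longlonglongrightarrow> 0"
    have "\<forall>\<^sub>F n in sequentially. \<bar>Y n\<bar> < 1"
      using order_tendstoD(2)[OF tendsto_rabs_zero[OF Y(2)], of 1] by simp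
    then obtain n0 where n0: "\<And>n. n \<ge> n0 \<Longrightarrow> \<bar>Y n\<bar> < 1" unfolding eventually_sequentially by blast
    have "(\<lambda>n. \<integral>w. R (Y (n + n0)) w \<partial>M) \<longlonglongrightarrow> (\<integral>w. 0 \<partial>M)"
    proof (rule integral_dominated_convergence[where w = "\<lambda>w. 2 * B w"])
      have "filterlim (\<lambda>n. Y (n + n0)) (at 0) sequentially"
        using Y LIMSEQ_ignore_initial_segment[OF Y(2)] by (simp add: filterlim_at)
      then show "AE w in M. (\<lambda>n. R (Y (n + n0)) w) \<longlonglongrightarrow> 0"
        by (intro AE_I2 filterlim_compose[OF lim])
      show "AE w in M. norm (R (Y (n + n0)) w) \<le> 2 * B w" for n
        using Rb Y(1) n0 by (intro AE_I2) auto
      show "R (Y (n + n0)) \<in> borel_measurable M" for n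
        unfolding R_def using meas borel_measurable_integrable[OF int] n0 by simp
    qed (use B in auto)
    then show "((\<lambda>h. \<integral>w. R h w \<partial>M) \<circ> Y) \<longlonglongrightarrow> 0" by (simp add: o_def LIMSEQ_offset)
  qed
  then have l: "((\<lambda>h. norm (\<integral>w. R h w \<partial>M)) \<longlongrightarrow> 0) (at 0)" by (rule tendsto_norm_zero)
  have "\<forall>\<^sub>F h in at 0. norm (\<integral>w. R h w \<partial>M) = norm ((\<integral>w. f w (0 + h) \<partial>M) -
      (\<integral>w. f w 0 \<partial>M) - h *\<^sub>R (\<integral>w. f' w 0 \<partial>M)) / norm h"
    unfolding eventually_at
  proof (intro exI[of _ 1] conjI ballI impI)
    fix h :: real assume "h \<noteq> 0 \<and> dist h 0 < 1"
    then show "norm (\<integral>w. R h w \<partial>M) = norm ((\<integral>w. f w (0 + h) \<partial>M) -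
      (\<integral>w. f w 0 \<partial>M) - h *\<^sub>R (\<integral>w. f' w 0 \<partial>M)) / norm h"
      unfolding R_def using int intp by (simp add: divide_inverse mult.commute)
  qed simp
  from Lim_transform_eventually[OF l this]
  show "((\<lambda>t. \<integral>w. f w t \<partial>M) has_vector_derivative (\<integral>w. f' w 0 \<partial>M)) (at 0)"
    unfolding has_vector_derivative_def has_derivative_at by (simp add: bounded_linear_scaleR_left)
qed

context holder_exponent
begin

text \<open>The radius \<open>B w\<close> is an integrable majorant for every derivative up to order
  \<open>r\<close>, so differentiation in \<open>y\<close> passes under the integral and the radii
  integrate. Measurability of the derivatives in \<open>w\<close> is a by-product of differentiating
  under the integral.\<close>

lemma hol_integral:
  fixes f :: "'a \<Rightarrow> 'n::finite rn \<Rightarrow> complex"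
  assumes "integrable M B" "\<And>w. w \<in> space M \<Longrightarrow> hol r sg (B w) (f w)"
    "\<And>y. (\<lambda>w. f w y) \<in> borel_measurable M"
  shows "hol r sg (\<integral>w. B w \<partial>M) (\<lambda>y. \<integral>w. f w y \<partial>M)"
  using assms(2,3)
proof (induction r arbitrary: f)
  case 0
  have int: "integrable M (\<lambda>w. f w y)" for y
    by (rule Bochner_Integration.integrable_bound[OF assms(1) 0(2)])
      (use hol_bound[OF 0(1)] in \<open>auto intro!: AE_I2 order_trans[OF _ abs_ge_self]\<close>)
  show ?case unfolding hol.simps
  proof (intro conjI allI)
    fix x y
    show "cmod (\<integral>w. f w x \<partial>M) \<le> (\<integral>w. B w \<partial>M)"
      using hol_bound[OF 0(1)] by (intro order_trans[OF integral_norm_bound] integral_mono integrable_norm int assms(1))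
    have "cmod ((\<integral>w. f w x \<partial>M) - (\<integral>w. f w y \<partial>M)) = cmod (\<integral>w. f w x - f w y \<partial>M)"
      using int by simp
    also have "\<dots> \<le> (\<integral>w. cmod (f w x - f w y) \<partial>M)" by (rule integral_norm_bound)
    also have "\<dots> \<le> (\<integral>w. B w * norm (x - y) powr sg \<partial>M)"
      by (intro integral_mono integrable_norm Bochner_Integration.integrable_diff int
          integrable_mult_left assms(1) hol_0D[OF 0(1)])
    finally show "cmod ((\<integral>w. f w x \<partial>M) - (\<integral>w. f w y \<partial>M)) \<le> (\<integral>w. B w \<partial>M) * norm (x - y) powr sg"
      by simp
  qed
next
  case (Suc r)
  have int: "integrable M (\<lambda>w. f w y)" for y
    by (rule Bochner_Integration.integrable_bound[OF assms(1) Suc.prems(2)])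
      (use hol_bound[OF Suc.prems(1)] in \<open>auto intro!: AE_I2 order_trans[OF _ abs_ge_self]\<close>)
  have D1: "integrable M (\<lambda>w. pdiff i (f w) (x + 0 *\<^sub>R axis i 1))" for i x
    by (rule has_vector_derivative_integral(1)[OF assms(1) pdiffable_at_line _ int])
      (use hol_SucD[OF Suc.prems(1)] hol_bound in blast)+
  have D2: "((\<lambda>t. \<integral>w. f w (x + t *\<^sub>R axis i 1) \<partial>M) has_vector_derivative
      (\<integral>w. pdiff i (f w) (x + 0 *\<^sub>R axis i 1) \<partial>M)) (at 0)" for i x
    by (rule has_vector_derivative_integral(2)[OF assms(1) pdiffable_at_line _ int])
      (use hol_SucD[OF Suc.prems(1)] hol_bound in blast)+
  have meas: "(\<lambda>w. pdiff i (f w) x) \<in> borel_measurable M" for i x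
    using borel_measurable_integrable[OF D1] by simp
  have der: "((\<lambda>t. \<integral>w. f w (x + t *\<^sub>R axis i 1) \<partial>M) has_vector_derivative (\<integral>w. pdiff i (f w) x \<partial>M)) (at 0)" for i x
    using D2 by simp
  show ?case
  proof (rule hol_SucI)
    show "cmod (\<integral>w. f w x \<partial>M) \<le> (\<integral>w. B w \<partial>M)" for x
      using hol_bound[OF Suc.prems(1)] by (intro order_trans[OF integral_norm_bound] integral_mono integrable_norm int assms(1))
    show "pdiffable_at i (\<lambda>y. \<integral>w. f w y \<partial>M) x" for i x
      by (rule pdiffable_atI[OF der])
    have "pdiff i (\<lambda>y. \<integral>w. f w y \<partial>M) = (\<lambda>x. \<integral>w. pdiff i (f w) x \<partial>M)" for i
      by (intro ext pdiff_eqI[OF der])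
    then show "hol r sg (\<integral>w. B w \<partial>M) (pdiff i (\<lambda>y. \<integral>w. f w y \<partial>M))" for i
      using Suc.IH[of "\<lambda>w. pdiff i (f w)"] hol_SucD(2)[OF Suc.prems(1)] meas by simp
  qed
qed

text \<open>In the integral form of the remainder the kernel (1 - t)^(N-1) / (N-1)! is at most 1 on
  the unit interval, so the remainder stays in the ball of the N-th derivative.\<close>

lemma hol_taylor:
  fixes g :: "nat \<Rightarrow> real \<Rightarrow> 'n::finite rn \<Rightarrow> complex"
  assumes N: "N > 0"
    and der: "\<And>j t y. j < N \<Longrightarrow> 0 \<le> t \<Longrightarrow> t \<le> 1 \<Longrightarrow> ((\<lambda>t. g j t y) has_vector_derivative g (Suc j) t y) (at t)"
    and cont: "\<And>y. continuous_on {0..1} (\<lambda>t. g N t y)"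
    and bd: "\<And>t. 0 \<le> t \<Longrightarrow> t \<le> 1 \<Longrightarrow> hol r sg B (g N t)"
  shows "hol r sg B (\<lambda>y. g 0 1 y - (\<Sum>j<N. g j 0 y / of_real (fact j)))"
proof -
  have B: "0 \<le> B" using hol_nonneg[OF bd[of 0]] by simp
  define G where "G t y = indicator {0..1} t *\<^sub>R (((1 - t) ^ (N - 1) / fact (N - 1)) *\<^sub>R g N t y)" for t :: real and y
  have si: "set_integrable lborel {0..1} (\<lambda>t. ((1 - t) ^ (N - 1) / fact (N - 1)) *\<^sub>R g N t y)" for y
    using cont by (intro borel_integrable_atLeastAtMost' continuous_intros) auto
  have eq: "g 0 1 y - (\<Sum>j<N. g j 0 y / of_real (fact j)) = (\<integral>t. G t y \<partial>lborel)" for y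
  proof -
    have "((\<lambda>t. ((1 - t) ^ (N - 1) / fact (N - 1)) *\<^sub>R g N t y) has_integral
        g 0 1 y - (\<Sum>i<N. ((1 - 0) ^ i / fact i) *\<^sub>R g i 0 y)) {0..1}"
      using der by (intro Taylor_has_integral[OF N, of "\<lambda>j t. g j t y" "\<lambda>t. g 0 t y"])
        (auto intro: has_vector_derivative_at_within)
    then have "integral {0..1} (\<lambda>t. ((1 - t) ^ (N - 1) / fact (N - 1)) *\<^sub>R g N t y) =
        g 0 1 y - (\<Sum>i<N. ((1 - 0) ^ i / fact i) *\<^sub>R g i 0 y)" by (rule integral_unique)
    then show ?thesis using set_borel_integral_eq_integral(2)[OF si, of y]
      unfolding set_lebesgue_integral_def G_def by (simp add: scaleR_conv_of_real divide_inverse mult.commute)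
  qed
  have "hol r sg (\<integral>t. indicator {0..1::real} t * B \<partial>lborel) (\<lambda>y. \<integral>t. G t y \<partial>lborel)"
  proof (rule hol_integral[where f = G])
    show "integrable lborel (\<lambda>t. indicator {0..1::real} t * B)"
      by (intro integrable_mult_left integrable_real_indicator) auto
    show "(\<lambda>t. G t y) \<in> borel_measurable lborel" for y
      using si[of y] unfolding set_integrable_def G_def by (rule borel_measurable_integrable)
    fix t :: real
    show "hol r sg (indicator {0..1} t * B) (G t)"
    proof (cases "t \<in> {0..1}")
      case True
      define c where "c = complex_of_real ((1 - t) ^ (N - 1) / fact (N - 1))"
      have "(1 - t) ^ (N - 1) \<le> fact (N - 1)"
        by (rule order_trans[OF power_le_one]) (use True in \<open>auto simp: fact_ge_1\<close>)
      moreover have "0 \<le> (1 - t) ^ (N - 1)" using True by simp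
      ultimately have c: "cmod c \<le> 1" unfolding c_def norm_of_real
        by (simp add: divide_le_eq)
      have "G t = (\<lambda>y. c * g N t y)" using True by (auto simp: G_def c_def scaleR_conv_of_real)
      moreover have "hol r sg (cmod c * B) (\<lambda>y. c * g N t y)" using True by (intro hol_cmult bd) auto
      ultimately show ?thesis
        using True c B by (auto elim!: hol_mono intro!: mult_left_le_one_le)
    next
      case False
      then have "G t = (\<lambda>y. 0)" "indicator {0..1::real} t * B = (0 :: real)" by (auto simp: G_def)
      then show ?thesis using hol_const[of r sg 0] by (simp only: norm_zero)
    qed
  qed
  then show ?thesis unfolding eq by simp
qed

text \<open>Each derivative, and the Hoelder quotient, brings down one factor bounded in terms of
  \<open>A\<close>. Only the real part of \<open>f\<close> enters exponentially, so oscillating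
  phases cost no more than a polynomial in \<open>A\<close>.\<close>

lemma hol_exp:
  "\<exists>C>0. \<forall>A c f. hol r sg A f \<longrightarrow> (\<forall>y. Re (f y) \<le> c) \<longrightarrow>
    hol r sg (C * (1 + A) ^ Suc r * exp c) (\<lambda>y :: 'n::finite rn. exp (f y))"
proof (induction r)
  case 0
  have "hol 0 sg (1 * (1 + A) ^ Suc 0 * exp c) (\<lambda>y. exp (f y))"
    if f: "hol 0 sg A f" and re: "\<forall>y. Re (f y) \<le> c" for A c and f :: "'n rn \<Rightarrow> complex"
    unfolding hol.simps
  proof (intro conjI allI)
    have A: "0 \<le> A" using hol_nonneg[OF f] .
    fix x y
    have "cmod (exp (f x)) \<le> exp c" using re by simp
    also have "\<dots> \<le> 1 * (1 + A) ^ Suc 0 * exp c" using A by simp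
    finally show "cmod (exp (f x)) \<le> 1 * (1 + A) ^ Suc 0 * exp c" .
    have "cmod (exp (f x) - exp (f y)) \<le> exp c * norm (f x - f y)"
    proof (rule field_differentiable_bound[where S = "{z. Re z \<le> c}" and f' = exp])
      show "convex {z. Re z \<le> c}" by (rule convex_halfspace_Re_le)
    qed (use re in \<open>auto intro: DERIV_subset[OF DERIV_exp]\<close>)
    also have "\<dots> \<le> exp c * (A * norm (x - y) powr sg)" by (intro mult_left_mono hol_0D[OF f]) auto
    also have "\<dots> \<le> 1 * (1 + A) ^ Suc 0 * exp c * norm (x - y) powr sg"
      using A by (simp add: algebra_simps)
    finally show "cmod (exp (f x) - exp (f y)) \<le> 1 * (1 + A) ^ Suc 0 * exp c * norm (x - y) powr sg" .
  qed
  then show ?case by (intro exI[of _ 1]) auto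
next
  case (Suc r)
  then obtain C where C: "C > 0" "\<And>A c f. hol r sg A f \<Longrightarrow> \<forall>y. Re (f y) \<le> c \<Longrightarrow>
    hol r sg (C * (1 + A) ^ Suc r * exp c) (\<lambda>y :: 'n rn. exp (f y))" by blast
  obtain M where M: "M > 0" "\<And>A B f g. hol r sg A f \<Longrightarrow> hol r sg B g \<Longrightarrow>
    hol r sg (M * (A * B)) (\<lambda>x :: 'n rn. f x * g x)" using hol_mult[of r] by blast
  define D where "D = real CARD('n) + 2"
  have D: "D \<ge> 1" unfolding D_def by simp
  define K where "K = M * C * D ^ Suc r + 1"
  have K: "K \<ge> 1" unfolding K_def using C M D by simp
  have "hol (Suc r) sg (K * (1 + A) ^ Suc (Suc r) * exp c) (\<lambda>y. exp (f y))"
    if f: "hol (Suc r) sg A f" and re: "\<forall>y. Re (f y) \<le> c" for A c and f :: "'n rn \<Rightarrow> complex"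
  proof (rule hol_SucI)
    have A: "0 \<le> A" using hol_nonneg[OF f] .
    fix x :: "'n rn"
    have "1 \<le> (1 + A) ^ Suc (Suc r)" using A by (intro one_le_power) simp
    then have "1 * 1 \<le> K * (1 + A) ^ Suc (Suc r)" using K by (intro mult_mono) auto
    then have "1 * exp c \<le> K * (1 + A) ^ Suc (Suc r) * exp c" by (intro mult_right_mono) auto
    moreover have "cmod (exp (f x)) \<le> exp c" using re by simp
    ultimately show "cmod (exp (f x)) \<le> K * (1 + A) ^ Suc (Suc r) * exp c" by linarith
    fix i
    show "pdiffable_at i (\<lambda>y. exp (f y)) x" by (intro pdiffable_exp hol_SucD[OF f])
    have pe: "pdiff i (\<lambda>y. exp (f y)) = (\<lambda>y. pdiff i f y * exp (f y))"
      by (intro ext pdiff_exp hol_SucD[OF f])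
    have "hol r sg (M * (A * (C * (1 + D * A) ^ Suc r * exp c))) (pdiff i (\<lambda>y. exp (f y)))"
      unfolding pe D_def by (intro M C hol_down f re hol_SucD[OF f])
    moreover have "M * (A * (C * (1 + D * A) ^ Suc r * exp c)) \<le> K * (1 + A) ^ Suc (Suc r) * exp c"
    proof -
      have "(1 + D * A) ^ Suc r \<le> (D * (1 + A)) ^ Suc r"
        using A D by (intro power_mono) (auto simp: algebra_simps)
      then have "(1 + D * A) ^ Suc r \<le> D ^ Suc r * (1 + A) ^ Suc r" unfolding power_mult_distrib .
      moreover have "A \<le> 1 + A" by simp
      ultimately have "A * (1 + D * A) ^ Suc r \<le> (1 + A) * (D ^ Suc r * (1 + A) ^ Suc r)"
        using A D by (intro mult_mono) auto
      then have "M * C * exp c * (A * (1 + D * A) ^ Suc r) \<le> M * C * exp c * ((1 + A) * (D ^ Suc r * (1 + A) ^ Suc r))"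
        using C M by (intro mult_left_mono) auto
      also have "\<dots> = (K - 1) * (1 + A) ^ Suc (Suc r) * exp c"
        unfolding K_def by (simp add: algebra_simps)
      also have "\<dots> \<le> K * (1 + A) ^ Suc (Suc r) * exp c"
        using A by (intro mult_right_mono) auto
      finally show ?thesis by (simp add: algebra_simps)
    qed
    ultimately show "hol r sg (K * (1 + A) ^ Suc (Suc r) * exp c) (pdiff i (\<lambda>y. exp (f y)))"
      by (rule hol_mono)
  qed
  moreover have "0 < K" using K by simp
  ultimately show ?case by blast
qed

text \<open>Only derivatives are bounded, not \<open>k\<close> itself: a diffeomorphism of the whole
  space is unbounded.\<close>

definition bdm :: "('n::finite rn \<Rightarrow> 'n rn) \<Rightarrow> bool" where
  "bdm k \<longleftrightarrow> (\<forall>j i x. pdiffable_at i (\<lambda>x. k x $ j) x) \<and>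
    (\<forall>r. \<exists>A. \<forall>i j. hol r sg A (\<lambda>x. complex_of_real (pdiff i (\<lambda>x. k x $ j) x)))"

lemma lipschitz_of_hol:
  fixes b :: "'n::finite rn \<Rightarrow> real"
  assumes "\<And>i x. pdiffable_at i b x" "\<And>i. hol r sg A (\<lambda>x. complex_of_real (pdiff i b x))"
  shows "\<bar>b x - b y\<bar> \<le> real CARD('n) * A * norm (x - y)"
proof -
  have "continuous_on UNIV (\<lambda>x. Re (complex_of_real (pdiff i b x)))" for i
    by (intro continuous_intros hol_continuous[OF assms(2)])
  then have "pd1 b" unfolding pd1_def Re_complex_of_real using assms(1) by blast
  from pd1_lipschitz[OF this, of A x y] show ?thesis
    using hol_bound[OF assms(2)] by simp
qed

lemma bdm_lipschitz:
  fixes k :: "'n::finite rn \<Rightarrow> 'n rn"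
  assumes "bdm k" shows "\<exists>K\<ge>1. \<forall>x y. norm (k x - k y) \<le> K * norm (x - y)"
proof -
  obtain A where A: "\<And>i j. hol 0 sg A (\<lambda>x. complex_of_real (pdiff i (\<lambda>x. k x $ j) x))"
    using assms unfolding bdm_def by blast
  have d: "pdiffable_at i (\<lambda>x. k x $ j) x" for i j x using assms unfolding bdm_def by blast
  have A0: "0 \<le> A" using hol_nonneg[OF A] .
  define K where "K = real CARD('n) * (real CARD('n) * A) + 1"
  have "norm (k x - k y) \<le> K * norm (x - y)" for x y
  proof -
    have "norm (k x - k y) \<le> (\<Sum>j\<in>UNIV. \<bar>(k x - k y) $ j\<bar>)" by (rule norm_le_l1_cart)
    also have "\<dots> \<le> (\<Sum>j\<in>(UNIV :: 'n set). real CARD('n) * A * norm (x - y))"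
      using lipschitz_of_hol[OF d A] by (intro sum_mono) auto
    also have "\<dots> \<le> K * norm (x - y)" unfolding K_def by (simp add: algebra_simps)
    finally show ?thesis .
  qed
  moreover have "K \<ge> 1" unfolding K_def using A0 by simp
  ultimately show ?thesis by blast
qed

text \<open>Induction by the chain rule; in the base case a Lipschitz constant of \<open>k\<close>
  enters to the power \<open>sg\<close>. The constant is independent of \<open>f\<close>, so whole
  families can be composed uniformly.\<close>

lemma hol_comp:
  fixes k :: "'n::finite rn \<Rightarrow> 'n rn"
  assumes "bdm k"
  shows "\<exists>C>0. \<forall>B f. hol r sg B f \<longrightarrow> hol r sg (C * B) (\<lambda>x. f (k x))"
proof (induction r)
  case 0
  obtain K where K: "K \<ge> 1" "\<And>x y. norm (k x - k y) \<le> K * norm (x - y)"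
    using bdm_lipschitz[OF assms] by blast
  have Kp: "K powr sg \<ge> 1" using K(1) sg by (simp add: ge_one_powr_ge_zero)
  have "hol 0 sg (K powr sg * B) (\<lambda>x. f (k x))" if f: "hol 0 sg B f" for B f
    unfolding hol.simps
  proof (intro conjI allI)
    have B: "0 \<le> B" using hol_nonneg[OF f] .
    fix x y
    show "cmod (f (k x)) \<le> K powr sg * B"
      using hol_bound[OF f, of "k x"] mult_right_mono[OF Kp B] by simp
    have "cmod (f (k x) - f (k y)) \<le> B * norm (k x - k y) powr sg" by (rule hol_0D[OF f])
    also have "\<dots> \<le> B * (K * norm (x - y)) powr sg"
      using K(2)[of x y] B sg by (intro mult_left_mono powr_mono2) auto
    also have "\<dots> = K powr sg * B * norm (x - y) powr sg" using K(1) by (simp add: powr_mult)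
    finally show "cmod (f (k x) - f (k y)) \<le> K powr sg * B * norm (x - y) powr sg" .
  qed
  moreover have "K powr sg > 0" using K(1) by simp
  ultimately show ?case by blast
next
  case (Suc r)
  then obtain C where C: "C > 0" "\<And>B f. hol r sg B f \<Longrightarrow> hol r sg (C * B) (\<lambda>x. f (k x))" by blast
  obtain M where M: "M > 0" "\<And>A B f g. hol r sg A f \<Longrightarrow> hol r sg B g \<Longrightarrow>
    hol r sg (M * (A * B)) (\<lambda>x :: 'n rn. f x * g x)" using hol_mult[of r] by blast
  obtain A where A: "\<And>i j. hol r sg A (\<lambda>x. complex_of_real (pdiff i (\<lambda>x. k x $ j) x))"
    using assms unfolding bdm_def by blast
  have d: "pdiffable_at i (\<lambda>x. k x $ j) x" for i j x using assms unfolding bdm_def by blast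
  have A0: "0 \<le> A" using hol_nonneg[OF A] .
  define K where "K = real CARD('n) * (M * A * C) + 1"
  have K: "K \<ge> 1" unfolding K_def using A0 C M by simp
  have "hol (Suc r) sg (K * B) (\<lambda>x. f (k x))" if f: "hol (Suc r) sg B f" for B f
  proof (rule hol_SucI)
    have B: "0 \<le> B" using hol_nonneg[OF f] .
    fix x i
    show "cmod (f (k x)) \<le> K * B" using hol_bound[OF f, of "k x"] mult_right_mono[OF K B] by simp
    show "pdiffable_at i (\<lambda>x. f (k x)) x" by (rule pd1_comp(1)[OF hol_pd1[OF f] d])
    have pe: "pdiff i (\<lambda>x. f (k x)) =
      (\<lambda>x. \<Sum>j\<in>UNIV. complex_of_real (pdiff i (\<lambda>x. k x $ j) x) * pdiff j f (k x))"
      using pd1_comp(2)[OF hol_pd1[OF f] d] by (auto simp: scaleR_conv_of_real)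
    have "hol r sg (\<Sum>j\<in>(UNIV::'n set). M * (A * (C * B))) (pdiff i (\<lambda>x. f (k x)))"
      unfolding pe by (intro hol_sum M A C hol_SucD[OF f])
    moreover have "(\<Sum>j\<in>(UNIV::'n set). M * (A * (C * B))) \<le> K * B"
      unfolding K_def using B by (simp add: algebra_simps)
    ultimately show "hol r sg (K * B) (pdiff i (\<lambda>x. f (k x)))" by (rule hol_mono)
  qed
  moreover have "0 < K" using K by simp
  ultimately show ?case by blast
qed

text \<open>The additional derivative makes the derivatives of order \<open>r\<close> Lipschitz, and
  \<open>lip_to_holder\<close> converts this into Hoelder quotients.\<close>

lemma hol_of_bounded:
  fixes f :: "'n::finite rn \<Rightarrow> complex"
  assumes "Ck (Suc r) f" "\<And>L x. length L \<le> Suc r \<Longrightarrow> cmod (pds L f x) \<le> B"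
  shows "hol r sg ((real CARD('n) + 2) * B) f"
  using assms
proof (induction r arbitrary: f)
  case 0
  have pd: "pd1 f" using Ck_Suc_pd1[OF 0(1)] .
  have bd: "cmod (f x) \<le> B" for x using 0(2)[of "[]"] by simp
  have bd': "cmod (pdiff i f x) \<le> B" for i x using 0(2)[of "[i]"] by simp
  have B: "0 \<le> B" using bd norm_ge_zero order_trans by blast
  have "cmod (f x - f y) \<le> (real CARD('n) * B + 2 * B) * norm (x - y) powr sg" for x y
  proof (rule lip_to_holder)
    show "cmod (f x - f y) \<le> 2 * B"
      using norm_triangle_ineq4[of "f x" "f y"] bd[of x] bd[of y] by linarith
    show "cmod (f x - f y) \<le> real CARD('n) * B * norm (x - y)"
      by (rule pd1_lipschitz[OF pd bd'])
  qed (use B in auto)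
  moreover have "cmod (f x) \<le> (real CARD('n) + 2) * B" for x
    using bd[of x] mult_right_mono[of 1 "real CARD('n) + 2" B] B by simp
  ultimately show ?case by (simp add: distrib_right)
next
  case (Suc r)
  have bd: "cmod (f x) \<le> B" for x using Suc.prems(2)[of "[]"] by simp
  have B: "0 \<le> B" using bd norm_ge_zero order_trans by blast
  have C: "\<forall>i x. pdiffable_at i f x" "\<forall>i. Ck (Suc r) (pdiff i f)"
    using Suc.prems(1) unfolding Ck_Suc_iff[of "Suc r"] by blast+
  show ?case
  proof (rule hol_SucI)
    show "cmod (f x) \<le> (real CARD('n) + 2) * B" for x
      using bd[of x] mult_right_mono[of 1 "real CARD('n) + 2" B] B by simp
    show "hol r sg ((real CARD('n) + 2) * B) (pdiff i f)" for i
    proof (rule Suc.IH)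
      show "Ck (Suc r) (pdiff i f)" using C by blast
      show "cmod (pds L (pdiff i f) x) \<le> B" if "length L \<le> Suc r" for L x
        using Suc.prems(2)[of "L @ [i]" x] that by simp
    qed
  qed (use C in blast)
qed

end

lemma has_vector_derivative_of_quadratic:
  fixes f :: "real \<Rightarrow> 'b::real_normed_vector"
  assumes "d > 0" "\<And>h. \<bar>h\<bar> < d \<Longrightarrow> norm (f (x + h) - f x - h *\<^sub>R f') \<le> K * h\<^sup>2"
  shows "(f has_vector_derivative f') (at x)"
  unfolding has_vector_derivative_def has_derivative_at_alt
proof (intro conjI allI impI)
  show "bounded_linear (\<lambda>h. h *\<^sub>R f')" by (rule bounded_linear_scaleR_left)
  fix e :: real assume e: "0 < e"
  define d' where "d' = min d (e / (\<bar>K\<bar> + 1))"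
  have "norm (f y - f x - (y - x) *\<^sub>R f') \<le> e * norm (y - x)" if y: "norm (y - x) < d'" for y
  proof -
    have "\<bar>y - x\<bar> < d" and K: "\<bar>y - x\<bar> * (\<bar>K\<bar> + 1) < e"
      using y unfolding d'_def by (auto simp: pos_less_divide_eq)
    from assms(2)[OF this(1)] have "norm (f y - f x - (y - x) *\<^sub>R f') \<le> K * (y - x)\<^sup>2" by simp
    also have "\<dots> \<le> (\<bar>K\<bar> + 1) * (y - x)\<^sup>2" by (intro mult_right_mono) auto
    also have "\<dots> = (\<bar>y - x\<bar> * (\<bar>K\<bar> + 1)) * \<bar>y - x\<bar>" unfolding power2_abs[symmetric, of "y - x"] power2_eq_square by (simp only: mult_ac)
    also have "\<dots> \<le> e * \<bar>y - x\<bar>" using K by (intro mult_right_mono) auto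
    finally show ?thesis by simp
  qed
  moreover have "d' > 0" unfolding d'_def using assms(1) e by simp
  ultimately show "\<exists>d>0. \<forall>y. norm (y - x) < d \<longrightarrow> norm (f y - f x - (y - x) *\<^sub>R f') \<le> e * norm (y - x)"
    by blast
qed

section \<open>Substituting a function of \<open>y\<close> for a smooth parameter\<close>

context holder_exponent
begin

text \<open>The basic estimate in the parameter: it justifies interchanging derivatives in
  \<open>s\<close> and \<open>y\<close>, gives the chain rule in \<open>hol_subst\<close>, and
  underlies Landau's inequality in \<open>hol_derivative_decay\<close>.\<close>

lemma hol_taylor2:
  fixes g :: "nat \<Rightarrow> real \<Rightarrow> 'n::finite rn \<Rightarrow> complex"
  assumes S: "convex S" "s \<in> S" "s + h \<in> S"
    and der: "\<And>j u y. u \<in> S \<Longrightarrow> ((\<lambda>s. g j s y) has_vector_derivative g (Suc j) u y) (at u)"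
    and bd: "\<And>u. u \<in> S \<Longrightarrow> hol r sg B (g 2 u)"
  shows "hol r sg (h\<^sup>2 * B) (\<lambda>y. g 0 (s + h) y - g 0 s y - h *\<^sub>R g 1 s y)"
proof -
  have mem: "s + t * h \<in> S" if "0 \<le> t" "t \<le> 1" for t
    using convexD[OF S, of "1 - t" t] that by (simp add: algebra_simps)
  define G where "G j t y = complex_of_real (h ^ j) * g j (s + t * h) y" for j t y
  have dG: "((\<lambda>t. G j t y) has_vector_derivative G (Suc j) t y) (at t)" if t: "0 \<le> t" "t \<le> 1" for j t y
  proof -
    have "((\<lambda>s. g j s y) \<circ> (\<lambda>t. s + t * h) has_vector_derivative h *\<^sub>R g (Suc j) (s + t * h) y) (at t)"
    proof (rule vector_diff_chain_at)
      show "((\<lambda>s. g j s y) has_vector_derivative g (Suc j) (s + t * h) y) (at (s + t * h))"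
        by (rule der[OF mem[OF t]])
    qed (auto intro!: derivative_eq_intros)
    from has_vector_derivative_mult_right[OF this, of "complex_of_real (h ^ j)"]
    show ?thesis unfolding G_def o_def by (simp add: scaleR_conv_of_real algebra_simps)
  qed
  have "hol r sg (h\<^sup>2 * B) (\<lambda>y. G 0 1 y - (\<Sum>j<2. G j 0 y / of_real (fact j)))"
  proof (rule hol_taylor)
    show "continuous_on {0..1} (\<lambda>t. G 2 t y)" for y
      using dG by (intro continuous_at_imp_continuous_on ballI has_vector_derivative_continuous) auto
    show "hol r sg (h\<^sup>2 * B) (G 2 t)" if "0 \<le> t" "t \<le> 1" for t
      using hol_cmult[OF bd[OF mem[OF that]], of "complex_of_real (h\<^sup>2)"]
      unfolding G_def by (simp add: norm_power)
  qed (use dG in auto)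
  then show ?thesis
    by (simp add: G_def numeral_2_eq_2 scaleR_conv_of_real diff_diff_eq)
qed

text \<open>The remainder of \<open>hol_taylor2\<close> is O(h^2) in a ball of order
  \<open>Suc r\<close>, hence so is its derivative in direction \<open>i\<close>; this identifies
  the derivative in \<open>s\<close> of \<open>pdiff i (g 0 s)\<close>.\<close>

lemma hol_pdiff_parameter:
  fixes g :: "nat \<Rightarrow> real \<Rightarrow> 'n::finite rn \<Rightarrow> complex"
  assumes S: "open S" "convex S" "s \<in> S"
    and der: "\<And>j u y. u \<in> S \<Longrightarrow> ((\<lambda>s. g j s y) has_vector_derivative g (Suc j) u y) (at u)"
    and bd: "\<And>j. \<exists>B. \<forall>u\<in>S. hol (Suc r) sg B (g j u)"
  shows "((\<lambda>s. pdiff i (g 0 s) y) has_vector_derivative pdiff i (g 1 s) y) (at s)"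
proof -
  obtain B where B: "\<And>u. u \<in> S \<Longrightarrow> hol (Suc r) sg B (g 2 u)" using bd by blast
  obtain d where d: "d > 0" "\<And>u. dist u s < d \<Longrightarrow> u \<in> S"
    using S(1,3) unfolding open_dist by blast
  have pd: "pdiffable_at i (g j u) y" if u: "u \<in> S" for j u y
  proof -
    obtain B' where "hol (Suc r) sg B' (g j u)" using bd[of j] u by blast
    then show ?thesis by (rule hol_SucD(1))
  qed
  show ?thesis
  proof (rule has_vector_derivative_of_quadratic[OF d(1)])
    fix h :: real assume "\<bar>h\<bar> < d"
    then have sh: "s + h \<in> S" by (intro d(2)) (simp add: dist_norm)
    have h1: "hol (Suc r) sg (h\<^sup>2 * B) (\<lambda>y. g 0 (s + h) y - g 0 s y - h *\<^sub>R g 1 s y)"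
      by (rule hol_taylor2[OF S(2,3) sh der B])
    have "pdiff i (\<lambda>y. g 0 (s + h) y - g 0 s y - h *\<^sub>R g 1 s y) y =
      pdiff i (g 0 (s + h)) y - pdiff i (g 0 s) y - h *\<^sub>R pdiff i (g 1 s) y"
      using pd[OF sh] pd[OF S(3)]
      by (simp add: pdiff_diff pdiffable_diff pdiffable_linear[OF bounded_linear_scaleR_right]
          pdiff_linear[OF bounded_linear_scaleR_right])
    then show "norm (pdiff i (g 0 (s + h)) y - pdiff i (g 0 s) y - h *\<^sub>R pdiff i (g 1 s) y) \<le> B * h\<^sup>2"
      using hol_bound[OF hol_SucD(2)[OF h1], of i y] by (simp add: mult.commute)
  qed
qed

text \<open>Each derivative in \<open>y\<close> falls on \<open>b\<close> at most once and costs a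
  factor \<open>A\<close>, and the Hoelder quotient costs one more, whence \<open>A ^ Suc r\<close>.
  The precise power matters because \<open>A\<close> will be proportional to |t|. The constant is
  uniform in \<open>g\<close>, \<open>b\<close>, \<open>S\<close>; the bounds \<open>B'\<close> only
  justify interchanging derivatives and do not enter it.\<close>

lemma hol_subst:
  "\<exists>C>0. \<forall>(g :: nat \<Rightarrow> real \<Rightarrow> 'n::finite rn \<Rightarrow> complex) b A B S.
    1 \<le> A \<longrightarrow> open S \<longrightarrow> convex S \<longrightarrow> (\<forall>x. b x \<in> S) \<longrightarrow>
    (\<forall>j. \<forall>s\<in>S. \<forall>y. ((\<lambda>s. g j s y) has_vector_derivative g (Suc j) s y) (at s)) \<longrightarrow>
    (\<forall>j\<le>Suc r. \<forall>s\<in>S. hol r sg B (g j s)) \<longrightarrow>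
    (\<forall>j. \<exists>B'. \<forall>s\<in>S. hol r sg B' (g j s)) \<longrightarrow>
    (\<forall>i x. pdiffable_at i b x) \<longrightarrow> (\<forall>i. hol r sg A (\<lambda>x. complex_of_real (pdiff i b x))) \<longrightarrow>
    hol r sg (C * A ^ Suc r * B) (\<lambda>y. g 0 (b y) y)"
proof (induction r)
  case 0
  have "hol 0 sg ((real CARD('n) + 3) * A ^ Suc 0 * B) (\<lambda>y. g 0 (b y) y)"
    if A: "1 \<le> A" and S: "open S" "convex S" "\<And>x. b x \<in> S"
      and der: "\<And>j s y. s \<in> S \<Longrightarrow> ((\<lambda>s. g j s y) has_vector_derivative g (Suc j) s y) (at s)"
      and bd: "\<And>j s. j \<le> Suc 0 \<Longrightarrow> s \<in> S \<Longrightarrow> hol 0 sg B (g j s)"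
      and b: "\<And>i x. pdiffable_at i b x" "\<And>i. hol 0 sg A (\<lambda>x. complex_of_real (pdiff i b x))"
    for g :: "nat \<Rightarrow> real \<Rightarrow> 'n rn \<Rightarrow> complex" and b A B S
    unfolding hol.simps(1)
  proof (intro conjI allI)
    have B: "0 \<le> B" using hol_nonneg[OF bd[OF _ S(3)]] by blast
    fix x y
    have 1: "cmod (g 0 (b x) x) \<le> B" for x using hol_bound[OF bd[OF _ S(3)]] by blast
    have "1 * B \<le> ((real CARD('n) + 3) * A ^ Suc 0) * B"
      using A B by (intro mult_right_mono) (auto simp: algebra_simps intro: add_increasing)
    then show "cmod (g 0 (b x) x) \<le> (real CARD('n) + 3) * A ^ Suc 0 * B" using 1[of x] by linarith
    have seg: "closed_segment (b y) (b x) \<subseteq> S" using S closed_segment_subset by blast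
    have "cmod (g 0 (b x) y - g 0 (b y) y) \<le> (real CARD('n) * A * B + 2 * B) * norm (x - y) powr sg"
    proof (rule lip_to_holder)
      show "cmod (g 0 (b x) y - g 0 (b y) y) \<le> 2 * B"
        using norm_triangle_ineq4[of "g 0 (b x) y" "g 0 (b y) y"] hol_bound[OF bd[OF _ S(3)], of 0 x y] 1[of y] by simp
      have "cmod (g 0 (b x) y - g 0 (b y) y) \<le> B * \<bar>b x - b y\<bar>"
        using seg der hol_bound[OF bd] by (intro norm_diff_le_of_vector_derivative[where g' = "\<lambda>s. g (Suc 0) s y"]) auto
      also have "\<dots> \<le> B * (real CARD('n) * A * norm (x - y))"
        by (intro mult_left_mono B lipschitz_of_hol[OF b])
      finally show "cmod (g 0 (b x) y - g 0 (b y) y) \<le> real CARD('n) * A * B * norm (x - y)"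
        by (simp add: algebra_simps)
    qed (use A B in auto)
    moreover have "cmod (g 0 (b x) x - g 0 (b x) y) \<le> B * norm (x - y) powr sg"
      by (rule hol_0D[OF bd[OF _ S(3)]]) simp
    moreover have "g 0 (b x) x - g 0 (b y) y = (g 0 (b x) x - g 0 (b x) y) + (g 0 (b x) y - g 0 (b y) y)" by simp
    ultimately have "cmod (g 0 (b x) x - g 0 (b y) y) \<le>
      B * norm (x - y) powr sg + (real CARD('n) * A * B + 2 * B) * norm (x - y) powr sg"
      using norm_triangle_ineq[of "g 0 (b x) x - g 0 (b x) y" "g 0 (b x) y - g 0 (b y) y"] by simp
    also have "\<dots> = (real CARD('n) * A * B + 3 * B) * norm (x - y) powr sg" by (simp add: algebra_simps)
    also have "\<dots> \<le> (real CARD('n) + 3) * A ^ Suc 0 * B * norm (x - y) powr sg"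
      using A B mult_right_mono[OF A, of "3 * B"] by (intro mult_right_mono) (auto simp: algebra_simps)
    finally show "cmod (g 0 (b x) x - g 0 (b y) y) \<le> (real CARD('n) + 3) * A ^ Suc 0 * B * norm (x - y) powr sg" .
  qed
  then show ?case by (intro exI[of _ "real CARD('n) + 3"]) (auto simp del: hol.simps)
next
  case (Suc r)
  then obtain C where C: "C > 0" "\<And>(g :: nat \<Rightarrow> real \<Rightarrow> 'n rn \<Rightarrow> complex) b A B S.
    1 \<le> A \<Longrightarrow> open S \<Longrightarrow> convex S \<Longrightarrow> (\<forall>x. b x \<in> S) \<Longrightarrow>
    (\<forall>j. \<forall>s\<in>S. \<forall>y. ((\<lambda>s. g j s y) has_vector_derivative g (Suc j) s y) (at s)) \<Longrightarrow>
    (\<forall>j\<le>Suc r. \<forall>s\<in>S. hol r sg B (g j s)) \<Longrightarrow>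
    (\<forall>j. \<exists>B'. \<forall>s\<in>S. hol r sg B' (g j s)) \<Longrightarrow>
    (\<forall>i x. pdiffable_at i b x) \<Longrightarrow> (\<forall>i. hol r sg A (\<lambda>x. complex_of_real (pdiff i b x))) \<Longrightarrow>
    hol r sg (C * A ^ Suc r * B) (\<lambda>y. g 0 (b y) y)" by blast
  obtain M where M: "M > 0" "\<And>A B f g. hol r sg A f \<Longrightarrow> hol r sg B g \<Longrightarrow>
    hol r sg (M * (A * B)) (\<lambda>x :: 'n rn. f x * g x)" using hol_mult[of r] by blast
  define D where "D = real CARD('n) + 2"
  have D: "D \<ge> 1" unfolding D_def by simp
  \<comment> \<open>In D^(r+3) one factor lowers the order of the derivative of \<open>b\<close>,
    one that of \<open>g 1\<close>, and r + 1 come from the induction hypothesis with D A in place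
    of \<open>A\<close>. The final 1 covers the supremum bound.\<close>
  define K where "K = C * D ^ Suc r + M * C * D ^ (r + 3) + 1"
  have K: "K \<ge> 1" unfolding K_def using C M D by simp
  have "hol (Suc r) sg (K * A ^ Suc (Suc r) * B) (\<lambda>y. g 0 (b y) y)"
    if A: "1 \<le> A" and S: "open S" "convex S" "\<And>x. b x \<in> S"
      and der: "\<And>j s y. s \<in> S \<Longrightarrow> ((\<lambda>s. g j s y) has_vector_derivative g (Suc j) s y) (at s)"
      and bd: "\<And>j s. j \<le> Suc (Suc r) \<Longrightarrow> s \<in> S \<Longrightarrow> hol (Suc r) sg B (g j s)"
      and ex: "\<And>j. \<exists>B'. \<forall>s\<in>S. hol (Suc r) sg B' (g j s)"
      and b: "\<And>i x. pdiffable_at i b x" "\<And>i. hol (Suc r) sg A (\<lambda>x. complex_of_real (pdiff i b x))"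
    for g :: "nat \<Rightarrow> real \<Rightarrow> 'n rn \<Rightarrow> complex" and b A B S
  proof (rule hol_SucI)
    have B: "0 \<le> B" using hol_nonneg[OF bd[OF _ S(3)]] by blast
    have b': "hol r sg (D * A) (\<lambda>x. complex_of_real (pdiff i b x))" for i
      unfolding D_def by (rule hol_down[OF b(2)])
    have DA: "1 \<le> D * A" using D A mult_mono[of 1 D 1 A] by simp
    fix x i
    have "1 * 1 \<le> K * A ^ Suc (Suc r)" using K A by (intro mult_mono one_le_power) auto
    then have "1 * B \<le> K * A ^ Suc (Suc r) * B" using B by (intro mult_right_mono) auto
    then show "cmod (g 0 (b x) x) \<le> K * A ^ Suc (Suc r) * B"
      using hol_bound[OF bd[OF _ S(3)], of 0 x x] by simp
    have der1: "((\<lambda>t. g 0 (b (x + t *\<^sub>R axis i 1)) (x + t *\<^sub>R axis i 1)) has_vector_derivative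
        pdiff i (g 0 (b x)) x + complex_of_real (pdiff i b x) * g 1 (b x) x) (at 0)" for x
    proof -
      define z where "z t = x + t *\<^sub>R axis i 1" for t :: real
      define \<beta> where "\<beta> t = b (z t) - b x" for t
      have z0: "z 0 = x" by (simp add: z_def)
      have \<beta>: "(\<beta> has_vector_derivative pdiff i b x) (at 0)" "\<beta> 0 = 0"
        unfolding \<beta>_def z_def using b(1)[of i x, unfolded pdiffable_at_iff]
        by (auto simp: has_vector_derivative_diff_const)
      \<comment> \<open>The remainder beyond first order in the parameter, taken at the moving point
        \<open>z t\<close>. It is quadratic in \<open>\<beta>\<close> and has derivative zero; of
        the linear term only the derivative of \<open>\<beta>\<close> survives, since
        \<open>\<beta>\<close> vanishes at 0.\<close>
      define psi where "psi t = g 0 (b (z t)) (z t) - g 0 (b x) (z t) - \<beta> t *\<^sub>R g 1 (b x) (z t)" for t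
      have psi: "(psi has_vector_derivative 0) (at 0)"
      proof (rule has_vector_derivative_zero_of_bound[OF \<beta>])
        fix t
        have "hol (Suc r) sg ((\<beta> t)\<^sup>2 * B) (\<lambda>y. g 0 (b x + \<beta> t) y - g 0 (b x) y - \<beta> t *\<^sub>R g 1 (b x) y)"
          using S bd[of 2] by (intro hol_taylor2[OF S(2)] der) (auto simp: \<beta>_def)
        from hol_bound[OF this, of "z t"] show "norm (psi t) \<le> B * (\<beta> t)\<^sup>2"
          unfolding psi_def \<beta>_def by (simp add: mult.commute)
      qed
      have g0: "((\<lambda>t. g 0 (b x) (z t)) has_vector_derivative pdiff i (g 0 (b x)) x) (at 0)"
        using hol_SucD(1)[OF bd[OF _ S(3), of 0]] unfolding pdiffable_at_iff z_def by simp
      have g1: "((\<lambda>t. g 1 (b x) (z t)) has_vector_derivative pdiff i (g 1 (b x)) x) (at 0)"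
        using hol_SucD(1)[OF bd[OF _ S(3), of 1]] unfolding pdiffable_at_iff z_def by simp
      have "((\<lambda>t. \<beta> t *\<^sub>R g 1 (b x) (z t)) has_vector_derivative
          \<beta> 0 *\<^sub>R pdiff i (g 1 (b x)) x + pdiff i b x *\<^sub>R g 1 (b x) (z 0)) (at 0)"
        using \<beta>(1) by (intro has_vector_derivative_scaleR g1) (simp add: has_real_derivative_iff_has_vector_derivative)
      then have "((\<lambda>t. \<beta> t *\<^sub>R g 1 (b x) (z t)) has_vector_derivative
          complex_of_real (pdiff i b x) * g 1 (b x) x) (at 0)"
        using \<beta>(2) z0 by (simp add: scaleR_conv_of_real)
      from has_vector_derivative_add[OF psi has_vector_derivative_add[OF g0 this]]
      show ?thesis unfolding psi_def by (simp add: z_def)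
    qed
    show "pdiffable_at i (\<lambda>y. g 0 (b y) y) x" by (rule pdiffable_atI[OF der1])
    have pe: "pdiff i (\<lambda>y. g 0 (b y) y) =
      (\<lambda>y. pdiff i (g 0 (b y)) y + complex_of_real (pdiff i b y) * g 1 (b y) y)"
      by (intro ext pdiff_eqI[OF der1])
    have h1: "hol r sg (C * (D * A) ^ Suc r * B) (\<lambda>y. pdiff i (g 0 (b y)) y)"
    proof (rule C(2)[of "D * A" S b "\<lambda>j s. pdiff i (g j s)" B])
      show "\<forall>j. \<forall>s\<in>S. \<forall>y. ((\<lambda>s. pdiff i (g j s) y) has_vector_derivative pdiff i (g (Suc j) s) y) (at s)"
      proof (intro allI ballI)
        fix j s y assume "s \<in> S"
        from hol_pdiff_parameter[OF S(1,2) this, where g = "\<lambda>l. g (j + l)" and r = r and i = i and y = y]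
        show "((\<lambda>s. pdiff i (g j s) y) has_vector_derivative pdiff i (g (Suc j) s) y) (at s)"
          using der ex by simp
      qed
      show "\<forall>j. \<exists>B'. \<forall>s\<in>S. hol r sg B' (pdiff i (g j s))"
      proof
        fix j obtain B' where "\<forall>s\<in>S. hol (Suc r) sg B' (g j s)" using ex[of j] by blast
        then show "\<exists>B'. \<forall>s\<in>S. hol r sg B' (pdiff i (g j s))" using hol_SucD(2) by blast
      qed
      show "\<forall>j\<le>Suc r. \<forall>s\<in>S. hol r sg B (pdiff i (g j s))"
        using hol_SucD(2)[OF bd] by simp
    qed (use DA S b(1) b' in auto)
    have h2: "hol r sg (C * (D * A) ^ Suc r * (D * B)) (\<lambda>y. g 1 (b y) y)"
    proof (rule C(2)[of "D * A" S b "\<lambda>j s. g (Suc j) s" "D * B", unfolded One_nat_def[symmetric]])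
      show "\<forall>j. \<exists>B'. \<forall>s\<in>S. hol r sg B' (g (Suc j) s)"
      proof
        fix j obtain B' where "\<forall>s\<in>S. hol (Suc r) sg B' (g (Suc j) s)" using ex[of "Suc j"] by blast
        then show "\<exists>B'. \<forall>s\<in>S. hol r sg B' (g (Suc j) s)" using hol_down by blast
      qed
      show "\<forall>j\<le>Suc r. \<forall>s\<in>S. hol r sg (D * B) (g (Suc j) s)"
        unfolding D_def using hol_down[OF bd] by simp
    qed (use DA S der b(1) b' in auto)
    have "hol r sg (C * (D * A) ^ Suc r * B + M * ((D * A) * (C * (D * A) ^ Suc r * (D * B))))
      (pdiff i (\<lambda>y. g 0 (b y) y))"
      unfolding pe by (intro hol_add h1 M(2) b' h2)
    moreover have "C * (D * A) ^ Suc r * B + M * ((D * A) * (C * (D * A) ^ Suc r * (D * B))) \<le> K * A ^ Suc (Suc r) * B"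
    proof -
      have "A ^ Suc r \<le> A ^ Suc (Suc r)" using A by (intro power_increasing) auto
      then have "C * D ^ Suc r * B * A ^ Suc r \<le> C * D ^ Suc r * B * A ^ Suc (Suc r)"
        using C D B by (intro mult_left_mono) auto
      moreover have "0 \<le> A ^ Suc (Suc r) * B" using A B by simp
      ultimately show ?thesis unfolding K_def power_mult_distrib
        by (simp add: algebra_simps power_add numeral_3_eq_3)
    qed
    ultimately show "hol r sg (K * A ^ Suc (Suc r) * B) (pdiff i (\<lambda>y. g 0 (b y) y))"
      by (rule hol_mono)
  qed
  moreover have "0 < K" using K by simp
  ultimately show ?case by (intro exI[of _ K]) (auto simp del: hol.simps power_Suc)
qed

lemma hol_substE:
  obtains C where "C > 0" "\<And>(g :: nat \<Rightarrow> real \<Rightarrow> 'n::finite rn \<Rightarrow> complex) b A B S.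
    1 \<le> A \<Longrightarrow> open S \<Longrightarrow> convex S \<Longrightarrow> \<forall>x. b x \<in> S \<Longrightarrow>
    \<forall>j. \<forall>s\<in>S. \<forall>y. ((\<lambda>s. g j s y) has_vector_derivative g (Suc j) s y) (at s) \<Longrightarrow>
    \<forall>j\<le>Suc r. \<forall>s\<in>S. hol r sg B (g j s) \<Longrightarrow>
    \<forall>j. \<exists>B'. \<forall>s\<in>S. hol r sg B' (g j s) \<Longrightarrow>
    \<forall>i x. pdiffable_at i b x \<Longrightarrow> \<forall>i. hol r sg A (\<lambda>x. complex_of_real (pdiff i b x)) \<Longrightarrow>
    hol r sg (C * A ^ Suc r * B) (\<lambda>y. g 0 (b y) y)"
proof -
  from hol_subst[of r, where ?'n = 'n] obtain C where C: "C > 0" and *: "\<forall>(g :: nat \<Rightarrow> real \<Rightarrow> 'n::finite rn \<Rightarrow> complex) b A B S.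
    1 \<le> A \<longrightarrow> open S \<longrightarrow> convex S \<longrightarrow> (\<forall>x. b x \<in> S) \<longrightarrow>
    (\<forall>j. \<forall>s\<in>S. \<forall>y. ((\<lambda>s. g j s y) has_vector_derivative g (Suc j) s y) (at s)) \<longrightarrow>
    (\<forall>j\<le>Suc r. \<forall>s\<in>S. hol r sg B (g j s)) \<longrightarrow>
    (\<forall>j. \<exists>B'. \<forall>s\<in>S. hol r sg B' (g j s)) \<longrightarrow>
    (\<forall>i x. pdiffable_at i b x) \<longrightarrow> (\<forall>i. hol r sg A (\<lambda>x. complex_of_real (pdiff i b x))) \<longrightarrow>
    hol r sg (C * A ^ Suc r * B) (\<lambda>y. g 0 (b y) y)" by (elim exE conjE)
  show ?thesis
    by (rule that[OF C], rule *[THEN spec, THEN spec, THEN spec, THEN spec, THEN spec,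
        THEN mp, THEN mp, THEN mp, THEN mp, THEN mp, THEN mp, THEN mp, THEN mp, THEN mp])
qed

end

text \<open>A function on \<open>coord_space I\<close> is treated as a function on the whole space by composing it
  with \<open>proj I\<close>.\<close>

definition proj :: "'n::finite set \<Rightarrow> 'n rn \<Rightarrow> 'n rn" where
  "proj I x = (\<chi> i. if i \<in> I then x $ i else 0)"

lemma proj_nth [simp]: "proj I x $ i = (if i \<in> I then x $ i else 0)"
  by (simp add: proj_def)

lemma proj_UNIV [simp]: "proj UNIV x = x"
  by (simp add: vec_eq_iff)

lemma tan_part_eq_proj: "tan_part x = proj tan_coords x"
  by (simp add: vec_eq_iff tan_part_def)

lemma proj_in [simp]: "proj I x \<in> coord_space I"
  by (simp add: coord_space_def)

lemma proj_id: "x \<in> coord_space I \<Longrightarrow> proj I x = x"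
  by (auto simp: coord_space_def vec_eq_iff)

lemma proj_add_axis: "proj I (x + t *\<^sub>R axis i 1) = (if i \<in> I then proj I x + t *\<^sub>R axis i 1 else proj I x)"
  by (auto simp: vec_eq_iff axis_def)

lemma norm_proj_diff_le: "norm (proj I x - proj I y) \<le> norm (x - y)"
  by (rule norm_le_componentwise_cart) auto

lemma continuous_on_proj: "continuous_on S (proj I)"
proof -
  have "continuous_on S (\<lambda>x. if i \<in> I then x $ i else 0)" for i
    by (cases "i \<in> I") (auto intro: continuous_intros)
  then show ?thesis unfolding proj_def by (rule continuous_on_vec_lambda)
qed

lemma pdiffable_comp_proj:
  "pdiffable_at i (\<lambda>x. f (proj I x)) x \<longleftrightarrow> i \<notin> I \<or> pdiffable_at i f (proj I x)"
  unfolding pdiffable_at_def proj_add_axis by (cases "i \<in> I") auto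

lemma pdiff_comp_proj:
  "pdiff i (\<lambda>x. f (proj I x)) = (\<lambda>x. if i \<in> I then pdiff i f (proj I x) else 0)"
  unfolding pdiff_def proj_add_axis by (cases "i \<in> I") (auto simp: vector_derivative_const_at)

lemma pds_comp_proj:
  "pds L (\<lambda>x. f (proj I x)) = (\<lambda>x. if set L \<subseteq> I then pds L f (proj I x) else 0)"
proof (induction L)
  case (Cons i L)
  show ?case
  proof (cases "set L \<subseteq> I")
    case True
    then show ?thesis unfolding foldr.simps o_apply Cons
      using pdiff_comp_proj[of i "pds L f" I] by (cases "i \<in> I") simp_all
  next
    case False
    then show ?thesis using Cons by (auto simp: pdiff_const)
  qed
qed simp

lemma Ck_zero: "Ck k (\<lambda>x :: 'n::finite rn. 0)"
  by (induction k) (auto simp: pdiff_const)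

text \<open>The composite is constant in the directions outside \<open>I\<close>. The reduction also
  covers n = 1, where the hyperplane is one point and the composite is constant.\<close>

lemma Ck_comp_proj: "Ck k (\<lambda>x. f (proj I x)) \<longleftrightarrow> Ck_on I k f"
proof (induction k arbitrary: f)
  case 0
  have "continuous_on (coord_space I) f" if "continuous_on UNIV (\<lambda>x. f (proj I x))"
    using continuous_on_subset[OF that, of "coord_space I"] continuous_on_cong[OF refl, of "coord_space I" "\<lambda>x. f (proj I x)" f]
    by (simp add: proj_id)
  moreover have "continuous_on UNIV (\<lambda>x. f (proj I x))" if "continuous_on (coord_space I) f"
    by (rule continuous_on_compose2[OF that continuous_on_proj]) auto
  ultimately show ?case by auto
next
  case (Suc k)
  have 1: "(\<forall>x. pdiffable_at i (\<lambda>x. f (proj I x)) x) \<longleftrightarrow> i \<notin> I \<or> (\<forall>x\<in>coord_space I. pdiffable_at i f x)" for i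
    unfolding pdiffable_comp_proj[of i f I] using proj_in[of I] proj_id[of _ I] by metis
  have 2: "Ck k (pdiff i (\<lambda>x. f (proj I x))) \<longleftrightarrow> i \<notin> I \<or> Ck_on I k (pdiff i f)" for i
    unfolding pdiff_comp_proj[of i f I] by (cases "i \<in> I") (simp_all add: Suc Ck_zero)
  have 3: "continuous_on (coord_space I) f" if "pd1 (\<lambda>x. f (proj I x))"
    using continuous_on_subset[OF pd1_continuous[OF that], of "coord_space I"]
      continuous_on_cong[OF refl, of "coord_space I" "\<lambda>x. f (proj I x)" f]
    by (simp add: proj_id)
  have "Ck (Suc k) (\<lambda>x. f (proj I x)) \<longleftrightarrow>
      (\<forall>i\<in>I. (\<forall>x\<in>coord_space I. pdiffable_at i f x) \<and> Ck_on I k (pdiff i f))"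
    unfolding Ck_Suc_iff using 1 2 by blast
  moreover have "Ck (Suc k) (\<lambda>x. f (proj I x)) \<Longrightarrow> continuous_on (coord_space I) f"
    by (intro 3 Ck_Suc_pd1)
  ultimately show ?case unfolding Ck_on.simps(2)[of I] by blast
qed

lemma mdiff_comp_proj:
  assumes "\<And>i. i \<notin> I \<Longrightarrow> \<beta> i = 0"
  shows "mdiff \<beta> (\<lambda>x. f (proj I x)) x = mdiff \<beta> f (proj I x)"
proof -
  have "set (mi_list \<beta>) \<subseteq> I" unfolding set_mi_list
  proof (intro subsetI)
    show "i \<in> I" if "i \<in> {i. \<beta> i \<noteq> 0}" for i using assms[of i] that by (cases "i \<in> I") auto
  qed
  then show ?thesis unfolding mdiff_eq_pds pds_comp_proj[of _ f I] by simp
qed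

section \<open>Comparison of \<open>hol\<close> with the Hoelder norm\<close>

lemma finite_multiindices: "finite {\<beta> :: 'n::finite multiindex. P \<beta> \<and> mi_order \<beta> \<le> r}"
proof (rule finite_subset)
  have "\<beta> i \<le> mi_order \<beta>" for \<beta> :: "'n multiindex" and i
    unfolding mi_order_def by (rule member_le_sum) auto
  then show "{\<beta> :: 'n multiindex. P \<beta> \<and> mi_order \<beta> \<le> r} \<subseteq> {\<beta>. \<forall>i. (i \<in> UNIV \<longrightarrow> \<beta> i \<in> {..r}) \<and> (i \<notin> UNIV \<longrightarrow> \<beta> i = 0)}"
    by (auto intro: order_trans)
  show "finite {\<beta> :: 'n multiindex. \<forall>i. (i \<in> UNIV \<longrightarrow> \<beta> i \<in> {..r}) \<and> (i \<notin> UNIV \<longrightarrow> \<beta> i = 0)}"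
    by (intro finite_set_of_finite_funs) auto
qed

lemma hol_of_pds:
  assumes "Ck r f" "\<And>L x. length L \<le> r \<Longrightarrow> cmod (pds L f x) \<le> B"
    "\<And>L x y. length L = r \<Longrightarrow> cmod (pds L f x - pds L f y) \<le> B * norm (x - y) powr sg"
  shows "hol r sg B f"
  using assms
proof (induction r arbitrary: f)
  case 0 then show ?case using 0(2,3)[of "[]"] by simp
next
  case (Suc r)
  have C: "\<forall>i x. pdiffable_at i f x" "\<forall>i. Ck r (pdiff i f)"
    using Suc.prems(1) unfolding Ck_Suc_iff by blast+
  show ?case
  proof (rule hol_SucI)
    show "cmod (f x) \<le> B" for x using Suc.prems(2)[of "[]"] by simp
    show "hol r sg B (pdiff i f)" for i
    proof (rule Suc.IH)
      show "Ck r (pdiff i f)" using C by blast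
      show "cmod (pds L (pdiff i f) x) \<le> B" if "length L \<le> r" for L x
        using Suc.prems(2)[of "L @ [i]" x] that by simp
      show "cmod (pds L (pdiff i f) x - pds L (pdiff i f) y) \<le> B * norm (x - y) powr sg" if "length L = r" for L x y
        using Suc.prems(3)[of "L @ [i]" x y] that by simp
    qed
  qed (use C in blast)
qed

lemma hol_pds: "hol r sg B f \<Longrightarrow> length L \<le> r \<Longrightarrow> hol (r - length L) sg B (pds L f)"
proof (induction L arbitrary: r f rule: rev_induct)
  case (snoc i L)
  then obtain r' where r: "r = Suc r'" by (cases r) auto
  then show ?case using snoc.IH[OF hol_SucD(2)[of r' sg B f i]] snoc.prems by simp
qed simp

context holder_exponent
begin

lemma hol_of_holder_norm:
  fixes f :: "'n::{finite,linorder} rn \<Rightarrow> complex"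
  assumes "holder_norm I \<tau> f \<le> ennreal B" "0 \<le> B" "sg = \<tau> - real (nat \<lfloor>\<tau>\<rfloor>)"
  shows "hol (nat \<lfloor>\<tau>\<rfloor>) sg B (\<lambda>x. f (proj I x))"
proof -
  define r where "r = nat \<lfloor>\<tau>\<rfloor>"
  define A where "A = {\<beta>. (\<forall>i. i \<notin> I \<longrightarrow> \<beta> i = 0) \<and> mi_order \<beta> \<le> r}"
  define A' where "A' = {\<beta>. (\<forall>i. i \<notin> I \<longrightarrow> \<beta> i = 0) \<and> mi_order \<beta> = r}"
  define P where "P = {(z, y). z \<in> coord_space I \<and> y \<in> coord_space I \<and> z \<noteq> y}"
  define g where "g x = f (proj I x)" for x
  have C: "Ck_on I r f" using assms(1) unfolding holder_norm_def Let_def r_def[symmetric]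
    by (auto split: if_splits simp: top_unique)
  have le: "(\<Sum>\<beta>\<in>A. SUP x\<in>coord_space I. ennreal (cmod (mdiff \<beta> f x))) +
      (\<Sum>\<beta>\<in>A'. SUP (z, y)\<in>P. ennreal (cmod (mdiff \<beta> f z - mdiff \<beta> f y) / norm (z - y) powr sg)) \<le> ennreal B"
    using assms(1) C unfolding holder_norm_def Let_def r_def[symmetric] A_def A'_def P_def
    by (simp add: assms(3) r_def)
  have fin: "finite A" unfolding A_def by (rule finite_multiindices)
  have fin': "finite A'" by (rule finite_subset[OF _ fin]) (auto simp: A_def A'_def)
  have b1: "cmod (mdiff \<beta> f x) \<le> B" if "\<beta> \<in> A" "x \<in> coord_space I" for \<beta> x
  proof -
    have "ennreal (cmod (mdiff \<beta> f x)) \<le> (SUP x\<in>coord_space I. ennreal (cmod (mdiff \<beta> f x)))"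
      by (rule SUP_upper[OF that(2)])
    also have "\<dots> \<le> (\<Sum>\<beta>\<in>A. SUP x\<in>coord_space I. ennreal (cmod (mdiff \<beta> f x)))"
      by (rule member_le_sum[OF that(1) _ fin]) auto
    also have "\<dots> \<le> ennreal B" by (rule order_trans[OF _ le]) (simp add: add_increasing2)
    finally show ?thesis using assms(2) by simp
  qed
  have b2: "cmod (mdiff \<beta> f z - mdiff \<beta> f y) \<le> B * norm (z - y) powr sg"
    if "\<beta> \<in> A'" "z \<in> coord_space I" "y \<in> coord_space I" for \<beta> z y
  proof (cases "z = y")
    case False
    have "ennreal (cmod (mdiff \<beta> f z - mdiff \<beta> f y) / norm (z - y) powr sg) \<le>
       (SUP (z, y)\<in>P. ennreal (cmod (mdiff \<beta> f z - mdiff \<beta> f y) / norm (z - y) powr sg))"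
      using that False by (intro SUP_upper2[of "(z, y)"]) (auto simp: P_def)
    also have "\<dots> \<le> (\<Sum>\<beta>\<in>A'. SUP (z, y)\<in>P. ennreal (cmod (mdiff \<beta> f z - mdiff \<beta> f y) / norm (z - y) powr sg))"
      by (rule member_le_sum[OF that(1) _ fin']) auto
    also have "\<dots> \<le> ennreal B" by (rule order_trans[OF _ le]) (simp add: add_increasing)
    finally have "cmod (mdiff \<beta> f z - mdiff \<beta> f y) / norm (z - y) powr sg \<le> B"
      using assms(2) by simp
    then show ?thesis using False by (simp add: pos_divide_le_eq)
  qed auto
  have Cg: "Ck r g" unfolding g_def Ck_comp_proj[of _ f I] by (rule C)
  have pg: "pds L g x = (if set L \<subseteq> I then mdiff (list_mi L) f (proj I x) else 0)" if "length L \<le> r" for L x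
  proof (cases "set L \<subseteq> I")
    case True
    have "pds L g x = mdiff (list_mi L) g x" using mdiff_list_mi[OF Ck_mono[OF Cg that]] by simp
    also have "\<dots> = mdiff (list_mi L) f (proj I x)"
      unfolding g_def using True by (intro mdiff_comp_proj) (auto simp: list_mi_def count_eq_zero_iff)
    finally show ?thesis using True by simp
  next
    case False then show ?thesis unfolding g_def pds_comp_proj[of _ f I] by simp
  qed
  have LA: "list_mi L \<in> A" if "length L \<le> r" "set L \<subseteq> I" for L
    using that unfolding A_def by (auto simp: mi_order_list_mi list_mi_def count_eq_zero_iff)
  have LA': "list_mi L \<in> A'" if "length L = r" "set L \<subseteq> I" for L
    using that unfolding A'_def by (auto simp: mi_order_list_mi list_mi_def count_eq_zero_iff)
  have "hol r sg B g"
  proof (rule hol_of_pds[OF Cg])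
    show "cmod (pds L g x) \<le> B" if "length L \<le> r" for L x
      unfolding pg[OF that] using b1[OF LA[OF that] proj_in] assms(2) by simp
    show "cmod (pds L g x - pds L g y) \<le> B * norm (x - y) powr sg" if L: "length L = r" for L x y
    proof (cases "set L \<subseteq> I")
      case True
      have "cmod (pds L g x - pds L g y) \<le> B * norm (proj I x - proj I y) powr sg"
        using pg[of L] L True b2[OF LA'[OF L True] proj_in proj_in] by simp
      also have "\<dots> \<le> B * norm (x - y) powr sg"
        using sg assms(2) by (intro mult_left_mono powr_mono2 norm_proj_diff_le) auto
      finally show ?thesis .
    next
      case False then show ?thesis using pg[of L] L assms(2) by simp
    qed
  qed
  then show ?thesis unfolding g_def r_def .
qed

lemma holder_norm_of_hol:
  assumes "sg = \<tau> - real (nat \<lfloor>\<tau>\<rfloor>)"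
  shows "\<exists>C>0. \<forall>(f :: 'n::{finite,linorder} rn \<Rightarrow> complex) B. hol (nat \<lfloor>\<tau>\<rfloor>) sg B (\<lambda>x. f (proj I x)) \<longrightarrow>
    holder_norm I \<tau> f \<le> ennreal (C * B)"
proof -
  define r where "r = nat \<lfloor>\<tau>\<rfloor>"
  define A where "A = {\<beta> :: 'n multiindex. (\<forall>i. i \<notin> I \<longrightarrow> \<beta> i = 0) \<and> mi_order \<beta> \<le> r}"
  define A' where "A' = {\<beta> :: 'n multiindex. (\<forall>i. i \<notin> I \<longrightarrow> \<beta> i = 0) \<and> mi_order \<beta> = r}"
  define P where "P = {(z :: 'n rn, y). z \<in> coord_space I \<and> y \<in> coord_space I \<and> z \<noteq> y}"
  \<comment> \<open>Each supremum in the two sums is at most \<open>B\<close>; the final 1 makes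
    positivity of the constant immediate.\<close>
  have "holder_norm I \<tau> f \<le> ennreal ((real (card A) + real (card A') + 1) * B)"
    if h: "hol r sg B (\<lambda>x. f (proj I x))" for f :: "'n rn \<Rightarrow> complex" and B
  proof -
    define g where "g x = f (proj I x)" for x
    have B: "0 \<le> B" using hol_nonneg[OF h] .
    have hg: "hol r sg B g" using h unfolding g_def .
    have C: "Ck_on I r f" using hol_Ck[OF h] unfolding Ck_comp_proj[of _ f I] .
    have mg: "mdiff \<beta> f x = pds (mi_list \<beta>) g x" if "\<beta> \<in> A" "x \<in> coord_space I" for \<beta> x
      using mdiff_comp_proj[of I \<beta> f x] that unfolding A_def g_def[symmetric] mdiff_eq_pds by (simp add: proj_id)
    have b1: "cmod (mdiff \<beta> f x) \<le> B" if "\<beta> \<in> A" "x \<in> coord_space I" for \<beta> x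
      unfolding mg[OF that] using that(1)
      by (intro hol_bound[OF hol_pds[OF hg]]) (simp add: A_def length_mi_list)
    have b2: "cmod (mdiff \<beta> f z - mdiff \<beta> f y) / norm (z - y) powr sg \<le> B"
      if "\<beta> \<in> A'" "(z, y) \<in> P" for \<beta> z y
    proof -
      have zy: "z \<in> coord_space I" "y \<in> coord_space I" "z \<noteq> y" using that unfolding P_def by auto
      have bA: "\<beta> \<in> A" "length (mi_list \<beta>) = r" using that unfolding A_def A'_def by (auto simp: length_mi_list)
      have "hol 0 sg B (pds (mi_list \<beta>) g)" using hol_pds[OF hg, of "mi_list \<beta>"] bA by simp
      from hol_0D[OF this, of z y] show ?thesis
        unfolding mg[OF bA(1) zy(1)] mg[OF bA(1) zy(2)] using zy(3) by (simp add: pos_divide_le_eq)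
    qed
    have "holder_norm I \<tau> f = (\<Sum>\<beta>\<in>A. SUP x\<in>coord_space I. ennreal (cmod (mdiff \<beta> f x))) +
      (\<Sum>\<beta>\<in>A'. SUP (z, y)\<in>P. ennreal (cmod (mdiff \<beta> f z - mdiff \<beta> f y) / norm (z - y) powr sg))"
      unfolding holder_norm_def Let_def A_def A'_def P_def using C by (simp add: r_def assms)
    also have "\<dots> \<le> of_nat (card A) * ennreal B + of_nat (card A') * ennreal B"
      using b1 b2 by (intro add_mono sum_bounded_above SUP_least) (auto intro!: ennreal_leI)
    also have "\<dots> = ennreal ((real (card A) + real (card A')) * B)"
      using B by (simp add: ennreal_of_nat_eq_real_of_nat ennreal_mult[symmetric] ennreal_plus[symmetric] distrib_right del: ennreal_plus)
    also have "\<dots> \<le> ennreal ((real (card A) + real (card A') + 1) * B)"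
      using B by (intro ennreal_leI mult_right_mono) auto
    finally show ?thesis .
  qed
  then show ?thesis unfolding r_def[symmetric]
    by (intro exI[of _ "real (card A) + real (card A') + 1"]) auto
qed

end

section \<open>Fourier inversion\<close>

lemma integrable_inverse_1_plus_square: "integrable lborel (\<lambda>x::real. inverse (1 + x\<^sup>2))"
  using integrable_inverse_1_plus_square by (simp add: einterval_def set_integrable_def)

text \<open>Fubini over the coordinates, through the description of \<open>lborel\<close> as the
  image of the product measure indexed by \<open>Basis\<close>.\<close>

lemma
  fixes f :: "'n::finite \<Rightarrow> real \<Rightarrow> 'b::{real_normed_field,banach,second_countable_topology}"
  assumes "\<And>i. integrable lborel (f i)"
  shows integrable_prod_components: "integrable lborel (\<lambda>x :: 'n rn. \<Prod>i\<in>UNIV. f i (x $ i))"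
    and integral_prod_components: "(\<integral>x. (\<Prod>i\<in>UNIV. f i (x $ i)) \<partial>(lborel :: 'n rn measure)) = (\<Prod>i\<in>UNIV. (\<integral>x. f i x \<partial>lborel))"
proof -
  interpret product_sigma_finite "\<lambda>b :: 'n rn. lborel :: real measure" ..
  have B: "(Basis :: 'n rn set) = (\<lambda>i. axis i 1) ` UNIV" by (auto simp: Basis_vec_def)
  have inj: "inj (\<lambda>i :: 'n. axis i (1::real))" by (auto simp: inj_on_def axis_eq_axis)
  define h where "h b = f (the_inv (\<lambda>i. axis i (1::real)) b)" for b :: "'n rn"
  have h: "h (axis i 1) = f i" for i unfolding h_def using the_inv_f_f[OF inj] by simp
  have re: "(\<Prod>b\<in>Basis. h b (x \<bullet> b)) = (\<Prod>i\<in>UNIV. f i (x $ i))" for x :: "'n rn"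
    unfolding B using inj by (subst prod.reindex) (auto simp: h inner_axis)
  have re2: "(\<Prod>b\<in>Basis. (\<integral>x. h b x \<partial>lborel)) = (\<Prod>i\<in>UNIV. (\<integral>x. f i x \<partial>lborel))"
    unfolding B using inj by (subst prod.reindex) (auto simp: h)
  have int: "integrable lborel (h b)" if "b \<in> Basis" for b
    using that assms unfolding B by (auto simp: h)
  then have [measurable]: "h b \<in> borel_measurable borel" if "b \<in> Basis" for b
    using that borel_measurable_integrable[of lborel "h b"] by simp
  have meas: "(\<lambda>x :: 'n rn. \<Prod>b\<in>Basis. h b (x \<bullet> b)) \<in> borel_measurable borel"
    by measurable
  have sm: "(\<lambda>f. \<Sum>b\<in>Basis. f b *\<^sub>R b) \<in> measurable (\<Pi>\<^sub>M b\<in>Basis. lborel) (borel :: 'n rn measure)"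
    by measurable
  have simp': "(\<Prod>b\<in>Basis. h b ((\<Sum>b\<in>Basis. y b *\<^sub>R b) \<bullet> b)) = (\<Prod>b\<in>Basis. h b (y b))" for y :: "'n rn \<Rightarrow> real"
    by (intro prod.cong) (auto simp: inner_sum_left_Basis)
  have "integrable lborel (\<lambda>x :: 'n rn. \<Prod>b\<in>Basis. h b (x \<bullet> b))"
    by (subst lborel_eq, subst integrable_distr_eq[OF sm meas])
      (use product_integrable_prod[of Basis h] int in \<open>simp add: simp'\<close>)
  then show "integrable lborel (\<lambda>x :: 'n rn. \<Prod>i\<in>UNIV. f i (x $ i))" by (simp add: re)
  have "(\<integral>x. (\<Prod>b\<in>Basis. h b (x \<bullet> b)) \<partial>(lborel :: 'n rn measure)) = (\<Prod>b\<in>Basis. (\<integral>x. h b x \<partial>lborel))"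
    by (subst lborel_eq, subst integral_distr[OF sm meas])
      (use product_integral_prod[of Basis h] int in \<open>simp add: simp'\<close>)
  then show "(\<integral>x. (\<Prod>i\<in>UNIV. f i (x $ i)) \<partial>(lborel :: 'n rn measure)) = (\<Prod>i\<in>UNIV. (\<integral>x. f i x \<partial>lborel))"
    by (simp add: re re2)
qed

text \<open>Comparison with a product of one-dimensional Cauchy densities: each coordinate uses up
  two powers of 1 + |x|, which explains the exponent 2 n.\<close>

lemma integrable_inverse_power_norm:
  assumes "k \<ge> 2 * CARD('n)"
  shows "integrable lborel (\<lambda>x :: 'n::finite rn. inverse ((1 + norm x) ^ k))"
proof (rule Bochner_Integration.integrable_bound)
  show "integrable lborel (\<lambda>x :: 'n rn. \<Prod>i\<in>UNIV. inverse (1 + (x $ i)\<^sup>2))"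
    by (intro integrable_prod_components integrable_inverse_1_plus_square)
  show "(\<lambda>x :: 'n rn. inverse ((1 + norm x) ^ k)) \<in> borel_measurable lborel" by simp
  show "AE x :: 'n rn in lborel. norm (inverse ((1 + norm x) ^ k)) \<le> norm (\<Prod>i\<in>UNIV. inverse (1 + (x $ i)\<^sup>2))"
  proof (intro AE_I2)
    fix x :: "'n rn"
    have 1: "1 + (x $ i)\<^sup>2 \<le> (1 + norm x)\<^sup>2" for i
    proof -
      have "(x $ i)\<^sup>2 \<le> (norm x)\<^sup>2" using component_le_norm_cart[of x i] by (metis abs_ge_zero power2_abs power_mono)
      moreover have "0 \<le> norm x" by simp
      ultimately show ?thesis unfolding power2_sum power_one by linarith
    qed
    have "inverse ((1 + norm x) ^ k) \<le> inverse ((1 + norm x) ^ (2 * CARD('n)))"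
      using assms by (intro le_imp_inverse_le power_increasing) (auto intro!: add_pos_nonneg zero_less_power)
    also have "\<dots> = (\<Prod>i\<in>(UNIV::'n set). inverse ((1 + norm x)\<^sup>2))"
      by (simp add: power_mult power_inverse)
    also have "\<dots> \<le> (\<Prod>i\<in>UNIV. inverse (1 + (x $ i)\<^sup>2))"
      using 1 by (intro prod_mono conjI le_imp_inverse_le) (auto intro: add_pos_nonneg)
    finally show "norm (inverse ((1 + norm x) ^ k)) \<le> norm (\<Prod>i\<in>UNIV. inverse (1 + (x $ i)\<^sup>2))"
      by (simp add: add_nonneg_nonneg)
  qed
qed

lemma integral_affine:
  fixes f :: "'n::finite rn \<Rightarrow> 'b::{banach,second_countable_topology}"
  assumes "c > 0" "f \<in> borel_measurable borel"
  shows "(\<integral>x. f x \<partial>lborel) = c ^ CARD('n) *\<^sub>R (\<integral>x. f (t + c *\<^sub>R x) \<partial>lborel)"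
    "integrable lborel f \<Longrightarrow> integrable lborel (\<lambda>x. f (t + c *\<^sub>R x))"
proof -
  have m[measurable]: "(\<lambda>x. t + c *\<^sub>R x) \<in> borel_measurable borel" by measurable
  note assms(2)[measurable]
  have eq: "lborel = density (distr lborel borel (\<lambda>x :: 'n rn. t + c *\<^sub>R x)) (\<lambda>_. ennreal (c ^ CARD('n)))"
    using lborel_affine[of c t] assms(1) by simp
  show "(\<integral>x. f x \<partial>lborel) = c ^ CARD('n) *\<^sub>R (\<integral>x. f (t + c *\<^sub>R x) \<partial>lborel)"
    using assms(1) by (subst eq) (simp add: integral_density integral_distr)
  assume int: "integrable lborel f"
  then have "integrable (density (distr lborel borel (\<lambda>x :: 'n rn. t + c *\<^sub>R x)) (\<lambda>_. ennreal (c ^ CARD('n)))) f"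
    using eq by simp
  then have "integrable lborel (\<lambda>x. c ^ CARD('n) *\<^sub>R f (t + c *\<^sub>R x))"
    using assms(1) by (subst (asm) integrable_density) (auto simp: integrable_distr_eq)
  from integrable_scaleR_right[OF this, of "inverse (c ^ CARD('n))"]
  show "integrable lborel (\<lambda>x. f (t + c *\<^sub>R x))" using assms(1) by simp
qed

lemma char_std_normal:
  "integrable lborel (\<lambda>x. cis (t * x) * complex_of_real (exp (- x\<^sup>2 / 2)))"
  "(\<integral>x. cis (t * x) * complex_of_real (exp (- x\<^sup>2 / 2)) \<partial>lborel) = complex_of_real (sqrt (2 * pi) * exp (- t\<^sup>2 / 2))"
proof -
  have g: "integrable lborel (\<lambda>x. std_normal_density x)" by simp
  have "integrable lborel (\<lambda>x. sqrt (2 * pi) * std_normal_density x)" using g by (rule integrable_mult_right)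
  then have g': "integrable lborel (\<lambda>x :: real. exp (- x\<^sup>2 / 2))"
    by (simp add: std_normal_density_def)
  show "integrable lborel (\<lambda>x. cis (t * x) * complex_of_real (exp (- x\<^sup>2 / 2)))"
    by (rule Bochner_Integration.integrable_bound[OF g']) (auto simp: norm_mult cis_conv_exp)
  have "complex_of_real (exp (- t\<^sup>2 / 2)) = (\<integral>x. iexp (t * x) \<partial>std_normal_distribution)"
    using char_std_normal_distribution by (simp add: char_def fun_eq_iff)
  also have "\<dots> = (\<integral>x. std_normal_density x *\<^sub>R iexp (t * x) \<partial>lborel)"
    by (subst integral_density) auto
  also have "\<dots> = (\<integral>x. complex_of_real (1 / sqrt (2 * pi)) * (cis (t * x) * complex_of_real (exp (- x\<^sup>2 / 2))) \<partial>lborel)"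
    by (intro Bochner_Integration.integral_cong) (auto simp: std_normal_density_def scaleR_conv_of_real cis_conv_exp)
  also have "\<dots> = complex_of_real (1 / sqrt (2 * pi)) * (\<integral>x. cis (t * x) * complex_of_real (exp (- x\<^sup>2 / 2)) \<partial>lborel)"
    by simp
  finally have "complex_of_real (sqrt (2 * pi)) * complex_of_real (exp (- t\<^sup>2 / 2)) =
     complex_of_real (sqrt (2 * pi)) * (complex_of_real (1 / sqrt (2 * pi)) * (\<integral>x. cis (t * x) * complex_of_real (exp (- x\<^sup>2 / 2)) \<partial>lborel))"
    by (rule arg_cong)
  also have "\<dots> = (complex_of_real (sqrt (2 * pi)) * complex_of_real (1 / sqrt (2 * pi))) * (\<integral>x. cis (t * x) * complex_of_real (exp (- x\<^sup>2 / 2)) \<partial>lborel)"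
    by (simp only: mult.assoc)
  also have "complex_of_real (sqrt (2 * pi)) * complex_of_real (1 / sqrt (2 * pi)) = 1"
    unfolding of_real_mult[symmetric] by simp
  finally show "(\<integral>x. cis (t * x) * complex_of_real (exp (- x\<^sup>2 / 2)) \<partial>lborel) = complex_of_real (sqrt (2 * pi) * exp (- t\<^sup>2 / 2))"
    by simp
qed

lemma gaussian_fourier:
  fixes w :: "'n::finite rn"
  shows "integrable lborel (\<lambda>x. cis (- (w \<bullet> x)) * complex_of_real (exp (- (norm x)\<^sup>2 / 2)))"
    "(\<integral>x. cis (- (w \<bullet> x)) * complex_of_real (exp (- (norm x)\<^sup>2 / 2)) \<partial>lborel) =
      complex_of_real (sqrt (2 * pi) ^ CARD('n) * exp (- (norm w)\<^sup>2 / 2))"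
proof -
  have n2: "(norm x)\<^sup>2 = (\<Sum>i\<in>UNIV. (x $ i)\<^sup>2)" for x :: "'n rn"
    unfolding norm_vec_def L2_set_def by (simp add: sum_nonneg)
  have e: "exp (- (norm x)\<^sup>2 / 2) = (\<Prod>i\<in>UNIV. exp (- (x $ i)\<^sup>2 / 2))" for x :: "'n rn"
    unfolding n2 by (simp add: exp_sum[symmetric] sum_negf sum_divide_distrib)
  have c: "cis (- (w \<bullet> x)) = (\<Prod>i\<in>UNIV. cis (- w $ i * x $ i))" for x :: "'n rn"
    by (simp add: cis_conv_exp inner_vec_def exp_sum[symmetric] sum_negf sum_distrib_left)
  have p: "cis (- (w \<bullet> x)) * complex_of_real (exp (- (norm x)\<^sup>2 / 2)) =
    (\<Prod>i\<in>UNIV. cis (- w $ i * x $ i) * complex_of_real (exp (- (x $ i)\<^sup>2 / 2)))" for x :: "'n rn"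
    unfolding e c by (simp only: of_real_prod prod.distrib)
  note int = char_std_normal(1)[of "- w $ i" for i]
  show "integrable lborel (\<lambda>x. cis (- (w \<bullet> x)) * complex_of_real (exp (- (norm x)\<^sup>2 / 2)))"
    unfolding p by (rule integrable_prod_components[OF int])
  show "(\<integral>x. cis (- (w \<bullet> x)) * complex_of_real (exp (- (norm x)\<^sup>2 / 2)) \<partial>lborel) =
      complex_of_real (sqrt (2 * pi) ^ CARD('n) * exp (- (norm w)\<^sup>2 / 2))"
    unfolding p integral_prod_components[OF int] char_std_normal(2)
    by (simp only: e[of w] of_real_prod of_real_mult of_real_power prod.distrib prod_constant power2_minus)
qed

lemma fourier_measurable:
  fixes F :: "'n::finite rn \<Rightarrow> complex"
  assumes [measurable]: "F \<in> borel_measurable borel"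
  shows "fourier F \<in> borel_measurable borel"
  unfolding fourier_def cis_conv_exp by measurable

text \<open>A dilated Gaussian factor makes the double integral absolutely convergent and is removed
  by dominated convergence on both sides. The origin is the only point needed, because test
  functions are centred at the point of evaluation.\<close>

lemma fourier_inversion_at_0:
  fixes F :: "'n::finite rn \<Rightarrow> complex"
  assumes cont: "continuous_on UNIV F" and bdd: "\<And>x. cmod (F x) \<le> B"
    and int: "integrable lborel F" "integrable lborel (fourier F)"
  shows "(\<integral>\<omega>. fourier F \<omega> \<partial>lborel) = (2 * pi) ^ CARD('n) * F 0"
proof -
  have Fm[measurable]: "F \<in> borel_measurable borel" by (rule borel_measurable_continuous_onI[OF cont])
  note fourier_measurable[OF Fm, measurable]
  define \<gamma> where "\<gamma> x = complex_of_real (exp (- (norm x)\<^sup>2 / 2))" for x :: "'n rn"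
  have \<gamma>m[measurable]: "\<gamma> \<in> borel_measurable borel" unfolding \<gamma>_def by measurable
  have \<gamma>1: "cmod (\<gamma> x) \<le> 1" for x unfolding \<gamma>_def by simp
  have \<gamma>int: "integrable lborel \<gamma>" using gaussian_fourier(1)[of 0] unfolding \<gamma>_def by simp
  define S where "S = complex_of_real (sqrt (2 * pi) ^ CARD('n))"
  \<comment> \<open>Fubini transfers the damping to the Fourier transform of the Gaussian; rescaling
    by \<open>e\<close> then gives a Gaussian average of \<open>F\<close> near 0.\<close>
  have key: "(\<integral>\<omega>. fourier F \<omega> * \<gamma> (e *\<^sub>R \<omega>) \<partial>lborel) = S * (\<integral>w. F (e *\<^sub>R w) * \<gamma> w \<partial>lborel)" if e: "e > 0" for e
  proof -
    have ge: "integrable lborel (\<lambda>\<omega>. \<gamma> (e *\<^sub>R \<omega>))" using integral_affine(2)[OF e \<gamma>m \<gamma>int, of 0] by simp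
    have "(\<integral>\<omega>. fourier F \<omega> * \<gamma> (e *\<^sub>R \<omega>) \<partial>lborel) = (\<integral>\<omega>. (\<integral>x. cis (- (x \<bullet> \<omega>)) * F x * \<gamma> (e *\<^sub>R \<omega>) \<partial>lborel) \<partial>lborel)"
      unfolding fourier_def by simp
    also have "\<dots> = (\<integral>x. (\<integral>\<omega>. cis (- (x \<bullet> \<omega>)) * F x * \<gamma> (e *\<^sub>R \<omega>) \<partial>lborel) \<partial>lborel)"
    proof (rule lborel_pair.Fubini_integral)
      have "integrable (lborel \<Otimes>\<^sub>M lborel) (\<lambda>(x :: 'n rn, \<omega> :: 'n rn). cis (- (x \<bullet> \<omega>)) * F x * \<gamma> (e *\<^sub>R \<omega>))"
      proof (rule lborel_pair.Fubini_integrable)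
        show "(\<lambda>(x :: 'n rn, \<omega> :: 'n rn). cis (- (x \<bullet> \<omega>)) * F x * \<gamma> (e *\<^sub>R \<omega>)) \<in> borel_measurable (lborel \<Otimes>\<^sub>M lborel)"
          unfolding cis_conv_exp by measurable
        have "integrable lborel (\<lambda>x. cmod (F x) * (\<integral>\<omega>. cmod (\<gamma> (e *\<^sub>R \<omega>)) \<partial>lborel))"
          by (intro integrable_mult_left integrable_norm int)
        then show "integrable lborel (\<lambda>x :: 'n rn. \<integral>\<omega>. norm (case (x, \<omega>) of (x, \<omega>) \<Rightarrow> cis (- (x \<bullet> \<omega>)) * F x * \<gamma> (e *\<^sub>R \<omega>)) \<partial>lborel)"
          by (simp add: norm_mult)
        show "AE x in lborel. integrable lborel (\<lambda>\<omega>. case (x, \<omega>) of (x :: 'n rn, \<omega>) \<Rightarrow> cis (- (x \<bullet> \<omega>)) * F x * \<gamma> (e *\<^sub>R \<omega>))"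
        proof (intro AE_I2)
          fix x :: "'n rn"
          have "integrable lborel (\<lambda>\<omega>. cmod (F x) * cmod (\<gamma> (e *\<^sub>R \<omega>)))"
            by (intro integrable_mult_right integrable_norm ge)
          then show "integrable lborel (\<lambda>\<omega>. case (x, \<omega>) of (x :: 'n rn, \<omega>) \<Rightarrow> cis (- (x \<bullet> \<omega>)) * F x * \<gamma> (e *\<^sub>R \<omega>))"
            by (rule Bochner_Integration.integrable_bound) (auto simp: norm_mult cis_conv_exp)
        qed
      qed
      then show "integrable (lborel \<Otimes>\<^sub>M lborel) (\<lambda>(x, \<omega>). cis (- (x \<bullet> \<omega>)) * F x * \<gamma> (e *\<^sub>R \<omega>))" .
    qed
    also have "\<dots> = (\<integral>x. F x * (\<integral>\<omega>. cis (- (x \<bullet> \<omega>)) * \<gamma> (e *\<^sub>R \<omega>) \<partial>lborel) \<partial>lborel)"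
      by (intro Bochner_Integration.integral_cong refl) (simp add: mult.assoc mult.left_commute[of _ "F _"])
    also have "\<dots> = (\<integral>x. F x * (e powi (- int CARD('n)) *\<^sub>R (S * \<gamma> (x /\<^sub>R e))) \<partial>lborel)"
    proof (intro Bochner_Integration.integral_cong refl arg_cong[of _ _ "(*) _"])
      fix x :: "'n rn"
      have "S * \<gamma> (x /\<^sub>R e) = (\<integral>\<omega>. cis (- ((x /\<^sub>R e) \<bullet> \<omega>)) * \<gamma> \<omega> \<partial>lborel)"
        using gaussian_fourier(2)[of "x /\<^sub>R e"] unfolding \<gamma>_def S_def by simp
      also have "\<dots> = e ^ CARD('n) *\<^sub>R (\<integral>\<omega>. cis (- ((x /\<^sub>R e) \<bullet> (0 + e *\<^sub>R \<omega>))) * \<gamma> (0 + e *\<^sub>R \<omega>) \<partial>lborel)"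
        by (rule integral_affine(1)[OF e]) (unfold cis_conv_exp, measurable)
      also have "\<dots> = e ^ CARD('n) *\<^sub>R (\<integral>\<omega>. cis (- (x \<bullet> \<omega>)) * \<gamma> (e *\<^sub>R \<omega>) \<partial>lborel)"
      proof -
        have "(x /\<^sub>R e) \<bullet> (0 + e *\<^sub>R \<omega>) = x \<bullet> \<omega>" for \<omega> using e by (simp add: mult.assoc[symmetric])
        then show ?thesis by (simp only: add_0)
      qed
      finally show "(\<integral>\<omega>. cis (- (x \<bullet> \<omega>)) * \<gamma> (e *\<^sub>R \<omega>) \<partial>lborel) = e powi (- int CARD('n)) *\<^sub>R (S * \<gamma> (x /\<^sub>R e))"
        using e by (simp add: power_int_minus)
    qed
    also have "\<dots> = e ^ CARD('n) *\<^sub>R (\<integral>w. F (0 + e *\<^sub>R w) * (e powi (- int CARD('n)) *\<^sub>R (S * \<gamma> ((0 + e *\<^sub>R w) /\<^sub>R e))) \<partial>lborel)"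
      by (rule integral_affine(1)[OF e]) measurable
    also have "\<dots> = S * (\<integral>w. F (e *\<^sub>R w) * \<gamma> w \<partial>lborel)"
    proof -
      have "F (0 + e *\<^sub>R w) * (e powi (- int CARD('n)) *\<^sub>R (S * \<gamma> ((0 + e *\<^sub>R w) /\<^sub>R e))) =
        (complex_of_real (e powi (- int CARD('n))) * S) * (F (e *\<^sub>R w) * \<gamma> w)" for w
        using e by (simp add: scaleR_conv_of_real[of _ "_ :: complex"])
      then have "(\<integral>w. F (0 + e *\<^sub>R w) * (e powi (- int CARD('n)) *\<^sub>R (S * \<gamma> ((0 + e *\<^sub>R w) /\<^sub>R e))) \<partial>lborel) =
          (complex_of_real (e powi (- int CARD('n))) * S) * (\<integral>w. F (e *\<^sub>R w) * \<gamma> w \<partial>lborel)"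
        by (simp only: integral_mult_right_zero)
      moreover have "complex_of_real (e ^ CARD('n)) * complex_of_real (e powi (- int CARD('n))) = 1"
        unfolding of_real_mult[symmetric] using e by (simp add: power_int_minus)
      ultimately show ?thesis
        unfolding scaleR_conv_of_real[of _ "_ :: complex"]
        by (simp only: mult.assoc[symmetric] mult_1_left)
    qed
    finally show ?thesis .
  qed
  define X where "X n = inverse (real (Suc n))" for n
  have X: "X \<longlonglongrightarrow> 0" "\<And>n. X n > 0" unfolding X_def by (rule LIMSEQ_inverse_real_of_nat, simp)
  have \<gamma>c: "isCont \<gamma> x" for x unfolding \<gamma>_def by (intro continuous_intros) auto
  have Fc: "isCont F x" for x using cont by (simp add: continuous_on_eq_continuous_at)
  have "(\<lambda>n. \<integral>\<omega>. fourier F \<omega> * \<gamma> (X n *\<^sub>R \<omega>) \<partial>lborel) \<longlonglongrightarrow> (\<integral>\<omega>. fourier F \<omega> \<partial>lborel)"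
  proof (rule integral_dominated_convergence[where w = "\<lambda>\<omega>. cmod (fourier F \<omega>)"])
    show "AE \<omega> in lborel. (\<lambda>n. fourier F \<omega> * \<gamma> (X n *\<^sub>R \<omega>)) \<longlonglongrightarrow> fourier F \<omega>"
    proof (intro AE_I2)
      fix \<omega> :: "'n rn"
      have "(\<lambda>n. X n *\<^sub>R \<omega>) \<longlonglongrightarrow> 0 *\<^sub>R \<omega>" by (intro tendsto_intros X)
      then have "(\<lambda>n. \<gamma> (X n *\<^sub>R \<omega>)) \<longlonglongrightarrow> \<gamma> 0" using isCont_tendsto_compose[OF \<gamma>c] by simp
      from tendsto_mult[OF tendsto_const this, of "fourier F \<omega>"]
      show "(\<lambda>n. fourier F \<omega> * \<gamma> (X n *\<^sub>R \<omega>)) \<longlonglongrightarrow> fourier F \<omega>" by (simp add: \<gamma>_def)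
    qed
    show "AE \<omega> in lborel. norm (fourier F \<omega> * \<gamma> (X n *\<^sub>R \<omega>)) \<le> cmod (fourier F \<omega>)" for n
      using \<gamma>1 by (intro AE_I2) (simp add: norm_mult mult_left_le)
  qed (use int in auto)
  moreover have "(\<lambda>n. S * (\<integral>w. F (X n *\<^sub>R w) * \<gamma> w \<partial>lborel)) \<longlonglongrightarrow> S * (\<integral>w. F 0 * \<gamma> w \<partial>lborel)"
  proof (intro tendsto_mult_left integral_dominated_convergence[where w = "\<lambda>w. B * cmod (\<gamma> w)"])
    show "AE w in lborel. (\<lambda>n. F (X n *\<^sub>R w) * \<gamma> w) \<longlonglongrightarrow> F 0 * \<gamma> w"
    proof (intro AE_I2 tendsto_mult_right)
      fix w :: "'n rn"
      have "(\<lambda>n. X n *\<^sub>R w) \<longlonglongrightarrow> 0 *\<^sub>R w" by (intro tendsto_intros X)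
      then show "(\<lambda>n. F (X n *\<^sub>R w)) \<longlonglongrightarrow> F 0" using isCont_tendsto_compose[OF Fc] by simp
    qed
    show "AE w in lborel. norm (F (X n *\<^sub>R w) * \<gamma> w) \<le> B * cmod (\<gamma> w)" for n
      using bdd by (intro AE_I2) (simp add: norm_mult mult_right_mono)
  qed (use \<gamma>int in auto)
  ultimately have "(\<integral>\<omega>. fourier F \<omega> \<partial>lborel) = S * (\<integral>w. F 0 * \<gamma> w \<partial>lborel)"
    using key[OF X(2)] by (simp add: LIMSEQ_unique)
  also have "(\<integral>w. F 0 * \<gamma> w \<partial>lborel) = F 0 * S"
    using gaussian_fourier(2)[of "0 :: 'n rn"] unfolding \<gamma>_def S_def by simp
  also have "S * (F 0 * S) = (S * S) * F 0" by simp
  also have "S * S = (2 * pi) ^ CARD('n)"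
    unfolding S_def of_real_mult[symmetric] power_mult_distrib[symmetric] by simp
  finally show ?thesis by simp
qed

section \<open>Families of rapidly decreasing functions\<close>

lemma pdiffable_cis_inner: "pdiffable_at i (\<lambda>x :: 'n::finite rn. cis (- (x \<bullet> \<omega>))) x"
  and pdiff_cis_inner: "pdiff i (\<lambda>x :: 'n::finite rn. cis (- (x \<bullet> \<omega>))) x = - \<i> * complex_of_real (\<omega> $ i) * cis (- (x \<bullet> \<omega>))"
proof -
  have e: "cis (- (x \<bullet> \<omega>)) = exp (- (\<i> * complex_of_real (x \<bullet> \<omega>)))" for x
    by (simp add: cis_conv_exp)
  have "((\<lambda>t. - (\<i> * complex_of_real ((x + t *\<^sub>R axis i 1) \<bullet> \<omega>))) has_vector_derivative - \<i> * complex_of_real (\<omega> $ i)) (at 0)"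
    by (auto intro!: derivative_eq_intros simp: inner_add_left inner_axis')
  then have "pdiffable_at i (\<lambda>x. - (\<i> * complex_of_real (x \<bullet> \<omega>))) x"
    "pdiff i (\<lambda>x. - (\<i> * complex_of_real (x \<bullet> \<omega>))) x = - \<i> * complex_of_real (\<omega> $ i)"
    by (auto intro: pdiffable_atI pdiff_eqI)
  then show "pdiffable_at i (\<lambda>x :: 'n::finite rn. cis (- (x \<bullet> \<omega>))) x"
    "pdiff i (\<lambda>x :: 'n::finite rn. cis (- (x \<bullet> \<omega>))) x = - \<i> * complex_of_real (\<omega> $ i) * cis (- (x \<bullet> \<omega>))"
    unfolding e by (auto intro: pdiffable_exp simp: pdiff_exp)
qed

lemma integrable_of_decay:
  fixes g :: "'n::finite rn \<Rightarrow> 'b::{banach,second_countable_topology}"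
  assumes "g \<in> borel_measurable borel" "\<And>x. norm (g x) \<le> C * inverse ((1 + norm x) ^ k)" "k \<ge> 2 * CARD('n)"
  shows "integrable lborel g"
proof (rule Bochner_Integration.integrable_bound)
  show "integrable lborel (\<lambda>x :: 'n rn. C * inverse ((1 + norm x) ^ k))"
    by (intro integrable_mult_right integrable_inverse_power_norm assms)
qed (use assms in \<open>auto intro!: AE_I2 order_trans[OF _ abs_ge_self]\<close>)

text \<open>Translation invariance: the integral of \<open>g\<close> shifted along axis
  \<open>i\<close> is constant in the shift, and its derivative is the integral of the partial
  derivative.\<close>

lemma integral_pdiff_eq_0:
  fixes g :: "'n::finite rn \<Rightarrow> complex"
  assumes "pd1 g" "\<And>x. cmod (g x) \<le> C * inverse ((1 + norm x) ^ k)"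
    "\<And>x. cmod (pdiff i g x) \<le> C * inverse ((1 + norm x) ^ k)" and k: "k \<ge> 2 * CARD('n)"
  shows "(\<integral>x. pdiff i g x \<partial>lborel) = 0"
proof -
  have C: "0 \<le> C" using order_trans[OF norm_ge_zero assms(2)[of 0]] by simp
  have gm: "g \<in> borel_measurable borel"
    by (rule borel_measurable_continuous_onI[OF pd1_continuous[OF assms(1)]])
  have int: "integrable lborel g" by (rule integrable_of_decay[OF gm assms(2) k])
  have ax: "norm (axis i 1 :: 'n rn) = 1" by (simp add: norm_axis_1)
  \<comment> \<open>A shift of length below 1 changes 1 + |x| by at most a factor 2, so one majorant
    serves all shifts.\<close>
  have bd: "cmod (pdiff i g (x + t *\<^sub>R axis i 1)) \<le> (2 ^ k * C) * inverse ((1 + norm x) ^ k)"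
    if "\<bar>t\<bar> < 1" for x t
  proof -
    let ?y = "x + t *\<^sub>R axis i 1"
    have "norm x \<le> norm ?y + norm (t *\<^sub>R axis i 1 :: 'n rn)"
      using norm_triangle_ineq4[of ?y "t *\<^sub>R axis i 1"] by simp
    then have "norm x \<le> norm ?y + \<bar>t\<bar>" using ax by simp
    then have "1 + norm x \<le> 2 * (1 + norm ?y)" using that norm_ge_zero[of ?y] by argo
    then have "(1 + norm x) ^ k \<le> 2 ^ k * (1 + norm ?y) ^ k"
      unfolding power_mult_distrib[symmetric] by (intro power_mono) auto
    moreover have "0 < (1 + norm x) ^ k" "0 < (1 + norm ?y) ^ k" by (auto intro!: zero_less_power add_pos_nonneg)
    ultimately have "inverse ((1 + norm ?y) ^ k) \<le> 2 ^ k * inverse ((1 + norm x) ^ k)"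
      by (simp add: field_simps)
    from mult_left_mono[OF this C] show ?thesis using assms(3)[of ?y] by (simp add: mult_ac)
  qed
  have "((\<lambda>t. \<integral>x. g (x + t *\<^sub>R axis i 1) \<partial>lborel) has_vector_derivative
      (\<integral>x. pdiff i g (x + 0 *\<^sub>R axis i 1) \<partial>lborel)) (at 0)"
  proof (rule has_vector_derivative_integral(2)[OF _ pdiffable_at_line bd])
    show "integrable lborel (\<lambda>x :: 'n rn. (2 ^ k * C) * inverse ((1 + norm x) ^ k))"
      by (intro integrable_mult_right integrable_inverse_power_norm k)
    show "integrable lborel (\<lambda>x. g (x + t *\<^sub>R axis i 1))" for t
      using integral_affine(2)[of 1 g "t *\<^sub>R axis i 1"] gm int by (simp add: add.commute)
  qed (use assms(1) in \<open>auto simp: pd1_def\<close>)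
  moreover have "(\<integral>x. g (x + t *\<^sub>R axis i 1) \<partial>lborel) = (\<integral>x. g x \<partial>lborel)" for t
    using integral_affine(1)[of 1 g "t *\<^sub>R axis i 1"] gm by (simp add: add.commute)
  ultimately show ?thesis
    using vector_derivative_at[of "\<lambda>t. \<integral>x. g x \<partial>lborel" "\<integral>x. pdiff i g x \<partial>lborel" 0]
    by (simp add: vector_derivative_const_at)
qed

text \<open>Integration by parts in the form of \<open>integral_pdiff_eq_0\<close>, applied to the
  product of \<open>F\<close> with the character \<open>E\<close>.\<close>

lemma fourier_pdiff:
  fixes F :: "'n::finite rn \<Rightarrow> complex"
  assumes "pd1 F" "\<And>x. cmod (F x) \<le> C * inverse ((1 + norm x) ^ k)"
    "\<And>x. cmod (pdiff i F x) \<le> C * inverse ((1 + norm x) ^ k)" and k: "k \<ge> 2 * CARD('n)"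
  shows "fourier (pdiff i F) \<omega> = \<i> * complex_of_real (\<omega> $ i) * fourier F \<omega>"
proof -
  define E where "E x = cis (- (x \<bullet> \<omega>))" for x
  have C: "0 \<le> C" using order_trans[OF norm_ge_zero assms(2)[of 0]] by simp
  have E: "pdiffable_at j E x" "pdiff j E x = - \<i> * complex_of_real (\<omega> $ j) * E x" for j x
    unfolding E_def by (rule pdiffable_cis_inner, rule pdiff_cis_inner)
  have Ec: "continuous_on UNIV E" unfolding E_def cis_conv_exp by (intro continuous_intros)
  have Fp: "pdiffable_at j F x" "continuous_on UNIV (pdiff j F)" for j x using assms(1) by (auto simp: pd1_def)
  have Fc: "continuous_on UNIV F" by (rule pd1_continuous[OF assms(1)])
  have pe: "pdiff j (\<lambda>x. E x * F x) = (\<lambda>x. E x * pdiff j F x + (- \<i> * complex_of_real (\<omega> $ j)) * (E x * F x))" for j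
    by (auto simp: pdiff_mult E Fp mult.assoc)
  have nE: "cmod (E x) = 1" for x unfolding E_def by simp
  have int: "integrable lborel (\<lambda>x. E x * F x)" "integrable lborel (\<lambda>x. E x * pdiff i F x)"
    by (rule integrable_of_decay[OF _ _ k, where C = C];
        use assms(2,3) nE in \<open>auto intro!: borel_measurable_continuous_onI continuous_intros Ec Fc Fp simp: norm_mult\<close>)+
  have "(\<integral>x. pdiff i (\<lambda>x. E x * F x) x \<partial>lborel) = 0"
  proof (rule integral_pdiff_eq_0[OF _ _ _ k, where C = "C * (1 + \<bar>\<omega> $ i\<bar>)"])
    show "pd1 (\<lambda>x. E x * F x)" unfolding pd1_def pe
      by (auto intro!: pdiffable_mult E Fp continuous_intros Ec Fc)
    fix x :: "'n rn"
    have I: "0 \<le> C * inverse ((1 + norm x) ^ k)" using C by simp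
    show "cmod (E x * F x) \<le> C * (1 + \<bar>\<omega> $ i\<bar>) * inverse ((1 + norm x) ^ k)"
      using assms(2)[of x] nE mult_nonneg_nonneg[OF I, of "\<bar>\<omega> $ i\<bar>"] by (simp add: norm_mult algebra_simps)
    have "cmod (pdiff i (\<lambda>x. E x * F x) x) \<le> cmod (pdiff i F x) + \<bar>\<omega> $ i\<bar> * cmod (F x)"
      unfolding pe by (rule order_trans[OF norm_triangle_ineq]) (simp add: norm_mult nE)
    also have "\<dots> \<le> C * inverse ((1 + norm x) ^ k) + \<bar>\<omega> $ i\<bar> * (C * inverse ((1 + norm x) ^ k))"
      by (intro add_mono assms mult_left_mono) auto
    finally show "cmod (pdiff i (\<lambda>x. E x * F x) x) \<le> C * (1 + \<bar>\<omega> $ i\<bar>) * inverse ((1 + norm x) ^ k)"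
      by (simp add: algebra_simps)
  qed
  then show ?thesis unfolding pe fourier_def E_def[symmetric] using int by simp
qed

text \<open>The index is that of the largest coordinate. Decay of a Fourier transform at \<omega> is
  thus read off from repeated derivatives in one direction, which may vary with \<omega>.\<close>

lemma one_plus_norm_power_le:
  fixes \<omega> :: "'n::finite rn"
  shows "\<exists>i. (1 + norm \<omega>) ^ k \<le> (2 * real CARD('n)) ^ k * max 1 (\<bar>\<omega> $ i\<bar> ^ k)"
proof -
  define M where "M = Max (range (\<lambda>i. \<bar>\<omega> $ i\<bar>))"
  have "M \<in> range (\<lambda>i. \<bar>\<omega> $ i\<bar>)" unfolding M_def by (intro Max_in) auto
  then obtain i where i: "M = \<bar>\<omega> $ i\<bar>" by auto
  have "norm \<omega> \<le> (\<Sum>i\<in>UNIV. \<bar>\<omega> $ i\<bar>)" by (rule norm_le_l1_cart)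
  also have "\<dots> \<le> (\<Sum>i\<in>(UNIV::'n set). M)" unfolding M_def by (intro sum_mono Max_ge) auto
  finally have "norm \<omega> \<le> real CARD('n) * \<bar>\<omega> $ i\<bar>" using i by simp
  moreover have "real CARD('n) * \<bar>\<omega> $ i\<bar> \<le> real CARD('n) * max 1 \<bar>\<omega> $ i\<bar>" by (intro mult_left_mono) auto
  moreover have "1 * 1 \<le> real CARD('n) * max 1 \<bar>\<omega> $ i\<bar>" by (intro mult_mono) (auto simp: Suc_leI)
  ultimately have "1 + norm \<omega> \<le> 2 * real CARD('n) * max 1 \<bar>\<omega> $ i\<bar>" by linarith
  then have "(1 + norm \<omega>) ^ k \<le> (2 * real CARD('n) * max 1 \<bar>\<omega> $ i\<bar>) ^ k"
    by (intro power_mono) auto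
  also have "\<dots> = (2 * real CARD('n)) ^ k * max 1 (\<bar>\<omega> $ i\<bar> ^ k)"
  proof (cases "1 \<le> \<bar>\<omega> $ i\<bar>")
    case True then show ?thesis using one_le_power[OF True, of k] by (simp add: power_mult_distrib max_absorb2)
  next
    case False then show ?thesis using power_le_one[of "\<bar>\<omega> $ i\<bar>" k] by (simp add: power_mult_distrib max_absorb1)
  qed
  finally show ?thesis by blast
qed

section \<open>Slowly increasing families\<close>

locale holder_class = holder_exponent +
  fixes r :: nat
begin

text \<open>In \<open>G t w y\<close> the number \<open>t\<close> is a large normal frequency, \<open>w\<close> a space variable at scale
  \<open>|t|^(-1/2)\<close>, and \<open>y\<close> the boundary point, in which regularity is limited.\<close>

definition pdw :: "'n::finite \<Rightarrow> (real \<Rightarrow> 'n rn \<Rightarrow> 'n rn \<Rightarrow> complex) \<Rightarrow> real \<Rightarrow> 'n rn \<Rightarrow> 'n rn \<Rightarrow> complex" where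
  "pdw i G t w y = pdiff i (\<lambda>w. G t w y) w"

text \<open>Slowly increasing multipliers in \<open>w\<close> with values in the Hoelder class of
  \<open>y\<close>, uniformly for |t| \<ge> 1. In \<open>tempered\<close> the exponent
  \<open>d\<close> may grow with the order of the derivative in \<open>w\<close>.\<close>

definition tempered_base :: "(real \<Rightarrow> 'n::finite rn \<Rightarrow> 'n rn \<Rightarrow> complex) \<Rightarrow> bool" where
  "tempered_base G \<longleftrightarrow> (\<exists>C d. \<forall>t w. 1 \<le> \<bar>t\<bar> \<longrightarrow> hol r sg (C * (1 + norm w) ^ d) (G t w)) \<and>
    (\<forall>t y. 1 \<le> \<bar>t\<bar> \<longrightarrow> continuous_on UNIV (\<lambda>w. G t w y))"

primrec tempered_upto :: "nat \<Rightarrow> (real \<Rightarrow> 'n::finite rn \<Rightarrow> 'n rn \<Rightarrow> complex) \<Rightarrow> bool" where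
  "tempered_upto 0 G \<longleftrightarrow> tempered_base G"
| "tempered_upto (Suc j) G \<longleftrightarrow> tempered_base G \<and>
    (\<forall>i. (\<forall>t w y. 1 \<le> \<bar>t\<bar> \<longrightarrow> pdiffable_at i (\<lambda>w. G t w y) w) \<and> tempered_upto j (pdw i G))"

definition tempered :: "(real \<Rightarrow> 'n::finite rn \<Rightarrow> 'n rn \<Rightarrow> complex) \<Rightarrow> bool" where
  "tempered G \<longleftrightarrow> (\<forall>j. tempered_upto j G)"

lemma tempered_baseD:
  assumes "tempered_base G"
  obtains C d where "C > 0" "\<And>t w. 1 \<le> \<bar>t\<bar> \<Longrightarrow> hol r sg (C * (1 + norm w) ^ d) (G t w)"
proof -
  from assms obtain C d where h: "\<And>t w. 1 \<le> \<bar>t\<bar> \<Longrightarrow> hol r sg (C * (1 + norm w) ^ d) (G t w)"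
    unfolding tempered_base_def by blast
  have "hol r sg ((\<bar>C\<bar> + 1) * (1 + norm w) ^ d) (G t w)" if "1 \<le> \<bar>t\<bar>" for t w
    by (rule hol_mono[OF h[OF that]]) (intro mult_right_mono, auto)
  then show ?thesis by (intro that[of "\<bar>C\<bar> + 1"]) auto
qed

lemma tempered_base_cong:
  "tempered_base G \<Longrightarrow> (\<And>t. 1 \<le> \<bar>t\<bar> \<Longrightarrow> G t = G' t) \<Longrightarrow> tempered_base G'"
  unfolding tempered_base_def by simp

lemma tempered_upto_cong:
  "tempered_upto j G \<Longrightarrow> (\<And>t. 1 \<le> \<bar>t\<bar> \<Longrightarrow> G t = G' t) \<Longrightarrow> tempered_upto j G'"
proof (induction j arbitrary: G G')
  case 0 then show ?case using tempered_base_cong by (simp; blast)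
next
  case (Suc j)
  have "pdw i G t = pdw i G' t" if "1 \<le> \<bar>t\<bar>" for i t
    using Suc.prems(2)[OF that] by (simp add: pdw_def fun_eq_iff)
  then have "tempered_upto j (pdw i G')" for i
    using Suc.IH[of "pdw i G" "pdw i G'"] Suc.prems(1) by simp
  moreover have "tempered_base G'" by (rule tempered_base_cong[of G]) (use Suc.prems in auto)
  ultimately show ?case using Suc.prems by simp
qed

lemma tempered_cong:
  "tempered G \<Longrightarrow> (\<And>t. 1 \<le> \<bar>t\<bar> \<Longrightarrow> G t = G' t) \<Longrightarrow> tempered G'"
  unfolding tempered_def using tempered_upto_cong by blast

lemma tempered_upto_Suc: "tempered_upto (Suc j) G \<Longrightarrow> tempered_upto j G"
  by (induction j arbitrary: G) auto

lemma temperedI: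
  assumes "tempered_base G" "\<And>i t w y. 1 \<le> \<bar>t\<bar> \<Longrightarrow> pdiffable_at i (\<lambda>w. G t w y) w" "\<And>i. tempered (pdw i G)"
  shows "tempered G"
  unfolding tempered_def
proof
  fix j show "tempered_upto j G" using assms unfolding tempered_def by (cases j) auto
qed

lemma temperedD:
  assumes "tempered G"
  shows "tempered_base G" "1 \<le> \<bar>t\<bar> \<Longrightarrow> pdiffable_at i (\<lambda>w. G t w y) w" "tempered (pdw i G)"
proof -
  show "tempered_base G" using assms unfolding tempered_def by (metis tempered_upto.simps(1))
  have s: "tempered_upto (Suc j) G" for j using assms unfolding tempered_def by blast
  show "1 \<le> \<bar>t\<bar> \<Longrightarrow> pdiffable_at i (\<lambda>w. G t w y) w" using s[of 0] by simp
  show "tempered (pdw i G)" unfolding tempered_def using s by simp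
qed

lemma tempered_base_add:
  assumes "tempered_base G" "tempered_base H"
  shows "tempered_base (\<lambda>t w y. G t w y + H t w y)"
proof -
  obtain C d where C: "C > 0" "\<And>t w. 1 \<le> \<bar>t\<bar> \<Longrightarrow> hol r sg (C * (1 + norm w) ^ d) (G t w)"
    using tempered_baseD[OF assms(1)] by blast
  obtain C' d' where C': "C' > 0" "\<And>t w. 1 \<le> \<bar>t\<bar> \<Longrightarrow> hol r sg (C' * (1 + norm w) ^ d') (H t w)"
    using tempered_baseD[OF assms(2)] by blast
  have "hol r sg ((C + C') * (1 + norm w) ^ max d d') (\<lambda>y. G t w y + H t w y)" if "1 \<le> \<bar>t\<bar>" for t w
  proof -
    have "C * (1 + norm w) ^ d \<le> C * (1 + norm w) ^ max d d'" "C' * (1 + norm w) ^ d' \<le> C' * (1 + norm w) ^ max d d'"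
      using C(1) C'(1) by (auto intro!: mult_left_mono power_increasing)
    then show ?thesis by (intro hol_mono[OF hol_add[OF C(2)[OF that] C'(2)[OF that]]]) (auto simp: distrib_right)
  qed
  then show ?thesis using assms unfolding tempered_base_def by (auto intro!: continuous_intros)
qed

lemma tempered_base_mult:
  assumes "tempered_base G" "tempered_base (H :: real \<Rightarrow> 'n::finite rn \<Rightarrow> 'n rn \<Rightarrow> complex)"
  shows "tempered_base (\<lambda>t w y. G t w y * H t w y)"
proof -
  obtain C d where C: "C > 0" "\<And>t w. 1 \<le> \<bar>t\<bar> \<Longrightarrow> hol r sg (C * (1 + norm w) ^ d) (G t w)"
    using tempered_baseD[OF assms(1)] by blast
  obtain C' d' where C': "C' > 0" "\<And>t w. 1 \<le> \<bar>t\<bar> \<Longrightarrow> hol r sg (C' * (1 + norm w) ^ d') (H t w)"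
    using tempered_baseD[OF assms(2)] by blast
  obtain M where M: "M > 0" "\<And>A B f g. hol r sg A f \<Longrightarrow> hol r sg B g \<Longrightarrow>
    hol r sg (M * (A * B)) (\<lambda>x :: 'n rn. f x * g x)" using hol_mult[of r] by blast
  have "hol r sg (M * C * C' * (1 + norm w) ^ (d + d')) (\<lambda>y. G t w y * H t w y)" if "1 \<le> \<bar>t\<bar>" for t w
    by (rule hol_mono[OF M(2)[OF C(2)[OF that] C'(2)[OF that]]]) (simp add: power_add mult_ac)
  then show ?thesis using assms unfolding tempered_base_def by (auto intro!: continuous_intros)
qed

lemma tempered_upto_add:
  "tempered_upto j G \<Longrightarrow> tempered_upto j H \<Longrightarrow> tempered_upto j (\<lambda>t w y. G t w y + H t w y)"
proof (induction j arbitrary: G H)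
  case 0 then show ?case by (simp add: tempered_base_add)
next
  case (Suc j)
  have "tempered_upto j (pdw i (\<lambda>t w y. G t w y + H t w y))" for i
  proof (rule tempered_upto_cong)
    show "tempered_upto j (\<lambda>t w y. pdw i G t w y + pdw i H t w y)" using Suc by auto
  qed (use Suc.prems in \<open>auto simp: pdw_def fun_eq_iff pdiff_add\<close>)
  then show ?case using Suc.prems by (auto intro: tempered_base_add pdiffable_add)
qed

lemma tempered_add: "tempered G \<Longrightarrow> tempered H \<Longrightarrow> tempered (\<lambda>t w y. G t w y + H t w y)"
  unfolding tempered_def using tempered_upto_add by blast

lemma tempered_upto_mult:
  "tempered_upto j G \<Longrightarrow> tempered_upto j H \<Longrightarrow> tempered_upto j (\<lambda>t w y. G t w y * H t w y)"
proof (induction j arbitrary: G H)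
  case 0 then show ?case by (simp add: tempered_base_mult)
next
  case (Suc j)
  have "tempered_upto j (pdw i (\<lambda>t w y. G t w y * H t w y))" for i
  proof (rule tempered_upto_cong)
    show "tempered_upto j (\<lambda>t w y. G t w y * pdw i H t w y + pdw i G t w y * H t w y)"
      using Suc.prems tempered_upto_Suc[OF Suc.prems(1)] tempered_upto_Suc[OF Suc.prems(2)]
      by (intro tempered_upto_add Suc.IH) auto
  qed (use Suc.prems in \<open>auto simp: pdw_def fun_eq_iff pdiff_mult\<close>)
  then show ?case using Suc.prems by (auto intro: tempered_base_mult pdiffable_mult)
qed

lemma tempered_mult: "tempered G \<Longrightarrow> tempered H \<Longrightarrow> tempered (\<lambda>t w y. G t w y * H t w y)"
  unfolding tempered_def using tempered_upto_mult by blast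

lemma tempered_const: "tempered (\<lambda>t (w :: 'n::finite rn) y. c)"
proof -
  have b: "tempered_base (\<lambda>t (w :: 'n rn) y. c)" for c
    unfolding tempered_base_def
    by (intro conjI exI[of _ "cmod c"] exI[of _ 0]) (auto simp: hol_const)
  have "tempered_upto j (\<lambda>t (w :: 'n rn) y. c)" for j
  proof (induction j arbitrary: c)
    case 0 then show ?case using b by simp
  next
    case (Suc j)
    have "pdw i (\<lambda>t (w :: 'n rn) y. c) = (\<lambda>t w y. 0)" for i by (simp add: pdw_def fun_eq_iff pdiff_const)
    then show ?case using b Suc by (simp add: pdiff_const)
  qed
  then show ?thesis unfolding tempered_def by blast
qed

lemma tempered_of_base_const:
  assumes "tempered_base (\<lambda>t (w :: 'n::finite rn) y. c t y)"
  shows "tempered (\<lambda>t (w :: 'n::finite rn) y. c t y)"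
proof (rule temperedI[OF assms])
  have "pdw i (\<lambda>t (w :: 'n rn) y. c t y) = (\<lambda>t w y. 0)" for i by (simp add: pdw_def fun_eq_iff pdiff_const)
  then show "tempered (pdw i (\<lambda>t (w :: 'n rn) y. c t y))" for i using tempered_const by simp
qed (simp add: pdiff_const)

lemma tempered_sum: "(\<And>k. k \<in> S \<Longrightarrow> tempered (G k)) \<Longrightarrow> tempered (\<lambda>t w y. \<Sum>k\<in>S. G k t w y)"
proof (induction S rule: infinite_finite_induct)
  case (insert k S) then show ?case by (auto intro: tempered_add)
qed (auto intro: tempered_const)

lemma tempered_power: "tempered G \<Longrightarrow> tempered (\<lambda>t w y. G t w y ^ k)"
  by (induction k) (auto intro: tempered_const tempered_mult)

lemma tempered_cmult: "tempered G \<Longrightarrow> tempered (\<lambda>t w y. c * G t w y)"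
  by (intro tempered_mult tempered_const)

end

section \<open>Elementary inequalities for Gaussians, brackets and words\<close>

lemma power_exp_bound:
  assumes "c > (0::real)"
  shows "\<exists>C. \<forall>x\<ge>0. (1 + x) ^ N * exp (- c * x\<^sup>2) \<le> C"
proof (intro exI allI impI)
  fix x :: real assume x: "0 \<le> x"
  have "(1 + x) ^ N \<le> exp x ^ N" using x exp_ge_add_one_self[of x] by (intro power_mono) auto
  then have "(1 + x) ^ N * exp (- c * x\<^sup>2) \<le> exp (real N * x) * exp (- c * x\<^sup>2)"
    by (intro mult_right_mono) (auto simp: exp_of_nat_mult)
  also have "\<dots> = exp (real N * x - c * x\<^sup>2)" by (simp add: exp_add[symmetric])
  \<comment> \<open>The maximum of the quadratic on the left, found by completing the
    square.\<close>
  also have "real N * x - c * x\<^sup>2 \<le> (real N)\<^sup>2 / (4 * c)"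
  proof -
    have "0 \<le> (2 * c * x - real N)\<^sup>2" by simp
    then have "4 * c * (real N * x - c * x\<^sup>2) \<le> (real N)\<^sup>2"
      by (simp add: power2_eq_square algebra_simps)
    then show ?thesis using assms by (simp add: pos_le_divide_eq mult.commute)
  qed
  finally show "(1 + x) ^ N * exp (- c * x\<^sup>2) \<le> exp ((real N)\<^sup>2 / (4 * c))" by simp
qed

lemma jap_ge_1: "1 \<le> jap x" and jap_ge_norm: "norm x \<le> jap x" and jap_pos: "0 < jap x"
proof -
  show 1: "1 \<le> jap x" unfolding jap_def by simp
  show "norm x \<le> jap x" unfolding jap_def by (rule real_le_rsqrt) simp
  show "0 < jap x" using 1 by linarith
qed

lemma jap_add_le: "jap x \<le> jap (x + z) + norm z"
proof -
  have "norm x \<le> norm (x + z) + norm z" using norm_triangle_ineq4[of "x + z" z] by simp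
  then have "1 + (norm x)\<^sup>2 \<le> 1 + (norm (x + z) + norm z)\<^sup>2" by (simp add: power_mono)
  also have "\<dots> = (1 + (norm (x + z))\<^sup>2) + 2 * norm z * norm (x + z) + (norm z)\<^sup>2"
    by (simp add: power2_eq_square algebra_simps)
  also have "\<dots> \<le> (jap (x + z))\<^sup>2 + 2 * norm z * jap (x + z) + (norm z)\<^sup>2"
    using jap_ge_norm[of "x + z"] by (intro add_mono mult_left_mono) (auto simp: jap_def add_nonneg_nonneg)
  also have "\<dots> = (jap (x + z) + norm z)\<^sup>2" by (simp add: power2_eq_square algebra_simps)
  finally show ?thesis unfolding jap_def[of x] using jap_pos[of "x + z"] by (intro real_le_lsqrt) auto
qed

text \<open>A Peetre-type inequality in which shifts of length up to the square root of the
  frequency cost nothing.\<close>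

lemma sqrt_peetre:
  assumes "0 < T" "T \<le> A" "A \<le> B + z" "1 \<le> B" "0 \<le> (z::real)"
  shows "T \<le> 4 * B * (1 + z / sqrt T)\<^sup>2"
\<comment> \<open>A short shift leaves B \<ge> A/2 \<ge> T/2. A long one has z \<ge> T/2, so that z
  / sqrt T is at least half of sqrt T and the square on the right alone suffices.\<close>
proof (cases "z \<le> A / 2")
  case True
  have "1 \<le> (1 + z / sqrt T)\<^sup>2" using assms by (simp add: one_le_power)
  then have "4 * B * 1 \<le> 4 * B * (1 + z / sqrt T)\<^sup>2" using assms by (intro mult_left_mono) auto
  then show ?thesis using True assms by linarith
next
  case False
  then have "T / 2 \<le> z" using assms by linarith
  then have "(T / 2)\<^sup>2 \<le> z\<^sup>2" using assms by (intro power_mono) auto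
  then have "T / 4 \<le> z\<^sup>2 / T" using assms by (simp add: field_simps power2_eq_square)
  also have "\<dots> = (z / sqrt T)\<^sup>2" using assms by (simp add: power_divide)
  also have "\<dots> \<le> (1 + z / sqrt T)\<^sup>2" using assms by (intro power_mono) auto
  finally have "T \<le> 4 * 1 * (1 + z / sqrt T)\<^sup>2" by simp
  also have "\<dots> \<le> 4 * B * (1 + z / sqrt T)\<^sup>2" using assms by (intro mult_right_mono) auto
  finally show ?thesis .
qed

lemma finite_lists_length [simp]: "finite {L :: 'n::finite list. length L = j}"
  using finite_lists_length_eq[of "UNIV :: 'n set" j] by simp

lemma sum_lists_Suc:
  "(\<Sum>L | length L = Suc j. f L) = (\<Sum>i\<in>(UNIV :: 'n::finite set). \<Sum>L | length L = j. f (i # L))"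
proof -
  have "(\<Sum>i\<in>(UNIV :: 'n set). \<Sum>L | length L = j. f (i # L)) =
      (\<Sum>(i, L)\<in>UNIV \<times> {L. length L = j}. f (i # L))"
    by (simp add: sum.cartesian_product)
  also have "\<dots> = (\<Sum>L | length L = Suc j. f L)"
    by (rule sum.reindex_bij_witness[of _ "\<lambda>L. (hd L, tl L)" "\<lambda>(i, L). i # L"])
      (auto simp: length_Suc_conv)
  finally show ?thesis by simp
qed

definition monom_list :: "'n::finite list \<Rightarrow> 'n rn \<Rightarrow> real" where
  "monom_list L v = prod_list (map (\<lambda>l. v $ l) L)"

lemma monom_list_simps [simp]: "monom_list [] v = 1" "monom_list (i # L) v = v $ i * monom_list L v"
  by (simp_all add: monom_list_def)

lemma abs_monom_list_le: "\<bar>monom_list L v\<bar> \<le> norm v ^ length L"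
  by (induction L) (auto simp: abs_mult intro!: mult_mono component_le_norm_cart)

lemma monom_list_scaleR: "monom_list L (c *\<^sub>R v) = c ^ length L * monom_list L v"
  by (induction L) auto

lemma continuous_on_monom_list: "continuous_on S (monom_list L)"
proof (induction L)
  case (Cons i L)
  have "continuous_on S (\<lambda>v. v $ i * monom_list L v)" by (intro continuous_intros Cons)
  then show ?case by (simp add: monom_list_def)
qed (simp add: monom_list_def)

section \<open>Rapidly decreasing families and their Fourier transforms\<close>

context holder_class
begin

text \<open>Schwartz functions of \<open>w\<close> with values in the Hoelder class of
  \<open>y\<close>. The constants must not depend on \<open>t\<close>: at the scale |t|^(-1/2) the
  test functions have this uniformity.\<close>

definition rapid :: "(real \<Rightarrow> 'n::finite rn \<Rightarrow> 'n rn \<Rightarrow> complex) \<Rightarrow> bool" where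
  "rapid F \<longleftrightarrow> (\<forall>t y. 1 \<le> \<bar>t\<bar> \<longrightarrow> smooth (\<lambda>w. F t w y)) \<and>
    (\<forall>L k. \<exists>C. \<forall>t w. 1 \<le> \<bar>t\<bar> \<longrightarrow> hol r sg (C * inverse ((1 + norm w) ^ k)) (\<lambda>y. pds L (\<lambda>w. F t w y) w))"

lemma tempered_smooth:
  assumes "tempered G" "1 \<le> \<bar>t\<bar>" shows "smooth (\<lambda>w. G t w y)"
proof (rule smooth_coinduct[where R = "\<lambda>g. \<exists>H. tempered H \<and> g = (\<lambda>w. H t w y)"])
  fix g assume "\<exists>H. tempered H \<and> g = (\<lambda>w. H t w y)"
  then obtain H where H: "tempered H" "g = (\<lambda>w. H t w y)" by blast
  show "continuous_on UNIV g \<and> (\<forall>i. (\<forall>x. pdiffable_at i g x) \<and> (\<exists>H. tempered H \<and> pdiff i g = (\<lambda>w. H t w y)))"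
  proof (intro conjI allI)
    show "continuous_on UNIV g" using temperedD(1)[OF H(1)] assms(2) unfolding H(2) tempered_base_def by blast
    show "pdiffable_at i g x" for i x unfolding H(2) by (rule temperedD(2)[OF H(1) assms(2)])
    show "\<exists>H. tempered H \<and> pdiff i g = (\<lambda>w. H t w y)" for i
      by (intro exI[of _ "pdw i H"]) (simp add: temperedD(3)[OF H(1)] pdw_def H(2))
  qed
qed (use assms in blast)

text \<open>Differentiation preserves the form of a tempered factor times
  \<open>exp (Q t w y)\<close>. By \<open>hol_exp\<close> the exponential costs a polynomial in the
  bound for \<open>Q\<close> and the exponential of the bound for its real part, and this Gaussian
  absorbs all polynomial growth.\<close>

lemma rapid_exp:
  fixes P Q :: "real \<Rightarrow> 'n::finite rn \<Rightarrow> 'n rn \<Rightarrow> complex"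
  assumes "tempered P" "tempered Q" "c > 0"
    and re: "\<And>t w y. 1 \<le> \<bar>t\<bar> \<Longrightarrow> Re (Q t w y) \<le> - c * (norm w)\<^sup>2"
  shows "rapid (\<lambda>t w y. P t w y * exp (Q t w y))"
proof -
  note Q = temperedD[OF assms(2)]
  have step: "pdiff i (\<lambda>w. P t w y * exp (Q t w y)) = (\<lambda>w. (pdw i P t w y + P t w y * pdw i Q t w y) * exp (Q t w y))"
    if "tempered P" "1 \<le> \<bar>t\<bar>" for P i t y
    using temperedD(2)[OF that] Q(2)[OF that(2)]
    by (auto simp: pdiff_mult pdiff_exp pdiffable_exp pdw_def algebra_simps)
  have tP: "tempered (\<lambda>t w y. pdw i P t w y + P t w y * pdw i Q t w y)" if "tempered P" for P i
    by (intro tempered_add tempered_mult temperedD(3) that assms(2))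
  have pdsP: "\<exists>P'. tempered P' \<and> (\<forall>t y. 1 \<le> \<bar>t\<bar> \<longrightarrow>
    pds L (\<lambda>w. P t w y * exp (Q t w y)) = (\<lambda>w. P' t w y * exp (Q t w y)))" for L
  proof (induction L)
    case Nil then show ?case using assms(1) by auto
  next
    case (Cons i L)
    then obtain P' where P': "tempered P'" "\<And>t y. 1 \<le> \<bar>t\<bar> \<Longrightarrow>
      pds L (\<lambda>w. P t w y * exp (Q t w y)) = (\<lambda>w. P' t w y * exp (Q t w y))" by blast
    then show ?case
      by (intro exI[of _ "\<lambda>t w y. pdw i P' t w y + P' t w y * pdw i Q t w y"]) (simp add: tP step)
  qed
  have sm: "smooth (\<lambda>w. P t w y * exp (Q t w y))" if t: "1 \<le> \<bar>t\<bar>" for t y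
  proof (rule smooth_coinduct[where R = "\<lambda>g. \<exists>P. tempered P \<and> g = (\<lambda>w. P t w y * exp (Q t w y))"])
    fix g assume "\<exists>P. tempered P \<and> g = (\<lambda>w. P t w y * exp (Q t w y))"
    then obtain P where P: "tempered P" "g = (\<lambda>w. P t w y * exp (Q t w y))" by blast
    show "continuous_on UNIV g \<and> (\<forall>i. (\<forall>x. pdiffable_at i g x) \<and>
      (\<exists>P. tempered P \<and> pdiff i g = (\<lambda>w. P t w y * exp (Q t w y))))"
    proof (intro conjI allI)
      show "continuous_on UNIV g" using temperedD(1)[OF P(1)] Q(1) t
        unfolding P(2) tempered_base_def by (intro continuous_intros) auto
      show "pdiffable_at i g x" for i x unfolding P(2)
        by (intro pdiffable_mult pdiffable_exp temperedD(2)[OF P(1) t] Q(2)[OF t])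
      show "\<exists>P. tempered P \<and> pdiff i g = (\<lambda>w. P t w y * exp (Q t w y))" for i
        unfolding P(2) step[OF P(1) t] using tP[OF P(1)] by blast
    qed
  qed (use assms(1) in blast)
  obtain M where M: "M > 0" "\<And>A B f g. hol r sg A f \<Longrightarrow> hol r sg B g \<Longrightarrow>
    hol r sg (M * (A * B)) (\<lambda>x :: 'n rn. f x * g x)" using hol_mult[of r] by blast
  obtain E where E: "E > 0" "\<And>A c f. hol r sg A f \<Longrightarrow> \<forall>y. Re (f y) \<le> c \<Longrightarrow>
    hol r sg (E * (1 + A) ^ Suc r * exp c) (\<lambda>y :: 'n rn. exp (f y))" using hol_exp[of r] by blast
  obtain C2 d2 where C2: "C2 > 0" "\<And>t w. 1 \<le> \<bar>t\<bar> \<Longrightarrow> hol r sg (C2 * (1 + norm w) ^ d2) (Q t w)"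
    using tempered_baseD[OF Q(1)] by blast
  have dec: "\<exists>C. \<forall>t w. 1 \<le> \<bar>t\<bar> \<longrightarrow> hol r sg (C * inverse ((1 + norm w) ^ k)) (\<lambda>y. P t w y * exp (Q t w y))"
    if tP1: "tempered P" for P :: "real \<Rightarrow> 'n rn \<Rightarrow> 'n rn \<Rightarrow> complex" and k
  proof -
    obtain C1 d1 where C1: "C1 > 0" "\<And>t w. 1 \<le> \<bar>t\<bar> \<Longrightarrow> hol r sg (C1 * (1 + norm w) ^ d1) (P t w)"
      using tempered_baseD[OF temperedD(1)[OF tP1]] by blast
    \<comment> \<open>The growth of \<open>P\<close>, the growth of \<open>Q\<close> raised to the
      power \<open>Suc r\<close> by \<open>hol_exp\<close>, and the decay asked for.\<close>
    define N where "N = d1 + d2 * Suc r + k"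
    obtain B where B: "\<And>x. 0 \<le> x \<Longrightarrow> (1 + x) ^ N * exp (- c * x\<^sup>2) \<le> B"
      using power_exp_bound[OF assms(3)] by blast
    define K where "K = M * C1 * E * (1 + C2) ^ Suc r"
    have K: "0 \<le> K" unfolding K_def using M C1 E C2 by (auto intro!: mult_nonneg_nonneg)
    have "hol r sg (K * B * inverse ((1 + norm w) ^ k)) (\<lambda>y. P t w y * exp (Q t w y))" if t: "1 \<le> \<bar>t\<bar>" for t and w :: "'n rn"
    proof (rule hol_mono)
      let ?x = "1 + norm w"
      have x: "1 \<le> ?x ^ d2" "0 < ?x ^ k" by (auto intro!: one_le_power zero_less_power add_pos_nonneg)
      show "hol r sg (M * ((C1 * ?x ^ d1) * (E * (1 + C2 * ?x ^ d2) ^ Suc r * exp (- c * (norm w)\<^sup>2))))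
          (\<lambda>y. P t w y * exp (Q t w y))"
        by (intro M(2) C1(2)[OF t] E(2) C2(2)[OF t] allI re[OF t])
      have "1 + C2 * ?x ^ d2 \<le> (1 + C2) * ?x ^ d2" using x by (simp add: algebra_simps)
      then have "(1 + C2 * ?x ^ d2) ^ Suc r \<le> ((1 + C2) * ?x ^ d2) ^ Suc r"
        using C2(1) x by (intro power_mono) (auto intro!: add_nonneg_nonneg mult_nonneg_nonneg)
      also have "\<dots> = (1 + C2) ^ Suc r * ?x ^ (d2 * Suc r)" unfolding power_mult_distrib power_mult ..
      finally have "M * C1 * E * (?x ^ d1 * exp (- c * (norm w)\<^sup>2)) * (1 + C2 * ?x ^ d2) ^ Suc r \<le>
          M * C1 * E * (?x ^ d1 * exp (- c * (norm w)\<^sup>2)) * ((1 + C2) ^ Suc r * ?x ^ (d2 * Suc r))"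
        using M C1 E by (intro mult_left_mono) auto
      then have "M * ((C1 * ?x ^ d1) * (E * (1 + C2 * ?x ^ d2) ^ Suc r * exp (- c * (norm w)\<^sup>2)))
          \<le> K * (?x ^ (d1 + d2 * Suc r) * exp (- c * (norm w)\<^sup>2))"
        unfolding K_def power_add by (simp only: mult_ac)
      also have "\<dots> = K * (?x ^ N * exp (- c * (norm w)\<^sup>2)) * inverse (?x ^ k)"
        unfolding N_def power_add[of _ _ k] using less_imp_neq[OF x(2), symmetric] by simp
      also have "\<dots> \<le> K * B * inverse (?x ^ k)"
        using K B[of "norm w"] x(2) by (intro mult_right_mono mult_left_mono) auto
      finally show "M * ((C1 * ?x ^ d1) * (E * (1 + C2 * ?x ^ d2) ^ Suc r * exp (- c * (norm w)\<^sup>2)))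
          \<le> K * B * inverse (?x ^ k)" .
    qed
    then show ?thesis by blast
  qed
  show ?thesis unfolding rapid_def
  proof (intro conjI allI impI)
    fix L k
    obtain P' where P': "tempered P'" "\<And>t y. 1 \<le> \<bar>t\<bar> \<Longrightarrow>
      pds L (\<lambda>w. P t w y * exp (Q t w y)) = (\<lambda>w. P' t w y * exp (Q t w y))" using pdsP by blast
    obtain C where "\<And>t w. 1 \<le> \<bar>t\<bar> \<Longrightarrow> hol r sg (C * inverse ((1 + norm w) ^ k)) (\<lambda>y. P' t w y * exp (Q t w y))"
      using dec[OF P'(1)] by blast
    then show "\<exists>C. \<forall>t w. 1 \<le> \<bar>t\<bar> \<longrightarrow> hol r sg (C * inverse ((1 + norm w) ^ k)) (\<lambda>y. pds L (\<lambda>w. P t w y * exp (Q t w y)) w)"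
      by (intro exI[of _ C]) (simp add: P'(2))
  qed (rule sm)
qed

lemma rapid_pds: "rapid F \<Longrightarrow> rapid (\<lambda>t w y. pds L (\<lambda>w. F t w y) w)"
  unfolding rapid_def
proof (intro conjI allI impI; elim conjE)
  fix L' k
  assume "\<forall>L k. \<exists>C. \<forall>t w. 1 \<le> \<bar>t\<bar> \<longrightarrow> hol r sg (C * inverse ((1 + norm w) ^ k)) (\<lambda>y. pds L (\<lambda>w. F t w y) w)"
  from this[rule_format, of k "L' @ L"]
  show "\<exists>C. \<forall>t w. 1 \<le> \<bar>t\<bar> \<longrightarrow> hol r sg (C * inverse ((1 + norm w) ^ k)) (\<lambda>y. pds L' (\<lambda>w. pds L (\<lambda>w. F t w y) w) w)"
    by simp
qed (auto intro: smooth_pds)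

lemma rapidD:
  assumes "rapid (F :: real \<Rightarrow> 'n::finite rn \<Rightarrow> 'n rn \<Rightarrow> complex)"
  shows "1 \<le> \<bar>t\<bar> \<Longrightarrow> smooth (\<lambda>w. F t w y)"
    "1 \<le> \<bar>t\<bar> \<Longrightarrow> (\<lambda>w. F t w y) \<in> borel_measurable borel"
    "\<exists>C. \<forall>t w. 1 \<le> \<bar>t\<bar> \<longrightarrow> hol r sg (C * inverse ((1 + norm w) ^ k)) (F t w)"
proof -
  show s: "smooth (\<lambda>w. F t w y)" if "1 \<le> \<bar>t\<bar>" for t using assms that unfolding rapid_def by blast
  show "(\<lambda>w. F t w y) \<in> borel_measurable borel" if "1 \<le> \<bar>t\<bar>"
    using pd1_continuous[OF smooth_pd1[OF s[OF that]]] by (rule borel_measurable_continuous_onI)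
  have "\<exists>C. \<forall>t w. 1 \<le> \<bar>t\<bar> \<longrightarrow> hol r sg (C * inverse ((1 + norm w) ^ k)) (\<lambda>y. pds [] (\<lambda>w. F t w y) w)"
    using assms unfolding rapid_def by blast
  then show "\<exists>C. \<forall>t w. 1 \<le> \<bar>t\<bar> \<longrightarrow> hol r sg (C * inverse ((1 + norm w) ^ k)) (F t w)" by simp
qed

lemma fourier_rapid_bound:
  fixes F :: "real \<Rightarrow> 'n::finite rn \<Rightarrow> 'n rn \<Rightarrow> complex"
  assumes "rapid F"
  shows "\<exists>C. \<forall>t \<omega>. 1 \<le> \<bar>t\<bar> \<longrightarrow> hol r sg C (\<lambda>y. fourier (\<lambda>w. F t w y) \<omega>)"
proof -
  define k where "k = 2 * CARD('n)"
  obtain C where C: "\<And>t w. 1 \<le> \<bar>t\<bar> \<Longrightarrow> hol r sg (C * inverse ((1 + norm w) ^ k)) (F t w)"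
    using rapidD(3)[OF assms] by blast
  have "hol r sg (\<integral>w. C * inverse ((1 + norm w) ^ k) \<partial>(lborel :: 'n rn measure)) (\<lambda>y. fourier (\<lambda>w. F t w y) \<omega>)"
    if t: "1 \<le> \<bar>t\<bar>" for t \<omega>
    unfolding fourier_def
  proof (rule hol_integral)
    show "integrable lborel (\<lambda>w :: 'n rn. C * inverse ((1 + norm w) ^ k))"
      by (intro integrable_mult_right integrable_inverse_power_norm) (simp add: k_def)
    show "hol r sg (C * inverse ((1 + norm w) ^ k)) (\<lambda>y. cis (- (w \<bullet> \<omega>)) * F t w y)" for w
      using hol_cmult[OF C[OF t], of "cis (- (w \<bullet> \<omega>))"] by simp
    show "(\<lambda>w. cis (- (w \<bullet> \<omega>)) * F t w y) \<in> borel_measurable lborel" for y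
      using rapidD(2)[OF assms t] unfolding cis_conv_exp by measurable
  qed
  then show ?thesis by blast
qed

lemma fourier_rapid_pdiff:
  fixes F :: "real \<Rightarrow> 'n::finite rn \<Rightarrow> 'n rn \<Rightarrow> complex"
  assumes "rapid F" "1 \<le> \<bar>t\<bar>"
  shows "fourier (\<lambda>w. pdiff i (\<lambda>w. F t w y) w) \<omega> = \<i> * complex_of_real (\<omega> $ i) * fourier (\<lambda>w. F t w y) \<omega>"
proof -
  define k where "k = 2 * CARD('n)"
  obtain C where C: "\<And>t w. 1 \<le> \<bar>t\<bar> \<Longrightarrow> hol r sg (C * inverse ((1 + norm w) ^ k)) (F t w)"
    using rapidD(3)[OF assms(1)] by blast
  obtain C' where C': "\<And>t w. 1 \<le> \<bar>t\<bar> \<Longrightarrow> hol r sg (C' * inverse ((1 + norm w) ^ k)) (\<lambda>y. pdiff i (\<lambda>w. F t w y) w)"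
    using rapidD(3)[OF rapid_pds[OF assms(1), of "[i]"], of k] by auto
  show ?thesis
  proof (rule fourier_pdiff[where C = "max C C'" and k = k])
    show "pd1 (\<lambda>w. F t w y)" by (intro smooth_pd1 rapidD(1) assms)
    fix w :: "'n rn"
    have I: "0 \<le> inverse ((1 + norm w) ^ k)" by simp
    show "cmod (F t w y) \<le> max C C' * inverse ((1 + norm w) ^ k)"
      using hol_bound[OF C[OF assms(2)], of w y] mult_right_mono[OF max.cobounded1 I, of C C'] by linarith
    show "cmod (pdiff i (\<lambda>w. F t w y) w) \<le> max C C' * inverse ((1 + norm w) ^ k)"
      using hol_bound[OF C'[OF assms(2), of w], of y] mult_right_mono[OF max.cobounded2 I, of C' C] by linarith
  qed (simp add: k_def)
qed

lemma fourier_rapid_pds: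
  assumes "rapid F" "1 \<le> \<bar>t\<bar>"
  shows "fourier (pds L (\<lambda>w. F t w y)) \<omega> = \<i> ^ length L * complex_of_real (monom_list L \<omega>) * fourier (\<lambda>w. F t w y) \<omega>"
proof (induction L)
  case (Cons i L)
  have "fourier (pds (i # L) (\<lambda>w. F t w y)) \<omega> = \<i> * complex_of_real (\<omega> $ i) * fourier (\<lambda>w. pds L (\<lambda>w. F t w y) w) \<omega>"
    using fourier_rapid_pdiff[OF rapid_pds[OF assms(1), of L] assms(2), of i y \<omega>] by simp
  then show ?case using Cons by simp
qed simp

text \<open>At each \<omega> the transform is divided by a power of its largest coordinate. This
  divisor does not depend on \<open>y\<close>, so the division respects the Hoelder balls; summing
  the constants over the coordinates makes them uniform.\<close>

lemma fourier_rapid_decay: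
  fixes F :: "real \<Rightarrow> 'n::finite rn \<Rightarrow> 'n rn \<Rightarrow> complex"
  assumes "rapid F"
  shows "\<exists>C\<ge>0. \<forall>t \<omega>. 1 \<le> \<bar>t\<bar> \<longrightarrow> hol r sg (C * inverse ((1 + norm \<omega>) ^ k)) (\<lambda>y. fourier (\<lambda>w. F t w y) \<omega>)"
proof -
  obtain C0 where C0: "\<And>t \<omega>. 1 \<le> \<bar>t\<bar> \<Longrightarrow> hol r sg C0 (\<lambda>y. fourier (\<lambda>w. F t w y) \<omega>)"
    using fourier_rapid_bound[OF assms] by blast
  have "\<forall>i. \<exists>C. \<forall>t \<omega>. 1 \<le> \<bar>t\<bar> \<longrightarrow> hol r sg C (\<lambda>y. fourier (\<lambda>w. pds (replicate k i) (\<lambda>w. F t w y) w) \<omega>)"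
    using fourier_rapid_bound[OF rapid_pds[OF assms]] by blast
  then obtain C1 where C1: "\<And>i t \<omega>. 1 \<le> \<bar>t\<bar> \<Longrightarrow> hol r sg (C1 i) (\<lambda>y. fourier (\<lambda>w. pds (replicate k i) (\<lambda>w. F t w y) w) \<omega>)"
    by metis
  define S where "S = C0 + (\<Sum>i\<in>UNIV. C1 i)"
  have nn: "0 \<le> C0" "\<And>i. 0 \<le> C1 i" using hol_nonneg[OF C0[of 1]] hol_nonneg[OF C1[of 1]] by auto
  have S: "C0 \<le> S" "C1 i \<le> S" for i
    unfolding S_def using nn member_le_sum[of i UNIV C1] by (auto intro: sum_nonneg)
  have mr: "monom_list (replicate k i) \<omega> = (\<omega> $ i) ^ k" for i \<omega> by (induction k) auto
  have "hol r sg ((2 * real CARD('n)) ^ k * S * inverse ((1 + norm \<omega>) ^ k)) (\<lambda>y. fourier (\<lambda>w. F t w y) \<omega>)"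
    if t: "1 \<le> \<bar>t\<bar>" for t \<omega>
  proof -
    obtain i where i: "(1 + norm \<omega>) ^ k \<le> (2 * real CARD('n)) ^ k * max 1 (\<bar>\<omega> $ i\<bar> ^ k)"
      using one_plus_norm_power_le by blast
    define m where "m = max 1 (\<bar>\<omega> $ i\<bar> ^ k)"
    have m: "m \<ge> 1" unfolding m_def by simp
    have h: "hol r sg (inverse m * S) (\<lambda>y. fourier (\<lambda>w. F t w y) \<omega>)"
    proof (cases "\<bar>\<omega> $ i\<bar> ^ k \<le> 1")
      case True
      then show ?thesis unfolding m_def using hol_mono[OF C0[OF t] S(1)] by (simp add: max_absorb1)
    next
      case False
      then have nz: "(\<omega> $ i) ^ k \<noteq> 0" by (metis abs_zero power_abs zero_le_one)
      define z where "z = \<i> ^ k * complex_of_real ((\<omega> $ i) ^ k)"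
      have z: "z \<noteq> 0" "cmod (inverse z) = inverse m"
        using nz False by (auto simp: z_def m_def norm_inverse norm_mult norm_power max_absorb2)
      have "fourier (\<lambda>w. pds (replicate k i) (\<lambda>w. F t w y) w) \<omega> = z * fourier (\<lambda>w. F t w y) \<omega>" for y
        using fourier_rapid_pds[OF assms t, of "replicate k i" y \<omega>] unfolding mr length_replicate z_def .
      then have "(\<lambda>y. fourier (\<lambda>w. F t w y) \<omega>) =
          (\<lambda>y. inverse z * fourier (\<lambda>w. pds (replicate k i) (\<lambda>w. F t w y) w) \<omega>)"
        using z(1) by (simp add: mult.assoc[symmetric])
      then show ?thesis
        using hol_cmult[OF hol_mono[OF C1[OF t] S(2)], of "inverse z" i \<omega>] unfolding z(2) by simp
    qed
    have "inverse m \<le> (2 * real CARD('n)) ^ k * inverse ((1 + norm \<omega>) ^ k)"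
    proof -
      have "0 < (1 + norm \<omega>) ^ k" by (auto intro!: zero_less_power add_pos_nonneg)
      then show ?thesis using i m unfolding m_def[symmetric] by (simp add: field_simps)
    qed
    from mult_right_mono[OF this, of S] show ?thesis using S(1) nn(1)
      by (intro hol_mono[OF h]) (simp add: mult_ac)
  qed
  moreover have "0 \<le> (2 * real CARD('n)) ^ k * S" using S(1) nn(1) by simp
  ultimately show ?thesis by blast
qed

text \<open>A monomial factor on the Fourier side is a derivative of \<open>F\<close>, up to powers
  of \<open>\<i>\<close>, and integrating over \<omega> evaluates that derivative at 0. This turns a
  Taylor polynomial of a symbol into derivatives of the test function at the origin.\<close>

lemma rapid_inversion:
  fixes F :: "real \<Rightarrow> 'n::finite rn \<Rightarrow> 'n rn \<Rightarrow> complex"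
  assumes "rapid F" "1 \<le> \<bar>t\<bar>"
  shows "integrable lborel (\<lambda>\<omega>. complex_of_real (monom_list L \<omega>) * fourier (\<lambda>w. F t w y) \<omega>)"
    "(\<integral>\<omega>. complex_of_real (monom_list L \<omega>) * fourier (\<lambda>w. F t w y) \<omega> \<partial>lborel) =
      (2 * pi) ^ CARD('n) * ((- \<i>) ^ length L * pds L (\<lambda>w. F t w y) 0)"
proof -
  define G where "G = pds L (\<lambda>w. F t w y)"
  have R: "rapid (\<lambda>t w y. pds L (\<lambda>w. F t w y) w)" by (rule rapid_pds[OF assms(1)])
  obtain C where C: "\<And>w. cmod (G w) \<le> C * inverse ((1 + norm w) ^ (2 * CARD('n)))"
    using rapidD(3)[OF R, of "2 * CARD('n)"] hol_bound assms(2) unfolding G_def by blast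
  have C0: "0 \<le> C" using order_trans[OF norm_ge_zero C[of 0]] by simp
  have sm: "smooth G" unfolding G_def by (intro smooth_pds rapidD(1) assms)
  have cont: "continuous_on UNIV G" by (rule pd1_continuous[OF smooth_pd1[OF sm]])
  have Gm: "G \<in> borel_measurable borel" by (rule borel_measurable_continuous_onI[OF cont])
  have bd: "cmod (G w) \<le> C" for w
  proof -
    have "inverse ((1 + norm w) ^ (2 * CARD('n))) \<le> 1" by (simp add: inverse_le_1_iff one_le_power)
    from mult_left_mono[OF this C0] show ?thesis using C[of w] by simp
  qed
  obtain C' where C': "\<And>\<omega>. cmod (fourier G \<omega>) \<le> C' * inverse ((1 + norm \<omega>) ^ (2 * CARD('n)))"
    using fourier_rapid_decay[OF R, of "2 * CARD('n)"] hol_bound assms(2) unfolding G_def by blast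
  have int: "integrable lborel (fourier G)"
    by (rule integrable_of_decay[OF fourier_measurable[OF Gm] C']) simp
  have eq: "complex_of_real (monom_list L \<omega>) * fourier (\<lambda>w. F t w y) \<omega> = (- \<i>) ^ length L * fourier G \<omega>" for \<omega>
    unfolding G_def fourier_rapid_pds[OF assms] by (simp add: mult.assoc[symmetric] power_mult_distrib[symmetric])
  show "integrable lborel (\<lambda>\<omega>. complex_of_real (monom_list L \<omega>) * fourier (\<lambda>w. F t w y) \<omega>)"
    unfolding eq by (intro integrable_mult_right int)
  have "integrable lborel G" by (rule integrable_of_decay[OF Gm C]) simp
  from fourier_inversion_at_0[OF cont bd this int]
  show "(\<integral>\<omega>. complex_of_real (monom_list L \<omega>) * fourier (\<lambda>w. F t w y) \<omega> \<partial>lborel) =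
      (2 * pi) ^ CARD('n) * ((- \<i>) ^ length L * pds L (\<lambda>w. F t w y) 0)"
    unfolding eq by (simp add: G_def)
qed

end

section \<open>Expansion of oscillatory integrals\<close>

context holder_class
begin

text \<open>Unlike in \<open>symbol_class\<close>, the covariable comes first.\<close>

definition symbol_family :: "int \<Rightarrow> ('n::finite rn \<Rightarrow> 'n rn \<Rightarrow> complex) \<Rightarrow> bool" where
  "symbol_family m q \<longleftrightarrow> (\<forall>y. smooth (\<lambda>\<xi>. q \<xi> y)) \<and>
    (\<forall>L. \<exists>C. \<forall>\<xi>. hol r sg (C * jap \<xi> powr (of_int m - real (length L))) (\<lambda>y. pds L (\<lambda>\<xi>. q \<xi> y) \<xi>))"

text \<open>The decay produced by the \<open>j\<close> derivatives beyond order \<open>N\<close> is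
  discarded, so that one exponent N - m serves all \<open>j\<close>.\<close>

lemma symbol_family_bound:
  assumes "symbol_family m q" "int N \<ge> m" "length L = N + j"
  shows "\<exists>C\<ge>0. \<forall>\<xi>. hol r sg (C * inverse (jap \<xi> ^ nat (int N - m))) (\<lambda>y. pds L (\<lambda>\<xi>. q \<xi> y) \<xi>)"
proof -
  obtain C where C: "\<And>\<xi>. hol r sg (C * jap \<xi> powr (of_int m - real (length L))) (\<lambda>y. pds L (\<lambda>\<xi>. q \<xi> y) \<xi>)"
    using assms(1) unfolding symbol_family_def by blast
  have "0 \<le> C"
    using hol_nonneg[OF C[of 0]] jap_pos[of "0 :: 'a rn"] by (simp add: zero_le_mult_iff powr_gt_zero not_le[symmetric])
  moreover have "jap \<xi> powr (of_int m - real (length L)) \<le> inverse (jap \<xi> ^ nat (int N - m))" for \<xi> :: "'a rn"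
  proof -
    have "jap \<xi> powr (of_int m - real (length L)) \<le> jap \<xi> powr (- real (nat (int N - m)))"
      using jap_ge_1[of \<xi>] assms(2,3) by (intro powr_mono) auto
    then show ?thesis using jap_pos[of \<xi>] by (simp add: powr_minus powr_realpow)
  qed
  ultimately show ?thesis by (intro exI[of _ C] conjI allI hol_mono[OF C] mult_left_mono)
qed

lemma pds_curve:
  assumes "smooth f" "\<And>j. ((\<lambda>t. c t $ j) has_vector_derivative c' j) (at t0)"
  shows "((\<lambda>t. pds L f (c t)) has_vector_derivative (\<Sum>j\<in>UNIV. c' j *\<^sub>R pds (j # L) f (c t0))) (at t0)"
  using pd1_curve[OF smooth_pd1[OF smooth_pds[OF assms(1)]] assms(2)] by simp

text \<open>Dividing the sum over words by \<open>fact j\<close> gives the usual Taylor polynomial,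
  since a multi-index \<alpha> of order j arises from j! / \<alpha>! words. The base point may
  depend on \<open>y\<close>.\<close>

lemma hol_taylor_lists:
  fixes f :: "'n::finite rn \<Rightarrow> 'n rn \<Rightarrow> complex"
  assumes N: "N > 0" and sm: "\<And>y. smooth (f y)"
    and bd: "\<And>\<theta> L. 0 \<le> \<theta> \<Longrightarrow> \<theta> \<le> 1 \<Longrightarrow> length L = N \<Longrightarrow> hol r sg (B L) (\<lambda>y. pds L (f y) (b y + \<theta> *\<^sub>R v))"
  shows "hol r sg (norm v ^ N * (\<Sum>L | length L = N. B L)) (\<lambda>y. f y (b y + v) -
    (\<Sum>j<N. (\<Sum>L | length L = j. complex_of_real (monom_list L v) * pds L (f y) (b y)) / fact j))"
proof -
  define g where "g j \<theta> y = (\<Sum>L | length L = j. complex_of_real (monom_list L v) * pds L (f y) (b y + \<theta> *\<^sub>R v))" for j \<theta> y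
  have der: "((\<lambda>\<theta>. g j \<theta> y) has_vector_derivative g (Suc j) \<theta> y) (at \<theta>)" for j \<theta> y
  proof -
    have "((\<lambda>\<theta>. g j \<theta> y) has_vector_derivative (\<Sum>L | length L = j. complex_of_real (monom_list L v) *
        (\<Sum>l\<in>UNIV. (v $ l) *\<^sub>R pds (l # L) (f y) (b y + \<theta> *\<^sub>R v)))) (at \<theta>)"
      unfolding g_def
      by (intro has_vector_derivative_sum has_vector_derivative_mult_right pds_curve sm)
        (auto intro!: derivative_eq_intros)
    also have "(\<Sum>L | length L = j. complex_of_real (monom_list L v) *
        (\<Sum>l\<in>UNIV. (v $ l) *\<^sub>R pds (l # L) (f y) (b y + \<theta> *\<^sub>R v))) = g (Suc j) \<theta> y"
      unfolding g_def sum_lists_Suc sum_distrib_left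
      by (subst sum.swap) (simp add: scaleR_conv_of_real mult_ac)
    finally show ?thesis .
  qed
  have "hol r sg (norm v ^ N * (\<Sum>L | length L = N. B L)) (\<lambda>y. g 0 1 y - (\<Sum>j<N. g j 0 y / of_real (fact j)))"
  proof (rule hol_taylor[where g = g and N = N, OF N der])
    show "continuous_on {0..1} (\<lambda>\<theta>. g N \<theta> y)" for y
      using der by (intro continuous_at_imp_continuous_on ballI has_vector_derivative_continuous) blast
    fix \<theta> :: real assume th: "0 \<le> \<theta>" "\<theta> \<le> 1"
    have "hol r sg (\<Sum>L | length L = N. norm v ^ N * B L) (g N \<theta>)"
      unfolding g_def
    proof (rule hol_sum)
      fix L assume "L \<in> {L :: 'n list. length L = N}"
      then have L: "length L = N" by simp
      have "cmod (complex_of_real (monom_list L v)) * B L \<le> norm v ^ N * B L"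
        using abs_monom_list_le[of L v] L hol_nonneg[OF bd[OF th L]] by (intro mult_right_mono) auto
      then show "hol r sg (norm v ^ N * B L) (\<lambda>y. complex_of_real (monom_list L v) * pds L (f y) (b y + \<theta> *\<^sub>R v))"
        by (rule hol_mono[OF hol_cmult[OF bd[OF th L]]])
    qed
    then show "hol r sg (norm v ^ N * (\<Sum>L | length L = N. B L)) (g N \<theta>)" by (simp only: sum_distrib_left)
  qed
  then show ?thesis unfolding g_def by simp
qed

text \<open>The remainder contains symbol derivatives at a frequency depending on \<open>y\<close>.
  \<open>hol_subst\<close> handles this with parameter a(y) t, whose derivative has size |t|, whence
  |t|^(Suc r). By \<open>sqrt_peetre\<close> the decay in |t| survives the shift by \<open>v\<close>
  at the price of powers of 1 + |v| / sqrt |t|.\<close>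

lemma symbol_taylor:
  fixes q :: "'n::finite rn \<Rightarrow> 'n rn \<Rightarrow> complex" and a :: "'n rn \<Rightarrow> real"
  assumes q: "symbol_family m q" and N: "int N \<ge> m" "N > 0"
    and c0: "c0 > 0" "\<And>y. c0 \<le> a y"
    and a: "\<And>i x. pdiffable_at i a x" "\<And>i. hol r sg A (\<lambda>x. complex_of_real (pdiff i a x))"
  shows "\<exists>C\<ge>0. \<forall>t v. 1 \<le> \<bar>t\<bar> \<longrightarrow>
    hol r sg (C * \<bar>t\<bar> ^ Suc r * inverse (\<bar>t\<bar> ^ nat (int N - m)) * (1 + norm v / sqrt \<bar>t\<bar>) ^ (2 * nat (int N - m)) * norm v ^ N)
      (\<lambda>y. q ((a y * t) *\<^sub>R axis i0 1 + v) y -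
        (\<Sum>j<N. (\<Sum>L | length L = j. complex_of_real (monom_list L v) * pds L (\<lambda>\<xi>. q \<xi> y) ((a y * t) *\<^sub>R axis i0 1)) / fact j))"
proof -
  define d where "d = nat (int N - m)"
  define e where "e = (axis i0 1 :: 'n rn)"
  have ne: "norm e = 1" unfolding e_def by (simp add: norm_axis_1)
  have sm: "smooth (\<lambda>\<xi>. q \<xi> y)" for y using q unfolding symbol_family_def by blast
  define A0 where "A0 = max 1 A"
  have A0: "1 \<le> A0" "A \<le> A0" unfolding A0_def by auto
  have "\<exists>C. N \<le> length L \<longrightarrow> 0 \<le> C \<and> (\<forall>\<xi>. hol r sg (C * inverse (jap \<xi> ^ d)) (\<lambda>y. pds L (\<lambda>\<xi>. q \<xi> y) \<xi>))" for L
    using symbol_family_bound[OF q N(1), of L "length L - N"] unfolding d_def by auto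
  then have "\<forall>L. \<exists>C. N \<le> length L \<longrightarrow> 0 \<le> C \<and> (\<forall>\<xi>. hol r sg (C * inverse (jap \<xi> ^ d)) (\<lambda>y. pds L (\<lambda>\<xi>. q \<xi> y) \<xi>))" ..
  from choice[OF this] obtain Cq where Cq': "\<forall>L. N \<le> length L \<longrightarrow> 0 \<le> Cq L \<and>
      (\<forall>\<xi>. hol r sg (Cq L * inverse (jap \<xi> ^ d)) (\<lambda>y. pds L (\<lambda>\<xi>. q \<xi> y) \<xi>))" ..
  have Cq: "0 \<le> Cq L" "hol r sg (Cq L * inverse (jap \<xi> ^ d)) (\<lambda>y. pds L (\<lambda>\<xi>. q \<xi> y) \<xi>)" if "length L = N + j" for L j \<xi>
    using Cq'[rule_format, of L] that by auto
  obtain Cs where Cs: "Cs > 0" "\<And>(g :: nat \<Rightarrow> real \<Rightarrow> 'n rn \<Rightarrow> complex) b A B S.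
    1 \<le> A \<Longrightarrow> open S \<Longrightarrow> convex S \<Longrightarrow> \<forall>x. b x \<in> S \<Longrightarrow>
    \<forall>j. \<forall>s\<in>S. \<forall>y. ((\<lambda>s. g j s y) has_vector_derivative g (Suc j) s y) (at s) \<Longrightarrow>
    \<forall>j\<le>Suc r. \<forall>s\<in>S. hol r sg B (g j s) \<Longrightarrow>
    \<forall>j. \<exists>B'. \<forall>s\<in>S. hol r sg B' (g j s) \<Longrightarrow>
    \<forall>i x. pdiffable_at i b x \<Longrightarrow> \<forall>i. hol r sg A (\<lambda>x. complex_of_real (pdiff i b x)) \<Longrightarrow>
    hol r sg (Cs * A ^ Suc r * B) (\<lambda>y. g 0 (b y) y)" by (rule hol_substE[of r, where ?'n = 'n]) (rule that; assumption)
  \<comment> \<open>Differentiating in the parameter \<open>s\<close> of the frequency s e adds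
    letters \<open>i0\<close> to the word.\<close>
  define ext where "ext j L = replicate j i0 @ L" for j L
  define CL where "CL L = (\<Sum>j\<le>Suc r. Cq (ext j L))" for L
  have CL: "Cq (ext j L) \<le> CL L" "0 \<le> CL L" if "length L = N" "j \<le> Suc r" for L j
  proof -
    have nn: "0 \<le> Cq (ext j L)" for j using that(1) by (intro Cq(1)) (simp add: ext_def)
    show "Cq (ext j L) \<le> CL L" unfolding CL_def using that(2) nn by (intro member_le_sum) auto
    show "0 \<le> CL L" unfolding CL_def by (intro sum_nonneg nn)
  qed
  \<comment> \<open>\<open>sqrt_peetre\<close> is applied with T = c0 |t| / 2; \<open>kap\<close>
    converts sqrt T into sqrt |t|.\<close>
  define kap where "kap = 1 + 1 / sqrt (c0 / 2)"
  have kap: "kap \<ge> 1" unfolding kap_def using c0 by simp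
  define K where "K = (8 * kap\<^sup>2 / c0) ^ d"
  have K: "0 \<le> K" unfolding K_def using c0 by simp
  have japb: "inverse (jap (s *\<^sub>R e + u) ^ d) \<le> K * (inverse (\<bar>t\<bar> ^ d) * (1 + norm v / sqrt \<bar>t\<bar>) ^ (2 * d))"
    if t: "1 \<le> \<bar>t\<bar>" and s: "c0 / 2 * \<bar>t\<bar> \<le> \<bar>s\<bar>" and u: "norm u \<le> norm v" for s t and u v :: "'n rn"
  proof -
    define T where "T = c0 / 2 * \<bar>t\<bar>"
    define X where "X = 1 + norm v / sqrt \<bar>t\<bar>"
    have T: "0 < T" unfolding T_def using c0 t by simp
    have X: "1 \<le> X" unfolding X_def using t by simp
    have "T \<le> jap (s *\<^sub>R e)" using s jap_ge_norm[of "s *\<^sub>R e"] ne unfolding T_def by simp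
    moreover have "jap (s *\<^sub>R e) \<le> jap (s *\<^sub>R e + u) + norm v" using jap_add_le[of "s *\<^sub>R e" u] u by linarith
    ultimately have "T \<le> 4 * jap (s *\<^sub>R e + u) * (1 + norm v / sqrt T)\<^sup>2"
      by (intro sqrt_peetre[OF T _ _ jap_ge_1]) auto
    also have "\<dots> \<le> 4 * jap (s *\<^sub>R e + u) * (kap * X)\<^sup>2"
    proof (intro mult_left_mono power_mono)
      have "norm v / sqrt T = (norm v / sqrt \<bar>t\<bar>) * (1 / sqrt (c0 / 2))"
        unfolding T_def real_sqrt_mult by simp
      then have e1: "norm v / sqrt T = (X - 1) * (kap - 1)" unfolding X_def kap_def by simp
      have "(X - 1) * (kap - 1) = kap * X - kap - X + 1" by (simp add: algebra_simps)
      then show "1 + norm v / sqrt T \<le> kap * X" unfolding e1 using X kap by linarith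
    qed (use jap_pos[of "s *\<^sub>R e + u"] T in \<open>auto intro!: add_nonneg_nonneg divide_nonneg_nonneg\<close>)
    finally have "c0 * \<bar>t\<bar> \<le> 8 * kap\<^sup>2 * X\<^sup>2 * jap (s *\<^sub>R e + u)"
      unfolding T_def by (simp add: power_mult_distrib mult_ac)
    then have "inverse (jap (s *\<^sub>R e + u)) \<le> (8 * kap\<^sup>2 / c0) * (inverse \<bar>t\<bar> * X\<^sup>2)"
      using jap_pos[of "s *\<^sub>R e + u"] c0 t by (simp add: field_simps)
    then have "inverse (jap (s *\<^sub>R e + u)) ^ d \<le> ((8 * kap\<^sup>2 / c0) * (inverse \<bar>t\<bar> * X\<^sup>2)) ^ d"
      using jap_pos[of "s *\<^sub>R e + u"] by (intro power_mono) auto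
    then show ?thesis unfolding K_def X_def[symmetric] power_mult_distrib[of _ "inverse \<bar>t\<bar> * X\<^sup>2"]
        power_mult_distrib[of "inverse \<bar>t\<bar>"] power_inverse power_mult .
  qed
  have tm: "hol r sg (Cs * (A0 * \<bar>t\<bar>) ^ Suc r * (CL L * (K * (inverse (\<bar>t\<bar> ^ d) * (1 + norm v / sqrt \<bar>t\<bar>) ^ (2 * d)))))
      (\<lambda>y. pds L (\<lambda>\<xi>. q \<xi> y) ((a y * t) *\<^sub>R e + \<theta> *\<^sub>R v))"
    if t: "1 \<le> \<bar>t\<bar>" and th: "0 \<le> \<theta>" "\<theta> \<le> 1" and L: "length L = N" for t \<theta> and v :: "'n rn" and L
  proof -
    \<comment> \<open>An open half line on the side of \<open>t\<close>, at distance c0 |t| / 2 from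
      0. It contains every a(y) t, and being convex it also contains the segments between
      them.\<close>
    define S where "S = (if t > 0 then {c0 / 2 * t<..} else {..<c0 / 2 * t})"
    have Sb: "c0 / 2 * \<bar>t\<bar> \<le> \<bar>s\<bar>" if "s \<in> S" for s
    proof (cases "t > 0")
      case True
      then have "c0 / 2 * t < s" using that unfolding S_def by simp
      then show ?thesis using True by simp
    next
      case False
      then have "s < c0 / 2 * t" "c0 / 2 * t \<le> 0" using that c0 unfolding S_def by (auto simp: mult_le_0_iff)
      then show ?thesis using False by simp
    qed
    have bS: "a y * t \<in> S" for y
    proof (cases "t > 0")
      case True
      have "c0 / 2 < a y" using c0(1) c0(2)[of y] by linarith
      then have "c0 / 2 * t < a y * t" using True by (rule mult_strict_right_mono)
      then show ?thesis unfolding S_def using True by simp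
    next
      case False
      then have "t < 0" using t by auto
      moreover have "c0 / 2 < a y" using c0(1) c0(2)[of y] by linarith
      then have "a y * t < c0 / 2 * t" using \<open>t < 0\<close> by (rule mult_strict_right_mono_neg)
      ultimately show ?thesis unfolding S_def by simp
    qed
    have uv: "norm (\<theta> *\<^sub>R v) \<le> norm v" using th mult_right_mono[OF th(2) norm_ge_zero[of v]] by simp
    define g where "g j s y = pds (ext j L) (\<lambda>\<xi>. q \<xi> y) (s *\<^sub>R e + \<theta> *\<^sub>R v)" for j s y
    have lx: "length (ext j L) = N + j" for j using L by (simp add: ext_def)
    have "hol r sg (Cs * (A0 * \<bar>t\<bar>) ^ Suc r * (CL L * (K * (inverse (\<bar>t\<bar> ^ d) * (1 + norm v / sqrt \<bar>t\<bar>) ^ (2 * d)))))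
      (\<lambda>y. g 0 (a y * t) y)"
    proof (rule Cs(2)[of "A0 * \<bar>t\<bar>" S "\<lambda>y. a y * t" g])
      show "1 \<le> A0 * \<bar>t\<bar>" using mult_mono[OF A0(1) t] A0(1) by simp
      show "open S" "convex S" unfolding S_def by auto
      show "\<forall>x. a x * t \<in> S" using bS by blast
      show "\<forall>j. \<forall>s\<in>S. \<forall>y. ((\<lambda>s. g j s y) has_vector_derivative g (Suc j) s y) (at s)"
      proof (intro allI ballI)
        fix j s y
        have "((\<lambda>s. pds (ext j L) (\<lambda>\<xi>. q \<xi> y) (s *\<^sub>R e + \<theta> *\<^sub>R v)) has_vector_derivative
          (\<Sum>l\<in>UNIV. (e $ l) *\<^sub>R pds (l # ext j L) (\<lambda>\<xi>. q \<xi> y) (s *\<^sub>R e + \<theta> *\<^sub>R v))) (at s)"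
          by (intro pds_curve sm) (auto intro!: derivative_eq_intros)
        moreover have "(\<Sum>l\<in>UNIV. (e $ l) *\<^sub>R pds (l # ext j L) (\<lambda>\<xi>. q \<xi> y) (s *\<^sub>R e + \<theta> *\<^sub>R v)) =
            pds (i0 # ext j L) (\<lambda>\<xi>. q \<xi> y) (s *\<^sub>R e + \<theta> *\<^sub>R v)"
          unfolding e_def axis_def by (simp add: if_distrib[of "\<lambda>c. c *\<^sub>R _"] cong: if_cong)
        ultimately show "((\<lambda>s. g j s y) has_vector_derivative g (Suc j) s y) (at s)"
          unfolding g_def ext_def by simp
      qed
      show "\<forall>j\<le>Suc r. \<forall>s\<in>S. hol r sg (CL L * (K * (inverse (\<bar>t\<bar> ^ d) * (1 + norm v / sqrt \<bar>t\<bar>) ^ (2 * d)))) (g j s)"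
      proof (intro allI impI ballI)
        fix j s assume j: "j \<le> Suc r" and s: "s \<in> S"
        show "hol r sg (CL L * (K * (inverse (\<bar>t\<bar> ^ d) * (1 + norm v / sqrt \<bar>t\<bar>) ^ (2 * d)))) (g j s)"
          unfolding g_def
          using CL[OF L j] jap_pos[of "s *\<^sub>R e + \<theta> *\<^sub>R v"]
          by (intro hol_mono[OF Cq(2)[OF lx]] mult_mono japb[OF t Sb[OF s] uv]) auto
      qed
      show "\<forall>j. \<exists>B'. \<forall>s\<in>S. hol r sg B' (g j s)"
      proof
        fix j
        have "hol r sg (Cq (ext j L)) (g j s)" for s
        proof -
          have "inverse (jap (s *\<^sub>R e + \<theta> *\<^sub>R v) ^ d) \<le> 1"
            using jap_ge_1[of "s *\<^sub>R e + \<theta> *\<^sub>R v"] by (simp add: inverse_le_1_iff one_le_power)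
          from mult_left_mono[OF this Cq(1)[OF lx, of j]] show ?thesis
            unfolding g_def by (intro hol_mono[OF Cq(2)[OF lx]]) simp
        qed
        then show "\<exists>B'. \<forall>s\<in>S. hol r sg B' (g j s)" by blast
      qed
      have bl: "bounded_linear (\<lambda>z :: real. z * t)" by (rule bounded_linear_mult_left)
      show "\<forall>i x. pdiffable_at i (\<lambda>y. a y * t) x" using pdiffable_linear[OF bl a(1)] by blast
      show "\<forall>i. hol r sg (A0 * \<bar>t\<bar>) (\<lambda>x. complex_of_real (pdiff i (\<lambda>y. a y * t) x))"
        using hol_cmult[OF hol_mono[OF a(2) A0(2)], of "complex_of_real t"] pdiff_linear[OF bl a(1)]
        by (simp add: mult.commute)
    qed
    then show ?thesis unfolding g_def ext_def by simp
  qed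
  define SC where "SC = (\<Sum>L | length L = N. Cs * A0 ^ Suc r * (CL L * K))"
  have SC: "0 \<le> SC" unfolding SC_def using Cs(1) A0 CL(2) K by (auto intro!: sum_nonneg mult_nonneg_nonneg)
  have main: "hol r sg (SC * \<bar>t\<bar> ^ Suc r * inverse (\<bar>t\<bar> ^ d) * (1 + norm v / sqrt \<bar>t\<bar>) ^ (2 * d) * norm v ^ N)
      (\<lambda>y. q ((a y * t) *\<^sub>R e + v) y -
        (\<Sum>j<N. (\<Sum>L | length L = j. complex_of_real (monom_list L v) * pds L (\<lambda>\<xi>. q \<xi> y) ((a y * t) *\<^sub>R e)) / fact j))"
    if t: "1 \<le> \<bar>t\<bar>" for t and v :: "'n rn"
  proof -
    define W where "W = \<bar>t\<bar> ^ Suc r * (inverse (\<bar>t\<bar> ^ d) * (1 + norm v / sqrt \<bar>t\<bar>) ^ (2 * d))"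
    have W: "0 \<le> W" unfolding W_def by simp
    let ?B = "\<lambda>L. Cs * (A0 * \<bar>t\<bar>) ^ Suc r * (CL L * (K * (inverse (\<bar>t\<bar> ^ d) * (1 + norm v / sqrt \<bar>t\<bar>) ^ (2 * d))))"
    have "hol r sg (norm v ^ N * (\<Sum>L | length L = N. ?B L)) (\<lambda>y. q ((a y * t) *\<^sub>R e + v) y -
        (\<Sum>j<N. (\<Sum>L | length L = j. complex_of_real (monom_list L v) * pds L (\<lambda>\<xi>. q \<xi> y) ((a y * t) *\<^sub>R e)) / fact j))"
      by (rule hol_taylor_lists[where f = "\<lambda>y \<xi>. q \<xi> y" and b = "\<lambda>y. (a y * t) *\<^sub>R e", OF N(2) sm tm[OF t]])
    moreover have "?B L = Cs * A0 ^ Suc r * (CL L * K) * W" for L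
      unfolding W_def power_mult_distrib by (simp only: mult_ac)
    then have "norm v ^ N * (\<Sum>L | length L = N. ?B L) = SC * W * norm v ^ N"
      unfolding SC_def by (simp only: sum_distrib_right[symmetric] mult.commute[of "norm v ^ N"])
    ultimately have "hol r sg (SC * W * norm v ^ N) (\<lambda>y. q ((a y * t) *\<^sub>R e + v) y -
        (\<Sum>j<N. (\<Sum>L | length L = j. complex_of_real (monom_list L v) * pds L (\<lambda>\<xi>. q \<xi> y) ((a y * t) *\<^sub>R e)) / fact j))"
      by (simp only:)
    then show ?thesis unfolding W_def by (simp add: mult.assoc)
  qed
  show ?thesis using SC main unfolding d_def e_def by blast
qed

text \<open>Taylor expansion about the frequency a(y) t with increment sqrt |t| \<omega>: the terms
  of order \<open>j\<close> carry sqrt |t| to the power \<open>j\<close> and are evaluated by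
  \<open>rapid_inversion\<close>. In the remainder the derivatives of order \<open>N\<close> gain
  |t|^(-(N - m)) and the increment pays |t|^(N/2), so large \<open>N\<close> gives arbitrary
  decay.\<close>

lemma fourier_expansion:
  fixes q :: "'n::finite rn \<Rightarrow> 'n rn \<Rightarrow> complex" and a :: "'n rn \<Rightarrow> real"
  assumes q: "symbol_family m q" and N: "int N \<ge> m" "N > 0"
    and c0: "c0 > 0" "\<And>y. c0 \<le> a y"
    and a: "\<And>i x. pdiffable_at i a x" "\<And>i. hol r sg A (\<lambda>x. complex_of_real (pdiff i a x))"
    and F: "rapid F"
  shows "\<exists>C\<ge>0. \<forall>t. 1 \<le> \<bar>t\<bar> \<longrightarrow>
    hol r sg (C * \<bar>t\<bar> ^ Suc r * inverse (\<bar>t\<bar> ^ nat (int N - m)) * sqrt \<bar>t\<bar> ^ N)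
      (\<lambda>y. (\<integral>\<omega>. q ((a y * t) *\<^sub>R axis i0 1 + sqrt \<bar>t\<bar> *\<^sub>R \<omega>) y * fourier (\<lambda>w. F t w y) \<omega> \<partial>lborel) -
        (2 * pi) ^ CARD('n) * (\<Sum>j<N. (\<Sum>L | length L = j. complex_of_real (sqrt \<bar>t\<bar> ^ j) * (- \<i>) ^ j *
          pds L (\<lambda>\<xi>. q \<xi> y) ((a y * t) *\<^sub>R axis i0 1) * pds L (\<lambda>w. F t w y) 0) / fact j))"
proof -
  define d where "d = nat (int N - m)"
  define e where "e = (axis i0 1 :: 'n rn)"
  define n2 where "n2 = 2 * CARD('n)"
  \<comment> \<open>The powers 2 d + N absorb the growth of the Taylor remainder in \<omega>; the
    remaining \<open>n2\<close> make the result integrable.\<close>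
  define k where "k = 2 * d + N + n2"
  obtain C where C: "0 \<le> C" "\<And>t v. 1 \<le> \<bar>t\<bar> \<Longrightarrow>
    hol r sg (C * \<bar>t\<bar> ^ Suc r * inverse (\<bar>t\<bar> ^ d) * (1 + norm v / sqrt \<bar>t\<bar>) ^ (2 * d) * norm v ^ N)
      (\<lambda>y. q ((a y * t) *\<^sub>R e + v) y -
        (\<Sum>j<N. (\<Sum>L | length L = j. complex_of_real (monom_list L v) * pds L (\<lambda>\<xi>. q \<xi> y) ((a y * t) *\<^sub>R e)) / fact j))"
    using symbol_taylor[OF q N c0 a] unfolding d_def e_def by blast
  obtain D where D: "0 \<le> D" "\<And>t \<omega>. 1 \<le> \<bar>t\<bar> \<Longrightarrow> hol r sg (D * inverse ((1 + norm \<omega>) ^ k)) (\<lambda>y. fourier (\<lambda>w. F t w y) \<omega>)"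
    using fourier_rapid_decay[OF F] by blast
  obtain M where M: "M > 0" "\<And>A B f g. hol r sg A f \<Longrightarrow> hol r sg B g \<Longrightarrow>
    hol r sg (M * (A * B)) (\<lambda>x :: 'n rn. f x * g x)" using hol_mult[of r] by blast
  define I where "I = (\<integral>\<omega>. inverse ((1 + norm \<omega>) ^ n2) \<partial>(lborel :: 'n rn measure))"
  have int: "integrable lborel (\<lambda>\<omega> :: 'n rn. inverse ((1 + norm \<omega>) ^ n2))"
    unfolding n2_def by (intro integrable_inverse_power_norm) simp
  have I: "0 \<le> I" unfolding I_def by (intro integral_nonneg_AE) auto
  have sm: "smooth (\<lambda>\<xi>. q \<xi> y)" for y using q unfolding symbol_family_def by blast
  have main: "hol r sg (M * C * D * I * \<bar>t\<bar> ^ Suc r * inverse (\<bar>t\<bar> ^ d) * sqrt \<bar>t\<bar> ^ N)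
      (\<lambda>y. (\<integral>\<omega>. q ((a y * t) *\<^sub>R e + sqrt \<bar>t\<bar> *\<^sub>R \<omega>) y * fourier (\<lambda>w. F t w y) \<omega> \<partial>lborel) -
        (2 * pi) ^ CARD('n) * (\<Sum>j<N. (\<Sum>L | length L = j. complex_of_real (sqrt \<bar>t\<bar> ^ j) * (- \<i>) ^ j *
          pds L (\<lambda>\<xi>. q \<xi> y) ((a y * t) *\<^sub>R e) * pds L (\<lambda>w. F t w y) 0) / fact j))"
    if t: "1 \<le> \<bar>t\<bar>" for t
  proof -
    define st where "st = sqrt \<bar>t\<bar>"
    have st: "st > 0" unfolding st_def using t by simp
    define W where "W = M * C * D * \<bar>t\<bar> ^ Suc r * inverse (\<bar>t\<bar> ^ d) * st ^ N"
    have W: "0 \<le> W" unfolding W_def using M C D st by (auto intro!: mult_nonneg_nonneg)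
    define T where "T y \<omega> = (\<Sum>j<N. (\<Sum>L | length L = j. complex_of_real (monom_list L (st *\<^sub>R \<omega>)) *
       pds L (\<lambda>\<xi>. q \<xi> y) ((a y * t) *\<^sub>R e)) / fact j)" for y and \<omega> :: "'n rn"
    define R where "R \<omega> y = (q ((a y * t) *\<^sub>R e + st *\<^sub>R \<omega>) y - T y \<omega>) * fourier (\<lambda>w. F t w y) \<omega>" for \<omega> y
    have Rh: "hol r sg (W * inverse ((1 + norm \<omega>) ^ n2)) (R \<omega>)" for \<omega>
    proof (rule hol_mono)
      let ?x = "1 + norm \<omega>"
      have x: "0 < ?x" by (simp add: add_pos_nonneg)
      have nv: "norm (st *\<^sub>R \<omega>) / sqrt \<bar>t\<bar> = norm \<omega>" using st unfolding st_def[symmetric] by simp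
      show "hol r sg (M * ((C * \<bar>t\<bar> ^ Suc r * inverse (\<bar>t\<bar> ^ d) * (1 + norm (st *\<^sub>R \<omega>) / sqrt \<bar>t\<bar>) ^ (2 * d) * norm (st *\<^sub>R \<omega>) ^ N)
          * (D * inverse (?x ^ k)))) (R \<omega>)"
        unfolding R_def T_def by (intro M(2) C(2) D(2) t)
      have "norm (st *\<^sub>R \<omega>) ^ N \<le> st ^ N * ?x ^ N"
        unfolding power_mult_distrib[symmetric] using st by (intro power_mono) (auto intro!: mult_left_mono)
      then have "(C * \<bar>t\<bar> ^ Suc r * inverse (\<bar>t\<bar> ^ d) * ?x ^ (2 * d)) * norm (st *\<^sub>R \<omega>) ^ N \<le>
         (C * \<bar>t\<bar> ^ Suc r * inverse (\<bar>t\<bar> ^ d) * ?x ^ (2 * d)) * (st ^ N * ?x ^ N)"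
        using C(1) x by (intro mult_left_mono) auto
      moreover have "0 \<le> D * inverse (?x ^ k)" using D(1) x by simp
      ultimately have "C * \<bar>t\<bar> ^ Suc r * inverse (\<bar>t\<bar> ^ d) * ?x ^ (2 * d) * norm (st *\<^sub>R \<omega>) ^ N * (D * inverse (?x ^ k))
        \<le> C * \<bar>t\<bar> ^ Suc r * inverse (\<bar>t\<bar> ^ d) * ?x ^ (2 * d) * (st ^ N * ?x ^ N) * (D * inverse (?x ^ k))"
        by (rule mult_right_mono)
      then have "M * (C * \<bar>t\<bar> ^ Suc r * inverse (\<bar>t\<bar> ^ d) * ?x ^ (2 * d) * norm (st *\<^sub>R \<omega>) ^ N * (D * inverse (?x ^ k)))
        \<le> M * (C * \<bar>t\<bar> ^ Suc r * inverse (\<bar>t\<bar> ^ d) * ?x ^ (2 * d) * (st ^ N * ?x ^ N) * (D * inverse (?x ^ k)))"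
        by (rule mult_left_mono[OF _ less_imp_le[OF M(1)]])
      also have "\<dots> = W * (?x ^ (2 * d + N) * inverse (?x ^ k))"
        unfolding W_def power_add by (simp only: mult_ac)
      also have "?x ^ (2 * d + N) * inverse (?x ^ k) = inverse (?x ^ n2)"
        unfolding k_def power_add[of _ "2 * d + N"] using x by simp
      finally show "M * ((C * \<bar>t\<bar> ^ Suc r * inverse (\<bar>t\<bar> ^ d) * (1 + norm (st *\<^sub>R \<omega>) / sqrt \<bar>t\<bar>) ^ (2 * d) * norm (st *\<^sub>R \<omega>) ^ N)
          * (D * inverse (?x ^ k))) \<le> W * inverse (?x ^ n2)" unfolding nv .
    qed
    have Fm[measurable]: "fourier (\<lambda>w. F t w y) \<in> borel_measurable borel" for y
      by (rule fourier_measurable[OF rapidD(2)[OF F t]])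
    have qc: "continuous_on UNIV (\<lambda>\<omega>. q ((a y * t) *\<^sub>R e + st *\<^sub>R \<omega>) y)" for y
      by (rule continuous_on_compose2[OF pd1_continuous[OF smooth_pd1[OF sm]]]) (auto intro!: continuous_intros)
    have Tc: "continuous_on UNIV (T y)" for y
      unfolding T_def monom_list_scaleR by (intro continuous_intros continuous_on_monom_list) auto
    have [measurable]: "(\<lambda>\<omega>. q ((a y * t) *\<^sub>R e + st *\<^sub>R \<omega>) y) \<in> borel_measurable borel" "T y \<in> borel_measurable borel" for y
      by (intro borel_measurable_continuous_onI qc Tc)+
    have Rm: "(\<lambda>\<omega>. R \<omega> y) \<in> borel_measurable borel" for y unfolding R_def by measurable
    have "hol r sg (\<integral>\<omega>. W * inverse ((1 + norm \<omega>) ^ n2) \<partial>(lborel :: 'n rn measure)) (\<lambda>y. \<integral>\<omega>. R \<omega> y \<partial>lborel)"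
      by (rule hol_integral[OF _ Rh]) (use int Rm in auto)
    then have h: "hol r sg (W * I) (\<lambda>y. \<integral>\<omega>. R \<omega> y \<partial>lborel)" unfolding I_def by simp
    have Rint: "integrable lborel (\<lambda>\<omega>. R \<omega> y)" for y
      by (rule integrable_of_decay[OF Rm hol_bound[OF Rh]]) (simp add: n2_def)
    define TL where "TL y L \<omega> = (complex_of_real (st ^ length L) * pds L (\<lambda>\<xi>. q \<xi> y) ((a y * t) *\<^sub>R e) / fact (length L)) *
       (complex_of_real (monom_list L \<omega>) * fourier (\<lambda>w. F t w y) \<omega>)" for y L \<omega>
    have TF: "T y \<omega> * fourier (\<lambda>w. F t w y) \<omega> = (\<Sum>j<N. \<Sum>L | length L = j. TL y L \<omega>)" for y \<omega>
      unfolding T_def TL_def monom_list_scaleR sum_distrib_right sum_divide_distrib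
      by (intro sum.cong refl) (auto simp: mult_ac)
    have TLint: "integrable lborel (TL y L)" for y L
      unfolding TL_def by (intro integrable_mult_right rapid_inversion(1) F t)
    have TFint: "integrable lborel (\<lambda>\<omega>. T y \<omega> * fourier (\<lambda>w. F t w y) \<omega>)" for y
      unfolding TF by (intro Bochner_Integration.integrable_sum TLint)
    have "(\<integral>\<omega>. T y \<omega> * fourier (\<lambda>w. F t w y) \<omega> \<partial>lborel) = (\<Sum>j<N. \<Sum>L | length L = j. \<integral>\<omega>. TL y L \<omega> \<partial>lborel)" for y
      unfolding TF by (simp add: TLint)
    moreover have "(\<integral>\<omega>. TL y L \<omega> \<partial>lborel) = (2 * pi) ^ CARD('n) * (complex_of_real (st ^ length L) * (- \<i>) ^ length L *
          pds L (\<lambda>\<xi>. q \<xi> y) ((a y * t) *\<^sub>R e) * pds L (\<lambda>w. F t w y) 0 / fact (length L))" for y L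
      unfolding TL_def integral_mult_right_zero rapid_inversion(2)[OF F t] by (simp add: mult_ac)
    ultimately have TI: "(\<integral>\<omega>. T y \<omega> * fourier (\<lambda>w. F t w y) \<omega> \<partial>lborel) = (2 * pi) ^ CARD('n) * (\<Sum>j<N. (\<Sum>L | length L = j.
        complex_of_real (st ^ j) * (- \<i>) ^ j * pds L (\<lambda>\<xi>. q \<xi> y) ((a y * t) *\<^sub>R e) * pds L (\<lambda>w. F t w y) 0) / fact j)" for y
      by (simp add: sum_distrib_left sum_divide_distrib)
    have "(\<integral>\<omega>. R \<omega> y \<partial>lborel) = (\<integral>\<omega>. q ((a y * t) *\<^sub>R e + st *\<^sub>R \<omega>) y * fourier (\<lambda>w. F t w y) \<omega> \<partial>lborel) -
      (\<integral>\<omega>. T y \<omega> * fourier (\<lambda>w. F t w y) \<omega> \<partial>lborel)" for y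
    proof -
      have "q ((a y * t) *\<^sub>R e + st *\<^sub>R \<omega>) y * fourier (\<lambda>w. F t w y) \<omega> = R \<omega> y + T y \<omega> * fourier (\<lambda>w. F t w y) \<omega>" for \<omega>
        unfolding R_def by (simp add: algebra_simps)
      then show ?thesis using Rint TFint by simp
    qed
    then show ?thesis using h unfolding TI W_def st_def by (simp add: mult_ac)
  qed
  have "0 \<le> M * C * D * I" using M C D I by simp
  then show ?thesis using main unfolding d_def e_def by blast
qed

end

section \<open>Two-sided asymptotic expansions\<close>

lemma has_vector_derivative_powi:
  assumes "s \<noteq> 0"
  shows "((\<lambda>s. complex_of_real s powi k) has_vector_derivative of_int k * complex_of_real s powi (k - 1)) (at s)"
proof -
  have "((\<lambda>z :: complex. z powi k) has_field_derivative of_int k * complex_of_real s powi (k - 1)) (at (of_real s))"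
    using assms by (auto intro!: derivative_eq_intros)
  from field_vector_diff_chain_at[where f = of_real and f' = 1 and x = s, OF _ this] show ?thesis
    using bounded_linear.has_vector_derivative[OF bounded_linear_of_real has_vector_derivative_id, of "at s"]
    by (simp add: o_def)
qed

lemma nonneg_of_mult_pos: "0 \<le> a * b \<Longrightarrow> 0 < b \<Longrightarrow> 0 \<le> (a :: real)"
  by (simp add: zero_le_mult_iff)

text \<open>The falling factorial k (k - 1) ... (k - j + 1), produced by differentiating an integer
  power, possibly of negative exponent, \<open>j\<close> times.\<close>

primrec ffact :: "int \<Rightarrow> nat \<Rightarrow> complex" where
  "ffact k 0 = 1"
| "ffact k (Suc j) = ffact k j * of_int (k - int j)"

lemma has_vector_derivative_ffact:
  assumes "s \<noteq> 0"
  shows "((\<lambda>s. ffact k j * complex_of_real s powi (k - int j)) has_vector_derivative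
    ffact k (Suc j) * complex_of_real s powi (k - int (Suc j))) (at s)"
  using has_vector_derivative_mult_right[OF has_vector_derivative_powi[OF assms, of "k - int j"], of "ffact k j"]
  by (simp add: algebra_simps)

lemma norm_powi_le:
  assumes "0 < \<epsilon>" "\<epsilon> \<le> \<bar>s\<bar>" "k \<le> int M"
  shows "cmod (complex_of_real s powi k) \<le> inverse (min 1 \<epsilon> ^ nat (- k)) * (1 + \<bar>s\<bar>) ^ M"
proof -
  have s: "0 < \<bar>s\<bar>" using assms by linarith
  have n: "cmod (complex_of_real s powi k) = \<bar>s\<bar> powi k" by (simp add: norm_power_int)
  have I: "1 \<le> inverse (min 1 \<epsilon> ^ nat (- k))"
    using assms by (intro one_le_inverse) (auto intro: power_le_one zero_less_power)
  show ?thesis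
  proof (cases "k \<ge> 0")
    case True
    then have "\<bar>s\<bar> powi k = \<bar>s\<bar> ^ nat k" by (simp add: power_int_def)
    also have "\<dots> \<le> (1 + \<bar>s\<bar>) ^ nat k" by (intro power_mono) auto
    also have "\<dots> \<le> (1 + \<bar>s\<bar>) ^ M" using assms(3) True by (intro power_increasing) auto
    also have "\<dots> \<le> inverse (min 1 \<epsilon> ^ nat (- k)) * (1 + \<bar>s\<bar>) ^ M"
      using mult_right_mono[OF I, of "(1 + \<bar>s\<bar>) ^ M"] by simp
    finally show ?thesis unfolding n .
  next
    case False
    then have "\<bar>s\<bar> powi k = inverse (\<bar>s\<bar> ^ nat (- k))" by (simp add: power_int_def power_inverse)
    also have "\<dots> \<le> inverse (min 1 \<epsilon> ^ nat (- k))"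
      using assms by (intro le_imp_inverse_le power_mono zero_less_power) auto
    also have "\<dots> * 1 \<le> \<dots> * (1 + \<bar>s\<bar>) ^ M"
      using order_trans[OF zero_le_one I] by (intro mult_left_mono one_le_power) auto
    finally show ?thesis unfolding n by simp
  qed
qed

context holder_class
begin

definition hol_bdd :: "('n::finite rn \<Rightarrow> complex) \<Rightarrow> bool" where
  "hol_bdd f \<longleftrightarrow> (\<exists>B. hol r sg B f)"

lemma hol_bdd_const: "hol_bdd (\<lambda>y. c)"
  unfolding hol_bdd_def using hol_const by blast

lemma hol_bdd_add: "hol_bdd f \<Longrightarrow> hol_bdd g \<Longrightarrow> hol_bdd (\<lambda>y. f y + g y)"
  unfolding hol_bdd_def using hol_add by blast

lemma hol_bdd_mult: "hol_bdd f \<Longrightarrow> hol_bdd g \<Longrightarrow> hol_bdd (\<lambda>y. f y * g y)"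
  unfolding hol_bdd_def using hol_mult[of r] by blast

lemma hol_bdd_sum: "(\<And>i. i \<in> S \<Longrightarrow> hol_bdd (f i)) \<Longrightarrow> hol_bdd (\<lambda>y. \<Sum>i\<in>S. f i y)"
proof (induction S rule: infinite_finite_induct)
  case (insert x F) then show ?case by (auto intro: hol_bdd_add)
qed (auto intro: hol_bdd_const)

text \<open>A single expansion serves both signs of \<open>t\<close>; this is where the transmission condition differs
  from the existence of expansions on two half lines.\<close>

definition ray_expansion :: "nat \<Rightarrow> (real \<Rightarrow> 'n::finite rn \<Rightarrow> complex) \<Rightarrow> bool" where
  "ray_expansion l f \<longleftrightarrow> (\<exists>S c C. finite S \<and> (\<forall>k. hol_bdd (c k)) \<and> (\<forall>t. 1 \<le> \<bar>t\<bar> \<longrightarrow>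
    hol r sg (C * inverse (\<bar>t\<bar> ^ l)) (\<lambda>y. f t y - (\<Sum>k\<in>S. c k y * complex_of_real t powi k))))"

lemma ray_expansionI:
  assumes "finite S" "\<And>k. hol_bdd (c k)" "\<And>t. 1 \<le> \<bar>t\<bar> \<Longrightarrow>
    hol r sg (C * inverse (\<bar>t\<bar> ^ l)) (\<lambda>y. f t y - (\<Sum>k\<in>S. c k y * complex_of_real t powi k))"
  shows "ray_expansion l f"
  unfolding ray_expansion_def using assms by (intro exI[of _ S] exI[of _ c] exI[of _ C]) simp

lemma ray_expansion_small:
  assumes "\<And>t. 1 \<le> \<bar>t\<bar> \<Longrightarrow> hol r sg (C * inverse (\<bar>t\<bar> ^ l)) (f t)"
  shows "ray_expansion l f"
  unfolding ray_expansion_def by (intro exI[of _ "{}"] exI[of _ "\<lambda>_ _. 0"] exI[of _ C]) (use assms hol_bdd_const in auto)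

lemma ray_expansion_add:
  assumes "ray_expansion l f" "ray_expansion l g"
  shows "ray_expansion l (\<lambda>t y. f t y + g t y)"
proof -
  obtain S c C where f: "finite S" "\<And>k. hol_bdd (c k)"
    "\<And>t. 1 \<le> \<bar>t\<bar> \<Longrightarrow> hol r sg (C * inverse (\<bar>t\<bar> ^ l)) (\<lambda>y. f t y - (\<Sum>k\<in>S. c k y * complex_of_real t powi k))"
    using assms(1) unfolding ray_expansion_def by blast
  obtain S' c' C' where g: "finite S'" "\<And>k. hol_bdd (c' k)"
    "\<And>t. 1 \<le> \<bar>t\<bar> \<Longrightarrow> hol r sg (C' * inverse (\<bar>t\<bar> ^ l)) (\<lambda>y. g t y - (\<Sum>k\<in>S'. c' k y * complex_of_real t powi k))"
    using assms(2) unfolding ray_expansion_def by blast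
  define d where "d k y = (if k \<in> S then c k y else 0) + (if k \<in> S' then c' k y else 0)" for k y
  have "hol_bdd (\<lambda>y. if k \<in> S then c k y else 0)" for k
    using f(2)[of k] hol_bdd_const[of 0] by (cases "k \<in> S") simp_all
  moreover have "hol_bdd (\<lambda>y. if k \<in> S' then c' k y else 0)" for k
    using g(2)[of k] hol_bdd_const[of 0] by (cases "k \<in> S'") simp_all
  ultimately have d: "hol_bdd (d k)" for k unfolding d_def by (rule hol_bdd_add)
  have eq: "(\<Sum>k\<in>S \<union> S'. d k y * complex_of_real t powi k) =
    (\<Sum>k\<in>S. c k y * complex_of_real t powi k) + (\<Sum>k\<in>S'. c' k y * complex_of_real t powi k)" for y t
  proof -
    have "(\<Sum>k\<in>S. c k y * complex_of_real t powi k) = (\<Sum>k\<in>S \<union> S'. (if k \<in> S then c k y else 0) * complex_of_real t powi k)"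
      using f(1) g(1) by (intro sum.mono_neutral_cong_left) auto
    moreover have "(\<Sum>k\<in>S'. c' k y * complex_of_real t powi k) = (\<Sum>k\<in>S \<union> S'. (if k \<in> S' then c' k y else 0) * complex_of_real t powi k)"
      using f(1) g(1) by (intro sum.mono_neutral_cong_left) auto
    ultimately show ?thesis unfolding d_def by (simp add: sum.distrib distrib_right)
  qed
  have "hol r sg ((C + C') * inverse (\<bar>t\<bar> ^ l)) (\<lambda>y. f t y + g t y - (\<Sum>k\<in>S \<union> S'. d k y * complex_of_real t powi k))"
    if "1 \<le> \<bar>t\<bar>" for t
    using hol_add[OF f(3)[OF that] g(3)[OF that]] unfolding eq by (simp add: algebra_simps)
  then show ?thesis using f(1) g(1) d by (intro ray_expansionI[of "S \<union> S'" d]) auto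
qed

lemma ray_expansion_zero: "ray_expansion l (\<lambda>t y. 0)"
  using ray_expansion_small[where C = 0 and f = "\<lambda>t y. 0"] hol_const[of r sg 0] by simp

lemma ray_expansion_sum: "(\<And>i. i \<in> A \<Longrightarrow> ray_expansion l (f i)) \<Longrightarrow> ray_expansion l (\<lambda>t y. \<Sum>i\<in>A. f i t y)"
proof (induction A rule: infinite_finite_induct)
  case (insert i A) then show ?case by (auto intro: ray_expansion_add)
qed (auto intro: ray_expansion_zero)

text \<open>Multiplication by t^i shifts the exponents and spoils the remainder by |t|^i; hence
  \<open>f\<close> has to be expanded to order l + i.\<close>

lemma ray_expansion_mult_power:
  assumes "ray_expansion (l + i) f" "hol_bdd g"
  shows "ray_expansion l (\<lambda>t y. complex_of_real t ^ i * g y * f t y)"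
proof -
  obtain S c C where f: "finite S" "\<And>k. hol_bdd (c k)"
    "\<And>t. 1 \<le> \<bar>t\<bar> \<Longrightarrow> hol r sg (C * inverse (\<bar>t\<bar> ^ (l + i))) (\<lambda>y. f t y - (\<Sum>k\<in>S. c k y * complex_of_real t powi k))"
    using assms(1) unfolding ray_expansion_def by blast
  obtain B where B: "hol r sg B g" using assms(2) unfolding hol_bdd_def by blast
  obtain M where M: "M > 0" "\<And>A B f g. hol r sg A f \<Longrightarrow> hol r sg B g \<Longrightarrow>
    hol r sg (M * (A * B)) (\<lambda>x :: 'a rn. f x * g x)" using hol_mult[of r] by blast
  define d where "d k y = g y * c (k - int i) y" for k y
  have "hol r sg (M * B * C * inverse (\<bar>t\<bar> ^ l)) (\<lambda>y. complex_of_real t ^ i * g y * f t y -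
      (\<Sum>k\<in>(\<lambda>k. k + int i) ` S. d k y * complex_of_real t powi k))" if t: "1 \<le> \<bar>t\<bar>" for t
  proof -
    have t0: "t \<noteq> 0" using t by auto
    have eq: "(\<Sum>k\<in>(\<lambda>k. k + int i) ` S. d k y * complex_of_real t powi k) =
      complex_of_real t ^ i * (g y * (\<Sum>k\<in>S. c k y * complex_of_real t powi k))" for y
      using t0 by (subst sum.reindex) (auto simp: inj_on_def d_def sum_distrib_left power_int_add mult_ac)
    have "hol r sg (cmod (complex_of_real t ^ i) * (M * (B * (C * inverse (\<bar>t\<bar> ^ (l + i))))))
      (\<lambda>y. complex_of_real t ^ i * (g y * (f t y - (\<Sum>k\<in>S. c k y * complex_of_real t powi k))))"
      by (intro hol_cmult M(2) B f(3) t)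
    moreover have "cmod (complex_of_real t ^ i) * (M * (B * (C * inverse (\<bar>t\<bar> ^ (l + i))))) = M * B * C * inverse (\<bar>t\<bar> ^ l)"
      using t0 by (simp add: norm_power power_add field_simps)
    moreover have "(\<lambda>y. complex_of_real t ^ i * g y * f t y - complex_of_real t ^ i * (g y * (\<Sum>k\<in>S. c k y * complex_of_real t powi k)))
      = (\<lambda>y. complex_of_real t ^ i * (g y * (f t y - (\<Sum>k\<in>S. c k y * complex_of_real t powi k))))"
      by (simp add: fun_eq_iff right_diff_distrib)
    ultimately show ?thesis unfolding eq by simp
  qed
  moreover have "hol_bdd (d k)" for k unfolding d_def by (intro hol_bdd_mult assms f(2))
  ultimately show ?thesis using f(1) by (intro ray_expansionI[of "(\<lambda>k. k + int i) ` S" d]) auto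
qed

text \<open>By Landau's inequality each derivative costs a square root of the decay.\<close>

lemma hol_derivative_decay:
  fixes g :: "nat \<Rightarrow> real \<Rightarrow> 'n::finite rn \<Rightarrow> complex"
  assumes eps: "0 < \<epsilon>"
    and der: "\<And>j s y. \<epsilon> \<le> \<bar>s\<bar> \<Longrightarrow> ((\<lambda>s. g j s y) has_vector_derivative g (Suc j) s y) (at s)"
    and crude: "\<And>j. \<exists>C. \<forall>s. \<epsilon> \<le> \<bar>s\<bar> \<longrightarrow> hol r sg (C * (1 + \<bar>s\<bar>) ^ M) (g j s)"
    and small: "\<And>s. \<epsilon> \<le> \<bar>s\<bar> \<Longrightarrow> hol r sg (C0 * inverse ((1 + \<bar>s\<bar>) ^ l)) (g 0 s)"
    and l: "l = 2 ^ j * (P + M)"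
  shows "\<exists>C. \<forall>s. \<epsilon> \<le> \<bar>s\<bar> \<longrightarrow> hol r sg (C * inverse ((1 + \<bar>s\<bar>) ^ P)) (g j s)"
  using l
proof (induction j arbitrary: P)
  case 0
  have "hol r sg (C0 * inverse ((1 + \<bar>s\<bar>) ^ P)) (g 0 s)" if "\<epsilon> \<le> \<bar>s\<bar>" for s
  proof (rule hol_mono[OF small[OF that]])
    have "0 \<le> C0" by (rule nonneg_of_mult_pos[OF hol_nonneg[OF small[OF that]]]) (simp add: zero_less_power)
    moreover have "(1 + \<bar>s\<bar>) ^ P \<le> (1 + \<bar>s\<bar>) ^ l" using 0 by (intro power_increasing) auto
    ultimately show "C0 * inverse ((1 + \<bar>s\<bar>) ^ l) \<le> C0 * inverse ((1 + \<bar>s\<bar>) ^ P)"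
      by (intro mult_left_mono le_imp_inverse_le) auto
  qed
  then show ?case by blast
next
  case (Suc j)
  \<comment> \<open>The induction hypothesis is used with 2 P + M in place of \<open>P\<close>,
    since (2 P + M) + M = 2 (P + M).\<close>
  obtain C where C: "\<And>s. \<epsilon> \<le> \<bar>s\<bar> \<Longrightarrow> hol r sg (C * inverse ((1 + \<bar>s\<bar>) ^ (2 * P + M))) (g j s)"
    using Suc.IH[of "2 * P + M"] Suc.prems by (auto simp: algebra_simps)
  obtain D where D: "\<And>s. \<epsilon> \<le> \<bar>s\<bar> \<Longrightarrow> hol r sg (D * (1 + \<bar>s\<bar>) ^ M) (g (Suc (Suc j)) s)"
    using crude by blast
  have nn: "0 \<le> C" "0 \<le> D"
    using nonneg_of_mult_pos[OF hol_nonneg[OF C[of \<epsilon>]]] nonneg_of_mult_pos[OF hol_nonneg[OF D[of \<epsilon>]]] eps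
    by (auto simp: zero_less_power)
  have "hol r sg ((2 * C + 2 ^ M * D) * inverse ((1 + \<bar>s\<bar>) ^ P)) (g (Suc j) s)" if s: "\<epsilon> \<le> \<bar>s\<bar>" for s
  proof -
    let ?x = "1 + \<bar>s\<bar>"
    \<comment> \<open>The step length balances both errors: decay of order 2 P + M divided by |h|
      leaves order \<open>P\<close>, and |h| times growth of order \<open>M\<close> is again of
      order \<open>P\<close>. The sign moves away from 0, which keeps the segment inside |s| \<ge>
      \<epsilon>.\<close>
    define h where "h = sgn s * inverse (?x ^ (P + M))"
    have x: "?x \<ge> 1" by simp
    have i1: "inverse (?x ^ (P + M)) \<le> 1" using one_le_power[OF x, of "P + M"] by (simp add: inverse_le_1_iff)
    have s0: "s \<noteq> 0" using s eps by auto
    have ah: "\<bar>h\<bar> = inverse (?x ^ (P + M))" unfolding h_def using s0 by (simp add: abs_mult abs_sgn_eq)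
    have h0: "h \<noteq> 0" using ah x by auto
    define S where "S = (if s > 0 then {s..s + h} else {s + h..s})"
    have hs: "h > 0 \<longleftrightarrow> s > 0" "h < 0 \<longleftrightarrow> s < 0" unfolding h_def using s0 x by (auto simp: sgn_real_def)
    have S: "convex S" "s \<in> S" "s + h \<in> S" unfolding S_def using hs s0 by auto
    have Sb: "\<epsilon> \<le> \<bar>u\<bar> \<and> \<bar>u\<bar> \<le> \<bar>s\<bar> + \<bar>h\<bar>" if "u \<in> S" for u
      using that s hs s0 unfolding S_def by (auto split: if_splits)
    have "hol r sg (h\<^sup>2 * (D * (2 * ?x) ^ M)) (\<lambda>y. g j (s + h) y - g j s y - h *\<^sub>R g (Suc j) s y)"
      using hol_taylor2[OF S, of "\<lambda>i. g (i + j)" r "D * (2 * ?x) ^ M"]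
    proof -
      assume *: "(\<And>i u y. u \<in> S \<Longrightarrow> ((\<lambda>s. g (i + j) s y) has_vector_derivative g (Suc i + j) u y) (at u)) \<Longrightarrow>
        (\<And>u. u \<in> S \<Longrightarrow> hol r sg (D * (2 * ?x) ^ M) (g (2 + j) u)) \<Longrightarrow>
        hol r sg (h\<^sup>2 * (D * (2 * ?x) ^ M)) (\<lambda>y. g (0 + j) (s + h) y - g (0 + j) s y - h *\<^sub>R g (1 + j) s y)"
      have "hol r sg (D * (2 * ?x) ^ M) (g (2 + j) u)" if "u \<in> S" for u
      proof -
        have "D * (1 + \<bar>u\<bar>) ^ M \<le> D * (2 * ?x) ^ M"
          using Sb[OF that] ah i1 nn by (intro mult_left_mono power_mono) auto
        then show ?thesis using hol_mono[OF D] Sb[OF that] by simp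
      qed
      then show ?thesis using * der Sb by simp
    qed
    then have "hol r sg (cmod (complex_of_real (inverse h)) * ((C * inverse (?x ^ (2 * P + M)) + C * inverse (?x ^ (2 * P + M))) + h\<^sup>2 * (D * (2 * ?x) ^ M)))
       (\<lambda>y. complex_of_real (inverse h) * ((g j (s + h) y - g j s y) - (g j (s + h) y - g j s y - h *\<^sub>R g (Suc j) s y)))"
    proof (intro hol_cmult hol_diff)
      have "\<epsilon> \<le> \<bar>s + h\<bar>" using Sb[OF S(3)] by simp
      moreover have "\<bar>s\<bar> \<le> \<bar>s + h\<bar>" using hs s0 by auto
      then have "inverse ((1 + \<bar>s + h\<bar>) ^ (2 * P + M)) \<le> inverse (?x ^ (2 * P + M))"
        by (intro le_imp_inverse_le power_mono zero_less_power) auto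
      ultimately show "hol r sg (C * inverse (?x ^ (2 * P + M))) (g j (s + h))"
        by (rule hol_mono[OF C mult_left_mono[OF _ nn(1)]])
    qed (rule C[OF s])
    moreover have "(\<lambda>y. complex_of_real (inverse h) * ((g j (s + h) y - g j s y) - (g j (s + h) y - g j s y - h *\<^sub>R g (Suc j) s y))) = g (Suc j) s"
      using h0 by (simp add: fun_eq_iff scaleR_conv_of_real)
    moreover have "cmod (complex_of_real (inverse h)) * ((C * inverse (?x ^ (2 * P + M)) + C * inverse (?x ^ (2 * P + M))) + h\<^sup>2 * (D * (2 * ?x) ^ M))
        = (2 * C + 2 ^ M * D) * inverse (?x ^ P)"
    proof -
      have "cmod (complex_of_real (inverse h)) = ?x ^ (P + M)" using ah by (simp add: norm_inverse)
      moreover have "h\<^sup>2 = inverse (?x ^ (P + M)) * inverse (?x ^ (P + M))"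
        using ah by (metis power2_abs power2_eq_square)
      moreover have "?x ^ P \<noteq> 0" "?x ^ M \<noteq> 0" using x by auto
      moreover have "(a * b) * ((C * inverse (a * a * b) + C * inverse (a * a * b)) + inverse (a * b) * inverse (a * b) * (D * (k * b)))
          = (2 * C + k * D) * inverse a" if "a \<noteq> 0" "b \<noteq> 0" for a b k :: real
        using that by (simp add: field_simps)
      ultimately show ?thesis
        by (simp only: power_add mult_2[of P] power_mult_distrib not_False_eq_True)
    qed
    ultimately show ?thesis by simp
  qed
  then show ?case by blast
qed

end

lemma jap_le: "jap x \<le> 1 + norm x"
  unfolding jap_def by (rule real_le_lsqrt) (auto simp: power2_eq_square algebra_simps)

lemma (in holder_class) hol_bdd_power: "hol_bdd f \<Longrightarrow> hol_bdd (\<lambda>y. f y ^ k)"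
  by (induction k) (auto intro: hol_bdd_mult hol_bdd_const)

section \<open>Normal frequencies rescaled by a positive Hoelder function\<close>

locale holder_scale = holder_class sg r for sg r +
  fixes a :: "'n::finite rn \<Rightarrow> real" and c0 c1 A :: real
  assumes c0: "0 < c0" "\<And>y. c0 \<le> a y" and c1: "\<And>y. a y \<le> c1"
    and a: "\<And>i x. pdiffable_at i a x" "\<And>i. hol r sg A (\<lambda>x. complex_of_real (pdiff i a x))"
begin

text \<open>This is \<open>hol_subst\<close> for the parameter a(y) t, whose derivative has size
  |t|. The family \<open>g\<close> is controlled away from s = 0 only, as is natural for negative
  powers of \<open>s\<close>.\<close>

lemma hol_subst_scaled:
  fixes g :: "nat \<Rightarrow> real \<Rightarrow> 'n rn \<Rightarrow> complex"
  assumes der: "\<And>j s y. c0 / 2 \<le> \<bar>s\<bar> \<Longrightarrow> ((\<lambda>s. g j s y) has_vector_derivative g (Suc j) s y) (at s)"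
    and crude: "\<And>j. \<exists>C. \<forall>s. c0 / 2 \<le> \<bar>s\<bar> \<longrightarrow> hol r sg (C * (1 + \<bar>s\<bar>) ^ M) (g j s)"
    and small: "\<And>j s. j \<le> Suc r \<Longrightarrow> c0 / 2 \<le> \<bar>s\<bar> \<Longrightarrow> hol r sg (C * inverse ((1 + \<bar>s\<bar>) ^ P)) (g j s)"
  shows "\<exists>C. \<forall>t. 1 \<le> \<bar>t\<bar> \<longrightarrow> hol r sg (C * \<bar>t\<bar> ^ Suc r * inverse (\<bar>t\<bar> ^ P)) (\<lambda>y. g 0 (a y * t) y)"
proof -
  obtain Cs where Cs: "Cs > 0" "\<And>(g :: nat \<Rightarrow> real \<Rightarrow> 'n rn \<Rightarrow> complex) b A B S.
    1 \<le> A \<Longrightarrow> open S \<Longrightarrow> convex S \<Longrightarrow> \<forall>x. b x \<in> S \<Longrightarrow>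
    \<forall>j. \<forall>s\<in>S. \<forall>y. ((\<lambda>s. g j s y) has_vector_derivative g (Suc j) s y) (at s) \<Longrightarrow>
    \<forall>j\<le>Suc r. \<forall>s\<in>S. hol r sg B (g j s) \<Longrightarrow>
    \<forall>j. \<exists>B'. \<forall>s\<in>S. hol r sg B' (g j s) \<Longrightarrow>
    \<forall>i x. pdiffable_at i b x \<Longrightarrow> \<forall>i. hol r sg A (\<lambda>x. complex_of_real (pdiff i b x)) \<Longrightarrow>
    hol r sg (Cs * A ^ Suc r * B) (\<lambda>y. g 0 (b y) y)" by (rule hol_substE[of r, where ?'n = 'n]) (rule that; assumption)
  define A0 where "A0 = max 1 A"
  have A0: "1 \<le> A0" "A \<le> A0" unfolding A0_def by auto
  have C: "0 \<le> C" using nonneg_of_mult_pos[OF hol_nonneg[OF small[of 0 "c0 / 2"]]] c0 by auto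
  have "hol r sg (Cs * A0 ^ Suc r * (C * inverse ((c0 / 2) ^ P)) * \<bar>t\<bar> ^ Suc r * inverse (\<bar>t\<bar> ^ P)) (\<lambda>y. g 0 (a y * t) y)"
    if t: "1 \<le> \<bar>t\<bar>" for t
  proof -
    \<comment> \<open>A bounded interval containing all a(y) t: the crude bounds grow with
      \<open>s\<close>, and on a bounded interval they become uniform. The factors 1/2 and 2 make it
      open around the values.\<close>
    define S where "S = (if t > 0 then {c0 / 2 * t<..<2 * c1 * t} else {2 * c1 * t<..<c0 / 2 * t})"
    have c1': "0 < c1" using c0(1) c0(2)[of undefined] c1[of undefined] by linarith
    have Sb: "c0 / 2 * \<bar>t\<bar> \<le> \<bar>s\<bar> \<and> \<bar>s\<bar> \<le> 2 * c1 * \<bar>t\<bar>" if "s \<in> S" for s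
    proof (cases "t > 0")
      case True
      then have "c0 / 2 * t < s" "s < 2 * c1 * t" "0 < c0 / 2 * t" using that c0 unfolding S_def by auto
      then show ?thesis using True by simp
    next
      case False
      then have "s < c0 / 2 * t" "2 * c1 * t < s" "c0 / 2 * t \<le> 0" using that c0 unfolding S_def by (auto simp: mult_le_0_iff)
      then show ?thesis using False by simp
    qed
    have "1 * (c0 / 2) \<le> \<bar>t\<bar> * (c0 / 2)" using t c0 by (intro mult_right_mono) auto
    then have Se: "c0 / 2 \<le> \<bar>s\<bar>" if "s \<in> S" for s using Sb[OF that] by (simp add: mult.commute)
    have ab: "c0 / 2 < a y" "a y < 2 * c1" for y using c0(1) c0(2)[of y] c1[of y] c1' by linarith+
    have bS: "a y * t \<in> S" for y
    proof (cases "t > 0")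
      case True
      then show ?thesis unfolding S_def using mult_strict_right_mono[OF ab(1) True] mult_strict_right_mono[OF ab(2) True] by simp
    next
      case False
      then have "t < 0" using t by auto
      then show ?thesis unfolding S_def using mult_strict_right_mono_neg[OF ab(1)] mult_strict_right_mono_neg[OF ab(2)] by simp
    qed
    have "hol r sg (Cs * (A0 * \<bar>t\<bar>) ^ Suc r * (C * inverse ((c0 / 2 * \<bar>t\<bar>) ^ P))) (\<lambda>y. g 0 (a y * t) y)"
    proof (rule Cs(2)[of "A0 * \<bar>t\<bar>" S "\<lambda>y. a y * t" g])
      show "1 \<le> A0 * \<bar>t\<bar>" using mult_mono[OF A0(1) t] A0(1) by simp
      show "open S" "convex S" unfolding S_def by auto
      show "\<forall>x. a x * t \<in> S" using bS by blast
      show "\<forall>j. \<forall>s\<in>S. \<forall>y. ((\<lambda>s. g j s y) has_vector_derivative g (Suc j) s y) (at s)"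
        using der Se by blast
      show "\<forall>j\<le>Suc r. \<forall>s\<in>S. hol r sg (C * inverse ((c0 / 2 * \<bar>t\<bar>) ^ P)) (g j s)"
      proof (intro allI impI ballI)
        fix j s assume j: "j \<le> Suc r" and s: "s \<in> S"
        have "0 < c0 / 2 * \<bar>t\<bar>" using c0 t by simp
        moreover have "c0 / 2 * \<bar>t\<bar> \<le> 1 + \<bar>s\<bar>" using Sb[OF s] by linarith
        ultimately have "inverse ((1 + \<bar>s\<bar>) ^ P) \<le> inverse ((c0 / 2 * \<bar>t\<bar>) ^ P)"
          by (intro le_imp_inverse_le power_mono zero_less_power) auto
        then show "hol r sg (C * inverse ((c0 / 2 * \<bar>t\<bar>) ^ P)) (g j s)"
          by (rule hol_mono[OF small[OF j Se[OF s]] mult_left_mono[OF _ C]])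
      qed
      show "\<forall>j. \<exists>B'. \<forall>s\<in>S. hol r sg B' (g j s)"
      proof
        fix j
        obtain D where D: "\<And>s. c0 / 2 \<le> \<bar>s\<bar> \<Longrightarrow> hol r sg (D * (1 + \<bar>s\<bar>) ^ M) (g j s)" using crude by blast
        have D0: "0 \<le> D" using nonneg_of_mult_pos[OF hol_nonneg[OF D[of "c0 / 2"]]] c0 by auto
        have "hol r sg (D * (1 + 2 * c1 * \<bar>t\<bar>) ^ M) (g j s)" if "s \<in> S" for s
          by (rule hol_mono[OF D[OF Se[OF that]]]) (use Sb[OF that] D0 in \<open>auto intro!: mult_left_mono power_mono\<close>)
        then show "\<exists>B'. \<forall>s\<in>S. hol r sg B' (g j s)" by blast
      qed
      have bl: "bounded_linear (\<lambda>z :: real. z * t)" by (rule bounded_linear_mult_left)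
      show "\<forall>i x. pdiffable_at i (\<lambda>y. a y * t) x" using pdiffable_linear[OF bl a(1)] by blast
      show "\<forall>i. hol r sg (A0 * \<bar>t\<bar>) (\<lambda>x. complex_of_real (pdiff i (\<lambda>y. a y * t) x))"
        using hol_cmult[OF hol_mono[OF a(2) A0(2)], of "complex_of_real t"] pdiff_linear[OF bl a(1)]
        by (simp add: mult.commute)
    qed
    moreover have "Cs * (A0 * \<bar>t\<bar>) ^ Suc r * (C * inverse ((c0 / 2 * \<bar>t\<bar>) ^ P)) =
      Cs * A0 ^ Suc r * (C * inverse ((c0 / 2) ^ P)) * \<bar>t\<bar> ^ Suc r * inverse (\<bar>t\<bar> ^ P)"
      unfolding power_mult_distrib inverse_mult_distrib by (simp only: mult_ac)
    ultimately show ?thesis by (simp only:)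
  qed
  then show ?thesis by blast
qed

lemma hol_bdd_scale: "hol_bdd (\<lambda>y. complex_of_real (a y))"
proof -
  have pe: "pdiff i (\<lambda>y. complex_of_real (a y)) = (\<lambda>y. complex_of_real (pdiff i a y))" for i
    by (intro ext pdiff_linear[OF bounded_linear_of_real a(1)])
  have "hol (Suc r) sg (max A c1) (\<lambda>y. complex_of_real (a y))"
  proof (rule hol_SucI)
    show "cmod (complex_of_real (a y)) \<le> max A c1" for y using c0(1) c0(2)[of y] c1[of y] by simp
    show "pdiffable_at i (\<lambda>y. complex_of_real (a y)) x" for i x
      by (intro pdiffable_linear[OF bounded_linear_of_real a(1)])
    show "hol r sg (max A c1) (pdiff i (\<lambda>y. complex_of_real (a y)))" for i
      unfolding pe by (rule hol_mono[OF a(2)]) simp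
  qed
  then show ?thesis unfolding hol_bdd_def using hol_down by blast
qed

text \<open>The substitution lemma applied to g(s) = 1/s and its derivatives, at t = 1, gives the
  reciprocal without a separate quotient rule.\<close>

lemma hol_bdd_inverse_scale: "hol_bdd (\<lambda>y. inverse (complex_of_real (a y)))"
proof -
  define g where "g j s y = ffact (- 1) j * complex_of_real s powi (- 1 - int j)" for j s and y :: "'n rn"
  define B where "B j = cmod (ffact (- 1) j) * inverse (min 1 (c0 / 2) ^ nat (- (- 1 - int j)))" for j
  have gb: "hol r sg (B j) (g j s)" if "c0 / 2 \<le> \<bar>s\<bar>" for j s
  proof -
    have "cmod (ffact (- 1) j * complex_of_real s powi (- 1 - int j)) \<le> B j"
      unfolding norm_mult B_def using norm_powi_le[of "c0 / 2" s "- 1 - int j" 0] that c0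
      by (intro mult_left_mono) auto
    then show ?thesis unfolding g_def using hol_mono[OF hol_const] by blast
  qed
  have mx: "B j \<le> Max (B ` {..Suc r})" if "j \<le> Suc r" for j using that by (intro Max_ge) auto
  have "\<exists>C. \<forall>t. 1 \<le> \<bar>t\<bar> \<longrightarrow> hol r sg (C * \<bar>t\<bar> ^ Suc r * inverse (\<bar>t\<bar> ^ 0)) (\<lambda>y. g 0 (a y * t) y)"
  proof (rule hol_subst_scaled[where M = 0 and C = "Max (B ` {..Suc r})"])
    show "((\<lambda>s. g j s y) has_vector_derivative g (Suc j) s y) (at s)" if "c0 / 2 \<le> \<bar>s\<bar>" for j s y
      unfolding g_def using that c0 by (intro has_vector_derivative_ffact) auto
    show "hol r sg (Max (B ` {..Suc r}) * inverse ((1 + \<bar>s\<bar>) ^ 0)) (g j s)" if "j \<le> Suc r" "c0 / 2 \<le> \<bar>s\<bar>" for j s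
      using hol_mono[OF gb[OF that(2)] mx[OF that(1)]] by simp
    show "\<exists>C. \<forall>s. c0 / 2 \<le> \<bar>s\<bar> \<longrightarrow> hol r sg (C * (1 + \<bar>s\<bar>) ^ 0) (g j s)" for j
      using gb by auto
  qed
  then obtain C where C: "\<forall>t. 1 \<le> \<bar>t\<bar> \<longrightarrow> hol r sg (C * \<bar>t\<bar> ^ Suc r * inverse (\<bar>t\<bar> ^ 0)) (\<lambda>y. g 0 (a y * t) y)" ..
  have "hol r sg (C * \<bar>1\<bar> ^ Suc r * inverse (\<bar>1 :: real\<bar> ^ 0)) (\<lambda>y. g 0 (a y * 1) y)"
    by (rule C[rule_format]) simp
  then show ?thesis unfolding hol_bdd_def g_def by (auto simp: power_int_minus)
qed

lemma hol_bdd_scale_powi: "hol_bdd (\<lambda>y. complex_of_real (a y) powi k)"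
proof (cases "k \<ge> 0")
  case True
  then show ?thesis using hol_bdd_power[OF hol_bdd_scale, of "nat k"] by (simp add: power_int_def)
next
  case False
  then show ?thesis using hol_bdd_power[OF hol_bdd_inverse_scale, of "nat (- k)"] by (simp add: power_int_def)
qed

text \<open>In the main terms the variables separate, since (a t)^k = a^k t^k. The remainder must be
  substituted as a function of \<open>s\<close> and \<open>y\<close>, and for this its
  \<open>s\<close>-derivatives up to order \<open>Suc r\<close> have to decay as well;
  \<open>hol_derivative_decay\<close> provides this from an expansion of much higher order.\<close>

lemma ray_expansion_subst:
  fixes q :: "'n rn \<Rightarrow> 'n rn \<Rightarrow> complex"
  assumes q: "symbol_family m q"
    and ex: "\<And>l. \<exists>S c C. finite S \<and> S \<subseteq> {..m} \<and> (\<forall>k. hol_bdd (c k)) \<and> (\<forall>t. 1 \<le> \<bar>t\<bar> \<longrightarrow>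
      hol r sg (C * inverse (\<bar>t\<bar> ^ l)) (\<lambda>y. q (t *\<^sub>R axis i0 1) y - (\<Sum>k\<in>S. c k y * complex_of_real t powi k)))"
  shows "ray_expansion l (\<lambda>t y. q ((a y * t) *\<^sub>R axis i0 1) y)"
proof -
  define \<epsilon> where "\<epsilon> = c0 / 2"
  have eps: "0 < \<epsilon>" unfolding \<epsilon>_def using c0 by simp
  \<comment> \<open>Bounds the growth of \<open>q\<close>, of the powers in its expansion and of
    their derivatives; the condition that \<open>S\<close> lies below \<open>m\<close> enters
    here.\<close>
  define M where "M = nat \<bar>m\<bar>"
  define P where "P = l + Suc r"
  \<comment> \<open>\<open>P\<close> exceeds \<open>l\<close> by the \<open>Suc r\<close> powers of
    |t| lost in the substitution; the factor \<open>2 ^ Suc r\<close> pays for that many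
    applications of Landau's inequality.\<close>
  define l' where "l' = 2 ^ Suc r * (P + M)"
  define e where "e = (axis i0 1 :: 'n rn)"
  have ne: "norm e = 1" unfolding e_def by (simp add: norm_axis_1)
  have sm: "smooth (\<lambda>\<xi>. q \<xi> y)" for y using q unfolding symbol_family_def by blast
  obtain S c C where S: "finite S" "S \<subseteq> {..m}" and S3: "\<forall>k. hol_bdd (c k)"
    and C0: "\<forall>t. 1 \<le> \<bar>t\<bar> \<longrightarrow> hol r sg (C * inverse (\<bar>t\<bar> ^ l')) (\<lambda>y. q (t *\<^sub>R e) y - (\<Sum>k\<in>S. c k y * complex_of_real t powi k))"
    using ex[of l', folded e_def] by (elim exE conjE)
  note S = S S3[rule_format] and C = C0[rule_format]
  have "\<forall>k. \<exists>B. hol r sg B (c k)" using S(3) unfolding hol_bdd_def by blast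
  from choice[OF this] obtain B where B: "\<And>k. hol r sg (B k) (c k)" by blast
  have B0: "0 \<le> B k" for k using hol_nonneg[OF B] .
  define g where "g j s y = pds (replicate j i0) (\<lambda>\<xi>. q \<xi> y) (s *\<^sub>R e) -
    (\<Sum>k\<in>S. c k y * (ffact k j * complex_of_real s powi (k - int j)))" for j s y
  have der: "((\<lambda>s. g j s y) has_vector_derivative g (Suc j) s y) (at s)" if "\<epsilon> \<le> \<bar>s\<bar>" for j s y
  proof -
    have "((\<lambda>s. pds (replicate j i0) (\<lambda>\<xi>. q \<xi> y) (s *\<^sub>R e)) has_vector_derivative
      (\<Sum>l\<in>UNIV. (e $ l) *\<^sub>R pds (l # replicate j i0) (\<lambda>\<xi>. q \<xi> y) (s *\<^sub>R e))) (at s)"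
      by (intro pds_curve sm) (auto intro!: derivative_eq_intros)
    also have "(\<Sum>l\<in>UNIV. (e $ l) *\<^sub>R pds (l # replicate j i0) (\<lambda>\<xi>. q \<xi> y) (s *\<^sub>R e)) =
        pds (replicate (Suc j) i0) (\<lambda>\<xi>. q \<xi> y) (s *\<^sub>R e)"
      unfolding e_def axis_def by (simp add: if_distrib[of "\<lambda>c. c *\<^sub>R _"] cong: if_cong)
    finally show ?thesis
      unfolding g_def using that eps
      by (intro has_vector_derivative_diff has_vector_derivative_sum has_vector_derivative_mult_right has_vector_derivative_ffact) auto
  qed
  have crude: "\<exists>D. \<forall>s. \<epsilon> \<le> \<bar>s\<bar> \<longrightarrow> hol r sg (D * (1 + \<bar>s\<bar>) ^ M) (g j s)" for j
  proof -
    obtain D where D: "\<And>\<xi>. hol r sg (D * jap \<xi> powr (of_int m - real (length (replicate j i0)))) (\<lambda>y. pds (replicate j i0) (\<lambda>\<xi>. q \<xi> y) \<xi>)"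
      using q unfolding symbol_family_def by blast
    have D0: "0 \<le> D" by (rule nonneg_of_mult_pos[OF hol_nonneg[OF D[of 0]]]) (simp add: jap_pos[THEN less_imp_neq, symmetric])
    define K where "K = (\<Sum>k\<in>S. B k * (cmod (ffact k j) * inverse (min 1 \<epsilon> ^ nat (- (k - int j)))))"
    have "hol r sg ((D + K) * (1 + \<bar>s\<bar>) ^ M) (g j s)" if s: "\<epsilon> \<le> \<bar>s\<bar>" for s
    proof -
      have "jap (s *\<^sub>R e) powr (of_int m - real (length (replicate j i0))) \<le> jap (s *\<^sub>R e) powr (real M)"
        using jap_ge_1[of "s *\<^sub>R e"] by (intro powr_mono) (auto simp: M_def)
      also have "\<dots> = jap (s *\<^sub>R e) ^ M" using jap_pos[of "s *\<^sub>R e"] by (simp add: powr_realpow)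
      also have "\<dots> \<le> (1 + \<bar>s\<bar>) ^ M" using jap_le[of "s *\<^sub>R e"] jap_pos[of "s *\<^sub>R e"] ne by (intro power_mono) auto
      finally have h1: "hol r sg (D * (1 + \<bar>s\<bar>) ^ M) (\<lambda>y. pds (replicate j i0) (\<lambda>\<xi>. q \<xi> y) (s *\<^sub>R e))"
        by (rule hol_mono[OF D mult_left_mono[OF _ D0]])
      have h2: "hol r sg (\<Sum>k\<in>S. B k * (cmod (ffact k j) * inverse (min 1 \<epsilon> ^ nat (- (k - int j)))) * (1 + \<bar>s\<bar>) ^ M)
        (\<lambda>y. \<Sum>k\<in>S. c k y * (ffact k j * complex_of_real s powi (k - int j)))"
      proof (rule hol_sum)
        fix k assume k: "k \<in> S"
        have kM: "k - int j \<le> int M" using S(2) k unfolding M_def by force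
        have "cmod (ffact k j * complex_of_real s powi (k - int j)) * B k \<le>
          B k * (cmod (ffact k j) * inverse (min 1 \<epsilon> ^ nat (- (k - int j)))) * (1 + \<bar>s\<bar>) ^ M"
          using mult_left_mono[OF norm_powi_le[OF eps s kM], of "B k * cmod (ffact k j)"] B0[of k]
          by (simp add: norm_mult mult_ac)
        from hol_mono[OF hol_cmult[OF B] this]
        show "hol r sg (B k * (cmod (ffact k j) * inverse (min 1 \<epsilon> ^ nat (- (k - int j)))) * (1 + \<bar>s\<bar>) ^ M)
          (\<lambda>y. c k y * (ffact k j * complex_of_real s powi (k - int j)))" by (simp only: mult.commute)
      qed
      show ?thesis using hol_diff[OF h1 h2] unfolding g_def K_def sum_distrib_right[symmetric] distrib_right[symmetric] .
    qed
    then show ?thesis by blast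
  qed
  have small0: "\<exists>D. \<forall>s. \<epsilon> \<le> \<bar>s\<bar> \<longrightarrow> hol r sg (D * inverse ((1 + \<bar>s\<bar>) ^ l')) (g 0 s)"
  proof -
    obtain D where D: "\<And>s. \<epsilon> \<le> \<bar>s\<bar> \<Longrightarrow> hol r sg (D * (1 + \<bar>s\<bar>) ^ M) (g 0 s)" using crude[of 0] by blast
    have D0: "0 \<le> D" using nonneg_of_mult_pos[OF hol_nonneg[OF D[of \<epsilon>]]] eps by (auto simp: zero_less_power)
    have C0: "0 \<le> C" using hol_nonneg[OF C[of 1]] by simp
    have "hol r sg ((C * 2 ^ l' + D * 2 ^ M * 2 ^ l') * inverse ((1 + \<bar>s\<bar>) ^ l')) (g 0 s)" if s: "\<epsilon> \<le> \<bar>s\<bar>" for s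
    proof (cases "1 \<le> \<bar>s\<bar>")
      case True
      have "(1 + \<bar>s\<bar>) ^ l' \<le> (2 * \<bar>s\<bar>) ^ l'" using True by (intro power_mono) auto
      then have "inverse ((2 * \<bar>s\<bar>) ^ l') \<le> inverse ((1 + \<bar>s\<bar>) ^ l')" by (intro le_imp_inverse_le zero_less_power) auto
      then have "2 ^ l' * inverse ((2 * \<bar>s\<bar>) ^ l') \<le> 2 ^ l' * inverse ((1 + \<bar>s\<bar>) ^ l')" by (intro mult_left_mono) auto
      then have "inverse (\<bar>s\<bar> ^ l') \<le> 2 ^ l' * inverse ((1 + \<bar>s\<bar>) ^ l')"
        unfolding power_mult_distrib inverse_mult_distrib by (simp add: mult.assoc[symmetric])
      then have "C * inverse (\<bar>s\<bar> ^ l') \<le> C * (2 ^ l' * inverse ((1 + \<bar>s\<bar>) ^ l'))" by (rule mult_left_mono[OF _ C0])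
      also have "\<dots> \<le> (C * 2 ^ l' + D * 2 ^ M * 2 ^ l') * inverse ((1 + \<bar>s\<bar>) ^ l')"
        using D0 by (simp add: distrib_right)
      finally show ?thesis using hol_mono[OF C[OF True]] unfolding g_def by simp
    next
      case False
      \<comment> \<open>For \<epsilon> \<le> |s| < 1 the weight is bounded below, so the crude bound
        is already a decay estimate.\<close>
      have "(1 + \<bar>s\<bar>) ^ M \<le> 2 ^ M" using False by (intro power_mono) auto
      moreover have "1 \<le> 2 ^ l' * inverse ((1 + \<bar>s\<bar>) ^ l')"
      proof -
        have "(1 + \<bar>s\<bar>) ^ l' \<le> 2 ^ l'" using False by (intro power_mono) auto
        moreover have "0 < (1 + \<bar>s\<bar>) ^ l'" by (auto intro: zero_less_power)
        ultimately show ?thesis by (simp add: field_simps)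
      qed
      ultimately have "(1 + \<bar>s\<bar>) ^ M * 1 \<le> 2 ^ M * (2 ^ l' * inverse ((1 + \<bar>s\<bar>) ^ l'))" by (intro mult_mono) auto
      then have "D * ((1 + \<bar>s\<bar>) ^ M * 1) \<le> D * (2 ^ M * (2 ^ l' * inverse ((1 + \<bar>s\<bar>) ^ l')))" by (rule mult_left_mono[OF _ D0])
      also have "\<dots> \<le> (C * 2 ^ l' + D * 2 ^ M * 2 ^ l') * inverse ((1 + \<bar>s\<bar>) ^ l')"
        using C0 by (simp add: distrib_right mult_ac)
      finally show ?thesis using hol_mono[OF D[OF s]] by simp
    qed
    then show ?thesis by blast
  qed
  then obtain D0 where D0: "\<And>s. \<epsilon> \<le> \<bar>s\<bar> \<Longrightarrow> hol r sg (D0 * inverse ((1 + \<bar>s\<bar>) ^ l')) (g 0 s)" by blast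
  have "\<exists>D. j \<le> Suc r \<longrightarrow> (\<forall>s. \<epsilon> \<le> \<bar>s\<bar> \<longrightarrow> hol r sg (D * inverse ((1 + \<bar>s\<bar>) ^ P)) (g j s))" for j
  proof (cases "j \<le> Suc r")
    case True
    \<comment> \<open>The decay that remains after only \<open>j\<close> differentiations; it is at
      least \<open>P\<close>.\<close>
    define P' where "P' = 2 ^ (Suc r - j) * (P + M) - M"
    have "1 * (P + M) \<le> 2 ^ (Suc r - j) * (P + M)" by (intro mult_right_mono) auto
    then have "P + M \<le> 2 ^ (Suc r - j) * (P + M)" by (simp only: mult_1)
    then have P': "P \<le> P'" "P' + M = 2 ^ (Suc r - j) * (P + M)" unfolding P'_def by arith+
    have "l' = 2 ^ j * (P' + M)" unfolding l'_def P'(2) using True by (simp add: power_add[symmetric] mult.assoc[symmetric] del: power_Suc)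
    from hol_derivative_decay[OF eps der crude D0 this]
    obtain D where D: "\<And>s. \<epsilon> \<le> \<bar>s\<bar> \<Longrightarrow> hol r sg (D * inverse ((1 + \<bar>s\<bar>) ^ P')) (g j s)" by blast
    have Dn: "0 \<le> D" using nonneg_of_mult_pos[OF hol_nonneg[OF D[of \<epsilon>]]] eps by (auto simp: zero_less_power)
    have "hol r sg (D * inverse ((1 + \<bar>s\<bar>) ^ P)) (g j s)" if "\<epsilon> \<le> \<bar>s\<bar>" for s
      using P'(1) by (intro hol_mono[OF D[OF that]] mult_left_mono[OF _ Dn] le_imp_inverse_le power_increasing zero_less_power) auto
    then show ?thesis by blast
  qed auto
  then have "\<forall>j. \<exists>D. j \<le> Suc r \<longrightarrow> (\<forall>s. \<epsilon> \<le> \<bar>s\<bar> \<longrightarrow> hol r sg (D * inverse ((1 + \<bar>s\<bar>) ^ P)) (g j s))" ..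
  from choice[OF this] obtain D where D: "\<And>j s. j \<le> Suc r \<Longrightarrow> \<epsilon> \<le> \<bar>s\<bar> \<Longrightarrow> hol r sg (D j * inverse ((1 + \<bar>s\<bar>) ^ P)) (g j s)" by blast
  have mx: "D j \<le> Max (D ` {..Suc r})" if "j \<le> Suc r" for j using that by (intro Max_ge) auto
  have "\<exists>K. \<forall>t. 1 \<le> \<bar>t\<bar> \<longrightarrow> hol r sg (K * \<bar>t\<bar> ^ Suc r * inverse (\<bar>t\<bar> ^ P)) (\<lambda>y. g 0 (a y * t) y)"
  proof (rule hol_subst_scaled[where g = g, OF der[unfolded \<epsilon>_def] crude[unfolded \<epsilon>_def]])
    show "hol r sg (Max (D ` {..Suc r}) * inverse ((1 + \<bar>s\<bar>) ^ P)) (g j s)" if "j \<le> Suc r" "c0 / 2 \<le> \<bar>s\<bar>" for j s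
      by (rule hol_mono[OF D[OF that[folded \<epsilon>_def]] mult_right_mono[OF mx[OF that(1)]]]) simp
  qed
  then obtain K where K: "\<And>t. 1 \<le> \<bar>t\<bar> \<Longrightarrow> hol r sg (K * \<bar>t\<bar> ^ Suc r * inverse (\<bar>t\<bar> ^ P)) (\<lambda>y. g 0 (a y * t) y)" by blast
  show ?thesis
  proof (rule ray_expansionI[OF S(1)])
    show "hol_bdd (\<lambda>y. c k y * complex_of_real (a y) powi k)" for k
      by (intro hol_bdd_mult S(3) hol_bdd_scale_powi)
    fix t :: real assume t: "1 \<le> \<bar>t\<bar>"
    have "K * \<bar>t\<bar> ^ Suc r * inverse (\<bar>t\<bar> ^ P) = K * inverse (\<bar>t\<bar> ^ l)"
      using t unfolding P_def power_add by (auto simp: field_simps)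
    moreover have "(\<lambda>y. g 0 (a y * t) y) = (\<lambda>y. q ((a y * t) *\<^sub>R axis i0 1) y -
        (\<Sum>k\<in>S. c k y * complex_of_real (a y) powi k * complex_of_real t powi k))"
      unfolding g_def e_def by (simp add: power_int_mult_distrib mult.assoc)
    ultimately show "hol r sg (K * inverse (\<bar>t\<bar> ^ l)) (\<lambda>y. q ((a y * t) *\<^sub>R axis i0 1) y -
        (\<Sum>k\<in>S. c k y * complex_of_real (a y) powi k * complex_of_real t powi k))"
      using K[OF t] by (simp only:)
  qed
qed

end

section \<open>Flat cutoff functions and dilations\<close>

lemma Ck_add:
  fixes f g :: "'n::finite rn \<Rightarrow> 'b::real_normed_vector"
  shows "Ck k f \<Longrightarrow> Ck k g \<Longrightarrow> Ck k (\<lambda>x. f x + g x)"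
proof (induction k arbitrary: f g)
  case 0 then show ?case by (auto intro: continuous_on_add)
next
  case (Suc k)
  have "pdiff i (\<lambda>x. f x + g x) = (\<lambda>x. pdiff i f x + pdiff i g x)" for i
    using Suc.prems by (intro ext pdiff_add) (auto simp: Ck_Suc_iff)
  then show ?case using Suc unfolding Ck_Suc_iff by (auto intro: pdiffable_add)
qed

lemma Ck_mult:
  fixes f g :: "'n::finite rn \<Rightarrow> complex"
  shows "Ck k f \<Longrightarrow> Ck k g \<Longrightarrow> Ck k (\<lambda>x. f x * g x)"
proof (induction k arbitrary: f g)
  case 0 then show ?case by (auto intro: continuous_on_mult)
next
  case (Suc k)
  have "pdiff i (\<lambda>x. f x * g x) = (\<lambda>x. f x * pdiff i g x + pdiff i f x * g x)" for i
    using Suc.prems by (intro ext pdiff_mult) (auto simp: Ck_Suc_iff)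
  moreover have "Ck k f" "Ck k g" using Suc.prems by (auto intro: Ck_SucD)
  ultimately show ?case using Suc unfolding Ck_Suc_iff by (auto intro: pdiffable_mult Ck_add)
qed

lemma Ck_exp:
  fixes f :: "'n::finite rn \<Rightarrow> complex"
  shows "Ck k f \<Longrightarrow> Ck k (\<lambda>x. exp (f x))"
proof (induction k arbitrary: f)
  case 0 then show ?case by (auto intro: continuous_on_exp)
next
  case (Suc k)
  have "pdiff i (\<lambda>x. exp (f x)) = (\<lambda>x. pdiff i f x * exp (f x))" for i
    using Suc.prems by (intro ext pdiff_exp) (auto simp: Ck_Suc_iff)
  moreover have "Ck k f" using Suc.prems by (auto intro: Ck_SucD)
  ultimately show ?case using Suc unfolding Ck_Suc_iff by (auto intro: pdiffable_exp Ck_mult)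
qed

lemma Ck_linear: "bounded_linear h \<Longrightarrow> Ck k f \<Longrightarrow> Ck k (\<lambda>x. h (f x))"
proof (induction k arbitrary: f)
  case 0 then show ?case by (auto intro: bounded_linear.continuous_on)
next
  case (Suc k)
  have "pdiff i (\<lambda>x. h (f x)) = (\<lambda>x. h (pdiff i f x))" for i
    using Suc.prems by (intro ext pdiff_linear) (auto simp: Ck_Suc_iff)
  then show ?case using Suc unfolding Ck_Suc_iff by (auto intro: pdiffable_linear)
qed

lemma smooth_add:
  fixes f g :: "'n::finite rn \<Rightarrow> 'b::real_normed_vector"
  shows "smooth f \<Longrightarrow> smooth g \<Longrightarrow> smooth (\<lambda>x. f x + g x)"
  unfolding smooth_Ck by (auto intro: Ck_add)

lemma smooth_mult:
  fixes f g :: "'n::finite rn \<Rightarrow> complex"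
  shows "smooth f \<Longrightarrow> smooth g \<Longrightarrow> smooth (\<lambda>x. f x * g x)"
  unfolding smooth_Ck by (auto intro: Ck_mult)

lemma smooth_exp:
  fixes f :: "'n::finite rn \<Rightarrow> complex"
  shows "smooth f \<Longrightarrow> smooth (\<lambda>x. exp (f x))"
  unfolding smooth_Ck by (auto intro: Ck_exp)

lemma smooth_linear: "bounded_linear h \<Longrightarrow> smooth f \<Longrightarrow> smooth (\<lambda>x. h (f x))"
  unfolding smooth_Ck by (auto intro: Ck_linear)

lemma smooth_const: "smooth (\<lambda>x :: 'n::finite rn. c)"
  by (rule smooth_coinduct[where R = "\<lambda>f. \<exists>c. f = (\<lambda>x. c)"]) (auto simp: pdiff_const)

lemma smooth_power:
  fixes f :: "'n::finite rn \<Rightarrow> complex"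
  shows "smooth f \<Longrightarrow> smooth (\<lambda>x. f x ^ k)"
  by (induction k) (auto intro: smooth_mult smooth_const)

lemma smooth_sum:
  fixes f :: "'a \<Rightarrow> 'n::finite rn \<Rightarrow> 'b::real_normed_vector"
  shows "(\<And>i. i \<in> S \<Longrightarrow> smooth (f i)) \<Longrightarrow> smooth (\<lambda>x. \<Sum>i\<in>S. f i x)"
  by (induction S rule: infinite_finite_induct) (auto intro: smooth_add smooth_const)

lemma pds_linear:
  assumes h: "bounded_linear h" and f: "smooth f"
  shows "pds L (\<lambda>x. h (f x)) = (\<lambda>x. h (pds L f x))"
proof (induction L)
  case (Cons i L)
  show ?case using smooth_pdiffable[OF smooth_pds[OF f]] by (simp add: Cons fun_eq_iff pdiff_linear[OF h])
qed simp

lemma pds_add: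
  fixes f g :: "'n::finite rn \<Rightarrow> 'b::real_normed_vector"
  assumes "smooth f" "smooth g"
  shows "pds L (\<lambda>x. f x + g x) = (\<lambda>x. pds L f x + pds L g x)"
proof (induction L)
  case (Cons l L)
  then show ?case using assms by (auto simp: Cons intro!: pdiff_add smooth_pdiffable smooth_pds)
qed simp

lemma pds_translate: "pds L (\<lambda>x. f (x + z)) = (\<lambda>x. pds L f (x + z))"
  by (induction L) (auto simp: fun_eq_iff pdiff_def add_ac)

lemma Ck_translate: "Ck k f \<Longrightarrow> Ck k (\<lambda>x. f (x + z))"
proof (induction k arbitrary: f)
  case 0 then show ?case by (auto intro!: continuous_on_compose2[of UNIV f] continuous_intros)
next
  case (Suc k)
  have "pdiff i (\<lambda>x. f (x + z)) = (\<lambda>x. pdiff i f (x + z))" for i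
    using pds_translate[of "[i]" f z] by simp
  moreover have "pdiffable_at i (\<lambda>x. f (x + z)) x = pdiffable_at i f (x + z)" for i x
    by (simp add: pdiffable_at_def add_ac)
  ultimately show ?case using Suc unfolding Ck_Suc_iff by auto
qed

lemma smooth_translate: "smooth f \<Longrightarrow> smooth (\<lambda>x. f (x + z))"
  unfolding smooth_Ck by (auto intro: Ck_translate)

lemma pdiff_scaleR:
  assumes "pdiffable_at i f (c *\<^sub>R w)"
  shows "pdiffable_at i (\<lambda>w. f (c *\<^sub>R w)) w" "pdiff i (\<lambda>w. f (c *\<^sub>R w)) w = c *\<^sub>R pdiff i f (c *\<^sub>R w)"
proof -
  have "((\<lambda>t. f (c *\<^sub>R w + t *\<^sub>R axis i 1)) has_vector_derivative pdiff i f (c *\<^sub>R w)) (at (c * 0))"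
    using assms by (simp add: pdiffable_at_iff)
  moreover have "((\<lambda>t. c * t) has_vector_derivative c) (at 0)"
    by (auto intro!: derivative_eq_intros)
  ultimately have "((\<lambda>t. f (c *\<^sub>R (w + t *\<^sub>R axis i 1))) has_vector_derivative c *\<^sub>R pdiff i f (c *\<^sub>R w)) (at 0)"
    using vector_diff_chain_at[of "\<lambda>t. c * t" c 0 "\<lambda>t. f (c *\<^sub>R w + t *\<^sub>R axis i 1)"]
    by (simp add: o_def scaleR_add_right)
  then show "pdiffable_at i (\<lambda>w. f (c *\<^sub>R w)) w" "pdiff i (\<lambda>w. f (c *\<^sub>R w)) w = c *\<^sub>R pdiff i f (c *\<^sub>R w)"
    by (auto intro: pdiff_eqI pdiffable_atI)
qed

lemma pds_scaleR:
  assumes f: "smooth f"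
  shows "pds L (\<lambda>w. f (c *\<^sub>R w)) = (\<lambda>w. c ^ length L *\<^sub>R pds L f (c *\<^sub>R w))"
proof (induction L)
  case (Cons i L)
  have d: "pdiffable_at i (pds L f) x" for x by (intro smooth_pdiffable smooth_pds f)
  have "pdiff i (\<lambda>w. c ^ length L *\<^sub>R pds L f (c *\<^sub>R w)) w = c ^ length L *\<^sub>R (c *\<^sub>R pds (i # L) f (c *\<^sub>R w))" for w
    using pdiff_linear[OF bounded_linear_scaleR_right pdiff_scaleR(1)[OF d], of "c ^ length L" c w] pdiff_scaleR(2)[OF d, of c w] by simp
  then show ?case by (simp add: Cons fun_eq_iff mult.commute)
qed simp

lemma bounded_linear_complex_component: "bounded_linear (\<lambda>v. complex_of_real (v $ i))"
  using bounded_linear_compose[OF bounded_linear_of_real bounded_linear_vec_nth] .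

lemma pdiff_component:
  "pdiffable_at j (\<lambda>v. complex_of_real (v $ i)) w"
  "pdiff j (\<lambda>v. complex_of_real (v $ i)) = (\<lambda>v. if i = j then 1 else 0)"
proof -
  have *: "((\<lambda>v. complex_of_real (v $ i)) has_derivative (\<lambda>v. complex_of_real (v $ i))) (at w)" for w :: "'a rn"
    by (rule bounded_linear_imp_has_derivative[OF bounded_linear_complex_component])
  show "pdiffable_at j (\<lambda>v. complex_of_real (v $ i)) w" by (rule has_derivative_imp_pdiff[OF *])
  show "pdiff j (\<lambda>v. complex_of_real (v $ i)) = (\<lambda>v. if i = j then 1 else 0)"
    using has_derivative_imp_pdiff(2)[OF *] by (auto simp: fun_eq_iff axis_def)
qed

lemma smooth_component: "smooth (\<lambda>v. complex_of_real (v $ i))"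
  by (rule smooth_coinduct[where R = "\<lambda>f. f = (\<lambda>v. complex_of_real (v $ i)) \<or> (\<exists>c. f = (\<lambda>v. c))"])
    (auto simp: pdiff_const pdiff_component(1)[of _ i] pdiff_component(2)[of _ i] intro!: continuous_intros)

text \<open>Truncating the exponential series gives a Gaussian factor that equals 1 to high order at
  the zeros of \<open>V\<close>, so that it does not change low order derivatives there.\<close>

definition cutoff :: "nat \<Rightarrow> complex \<Rightarrow> complex" where
  "cutoff M v = (\<Sum>i<M. v ^ i / fact i) * exp (- v)"

text \<open>The derivatives of the truncated series and of \<open>exp (- v)\<close> telescope,
  leaving only the last term; hence the zero of order \<open>M\<close> at v = 0.\<close>

lemma has_field_derivative_cutoff:
  "(cutoff (Suc M) has_field_derivative - (v ^ M / fact M) * exp (- v)) (at v)"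
proof (induction M)
  case 0
  have "cutoff (Suc 0) = (\<lambda>v. exp (- v))" by (simp add: cutoff_def fun_eq_iff)
  then show ?case by (auto intro!: derivative_eq_intros)
next
  case (Suc M)
  have "cutoff (Suc (Suc M)) = (\<lambda>v. cutoff (Suc M) v + v ^ Suc M / fact (Suc M) * exp (- v))"
    by (simp add: cutoff_def fun_eq_iff distrib_right)
  moreover have "((\<lambda>v. v ^ Suc M / fact (Suc M) * exp (- v)) has_field_derivative
      v ^ M / fact M * exp (- v) - v ^ Suc M / fact (Suc M) * exp (- v)) (at v)"
  proof -
    have "((\<lambda>v. v ^ Suc M) has_field_derivative of_nat (Suc M) * v ^ M) (at v)"
      using DERIV_power_Suc[OF DERIV_ident, of M v UNIV] by simp
    from DERIV_cdivide[OF this, of "fact (Suc M)"]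
    have 1: "((\<lambda>v. v ^ Suc M / fact (Suc M)) has_field_derivative v ^ M / fact M) (at v)"
      unfolding fact_Suc by (simp del: of_nat_Suc power_Suc)
    have 2: "((\<lambda>v. exp (- v)) has_field_derivative - exp (- v)) (at v)" by (auto intro!: derivative_eq_intros)
    show ?thesis using DERIV_mult[OF 1 2] by (simp add: algebra_simps)
  qed
  ultimately show ?case using DERIV_add[OF Suc] by fastforce
qed

lemma pdiff_cutoff:
  assumes "pdiffable_at i V x"
  shows "pdiffable_at i (\<lambda>x. cutoff (Suc M) (V x)) x"
    "pdiff i (\<lambda>x. cutoff (Suc M) (V x)) x = - (V x ^ M / fact M) * exp (- V x) * pdiff i V x"
proof -
  have "((\<lambda>t. cutoff (Suc M) (V (x + t *\<^sub>R axis i 1))) has_vector_derivative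
      pdiff i V x * (- (V x ^ M / fact M) * exp (- V x))) (at 0)"
    using field_vector_diff_chain_at[OF assms[unfolded pdiffable_at_iff], of "cutoff (Suc M)" "- (V x ^ M / fact M) * exp (- V x)"]
      has_field_derivative_cutoff[of M "V x"] unfolding o_def by simp
  then show "pdiffable_at i (\<lambda>x. cutoff (Suc M) (V x)) x"
    "pdiff i (\<lambda>x. cutoff (Suc M) (V x)) x = - (V x ^ M / fact M) * exp (- V x) * pdiff i V x"
    by (auto intro: pdiffable_atI simp: pdiff_eqI mult.commute)
qed

text \<open>Every derivative uses up at most one power of \<open>V\<close> in the error term, which
  is therefore still divisible by \<open>V\<close> as long as fewer than \<open>Suc M\<close>
  derivatives are taken.\<close>

lemma pds_mult_cutoff:
  fixes g V :: "'n::finite rn \<Rightarrow> complex"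
  assumes g: "smooth g" and V: "smooth V"
  shows "length L \<le> Suc M \<Longrightarrow> \<exists>h. smooth h \<and>
    pds L (\<lambda>x. g x * cutoff (Suc M) (V x)) = (\<lambda>x. pds L g x * cutoff (Suc M) (V x) + V x ^ (Suc M - length L) * h x)"
proof (induction L)
  case Nil
  show ?case by (rule exI[of _ "\<lambda>x. 0"]) (auto intro: smooth_const)
next
  case (Cons i L)
  then obtain h where h: "smooth h" and e: "pds L (\<lambda>x. g x * cutoff (Suc M) (V x)) =
      (\<lambda>x. pds L g x * cutoff (Suc M) (V x) + V x ^ (Suc M - length L) * h x)" by auto
  define d where "d = M - length L"
  have d: "Suc M - length L = Suc d" "Suc M - length (i # L) = d" "M = d + length L" using Cons.prems unfolding d_def by auto
  \<comment> \<open>The summands come from the cutoff, from \<open>h\<close>, and from the power of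
    \<open>V\<close>. The first carries V^M, of which V^d is split off by M = d + length L.\<close>
  define h' where "h' x = - (pds L g x * V x ^ length L * exp (- V x) * pdiff i V x / fact M) +
    V x * pdiff i h x + of_nat (Suc d) * pdiff i V x * h x" for x
  have sV: "smooth (\<lambda>x. - V x)" using smooth_linear[OF bounded_linear_minus[OF bounded_linear_ident] V] .
  have "h' = (\<lambda>x. (- 1 / fact M) * (pds L g x * V x ^ length L * exp (- V x) * pdiff i V x) +
    V x * pdiff i h x + of_nat (Suc d) * pdiff i V x * h x)" unfolding h'_def by (simp add: fun_eq_iff)
  then have "smooth h'" by (simp only:) (intro smooth_add smooth_mult smooth_const smooth_pds smooth_pdiff smooth_power smooth_exp g V h sV)
  moreover have "pdiff i (\<lambda>x. pds L g x * cutoff (Suc M) (V x) + V x ^ Suc d * h x) x =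
    pds (i # L) g x * cutoff (Suc M) (V x) + V x ^ d * h' x" for x
  proof -
    have p: "pdiffable_at i (pds L g) x" "pdiffable_at i V x" "pdiffable_at i h x" "pdiffable_at i (\<lambda>x. V x ^ Suc d) x"
      using g V h by (auto intro!: smooth_pdiffable smooth_pds smooth_power simp del: power_Suc)
    have "((\<lambda>t. V (x + t *\<^sub>R axis i 1) ^ Suc d) has_vector_derivative pdiff i V x * (of_nat (Suc d) * V x ^ d)) (at 0)"
    proof -
      have "((\<lambda>v. v ^ Suc d) has_field_derivative of_nat (Suc d) * V x ^ d) (at (V x))"
        using DERIV_power_Suc[OF DERIV_ident, of d "V x" UNIV] by simp
      then show ?thesis
        using field_vector_diff_chain_at[of "\<lambda>t. V (x + t *\<^sub>R axis i 1)" "pdiff i V x" 0 "\<lambda>v. v ^ Suc d" "of_nat (Suc d) * V x ^ d"]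
          p(2) unfolding pdiffable_at_iff o_def by (simp del: power_Suc of_nat_Suc)
    qed
    then have dp: "pdiff i (\<lambda>x. V x ^ Suc d) x = pdiff i V x * (of_nat (Suc d) * V x ^ d)" by (rule pdiff_eqI)
    show ?thesis
      unfolding pdiff_add[OF pdiffable_mult[OF p(1) pdiff_cutoff(1)[OF p(2)]] pdiffable_mult[OF p(4) p(3)]]
        pdiff_mult[OF p(1) pdiff_cutoff(1)[OF p(2)]] pdiff_mult[OF p(4) p(3)] pdiff_cutoff(2)[OF p(2)] dp h'_def
      by (simp add: d(3) power_add algebra_simps)
  qed
  ultimately show ?case unfolding d(2) by (intro exI[of _ h']) (simp add: e d(1) fun_eq_iff)
qed

lemma pds_mult_cutoff_eq:
  fixes g V :: "'n::finite rn \<Rightarrow> complex"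
  assumes g: "smooth g" and V: "smooth V" and V0: "V x = 0" and L: "length L < M"
  shows "pds L (\<lambda>x. g x * cutoff M (V x)) x = pds L g x"
proof -
  obtain M' where M: "M = Suc M'" using L by (cases M) auto
  obtain h where "pds L (\<lambda>x. g x * cutoff (Suc M') (V x)) =
      (\<lambda>x. pds L g x * cutoff (Suc M') (V x) + V x ^ (Suc M' - length L) * h x)"
    using pds_mult_cutoff[OF g V, of L M'] L M by auto
  moreover have "cutoff (Suc M') 0 = 1" by (simp add: cutoff_def sum.lessThan_Suc_shift del: sum.lessThan_Suc)
  ultimately show ?thesis using L V0 unfolding M by simp
qed

lemma smooth_monom_list: "smooth (\<lambda>w :: 'n::finite rn. complex_of_real (monom_list G w))"
  by (induction G) (auto intro: smooth_mult smooth_const smooth_component)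

section \<open>Sums over words with symmetric coefficients\<close>

definition symm_coeff :: "('n list \<Rightarrow> complex) \<Rightarrow> bool" where
  "symm_coeff c \<longleftrightarrow> (\<forall>L L'. mset L = mset L' \<longrightarrow> c L = c L')"

lemma sum_pds_Suc:
  fixes f :: "'n::finite rn \<Rightarrow> complex"
  assumes "smooth f"
  shows "(\<Sum>L | length L = Suc j. c L * pds L f x) = (\<Sum>i\<in>UNIV. \<Sum>L | length L = j. c (i # L) * pds L (pdiff i f) x)"
proof -
  have "pds (i # L) f = pds L (pdiff i f)" for i L
    using smooth_pds_perm[OF assms, of "i # L" "L @ [i]"] by simp
  then show ?thesis unfolding sum_lists_Suc by simp
qed

text \<open>Leibniz' rule: the linear factor is either not differentiated or differentiated once, by
  a letter \<open>i\<close> in one of \<open>Suc j\<close> positions. Symmetry of the coefficients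
  makes all positions equal, so they combine into the factor \<open>Suc j\<close>.\<close>

lemma sum_pds_mult_component:
  fixes H :: "'n::finite rn \<Rightarrow> complex"
  assumes "symm_coeff c" "smooth H"
  shows "(\<Sum>L | length L = Suc j. c L * pds L (\<lambda>w. complex_of_real (w $ i) * H w) x) =
    complex_of_real (x $ i) * (\<Sum>L | length L = Suc j. c L * pds L H x) +
    of_nat (Suc j) * (\<Sum>L | length L = j. c (i # L) * pds L H x)"
  using assms
proof (induction j arbitrary: c H)
  case 0
  have pd: "pdiff a (\<lambda>w. complex_of_real (w $ i) * H w) x = complex_of_real (x $ i) * pdiff a H x + (if i = a then H x else 0)" for a
    using pdiff_mult[OF pdiff_component(1)[of a i x] smooth_pdiffable[OF 0(2), of a x]] pdiff_component(2)[of a i] by simp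
  show ?case
    unfolding sum_pds_Suc[OF smooth_mult[OF smooth_component 0(2)]] sum_pds_Suc[OF 0(2)]
    by (simp add: pd distrib_left sum.distrib sum_distrib_left mult.left_commute[of "complex_of_real _"] if_distrib[of "\<lambda>z. _ * z"] cong: if_cong)
next
  case (Suc j)
  note c = Suc.prems(1) and H = Suc.prems(2)
  have pd: "pdiff a (\<lambda>w. complex_of_real (w $ i) * H w) = (\<lambda>x. complex_of_real (x $ i) * pdiff a H x + (if i = a then H x else 0))" for a
    using pdiff_mult[OF pdiff_component(1)[of a i] smooth_pdiffable[OF H, of a]] pdiff_component(2)[of a i] by (simp add: fun_eq_iff)
  have pa: "pds M (\<lambda>x. f x + g x) = (\<lambda>x. pds M f x + pds M g x)" if "smooth f" "smooth g" for M and f g :: "'n rn \<Rightarrow> complex"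
    by (rule pds_add[OF that])
  have sy: "symm_coeff (\<lambda>L. c (a # L))" for a using c by (simp add: symm_coeff_def)
  have ex: "c (a # i # L) = c (i # a # L)" for a L using c by (simp add: symm_coeff_def)
  define B where "B a = (\<Sum>L | length L = Suc j. c (a # L) * pds L (\<lambda>x. complex_of_real (x $ i) * pdiff a H x) x)" for a
  have "(\<Sum>L | length L = Suc j. c (a # L) * pds L (pdiff a (\<lambda>w. complex_of_real (w $ i) * H w)) x) =
      B a + (if i = a then \<Sum>L | length L = Suc j. c (a # L) * pds L H x else 0)" for a
    unfolding pd B_def by (simp add: pa smooth_mult smooth_component smooth_pdiff H distrib_left sum.distrib)
  then have "(\<Sum>L | length L = Suc (Suc j). c L * pds L (\<lambda>w. complex_of_real (w $ i) * H w) x) =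
      (\<Sum>a\<in>UNIV. B a) + (\<Sum>L | length L = Suc j. c (i # L) * pds L H x)"
    unfolding sum_pds_Suc[OF smooth_mult[OF smooth_component H]] by (simp add: sum.distrib)
  also have "(\<Sum>a\<in>UNIV. B a) = complex_of_real (x $ i) * (\<Sum>L | length L = Suc (Suc j). c L * pds L H x) +
     of_nat (Suc j) * (\<Sum>L | length L = Suc j. c (i # L) * pds L H x)"
    unfolding B_def Suc.IH[OF sy smooth_pdiff[OF H]] sum_pds_Suc[OF H] ex
    by (simp add: sum.distrib sum_distrib_left)
  finally show ?case by (simp add: algebra_simps)
qed

text \<open>A monomial picks a single coefficient out of a Taylor sum. With c the derivatives of a
  symbol, this reduces the whole expansion of the left side of the operator identity to one
  derivative.\<close>

lemma sum_pds_monom_list: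
  assumes "symm_coeff c"
  shows "(\<Sum>L | length L = j. c L * pds L (\<lambda>w :: 'n::finite rn. complex_of_real (monom_list G w)) 0) =
    (if j = length G then fact j * c G else 0)"
  using assms
proof (induction G arbitrary: c j)
  case Nil
  have "(\<Sum>L | length L = Suc j. c L * pds L (\<lambda>w :: 'n rn. complex_of_real (monom_list [] w)) 0) = 0" for j
  proof -
    have z: "pds L (\<lambda>w :: 'n rn. 0 :: complex) = (\<lambda>w. 0)" for L by (induction L) (auto simp: pdiff_const)
    show ?thesis using sum_pds_Suc[OF smooth_monom_list[of "[]"], where j = j and c = c and x = 0] by (simp add: pdiff_const z)
  qed
  then show ?case by (cases j) auto
next
  case (Cons i G)
  have sy: "symm_coeff (\<lambda>L. c (i # L))" using Cons.prems by (simp add: symm_coeff_def)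
  show ?case
  proof (cases j)
    case (Suc j')
    have "(\<Sum>L | length L = Suc j'. c L * pds L (\<lambda>w :: 'n rn. complex_of_real (monom_list (i # G) w)) 0) =
      of_nat (Suc j') * (\<Sum>L | length L = j'. c (i # L) * pds L (\<lambda>w. complex_of_real (monom_list G w)) 0)"
      using sum_pds_mult_component[OF Cons.prems smooth_monom_list[of G], where j = j' and i = i and x = 0] by simp
    then show ?thesis unfolding Suc Cons.IH[OF sy] by (simp add: Suc)
  qed auto
qed

section \<open>Dilations of tempered families\<close>

context holder_class
begin

text \<open>The case N = 1 of \<open>hol_taylor\<close>, along the segment from 0 to
  \<open>z\<close>. From bounds on derivatives alone it yields linear growth, and also an additional
  order of vanishing at the origin.\<close>

lemma hol_mean_value:
  fixes R :: "'n::finite rn \<Rightarrow> 'n rn \<Rightarrow> complex"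
  assumes sm: "\<And>y. smooth (\<lambda>z. R z y)" and R0: "\<And>y. R 0 y = 0"
    and bd: "\<And>i \<theta>. 0 \<le> \<theta> \<Longrightarrow> \<theta> \<le> 1 \<Longrightarrow> hol r sg B (\<lambda>y. pdiff i (\<lambda>z. R z y) (\<theta> *\<^sub>R z))"
  shows "hol r sg (real CARD('n) * (norm z * B)) (R z)"
proof -
  define g where "g j \<theta> y = (if j = 0 then R (\<theta> *\<^sub>R z) y else \<Sum>i\<in>UNIV. z $ i *\<^sub>R pdiff i (\<lambda>z. R z y) (\<theta> *\<^sub>R z))"
    for j :: nat and \<theta> y
  have B: "0 \<le> B" by (rule hol_nonneg[OF bd[of 0]]) auto
  have "hol r sg (real CARD('n) * (norm z * B)) (\<lambda>y. g 0 1 y - (\<Sum>j<1. g j 0 y / of_real (fact j)))"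
  proof (rule hol_taylor[where g = g])
    fix j :: nat and \<theta> :: real and y assume "j < 1"
    have "((\<lambda>\<theta>. pds [] (\<lambda>z. R z y) (\<theta> *\<^sub>R z)) has_vector_derivative
        (\<Sum>i\<in>UNIV. z $ i *\<^sub>R pds (i # []) (\<lambda>z. R z y) (\<theta> *\<^sub>R z))) (at \<theta>)"
      by (intro pds_curve sm) (auto intro!: derivative_eq_intros)
    then show "((\<lambda>\<theta>. g j \<theta> y) has_vector_derivative g (Suc j) \<theta> y) (at \<theta>)"
      using \<open>j < 1\<close> unfolding g_def by simp
  next
    fix y
    have "continuous_on UNIV (pdiff i (\<lambda>z. R z y))" for i
      using smooth_pd1[OF sm] unfolding pd1_def by blast
    then have "continuous_on {0..1} (\<lambda>\<theta>. pdiff i (\<lambda>z. R z y) (\<theta> *\<^sub>R z))" for i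
      by (rule continuous_on_compose2) (auto intro!: continuous_intros)
    then show "continuous_on {0..1} (\<lambda>\<theta>. g 1 \<theta> y)" unfolding g_def by (auto intro!: continuous_intros)
  next
    fix \<theta> :: real assume \<theta>: "0 \<le> \<theta>" "\<theta> \<le> 1"
    have "hol r sg (\<Sum>i\<in>(UNIV :: 'n set). norm z * B) (\<lambda>y. \<Sum>i\<in>UNIV. complex_of_real (z $ i) * pdiff i (\<lambda>z. R z y) (\<theta> *\<^sub>R z))"
    proof (rule hol_sum)
      fix i
      have "cmod (complex_of_real (z $ i)) * B \<le> norm z * B"
        using component_le_norm_cart[of z i] B by (intro mult_right_mono) auto
      then show "hol r sg (norm z * B) (\<lambda>y. complex_of_real (z $ i) * pdiff i (\<lambda>z. R z y) (\<theta> *\<^sub>R z))"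
        by (rule hol_mono[OF hol_cmult[OF bd[OF \<theta>]]])
    qed
    then show "hol r sg (real CARD('n) * (norm z * B)) (g 1 \<theta>)"
      unfolding g_def by (simp add: scaleR_conv_of_real[of _ "_ :: complex"])
  qed auto
  then show ?thesis unfolding g_def by (simp add: R0)
qed

lemma tempered_bounded_scalar:
  assumes "\<And>t. 1 \<le> \<bar>t\<bar> \<Longrightarrow> cmod (c t) \<le> B"
  shows "tempered (\<lambda>t (w :: 'n::finite rn) y. c t)"
proof (rule tempered_of_base_const)
  have "\<forall>t (w :: 'n rn). 1 \<le> \<bar>t\<bar> \<longrightarrow> hol r sg (B * (1 + norm w) ^ 0) (\<lambda>y :: 'n rn. c t)"
    using hol_mono[OF hol_const assms] by auto
  then have "\<exists>C d. \<forall>t (w :: 'n rn). 1 \<le> \<bar>t\<bar> \<longrightarrow> hol r sg (C * (1 + norm w) ^ d) (\<lambda>y :: 'n rn. c t)" by blast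
  then show "tempered_base (\<lambda>t (w :: 'n rn) y. c t)" unfolding tempered_base_def by auto
qed

lemma tempered_hol_bdd:
  assumes "hol_bdd c" shows "tempered (\<lambda>t (w :: 'n::finite rn) y. c y)"
proof (rule tempered_of_base_const)
  obtain B where "hol r sg B c" using assms unfolding hol_bdd_def by blast
  then have "\<forall>t w. 1 \<le> \<bar>t\<bar> \<longrightarrow> hol r sg (B * (1 + norm w) ^ 0) c" by simp
  then have "\<exists>C d. \<forall>t (w :: 'n rn). 1 \<le> \<bar>t\<bar> \<longrightarrow> hol r sg (C * (1 + norm w) ^ d) c" by blast
  then show "tempered_base (\<lambda>t (w :: 'n rn) y. c y)" unfolding tempered_base_def by auto
qed

lemma tempered_component: "tempered (\<lambda>t (w :: 'n::finite rn) y. complex_of_real (w $ i))"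
proof (rule temperedI)
  have "hol r sg (1 * (1 + norm w) ^ 1) (\<lambda>y :: 'n rn. complex_of_real (w $ i))" for w :: "'n rn"
    using component_le_norm_cart[of w i] by (intro hol_mono[OF hol_const]) auto
  then show "tempered_base (\<lambda>t (w :: 'n rn) y. complex_of_real (w $ i))"
    unfolding tempered_base_def by (intro conjI exI[of _ 1] allI impI continuous_intros) auto
  have "pdw j (\<lambda>t (w :: 'n rn) y. complex_of_real (w $ i)) = (\<lambda>t w y. if i = j then 1 else 0)" for j
    unfolding pdw_def pdiff_component(2) by simp
  then show "tempered (pdw j (\<lambda>t (w :: 'n rn) y. complex_of_real (w $ i)))" for j
    using tempered_const[of "if i = j then 1 else 0"] by simp
qed (rule pdiff_component)

lemma tempered_prod_list:
  "(\<And>i. i \<in> set L \<Longrightarrow> tempered (G i)) \<Longrightarrow> tempered (\<lambda>t w y. prod_list (map (\<lambda>i. G i t w y) L))"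
  by (induction L) (auto intro: tempered_const tempered_mult)

lemma inverse_sqrt_bounds:
  assumes "1 \<le> \<bar>t\<bar>"
  shows "0 < inverse (sqrt \<bar>t\<bar>)" "inverse (sqrt \<bar>t\<bar>) \<le> 1" "norm (inverse (sqrt \<bar>t\<bar>) *\<^sub>R w) \<le> norm w"
    "sqrt \<bar>t\<bar> * norm (inverse (sqrt \<bar>t\<bar>) *\<^sub>R w) = norm w"
proof -
  have "1 \<le> sqrt \<bar>t\<bar>" using assms by simp
  then have "0 < inverse (sqrt \<bar>t\<bar>)" "inverse (sqrt \<bar>t\<bar>) \<le> 1" by (auto intro: inverse_le_1_iff[THEN iffD2])
  then show "0 < inverse (sqrt \<bar>t\<bar>)" "inverse (sqrt \<bar>t\<bar>) \<le> 1" "norm (inverse (sqrt \<bar>t\<bar>) *\<^sub>R w) \<le> norm w"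
    using mult_right_mono[of "inverse (sqrt \<bar>t\<bar>)" 1 "norm w"] by auto
  show "sqrt \<bar>t\<bar> * norm (inverse (sqrt \<bar>t\<bar>) *\<^sub>R w) = norm w" using \<open>1 \<le> sqrt \<bar>t\<bar>\<close> by (simp add: mult.assoc[symmetric])
qed

lemma tempered_continuous: "tempered G \<Longrightarrow> 1 \<le> \<bar>t\<bar> \<Longrightarrow> continuous_on UNIV (\<lambda>w. G t w y)"
  using temperedD(1) unfolding tempered_base_def by blast

lemma tempered_continuous_scale:
  "tempered (\<lambda>t. R) \<Longrightarrow> continuous_on UNIV (\<lambda>w. R (c *\<^sub>R w) y)"
  by (rule continuous_on_compose2[OF tempered_continuous[of "\<lambda>t. R" 1 y]]) (auto intro!: continuous_intros)

lemma tempered_hol: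
  fixes R :: "'n::finite rn \<Rightarrow> 'n rn \<Rightarrow> complex"
  assumes "tempered (\<lambda>t. R)"
  obtains C d where "0 < C" "\<forall>z. hol r sg (C * (1 + norm z) ^ d) (R z)"
proof (rule tempered_baseD[OF temperedD(1)[OF assms]])
  fix C d assume C: "0 < C" "\<And>(t :: real) w. 1 \<le> \<bar>t\<bar> \<Longrightarrow> hol r sg (C * (1 + norm w) ^ d) (R w)"
  show thesis by (rule that[OF C(1)]) (use C(2)[of 1] in auto)
qed

text \<open>Dilations preserve tempered families, and the order of vanishing at the origin is
  compensated by the matching power of \<open>|t|\<close>.\<close>

lemma tempered_scale:
  fixes R :: "'n::finite rn \<Rightarrow> 'n rn \<Rightarrow> complex"
  assumes "tempered (\<lambda>t. R)"
  shows "tempered (\<lambda>t w y. R (inverse (sqrt \<bar>t\<bar>) *\<^sub>R w) y)"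
proof -
  have base: "tempered_base (\<lambda>t w y. R (inverse (sqrt \<bar>t\<bar>) *\<^sub>R w) y)"
    if R: "tempered (\<lambda>t. R)" for R :: "'n rn \<Rightarrow> 'n rn \<Rightarrow> complex"
  proof -
    obtain C d where C: "C > 0" "\<forall>w. hol r sg (C * (1 + norm w) ^ d) (R w)" by (rule tempered_hol[OF R])
    have "C * (1 + norm (inverse (sqrt \<bar>t\<bar>) *\<^sub>R w)) ^ d \<le> C * (1 + norm w) ^ d" if t: "1 \<le> \<bar>t\<bar>" for t and w :: "'n rn"
      using inverse_sqrt_bounds(3)[OF t, of w] C(1) by (intro mult_left_mono power_mono) auto
    then have "\<forall>t w. 1 \<le> \<bar>t\<bar> \<longrightarrow> hol r sg (C * (1 + norm w) ^ d) (R (inverse (sqrt \<bar>t\<bar>) *\<^sub>R w))"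
      using hol_mono[OF C(2)[rule_format]] by simp
    then have "\<exists>C d. \<forall>t w. 1 \<le> \<bar>t\<bar> \<longrightarrow> hol r sg (C * (1 + norm w) ^ d) (R (inverse (sqrt \<bar>t\<bar>) *\<^sub>R w))"
      by (intro exI)
    then show ?thesis using tempered_continuous_scale[OF R] unfolding tempered_base_def by (intro conjI allI impI)
  qed
  have "tempered_upto j (\<lambda>t w y. R (inverse (sqrt \<bar>t\<bar>) *\<^sub>R w) y)" for j
    using assms
  proof (induction j arbitrary: R)
    case 0
    then show ?case using base by simp
  next
    case (Suc j)
    have d: "pdiffable_at i (\<lambda>w. R w y) x" for i x y
      using temperedD(2)[OF Suc.prems, of 1] by simp
    define R' where "R' i w y = pdiff i (\<lambda>w. R w y) w" for i w y
    have "tempered (\<lambda>t. R' i)" for i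
      using temperedD(3)[OF Suc.prems, of i] unfolding R'_def pdw_def .
    from Suc.IH[OF this] have t: "tempered_upto j (\<lambda>t w y. R' i (inverse (sqrt \<bar>t\<bar>) *\<^sub>R w) y)" for i .
    have "cmod (complex_of_real (inverse (sqrt \<bar>t\<bar>))) \<le> 1" if "1 \<le> \<bar>t\<bar>" for t
      using inverse_sqrt_bounds(1,2)[OF that] unfolding norm_of_real by simp
    from tempered_bounded_scalar[where c = "\<lambda>t. complex_of_real (inverse (sqrt \<bar>t\<bar>))" and ?'n = 'n, OF this]
    have "tempered_upto j (\<lambda>t (w :: 'n rn) y. complex_of_real (inverse (sqrt \<bar>t\<bar>)))"
      unfolding tempered_def by blast
    from tempered_upto_mult[OF this t]
    have "tempered_upto j (pdw i (\<lambda>t w y. R (inverse (sqrt \<bar>t\<bar>) *\<^sub>R w) y))" for i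
      unfolding pdw_def pdiff_scaleR(2)[OF d] R'_def scaleR_conv_of_real[of _ "_ :: complex"] .
    then show ?case using base[OF Suc.prems] pdiff_scaleR(1)[OF d] by simp
  qed
  then show ?thesis unfolding tempered_def by blast
qed

text \<open>Along the segment the factor |z|^k bounds the derivatives, and the mean value estimate
  contributes one more factor |z|. The constants are maximised over the finitely many
  directions.\<close>

lemma hol_bound_vanishing:
  fixes R :: "'n::finite rn \<Rightarrow> 'n rn \<Rightarrow> complex"
  assumes R: "tempered (\<lambda>t. R)" and R0: "\<And>y. R 0 y = 0"
    and d: "\<And>i. \<exists>C d. \<forall>z. hol r sg (C * norm z ^ k * (1 + norm z) ^ d) (\<lambda>y. pdiff i (\<lambda>z. R z y) z)"
  shows "\<exists>C d. \<forall>z. hol r sg (C * norm z ^ Suc k * (1 + norm z) ^ d) (R z)"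
proof -
  have "\<forall>i. \<exists>Cd. \<forall>z. hol r sg (fst Cd * norm z ^ k * (1 + norm z) ^ snd Cd) (\<lambda>y. pdiff i (\<lambda>z. R z y) z)"
    using d by simp
  from choice[OF this] obtain Cd where Cd: "\<And>i z. hol r sg (fst (Cd i) * norm z ^ k * (1 + norm z) ^ snd (Cd i)) (\<lambda>y. pdiff i (\<lambda>z. R z y) z)"
    by blast
  define C where "C = Max (range (\<lambda>i. \<bar>fst (Cd i)\<bar>))"
  define D where "D = Max (range (\<lambda>i. snd (Cd i)))"
  have CD: "\<bar>fst (Cd i)\<bar> \<le> C" "snd (Cd i) \<le> D" for i unfolding C_def D_def by (auto intro: Max_ge)
  have C0: "0 \<le> C" using CD(1)[of undefined] by linarith
  have "hol r sg (real CARD('n) * (norm z * (C * norm z ^ k * (1 + norm z) ^ D))) (R z)" for z :: "'n rn"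
  proof (rule hol_mean_value[where R = R, OF _ R0])
    show "smooth (\<lambda>z. R z y)" for y using tempered_smooth[OF R, of 1] by simp
    fix i and \<theta> :: real assume \<theta>: "0 \<le> \<theta>" "\<theta> \<le> 1"
    have n: "norm (\<theta> *\<^sub>R z) \<le> norm z" using \<theta> by (simp add: mult_left_le_one_le)
    have "fst (Cd i) * norm (\<theta> *\<^sub>R z) ^ k * (1 + norm (\<theta> *\<^sub>R z)) ^ snd (Cd i) \<le>
        C * norm (\<theta> *\<^sub>R z) ^ k * (1 + norm (\<theta> *\<^sub>R z)) ^ snd (Cd i)"
      using CD(1)[of i] by (intro mult_right_mono) auto
    also have "\<dots> \<le> C * norm z ^ k * (1 + norm z) ^ snd (Cd i)"
      using n C0 by (intro mult_mono power_mono mult_nonneg_nonneg) auto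
    also have "\<dots> \<le> C * norm z ^ k * (1 + norm z) ^ D"
      using C0 CD(2)[of i] by (intro mult_left_mono power_increasing mult_nonneg_nonneg) auto
    finally show "hol r sg (C * norm z ^ k * (1 + norm z) ^ D) (\<lambda>y. pdiff i (\<lambda>z. R z y) (\<theta> *\<^sub>R z))"
      by (rule hol_mono[OF Cd])
  qed
  moreover have "real CARD('n) * (norm z * (C * norm z ^ k * (1 + norm z) ^ D)) =
      real CARD('n) * C * norm z ^ Suc k * (1 + norm z) ^ D" for z :: "'n rn" by simp
  ultimately have "hol r sg (real CARD('n) * C * norm z ^ Suc k * (1 + norm z) ^ D) (R z)" for z :: "'n rn" by (simp only:)
  then show ?thesis by blast
qed

lemma tempered_pdiff:
  assumes "tempered (\<lambda>t. R)"
  shows "tempered (\<lambda>t w y. pdiff i (\<lambda>w. R w y) w)"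
  using temperedD(3)[OF assms, of i] unfolding pdw_def .

text \<open>With z = w / sqrt |t| the product sqrt |t| |z| is |w|, so a zero of order
  \<open>Suc k\<close> compensates the prefactor. A derivative in \<open>w\<close> brings out 1 /
  sqrt |t| and leaves the exponent \<open>k\<close> in front of the derivative of
  \<open>R\<close>.\<close>

lemma tempered_scale_power:
  fixes R :: "'n::finite rn \<Rightarrow> 'n rn \<Rightarrow> complex"
  assumes R: "tempered (\<lambda>t. R)"
    and bd: "\<exists>C d. \<forall>z. hol r sg (C * norm z ^ Suc k * (1 + norm z) ^ d) (R z)"
    and d: "\<And>i. tempered (\<lambda>t w y. complex_of_real (sqrt \<bar>t\<bar> ^ k) * pdiff i (\<lambda>w. R w y) (inverse (sqrt \<bar>t\<bar>) *\<^sub>R w))"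
  shows "tempered (\<lambda>t w y. complex_of_real (sqrt \<bar>t\<bar> ^ Suc k) * R (inverse (sqrt \<bar>t\<bar>) *\<^sub>R w) y)"
proof (rule temperedI)
  obtain C d where C: "\<And>z. hol r sg (C * norm z ^ Suc k * (1 + norm z) ^ d) (R z)" using bd by blast
  \<comment> \<open>Read off at a unit vector, where the radius is C 2^d; at z = 0 the radius
    vanishes and carries no information.\<close>
  have C0: "0 \<le> C" by (rule nonneg_of_mult_pos[of _ "2 ^ d"]) (use hol_nonneg[OF C[of "axis undefined 1"]] in \<open>auto simp: norm_axis_1\<close>)
  have "hol r sg (C * (1 + norm w) ^ (Suc k + d)) (\<lambda>y. complex_of_real (sqrt \<bar>t\<bar> ^ Suc k) * R (inverse (sqrt \<bar>t\<bar>) *\<^sub>R w) y)"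
    if t: "1 \<le> \<bar>t\<bar>" for t and w :: "'n rn"
  proof (rule hol_mono[OF hol_cmult[OF C]])
    let ?z = "inverse (sqrt \<bar>t\<bar>) *\<^sub>R w"
    have "cmod (complex_of_real (sqrt \<bar>t\<bar> ^ Suc k)) = sqrt \<bar>t\<bar> ^ Suc k"
      unfolding norm_of_real using t by (intro abs_of_nonneg zero_le_power) auto
    then have "cmod (complex_of_real (sqrt \<bar>t\<bar> ^ Suc k)) * (C * norm ?z ^ Suc k * (1 + norm ?z) ^ d) =
       C * (sqrt \<bar>t\<bar> * norm ?z) ^ Suc k * (1 + norm ?z) ^ d" unfolding power_mult_distrib by (simp only: mult_ac)
    also have "\<dots> = C * norm w ^ Suc k * (1 + norm ?z) ^ d" unfolding inverse_sqrt_bounds(4)[OF t] ..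
    also have "\<dots> \<le> C * (1 + norm w) ^ Suc k * (1 + norm w) ^ d"
      using inverse_sqrt_bounds(3)[OF t, of w] C0 by (intro mult_mono power_mono mult_nonneg_nonneg) auto
    finally show "cmod (complex_of_real (sqrt \<bar>t\<bar> ^ Suc k)) * (C * norm ?z ^ Suc k * (1 + norm ?z) ^ d) \<le>
       C * (1 + norm w) ^ (Suc k + d)" by (simp only: power_add mult.assoc)
  qed
  then have "\<exists>C d. \<forall>t w. 1 \<le> \<bar>t\<bar> \<longrightarrow> hol r sg (C * (1 + norm w) ^ d)
      (\<lambda>y. complex_of_real (sqrt \<bar>t\<bar> ^ Suc k) * R (inverse (sqrt \<bar>t\<bar>) *\<^sub>R w) y)" by blast
  then show "tempered_base (\<lambda>t w y. complex_of_real (sqrt \<bar>t\<bar> ^ Suc k) * R (inverse (sqrt \<bar>t\<bar>) *\<^sub>R w) y)"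
    using tempered_continuous_scale[OF R] unfolding tempered_base_def by (auto intro!: continuous_on_mult continuous_on_const simp del: power_Suc)
  have pd: "pdiffable_at i (\<lambda>w. R w y) x" for i x y using temperedD(2)[OF R, of 1] by simp
  have bl: "bounded_linear (\<lambda>x. c * x)" for c :: complex by (rule bounded_linear_mult_right)
  show "pdiffable_at i (\<lambda>w. complex_of_real (sqrt \<bar>t\<bar> ^ Suc k) * R (inverse (sqrt \<bar>t\<bar>) *\<^sub>R w) y) w" for i t w y
    by (intro pdiffable_linear[OF bl] pdiff_scaleR(1) pd)
  show "tempered (pdw i (\<lambda>t w y. complex_of_real (sqrt \<bar>t\<bar> ^ Suc k) * R (inverse (sqrt \<bar>t\<bar>) *\<^sub>R w) y))" for i
  proof (rule tempered_cong[OF d[of i]])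
    fix t :: real assume t: "1 \<le> \<bar>t\<bar>"
    then have "complex_of_real (sqrt \<bar>t\<bar>) * complex_of_real (inverse (sqrt \<bar>t\<bar>)) = 1"
      by (simp add: of_real_mult[symmetric] del: of_real_mult)
    then have "complex_of_real (sqrt \<bar>t\<bar> ^ Suc k) * (complex_of_real (inverse (sqrt \<bar>t\<bar>)) * x) = complex_of_real (sqrt \<bar>t\<bar> ^ k) * x" for x
      by (simp add: mult_ac)
    then show "(\<lambda>w y. complex_of_real (sqrt \<bar>t\<bar> ^ k) * pdiff i (\<lambda>w. R w y) (inverse (sqrt \<bar>t\<bar>) *\<^sub>R w)) =
      pdw i (\<lambda>t w y. complex_of_real (sqrt \<bar>t\<bar> ^ Suc k) * R (inverse (sqrt \<bar>t\<bar>) *\<^sub>R w) y) t"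
      unfolding pdw_def pdiff_linear[OF bl pdiff_scaleR(1)[OF pd]] pdiff_scaleR(2)[OF pd]
      by (simp add: scaleR_conv_of_real[of _ "_ :: complex"] fun_eq_iff)
  qed
qed

lemma tempered_scale_vanishing:
  fixes R :: "'n::finite rn \<Rightarrow> 'n rn \<Rightarrow> complex"
  assumes R: "tempered (\<lambda>t. R)" and R0: "\<And>y. R 0 y = 0"
  shows "tempered (\<lambda>t w y. complex_of_real (sqrt \<bar>t\<bar>) * R (inverse (sqrt \<bar>t\<bar>) *\<^sub>R w) y)"
    "\<exists>C d. \<forall>z. hol r sg (C * norm z ^ 1 * (1 + norm z) ^ d) (R z)"
proof -
  have b: "\<exists>C d. \<forall>z. hol r sg (C * norm z ^ Suc 0 * (1 + norm z) ^ d) (R z)"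
  proof (rule hol_bound_vanishing[OF R R0])
    fix i
    obtain C d where "\<forall>z. hol r sg (C * (1 + norm z) ^ d) (\<lambda>y. pdiff i (\<lambda>z. R z y) z)"
      by (rule tempered_hol[OF tempered_pdiff[OF R]])
    then show "\<exists>C d. \<forall>z. hol r sg (C * norm z ^ 0 * (1 + norm z) ^ d) (\<lambda>y. pdiff i (\<lambda>z. R z y) z)"
      by (intro exI[of _ C] exI[of _ d]) simp
  qed
  then show "\<exists>C d. \<forall>z. hol r sg (C * norm z ^ 1 * (1 + norm z) ^ d) (R z)" by simp
  show "tempered (\<lambda>t w y. complex_of_real (sqrt \<bar>t\<bar>) * R (inverse (sqrt \<bar>t\<bar>) *\<^sub>R w) y)"
    using tempered_scale_power[OF R b] tempered_scale[OF tempered_pdiff[OF R]] by simp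
qed

text \<open>The first order case is applied to the derivatives of \<open>R\<close>, which vanish at
  0 by assumption. This is the form needed for the phase: a second order zero absorbs a full factor
  |t|.\<close>

lemma tempered_scale_vanishing2:
  fixes R :: "'n::finite rn \<Rightarrow> 'n rn \<Rightarrow> complex"
  assumes R: "tempered (\<lambda>t. R)" and R0: "\<And>y. R 0 y = 0" and R1: "\<And>i y. pdiff i (\<lambda>z. R z y) 0 = 0"
  shows "tempered (\<lambda>t w y. complex_of_real \<bar>t\<bar> * R (inverse (sqrt \<bar>t\<bar>) *\<^sub>R w) y)"
proof -
  note v = tempered_scale_vanishing[OF tempered_pdiff[OF R] R1]
  have "tempered (\<lambda>t w y. complex_of_real (sqrt \<bar>t\<bar> ^ Suc 1) * R (inverse (sqrt \<bar>t\<bar>) *\<^sub>R w) y)"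
    by (rule tempered_scale_power[OF R hol_bound_vanishing[OF R R0 v(2)]]) (use v(1) in simp)
  then show ?thesis by (simp add: power2_eq_square flip: of_real_mult)
qed

end

section \<open>Diffeomorphisms of the half space\<close>

lemma finite_lists_length_atMost: "finite {L :: 'n::finite list. length L \<le> k}"
  using finite_lists_length_le[of "UNIV :: 'n set" k] by simp

lemma uniform_bound_lists:
  assumes "\<And>L :: 'n::finite list. \<exists>B. \<forall>x. cmod (F L x) \<le> B"
  shows "\<exists>B\<ge>0. \<forall>L x. length L \<le> k \<longrightarrow> cmod (F L x) \<le> B"
proof -
  have "\<forall>L. \<exists>B. \<forall>x. cmod (F L x) \<le> B" using assms ..
  from choice[OF this] obtain B where B: "\<And>L x. cmod (F L x) \<le> B L" by blast
  have "cmod (F L x) \<le> Max ((\<lambda>L. \<bar>B L\<bar>) ` {L. length L \<le> k})" if "length L \<le> k" for L x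
  proof -
    have "\<bar>B L\<bar> \<le> Max ((\<lambda>L. \<bar>B L\<bar>) ` {L. length L \<le> k})"
      using that by (intro Max_ge finite_imageI finite_lists_length_atMost) auto
    then show ?thesis using B[of L x] by linarith
  qed
  moreover have "0 \<le> Max ((\<lambda>L. \<bar>B L\<bar>) ` {L. length L \<le> k})"
    using calculation[of "[]"] norm_ge_zero order_trans by (metis list.size(3) zero_le)
  ultimately show ?thesis by blast
qed

lemma bounded_pds_component:
  fixes k :: "'n::{finite,linorder} rn \<Rightarrow> 'n rn"
  assumes "smooth k" "\<And>\<alpha>. mi_order \<alpha> \<ge> 1 \<Longrightarrow> bounded (range (mdiff \<alpha> k))" "L \<noteq> []"
  shows "\<exists>B. \<forall>x. cmod (pds L (\<lambda>x. complex_of_real (k x $ j)) x) \<le> B"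
proof -
  have "mi_order (list_mi L) \<ge> 1" using assms(3) by (cases L) (auto simp: mi_order_list_mi)
  from assms(2)[OF this] obtain B where B: "\<And>x. norm (pds L k x) \<le> B"
    using assms(1) unfolding smooth_Ck bounded_iff by (auto simp: mdiff_list_mi)
  have "pds L (\<lambda>x. complex_of_real (k x $ j)) = (\<lambda>x. complex_of_real (pds L k x $ j))"
    by (rule pds_linear[OF bounded_linear_complex_component assms(1)])
  moreover have "cmod (complex_of_real (pds L k x $ j)) \<le> B" for x
    using component_le_norm_cart[of "pds L k x" j] B[of x] by simp
  ultimately show ?thesis by auto
qed

context holder_exponent
begin

lemma hol_translates:
  fixes f :: "'n::finite rn \<Rightarrow> complex"
  assumes "smooth f" "\<And>L. \<exists>B. \<forall>x. cmod (pds L f x) \<le> B"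
  shows "\<exists>A. \<forall>z. hol r sg A (\<lambda>x. f (z + x))"
proof -
  obtain B where B: "\<And>L x. length L \<le> Suc r \<Longrightarrow> cmod (pds L f x) \<le> B"
    using uniform_bound_lists[of "\<lambda>L. pds L f" "Suc r"] assms(2) by blast
  have "Ck (Suc r) (\<lambda>x. f (x + z))" for z using smooth_translate[OF assms(1)] unfolding smooth_Ck by blast
  from hol_of_bounded[OF this] have "hol r sg ((real CARD('n) + 2) * B) (\<lambda>x. f (x + z))" for z
    unfolding pds_translate using B by blast
  then have "hol r sg ((real CARD('n) + 2) * B) (\<lambda>x. f (z + x))" for z by (subst add.commute)
  then show ?thesis by blast
qed

lemma bdm_of_bounded:
  fixes k :: "'n::{finite,linorder} rn \<Rightarrow> 'n rn"
  assumes k: "smooth k" "\<And>\<alpha>. mi_order \<alpha> \<ge> 1 \<Longrightarrow> bounded (range (mdiff \<alpha> k))"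
  shows "bdm k"
  unfolding bdm_def
proof (intro conjI allI)
  have sc: "smooth (\<lambda>x. complex_of_real (k x $ j))" for j
    by (rule smooth_linear[OF bounded_linear_complex_component k(1)])
  show d: "pdiffable_at i (\<lambda>x. k x $ j) x" for i j x
    by (rule pdiffable_linear[OF bounded_linear_vec_nth smooth_pdiffable[OF k(1)]])
  have e: "pdiff i (\<lambda>x. complex_of_real (k x $ j)) = (\<lambda>x. complex_of_real (pdiff i (\<lambda>x. k x $ j) x))" for i j
    by (intro ext pdiff_linear[OF bounded_linear_of_real d])
  fix r
  have "\<exists>A. hol r sg A (\<lambda>x. complex_of_real (pdiff i (\<lambda>x. k x $ j) x))" for i j
  proof -
    have "\<exists>B. \<forall>x. cmod (pds L (pdiff i (\<lambda>x. complex_of_real (k x $ j))) x) \<le> B" for L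
      using bounded_pds_component[OF k, of "L @ [i]" j] by simp
    from hol_translates[OF smooth_pdiff[OF sc] this, of r]
    obtain A where "\<forall>z. hol r sg A (\<lambda>x. pdiff i (\<lambda>x. complex_of_real (k x $ j)) (z + x))" by blast
    from this[rule_format, of 0] show ?thesis unfolding e by auto
  qed
  then have "\<forall>ij. \<exists>A. hol r sg A (\<lambda>x. complex_of_real (pdiff (fst ij) (\<lambda>x. k x $ snd ij) x))" by blast
  from choice[OF this] obtain A where A: "\<And>i j. hol r sg (A (i, j)) (\<lambda>x. complex_of_real (pdiff i (\<lambda>x. k x $ j) x))"
    by (metis fst_conv snd_conv)
  have "hol r sg (Max (range A)) (\<lambda>x. complex_of_real (pdiff i (\<lambda>x. k x $ j) x))" for i j
    by (rule hol_mono[OF A]) simp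
  then show "\<exists>A. \<forall>i j. hol r sg A (\<lambda>x. complex_of_real (pdiff i (\<lambda>x. k x $ j) x))" by blast
qed

lemma bdm_proj: "bdm (proj (I :: 'n::finite set))"
  unfolding bdm_def
proof (intro conjI allI)
  have d: "((\<lambda>t. proj I (x + t *\<^sub>R axis i 1) $ j) has_vector_derivative (if j \<in> I \<and> i = j then 1 else 0)) (at 0)" for i j :: 'n and x
    by (cases "j \<in> I") (auto simp: axis_def intro!: derivative_eq_intros)
  show "pdiffable_at i (\<lambda>x. proj I x $ j) x" for i j x by (rule pdiffable_atI[OF d])
  have e: "pdiff i (\<lambda>x. proj I x $ j) x = (if j \<in> I \<and> i = j then 1 else 0)" for i j x by (rule pdiff_eqI[OF d])
  show "\<exists>A. \<forall>i j. hol r sg A (\<lambda>x. complex_of_real (pdiff i (\<lambda>x. proj I x $ j) x))" for r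
    unfolding e by (intro exI[of _ 1] allI hol_mono[OF hol_const]) auto
qed

end

locale half_space_diffeo = holder_class sg r for sg r +
  fixes \<kappa> :: "'n::{finite,linorder} rn \<Rightarrow> 'n rn"
  assumes diffeo: "bounded_smooth_diffeo \<kappa>"
    and boundary: "\<kappa> ` {x. x $ last_coord = 0} = {x. x $ last_coord = 0}"
    and inside: "\<kappa> ` {x. x $ last_coord > 0} = {x. x $ last_coord > 0}"
begin

lemma kappa_facts: "bij \<kappa>" "smooth \<kappa>" "smooth (inv \<kappa>)"
  "\<And>\<alpha>. mi_order \<alpha> \<ge> 1 \<Longrightarrow> bounded (range (mdiff \<alpha> \<kappa>))"
  "\<And>\<alpha>. mi_order \<alpha> \<ge> 1 \<Longrightarrow> bounded (range (mdiff \<alpha> (inv \<kappa>)))"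
  using diffeo unfolding bounded_smooth_diffeo_def by blast+

lemma kappa_inv [simp]: "\<kappa> (inv \<kappa> x) = x" "inv \<kappa> (\<kappa> x) = x"
  using kappa_facts(1) by (auto simp: bij_def surj_f_inv_f)

lemma kappa_boundary: "x $ last_coord = 0 \<Longrightarrow> \<kappa> x $ last_coord = 0"
  "x $ last_coord = 0 \<Longrightarrow> inv \<kappa> x $ last_coord = 0"
  "x $ last_coord > 0 \<Longrightarrow> inv \<kappa> x $ last_coord > 0"
  using boundary inside kappa_inv(2) by (auto simp: set_eq_iff image_iff) (metis kappa_inv)+

text \<open>This is the map k of the overview, and \<open>normal_slope\<close> is its function a.
  Composition with \<open>proj\<close> extends them from the boundary to the whole space, where
  \<open>hol\<close> is defined.\<close>

definition base_point :: "'n rn \<Rightarrow> 'n rn" where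
  "base_point y = inv \<kappa> (proj tan_coords y)"

definition normal_slope :: "'n rn \<Rightarrow> real" where
  "normal_slope y = pdiff last_coord (\<lambda>x. \<kappa> x $ last_coord) (base_point y)"

lemma base_point_last: "base_point y $ last_coord = 0" and kappa_base_point: "\<kappa> (base_point y) = proj tan_coords y"
  unfolding base_point_def by (auto intro: kappa_boundary)

lemma hol_base_point: "\<exists>C>0. \<forall>B f. hol k sg B f \<longrightarrow> hol k sg (C * B) (\<lambda>y. f (base_point y))"
proof -
  obtain C where C: "C > 0" "\<forall>B f. hol k sg B f \<longrightarrow> hol k sg (C * B) (\<lambda>x. f (inv \<kappa> x))"
    using hol_comp[OF bdm_of_bounded[OF kappa_facts(3,5)], of k] by blast
  obtain D where D: "D > 0" "\<forall>B f. hol k sg B f \<longrightarrow> hol k sg (D * B) (\<lambda>x :: 'n rn. f (proj tan_coords x))"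
    using hol_comp[OF bdm_proj, of k tan_coords] by blast
  have "hol k sg (D * C * B) (\<lambda>y. f (base_point y))" if "hol k sg B f" for B f
    using D(2)[rule_format, OF C(2)[rule_format, OF that]] unfolding base_point_def by (simp add: mult.assoc)
  then show ?thesis using C(1) D(1) by (intro exI[of _ "D * C"]) auto
qed

definition kappa_c :: "'n \<Rightarrow> 'n rn \<Rightarrow> complex" where
  "kappa_c j x = complex_of_real (\<kappa> x $ j)"

lemma smooth_kappa_c: "smooth (kappa_c j)"
  unfolding kappa_c_def by (rule smooth_linear[OF bounded_linear_complex_component kappa_facts(2)])

lemma pdiffable_kappa: "pdiffable_at i (\<lambda>x. \<kappa> x $ j) x"
  by (rule pdiffable_linear[OF bounded_linear_vec_nth smooth_pdiffable[OF kappa_facts(2)]])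

lemma pdiff_kappa_c: "pdiff i (kappa_c j) x = complex_of_real (pdiff i (\<lambda>x. \<kappa> x $ j) x)"
  unfolding kappa_c_def by (rule pdiff_linear[OF bounded_linear_of_real pdiffable_kappa])

lemma hol_kappa_translates:
  assumes "L \<noteq> []"
  shows "\<exists>A. \<forall>z. hol k sg A (\<lambda>y. pds L (kappa_c j) (z + base_point y))"
proof -
  have "\<exists>B. \<forall>x. cmod (pds L' (pds L (kappa_c j)) x) \<le> B" for L'
    using bounded_pds_component[OF kappa_facts(2,4), of "L' @ L" j] assms unfolding kappa_c_def by simp
  from hol_translates[OF smooth_pds[OF smooth_kappa_c] this, of k]
  obtain A where A: "\<forall>z. hol k sg A (\<lambda>x. pds L (kappa_c j) (z + x))" by blast
  obtain C where "\<forall>B f. hol k sg B f \<longrightarrow> hol k sg (C * B) (\<lambda>y. f (base_point y))"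
    using hol_base_point[of k] by blast
  then have "\<forall>z. hol k sg (C * A) (\<lambda>y. pds L (kappa_c j) (z + base_point y))" using A by blast
  then show ?thesis by blast
qed

lemma pdiff_kappa_tangential:
  assumes "x $ last_coord = 0" "i \<noteq> last_coord"
  shows "pdiff i (\<lambda>x. \<kappa> x $ last_coord) x = 0"
proof (rule pdiff_eqI)
  have "\<kappa> (x + t *\<^sub>R axis i 1) $ last_coord = 0" for t
    using assms by (intro kappa_boundary) (simp add: axis_def)
  then show "((\<lambda>t. \<kappa> (x + t *\<^sub>R axis i 1) $ last_coord) has_vector_derivative 0) (at 0)" by simp
qed

text \<open>In the chain rule for the normal component of \<kappa> after its inverse the tangential
  terms vanish, so the slope is the reciprocal of a normal derivative of the inverse. That
  derivative is bounded, and it is positive because the inverse maps the open half space to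
  itself.\<close>

lemma normal_slope_bounds: "\<exists>c0 c1. 0 < c0 \<and> (\<forall>y. c0 \<le> normal_slope y \<and> normal_slope y \<le> c1)"
proof -
  let ?n = "last_coord :: 'n"
  obtain B where B: "\<And>x. cmod (pds [?n] (\<lambda>x. complex_of_real (inv \<kappa> x $ ?n)) x) \<le> B"
    using bounded_pds_component[OF kappa_facts(3,5), of "[?n]" ?n] by blast
  obtain B' where B': "\<And>x. cmod (pds [?n] (\<lambda>x. complex_of_real (\<kappa> x $ ?n)) x) \<le> B'"
    using bounded_pds_component[OF kappa_facts(2,4), of "[?n]" ?n] by blast
  have ik: "pdiffable_at i (\<lambda>x. inv \<kappa> x $ j) x" for i j x
    by (rule pdiffable_linear[OF bounded_linear_vec_nth smooth_pdiffable[OF kappa_facts(3)]])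
  define b where "b y = pdiff ?n (\<lambda>x. inv \<kappa> x $ ?n) (proj tan_coords y)" for y
  have bB: "\<bar>b y\<bar> \<le> B" for y
    using B[of "proj tan_coords y"] pdiff_linear[OF bounded_linear_of_real[where ?'a = complex] ik[of ?n ?n]]
    unfolding b_def by simp
  have ab: "b y * normal_slope y = 1" for y
  proof -
    let ?x = "proj tan_coords y"
    have "pd1 (\<lambda>x. \<kappa> x $ ?n)" by (intro smooth_pd1 smooth_linear[OF bounded_linear_vec_nth kappa_facts(2)])
    from pd1_comp(2)[where k = "inv \<kappa>" and i = ?n and x = ?x, OF this ik]
    have "pdiff ?n (\<lambda>x. x $ ?n) ?x = (\<Sum>j\<in>UNIV. pdiff ?n (\<lambda>x. inv \<kappa> x $ j) ?x * pdiff j (\<lambda>x. \<kappa> x $ ?n) (inv \<kappa> ?x))"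
      by simp
    also have "\<dots> = (\<Sum>j\<in>UNIV. if j = ?n then b y * normal_slope y else 0)"
      using pdiff_kappa_tangential[OF base_point_last[of y]]
      by (intro sum.cong) (auto simp: b_def normal_slope_def base_point_def)
    also have "\<dots> = b y * normal_slope y" by simp
    finally show ?thesis using has_derivative_imp_pdiff(2)[OF bounded_linear_imp_has_derivative[OF bounded_linear_vec_nth[of ?n]], of ?n ?x] by simp
  qed
  have b0: "0 \<le> b y" for y
  proof (rule ccontr)
    assume "\<not> 0 \<le> b y"
    then have "b y < 0" by simp
    have "((\<lambda>t. inv \<kappa> (proj tan_coords y + t *\<^sub>R axis ?n 1) $ ?n) has_real_derivative b y) (at 0)"
      using ik[of ?n ?n "proj tan_coords y"] unfolding b_def pdiffable_at_iff has_real_derivative_iff_has_vector_derivative .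
    from DERIV_neg_dec_right[OF this \<open>b y < 0\<close>] obtain d where d: "d > 0" "\<And>h. 0 < h \<Longrightarrow> h < d \<Longrightarrow>
        inv \<kappa> (proj tan_coords y + (0 + h) *\<^sub>R axis ?n 1) $ ?n < inv \<kappa> (proj tan_coords y + 0 *\<^sub>R axis ?n 1) $ ?n"
      by blast
    have "0 < inv \<kappa> (proj tan_coords y + (0 + d / 2) *\<^sub>R axis ?n 1) $ ?n"
      using d(1) by (intro kappa_boundary) (simp add: axis_def)
    moreover have "inv \<kappa> (proj tan_coords y + 0 *\<^sub>R axis ?n 1) $ ?n = 0" by (intro kappa_boundary) simp
    ultimately show False using d(2)[of "d / 2"] d(1) by simp
  qed
  have bp: "0 < b y" for y using ab[of y] b0[of y] by (cases "b y = 0") auto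
  have Bp: "0 < B" using bp[of undefined] bB[of undefined] by linarith
  have "inverse B \<le> normal_slope y \<and> normal_slope y \<le> B'" for y
  proof
    have "normal_slope y = inverse (b y)" using ab[of y] bp[of y] by (simp add: field_simps)
    then show "inverse B \<le> normal_slope y" using bp[of y] bB[of y] by (simp add: le_imp_inverse_le)
    show "normal_slope y \<le> B'"
      using B'[of "base_point y"] pdiff_linear[OF bounded_linear_of_real[where ?'a = complex] pdiffable_kappa[of ?n ?n]]
      unfolding normal_slope_def by simp
  qed
  then show ?thesis using Bp by (intro exI[of _ "inverse B"] exI[of _ B']) auto
qed

lemma hol_normal_slope: "\<exists>A. hol k sg A (\<lambda>y. complex_of_real (normal_slope y))"
proof -
  obtain A where "\<forall>z. hol k sg A (\<lambda>y. pds [last_coord] (kappa_c last_coord) (z + base_point y))"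
    using hol_kappa_translates[of "[last_coord]" k last_coord] by blast
  from this[rule_format, of 0] show ?thesis unfolding normal_slope_def by (auto simp: pdiff_kappa_c)
qed

lemma normal_slope_scale: "\<exists>c0 c1 A. holder_scale sg r normal_slope c0 c1 A"
proof -
  obtain c0 c1 where c: "0 < c0" "\<And>y. c0 \<le> normal_slope y" "\<And>y. normal_slope y \<le> c1"
    using normal_slope_bounds by blast
  obtain A where A: "hol (Suc r) sg A (\<lambda>y. complex_of_real (normal_slope y))" using hol_normal_slope by blast
  have d: "pdiffable_at i normal_slope x" for i x
    using pdiffable_linear[OF bounded_linear_Re hol_SucD(1)[OF A]] by simp
  have e: "pdiff i (\<lambda>x. complex_of_real (normal_slope x)) = (\<lambda>x. complex_of_real (pdiff i normal_slope x))" for i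
    by (intro ext pdiff_linear[OF bounded_linear_of_real d])
  have "hol r sg A (\<lambda>x. complex_of_real (pdiff i normal_slope x))" for i
    using hol_SucD(2)[OF A, of i] unfolding e .
  with c d show ?thesis
    by (intro exI[of _ c0] exI[of _ c1] exI[of _ A]) unfold_locales
qed

end

text \<open>Substitution \<xi> = \<eta> + c \<omega> in frequency and v = x + w / c in space. The
  factors exp(i x \<xi>) cancel against those of the translated Fourier transform, and the powers of
  \<open>c\<close> against each other.\<close>

lemma psdo_rescaled:
  fixes p :: "'n::finite rn \<Rightarrow> 'n rn \<Rightarrow> complex"
  assumes p: "continuous_on UNIV (p x)" and f: "continuous_on UNIV f" and c: "c > 0"
  shows "psdo p f x = (\<integral>\<omega>. p x (\<eta> + c *\<^sub>R \<omega>) *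
    fourier (\<lambda>w. cis (- (w \<bullet> \<eta>) / c) * f (x + inverse c *\<^sub>R w)) \<omega> \<partial>lborel) / (2 * pi) ^ CARD('n)"
proof -
  have [measurable]: "p x \<in> borel_measurable borel" "f \<in> borel_measurable borel"
    using p f by (auto intro: borel_measurable_continuous_onI)
  have [measurable]: "fourier f \<in> borel_measurable borel" by (rule fourier_measurable) measurable
  have mc: "(\<lambda>w. cis (- (w \<bullet> \<xi>))) \<in> borel_measurable borel" for \<xi> :: "'n rn"
    by (intro borel_measurable_continuous_onI continuous_intros)
  have mc': "(\<lambda>w. cis (\<xi> \<bullet> w)) \<in> borel_measurable borel" for \<xi> :: "'n rn"
    by (intro borel_measurable_continuous_onI continuous_intros)
  note [measurable] = mc mc'
  define h where "h w = cis (- (w \<bullet> \<eta>) / c) * f (x + inverse c *\<^sub>R w)" for w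
  have ff: "fourier f (\<eta> + c *\<^sub>R \<omega>) = inverse c ^ CARD('n) *\<^sub>R (cis (- (x \<bullet> (\<eta> + c *\<^sub>R \<omega>))) * fourier h \<omega>)" for \<omega>
  proof -
    have "fourier f (\<eta> + c *\<^sub>R \<omega>) = inverse c ^ CARD('n) *\<^sub>R
      (\<integral>w. cis (- ((x + inverse c *\<^sub>R w) \<bullet> (\<eta> + c *\<^sub>R \<omega>))) * f (x + inverse c *\<^sub>R w) \<partial>lborel)"
      unfolding fourier_def by (rule integral_affine(1)) (use c in \<open>simp, measurable\<close>)
    also have "(\<lambda>w. cis (- ((x + inverse c *\<^sub>R w) \<bullet> (\<eta> + c *\<^sub>R \<omega>))) * f (x + inverse c *\<^sub>R w)) =
      (\<lambda>w. cis (- (x \<bullet> (\<eta> + c *\<^sub>R \<omega>))) * (cis (- (w \<bullet> \<omega>)) * h w))"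
    proof
      fix w
      have "- ((x + inverse c *\<^sub>R w) \<bullet> (\<eta> + c *\<^sub>R \<omega>)) = - (x \<bullet> (\<eta> + c *\<^sub>R \<omega>)) + (- (w \<bullet> \<omega>) + - (w \<bullet> \<eta>) / c)"
        using c by (simp add: inner_add_left inner_add_right field_simps)
      then show "cis (- ((x + inverse c *\<^sub>R w) \<bullet> (\<eta> + c *\<^sub>R \<omega>))) * f (x + inverse c *\<^sub>R w) =
        cis (- (x \<bullet> (\<eta> + c *\<^sub>R \<omega>))) * (cis (- (w \<bullet> \<omega>)) * h w)"
        unfolding h_def by (simp only: cis_mult[symmetric] mult.assoc)
    qed
    finally show ?thesis unfolding fourier_def by simp
  qed
  have "(\<integral>\<xi>. cis (x \<bullet> \<xi>) * p x \<xi> * fourier f \<xi> \<partial>lborel) = c ^ CARD('n) *\<^sub>R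
    (\<integral>\<omega>. cis (x \<bullet> (\<eta> + c *\<^sub>R \<omega>)) * p x (\<eta> + c *\<^sub>R \<omega>) * fourier f (\<eta> + c *\<^sub>R \<omega>) \<partial>lborel)"
    by (rule integral_affine(1)[OF c]) measurable
  also have "(\<lambda>\<omega>. cis (x \<bullet> (\<eta> + c *\<^sub>R \<omega>)) * p x (\<eta> + c *\<^sub>R \<omega>) * fourier f (\<eta> + c *\<^sub>R \<omega>)) =
    (\<lambda>\<omega>. inverse c ^ CARD('n) *\<^sub>R (p x (\<eta> + c *\<^sub>R \<omega>) * fourier h \<omega>))"
  proof
    fix \<omega>
    have "cis (x \<bullet> (\<eta> + c *\<^sub>R \<omega>)) * cis (- (x \<bullet> (\<eta> + c *\<^sub>R \<omega>))) = 1" by (simp add: cis_mult)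
    then show "cis (x \<bullet> (\<eta> + c *\<^sub>R \<omega>)) * p x (\<eta> + c *\<^sub>R \<omega>) * fourier f (\<eta> + c *\<^sub>R \<omega>) =
      inverse c ^ CARD('n) *\<^sub>R (p x (\<eta> + c *\<^sub>R \<omega>) * fourier h \<omega>)"
      unfolding ff by (simp add: algebra_simps)
  qed
  finally have "(\<integral>\<xi>. cis (x \<bullet> \<xi>) * p x \<xi> * fourier f \<xi> \<partial>lborel) =
    (\<integral>\<omega>. p x (\<eta> + c *\<^sub>R \<omega>) * fourier h \<omega> \<partial>lborel)"
    using c by (simp add: power_mult_distrib[symmetric])
  then show ?thesis unfolding psdo_def h_def by simp
qed

lemma (in holder_class) schwartz_rapid:
  fixes F :: "real \<Rightarrow> 'n::{finite,linorder} rn \<Rightarrow> 'n rn \<Rightarrow> complex"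
  assumes "rapid F" "1 \<le> \<bar>t\<bar>"
  shows "(\<lambda>w. F t w y) \<in> schwartz"
  unfolding schwartz_def
proof (intro CollectI conjI allI)
  show "smooth (\<lambda>w. F t w y)" by (rule rapidD(1)[OF assms])
  fix \<alpha> \<beta> :: "'n multiindex"
  define k where "k = (\<Sum>i\<in>UNIV. \<alpha> i)"
  obtain C where C: "hol r sg (C * inverse ((1 + norm w) ^ k)) (\<lambda>y. pds (mi_list \<beta>) (\<lambda>w. F t w y) w)" for w
    using assms unfolding rapid_def by blast
  have C0: "0 \<le> C" using hol_nonneg[OF C[of 0]] by simp
  have "norm ((\<Prod>i\<in>UNIV. (x $ i) ^ \<alpha> i) *\<^sub>R mdiff \<beta> (\<lambda>w. F t w y) x) \<le> C" for x
  proof -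
    have "\<bar>\<Prod>i\<in>UNIV. (x $ i) ^ \<alpha> i\<bar> \<le> (\<Prod>i\<in>UNIV. (1 + norm x) ^ \<alpha> i)"
      unfolding abs_prod power_abs by (intro prod_mono conjI power_mono order_trans[OF component_le_norm_cart]) auto
    also have "\<dots> = (1 + norm x) ^ k" unfolding k_def by (simp add: power_sum)
    finally have "\<bar>\<Prod>i\<in>UNIV. (x $ i) ^ \<alpha> i\<bar> * cmod (mdiff \<beta> (\<lambda>w. F t w y) x) \<le> (1 + norm x) ^ k * (C * inverse ((1 + norm x) ^ k))"
      unfolding mdiff_eq_pds by (intro mult_mono hol_bound[OF C]) auto
    also have "\<dots> = C" by (simp add: add_nonneg_eq_0_iff)
    finally show ?thesis by simp
  qed
  then show "bounded (range (\<lambda>x. (\<Prod>i\<in>UNIV. (x $ i) ^ \<alpha> i) *\<^sub>R mdiff \<beta> (\<lambda>w. F t w y) x))"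
    unfolding bounded_iff by blast
qed

text \<open>One formula for three functions: the test function itself, its rescaling at the boundary
  point, and its pullback by \<kappa>. \<open>W\<close> holds the rescaled coordinates, \<Phi> the
  phase.\<close>

definition test_fun :: "'n::finite list \<Rightarrow> nat \<Rightarrow> ('n \<Rightarrow> complex) \<Rightarrow> complex \<Rightarrow> complex" where
  "test_fun G M W \<Phi> = prod_list (map W G) * exp \<Phi> * cutoff M ((\<Sum>j\<in>UNIV. (W j)\<^sup>2) / 2)"

text \<open>With an imaginary phase the modulus is governed by the Gaussian in \<open>W\<close>. The
  constant \<open>D\<close> admits coordinates centred away from the origin, where the quadratic
  lower bound holds only up to a constant.\<close>

lemma (in holder_class) rapid_test_fun:
  fixes W :: "'n::finite \<Rightarrow> real \<Rightarrow> 'n rn \<Rightarrow> 'n rn \<Rightarrow> complex"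
  assumes W: "\<And>j. tempered (W j)" and \<Phi>: "tempered \<Phi>" and re: "\<And>t w y. Re (\<Phi> t w y) = 0"
    and c: "c > 0" "\<And>t w y. 1 \<le> \<bar>t\<bar> \<Longrightarrow> c * (norm w)\<^sup>2 \<le> Re (\<Sum>j\<in>UNIV. (W j t w y)\<^sup>2) + D"
  shows "rapid (\<lambda>t w y. test_fun G M (\<lambda>j. W j t w y) (\<Phi> t w y))"
proof -
  define V where "V t w y = (1 / 2) * (\<Sum>j\<in>UNIV. (W j t w y)\<^sup>2)" for t w y
  have V: "tempered V" unfolding V_def by (intro tempered_cmult tempered_sum tempered_power W)
  define P where "P t w y = prod_list (map (\<lambda>j. W j t w y) G) * (\<Sum>i<M. inverse (fact i) * V t w y ^ i) * exp (of_real (D / 2))" for t w y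
  define Q where "Q t w y = \<Phi> t w y + ((- 1) * V t w y + (- of_real (D / 2)))" for t w y
  have "tempered P" unfolding P_def by (intro tempered_mult tempered_prod_list tempered_sum tempered_power tempered_const W V)
  moreover have "tempered Q" unfolding Q_def by (intro tempered_add tempered_mult tempered_const \<Phi> V)
  moreover have "Re (Q t w y) \<le> - (c / 2) * (norm w)\<^sup>2" if "1 \<le> \<bar>t\<bar>" for t w y
    using c(2)[OF that, of w y] re unfolding Q_def V_def by simp
  ultimately have "rapid (\<lambda>t w y. P t w y * exp (Q t w y))" using c(1) by (intro rapid_exp[where c = "c / 2"]) auto
  moreover have "P t w y * exp (Q t w y) = test_fun G M (\<lambda>j. W j t w y) (\<Phi> t w y)" for t w y
  proof -
    have v: "(\<Sum>j\<in>UNIV. (W j t w y)\<^sup>2) / 2 = V t w y" unfolding V_def by simp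
    have "exp (of_real (D / 2)) * exp (Q t w y) = exp (\<Phi> t w y) * exp (- V t w y)"
      unfolding exp_add[symmetric] Q_def by (intro arg_cong[of _ _ exp]) simp
    then have "P t w y * exp (Q t w y) = prod_list (map (\<lambda>j. W j t w y) G) * (\<Sum>i<M. inverse (fact i) * V t w y ^ i) * (exp (\<Phi> t w y) * exp (- V t w y))"
      unfolding P_def by (simp only: mult.assoc)
    then show ?thesis unfolding test_fun_def cutoff_def v by (simp add: divide_inverse mult_ac)
  qed
  ultimately show ?thesis by simp
qed

section \<open>The operator identity on the test functions\<close>

context half_space_diffeo
begin

definition disp :: "'n \<Rightarrow> 'n rn \<Rightarrow> 'n rn \<Rightarrow> complex" where
  "disp j z y = kappa_c j (z + base_point y) - kappa_c j (base_point y)"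

text \<open>The difference \<kappa>_n(k(y) + z) - a(y) z_n of the overview, since \<kappa>_n
  vanishes at the boundary point k(y).\<close>

definition bend :: "'n rn \<Rightarrow> 'n rn \<Rightarrow> complex" where
  "bend z y = disp last_coord z y - complex_of_real (normal_slope y) * complex_of_real (z $ last_coord)"

lemma tempered_kappa_translates:
  assumes "L \<noteq> []"
  shows "tempered (\<lambda>t z y. pds L (kappa_c j) (z + base_point y))"
proof -
  have base: "tempered_base (\<lambda>t z y. pds L (kappa_c j) (z + base_point y))" if L: "L \<noteq> []" for L
  proof -
    obtain A where A: "\<forall>z. hol r sg A (\<lambda>y. pds L (kappa_c j) (z + base_point y))"
      using hol_kappa_translates[OF L, of r j] ..
    then have "\<forall>(t :: real) z. 1 \<le> \<bar>t\<bar> \<longrightarrow> hol r sg (A * (1 + norm z) ^ 0) (\<lambda>y. pds L (kappa_c j) (z + base_point y))" by simp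
    then have "\<exists>C d. \<forall>(t :: real) z. 1 \<le> \<bar>t\<bar> \<longrightarrow> hol r sg (C * (1 + norm z) ^ d) (\<lambda>y. pds L (kappa_c j) (z + base_point y))" by (intro exI)
    moreover have "continuous_on UNIV (\<lambda>z. pds L (kappa_c j) (z + base_point y))" for y
      by (intro pd1_continuous smooth_pd1 smooth_translate smooth_pds smooth_kappa_c)
    ultimately show ?thesis unfolding tempered_base_def by (intro conjI allI impI)
  qed
  have "tempered_upto n (\<lambda>t z y. pds L (kappa_c j) (z + base_point y))" for n
    using assms
  proof (induction n arbitrary: L)
    case 0
    then show ?case using base by simp
  next
    case (Suc n)
    have "pdiffable_at i (\<lambda>z. pds L (kappa_c j) (z + base_point y)) z" for i y z
      by (intro smooth_pdiffable smooth_translate smooth_pds smooth_kappa_c)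
    moreover have "pdw i (\<lambda>t z y. pds L (kappa_c j) (z + base_point y)) = (\<lambda>t z y. pds (i # L) (kappa_c j) (z + base_point y))" for i
      using pds_translate[of "[i]" "pds L (kappa_c j)"] by (simp add: pdw_def fun_eq_iff)
    ultimately show ?case using Suc.IH[of "_ # L"] base[OF Suc.prems] by simp
  qed
  then show ?thesis unfolding tempered_def by blast
qed

lemma disp_0 [simp]: "disp j 0 y = 0" by (simp add: disp_def)

lemma bend_0 [simp]: "bend 0 y = 0" by (simp add: bend_def)

lemma smooth_disp: "smooth (\<lambda>z. disp j z y)"
  unfolding disp_def diff_conv_add_uminus by (rule smooth_add[OF smooth_translate[OF smooth_kappa_c] smooth_const])

lemma pdiff_disp: "pdiff i (\<lambda>z. disp j z y) z = pds [i] (kappa_c j) (z + base_point y)"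
proof -
  have "pdiffable_at i (\<lambda>z. kappa_c j (z + base_point y)) z"
    by (intro smooth_pdiffable smooth_translate smooth_kappa_c)
  from pdiff_diff[OF this pdiff_const(1)] show ?thesis
    using fun_cong[OF pds_translate[of "[i]" "kappa_c j" "base_point y"], of z] by (simp add: disp_def pdiff_const)
qed

text \<open>\<kappa> is unbounded, so growth is controlled through its bounded derivatives by
  \<open>hol_mean_value\<close>; this gives linear growth in \<open>z\<close>.\<close>

lemma tempered_disp: "tempered (\<lambda>t. disp j)"
proof (rule temperedI)
  have "\<forall>i. \<exists>A. \<forall>z. hol r sg A (\<lambda>y. pds [i] (kappa_c j) (z + base_point y))"
    using hol_kappa_translates by blast
  from choice[OF this] obtain A where A: "\<forall>i z. hol r sg (A i) (\<lambda>y. pds [i] (kappa_c j) (z + base_point y))" by blast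
  have A': "hol r sg (Max (range A)) (\<lambda>y. pds [i] (kappa_c j) (z + base_point y))" for i z
    by (rule hol_mono[OF A[rule_format]]) simp
  have A0: "0 \<le> Max (range A)" by (rule hol_nonneg[OF A'])
  have h: "hol r sg (real CARD('n) * (norm z * Max (range A))) (disp j z)" for z
    by (rule hol_mean_value[where R = "disp j"]) (simp_all add: smooth_disp pdiff_disp A'[simplified])
  have "hol r sg (real CARD('n) * Max (range A) * (1 + norm z) ^ 1) (disp j z)" for z
    by (rule hol_mono[OF h]) (use A0 in \<open>auto simp: algebra_simps\<close>)
  then have "\<forall>(t :: real) z. 1 \<le> \<bar>t\<bar> \<longrightarrow> hol r sg (real CARD('n) * Max (range A) * (1 + norm z) ^ 1) (disp j z)" by simp
  then have "\<exists>C d. \<forall>(t :: real) z. 1 \<le> \<bar>t\<bar> \<longrightarrow> hol r sg (C * (1 + norm z) ^ d) (disp j z)" by (intro exI)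
  then show "tempered_base (\<lambda>t. disp j)"
    unfolding tempered_base_def using pd1_continuous[OF smooth_pd1[OF smooth_disp]] by (intro conjI allI impI)
  show "pdiffable_at i (\<lambda>w. disp j w y) w" for i w y by (rule smooth_pdiffable[OF smooth_disp])
  show "tempered (pdw i (\<lambda>t. disp j))" for i
    unfolding pdw_def pdiff_disp by (rule tempered_kappa_translates) simp
qed

lemma tempered_bend: "tempered (\<lambda>t. bend)"
proof -
  have "hol_bdd (\<lambda>y. complex_of_real (normal_slope y))" using hol_normal_slope unfolding hol_bdd_def by blast
  then have "tempered (\<lambda>t z y. disp last_coord z y + (- 1) * (complex_of_real (normal_slope y) * complex_of_real (z $ last_coord)))"
    by (intro tempered_add tempered_disp tempered_mult tempered_const tempered_hol_bdd tempered_component)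
  then show ?thesis unfolding bend_def by simp
qed

text \<open>Tangential derivatives of \<kappa>_n vanish on the boundary, and the normal one is
  cancelled by the definition of the slope. Invariance of the boundary hyperplane is essential at
  this point.\<close>

lemma pdiff_bend_0: "pdiff i (\<lambda>z. bend z y) 0 = 0"
proof -
  let ?c = "complex_of_real (normal_slope y)"
  have l: "bounded_linear (\<lambda>z. ?c * z)" by (rule bounded_linear_mult_right)
  have "pdiff i (\<lambda>z. ?c * complex_of_real (z $ last_coord)) 0 = ?c * (if last_coord = i then 1 else 0)"
    unfolding pdiff_linear[OF l pdiff_component(1)] by (simp add: pdiff_component(2))
  then have "pdiff i (\<lambda>z. bend z y) 0 = pdiff i (\<lambda>z. disp last_coord z y) 0 - ?c * (if last_coord = i then 1 else 0)"
    unfolding bend_def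
    by (subst pdiff_diff[OF smooth_pdiffable[OF smooth_disp] pdiffable_linear[OF l pdiff_component(1)]]) simp
  also have "\<dots> = 0"
    using pdiff_kappa_tangential[OF base_point_last[of y], of i]
    by (auto simp: pdiff_disp pdiff_kappa_c normal_slope_def)
  finally show ?thesis .
qed

text \<open>A Lipschitz bound for the inverse of \<kappa> prevents displacements from shrinking by
  more than a constant factor, so the pulled back cutoff keeps its Gaussian decay.\<close>

lemma disp_square: "\<exists>c>0. \<forall>z y. c * (norm z)\<^sup>2 \<le> Re (\<Sum>j\<in>UNIV. (disp j z y)\<^sup>2)"
proof -
  obtain K where K: "K \<ge> 1" "\<And>x y. norm (inv \<kappa> x - inv \<kappa> y) \<le> K * norm (x - y)"
    using bdm_lipschitz[OF bdm_of_bounded[OF kappa_facts(3,5)]] by blast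
  have "inverse (K\<^sup>2) * (norm z)\<^sup>2 \<le> Re (\<Sum>j\<in>UNIV. (disp j z y)\<^sup>2)" for z y
  proof -
    define d where "d = \<kappa> (z + base_point y) - \<kappa> (base_point y)"
    have "norm z \<le> K * norm d" using K(2)[of "\<kappa> (z + base_point y)" "\<kappa> (base_point y)"] by (simp add: d_def)
    then have "(norm z)\<^sup>2 \<le> (K * norm d)\<^sup>2" by (intro power_mono) auto
    then have "inverse (K\<^sup>2) * (norm z)\<^sup>2 \<le> (norm d)\<^sup>2" using K(1) by (simp add: field_simps power_mult_distrib)
    also have "(norm d)\<^sup>2 = (\<Sum>j\<in>UNIV. (d $ j)\<^sup>2)"
      by (simp add: norm_vec_def L2_set_def sum_nonneg)
    also have "\<dots> = Re (\<Sum>j\<in>UNIV. (disp j z y)\<^sup>2)"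
    proof -
      have "disp j z y = complex_of_real (d $ j)" for j by (simp add: disp_def kappa_c_def d_def)
      then show ?thesis by (simp flip: of_real_power of_real_sum)
    qed
    finally show ?thesis .
  qed
  then show ?thesis using K(1) by (intro exI[of _ "inverse (K\<^sup>2)"]) (auto intro: zero_less_power)
qed

definition model_fun :: "'n list \<Rightarrow> nat \<Rightarrow> real \<Rightarrow> 'n rn \<Rightarrow> 'n rn \<Rightarrow> complex" where
  "model_fun G M t w y = test_fun G M (\<lambda>j. complex_of_real (w $ j)) 0"

text \<open>The linear part of the phase has been moved into the frequency a(y) t, leaving
  \<open>t\<close> times \<open>bend\<close>. In \<open>model_fun\<close> the phase is exactly
  linear and nothing is left.\<close>

definition pulled_fun :: "'n list \<Rightarrow> nat \<Rightarrow> real \<Rightarrow> 'n rn \<Rightarrow> 'n rn \<Rightarrow> complex" where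
  "pulled_fun G M t w y =
    test_fun G M (\<lambda>j. complex_of_real (sqrt \<bar>t\<bar>) * disp j (inverse (sqrt \<bar>t\<bar>) *\<^sub>R w) y)
      (\<i> * complex_of_real t * bend (inverse (sqrt \<bar>t\<bar>) *\<^sub>R w) y)"

lemma Re_sum_square_component: "Re (\<Sum>j\<in>UNIV. (complex_of_real (w $ j))\<^sup>2) = (norm w)\<^sup>2"
proof -
  have "(\<Sum>j\<in>UNIV. (complex_of_real (w $ j))\<^sup>2) = complex_of_real ((norm w)\<^sup>2)"
    by (simp add: norm_vec_def L2_set_def sum_nonneg)
  then show ?thesis by simp
qed

lemma rapid_model_fun: "rapid (model_fun G M)"
proof -
  have "rapid (\<lambda>t (w :: 'n rn) y. test_fun G M (\<lambda>j. complex_of_real (w $ j)) 0)"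
  proof (rule rapid_test_fun[where c = 1 and D = 0])
    show "1 * (norm w)\<^sup>2 \<le> Re (\<Sum>j\<in>UNIV. (complex_of_real (w $ j))\<^sup>2) + 0" for w :: "'n rn"
      unfolding Re_sum_square_component by simp
  qed (auto intro: tempered_component tempered_const)
  then show ?thesis unfolding model_fun_def[abs_def] .
qed

lemma rapid_pulled_fun: "rapid (pulled_fun G M)"
proof -
  obtain c where c: "c > 0" "\<And>z y. c * (norm z)\<^sup>2 \<le> Re (\<Sum>j\<in>UNIV. (disp j z y)\<^sup>2)" using disp_square by blast
  have "rapid (\<lambda>t w y. test_fun G M (\<lambda>j. complex_of_real (sqrt \<bar>t\<bar>) * disp j (inverse (sqrt \<bar>t\<bar>) *\<^sub>R w) y)
      (\<i> * (complex_of_real t * bend (inverse (sqrt \<bar>t\<bar>) *\<^sub>R w) y)))"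
  proof (rule rapid_test_fun[where c = c and D = 0, OF _ _ _ c(1)])
    show "tempered (\<lambda>t w y. complex_of_real (sqrt \<bar>t\<bar>) * disp j (inverse (sqrt \<bar>t\<bar>) *\<^sub>R w) y)" for j
      by (rule tempered_scale_vanishing[OF tempered_disp]) simp
    \<comment> \<open>The dilation lemma supplies the factor |t|; the bounded factor
      \<open>sgn t\<close> turns it into \<open>t\<close>, so both signs of the frequency are
      treated together.\<close>
    have "tempered (\<lambda>t (w :: 'n rn) y. complex_of_real (sgn t))"
      by (rule tempered_bounded_scalar[of _ 1]) (simp add: sgn_if)
    from tempered_mult[OF this tempered_scale_vanishing2[OF tempered_bend bend_0 pdiff_bend_0]]
    have "tempered (\<lambda>t w y. complex_of_real t * bend (inverse (sqrt \<bar>t\<bar>) *\<^sub>R w) y)"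
      by (rule tempered_cong) (simp add: fun_eq_iff mult.assoc[symmetric] sgn_mult_abs flip: of_real_mult)
    then show "tempered (\<lambda>t w y. \<i> * (complex_of_real t * bend (inverse (sqrt \<bar>t\<bar>) *\<^sub>R w) y))"
      by (rule tempered_cmult)
    have "Im (bend z y) = 0" for z y by (simp add: bend_def disp_def kappa_c_def)
    then show "Re (\<i> * (complex_of_real t * bend (inverse (sqrt \<bar>t\<bar>) *\<^sub>R w) y)) = 0" for t w y by simp
    fix t :: real and w y :: "'n rn" assume t: "1 \<le> \<bar>t\<bar>"
    let ?z = "inverse (sqrt \<bar>t\<bar>) *\<^sub>R w"
    have "c * (norm w)\<^sup>2 = (sqrt \<bar>t\<bar>)\<^sup>2 * (c * (norm ?z)\<^sup>2)"
      using arg_cong[OF inverse_sqrt_bounds(4)[OF t, of w], of "\<lambda>x. c * x\<^sup>2"] by (simp only: power_mult_distrib mult_ac)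
    also have "\<dots> \<le> (sqrt \<bar>t\<bar>)\<^sup>2 * Re (\<Sum>j\<in>UNIV. (disp j ?z y)\<^sup>2)" by (intro mult_left_mono c(2)) auto
    also have "\<dots> = Re (complex_of_real ((sqrt \<bar>t\<bar>)\<^sup>2) * (\<Sum>j\<in>UNIV. (disp j ?z y)\<^sup>2))" by simp
    also have "\<dots> = Re (\<Sum>j\<in>UNIV. (complex_of_real (sqrt \<bar>t\<bar>) * disp j ?z y)\<^sup>2)"
      unfolding sum_distrib_left power_mult_distrib of_real_power ..
    finally show "c * (norm w)\<^sup>2 \<le> Re (\<Sum>j\<in>UNIV. (complex_of_real (sqrt \<bar>t\<bar>) * disp j ?z y)\<^sup>2) + 0" by simp
  qed
  then show ?thesis unfolding pulled_fun_def[abs_def] by (simp only: mult.assoc)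
qed

text \<open>Both operators are evaluated on the same \<open>u\<close>, at the boundary point and at
  its preimage, and each side is rescaled about its own frequency. The factor \<open>1 * t\<close>
  puts the left side into the shape of \<open>fourier_expansion\<close> with slope 1.\<close>

lemma operator_identity:
  assumes op: "\<And>u. u \<in> schwartz \<Longrightarrow> psdo p_tilde u = psdo p (u \<circ> \<kappa>) \<circ> inv \<kappa>"
    and p: "\<And>x. smooth (p x)" and pt: "\<And>x. smooth (p_tilde x)" and t: "1 \<le> \<bar>t\<bar>"
  shows "(\<integral>\<omega>. p_tilde (proj tan_coords y) ((1 * t) *\<^sub>R axis last_coord 1 + sqrt \<bar>t\<bar> *\<^sub>R \<omega>) * fourier (\<lambda>w. model_fun G M t w y) \<omega> \<partial>lborel) =
    (\<integral>\<omega>. p (base_point y) ((normal_slope y * t) *\<^sub>R axis last_coord 1 + sqrt \<bar>t\<bar> *\<^sub>R \<omega>) * fourier (\<lambda>w. pulled_fun G M t w y) \<omega> \<partial>lborel)"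
proof -
  let ?n = "last_coord :: 'n" and ?b = "proj tan_coords y :: 'n rn"
  define s where "s = sqrt \<bar>t\<bar>"
  have s: "s > 0" unfolding s_def using t by simp
  define u where "u v = test_fun G M (\<lambda>j. complex_of_real (s * (v - ?b) $ j)) (\<i> * complex_of_real (t * (v - ?b) $ ?n))" for v
  have us: "u \<in> schwartz"
  proof -
    \<comment> \<open>For fixed \<open>t\<close> and \<open>y\<close> the function \<open>u\<close>
      is viewed as a family constant in \<open>t'\<close> and \<open>y'\<close>, so that it inherits
      the Schwartz property from \<open>rapid\<close>.\<close>
    have "rapid (\<lambda>t' (v :: 'n rn) y'. test_fun G M (\<lambda>j. complex_of_real s * (complex_of_real (v $ j) + complex_of_real (- ?b $ j)))
      (\<i> * (complex_of_real t * (complex_of_real (v $ ?n) + complex_of_real (- ?b $ ?n)))))"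
    proof (rule rapid_test_fun[where c = "s\<^sup>2 / 2" and D = "s\<^sup>2 * (norm ?b)\<^sup>2"])
      fix v :: "'n rn"
      have "(norm v)\<^sup>2 \<le> (norm (v - ?b) + norm ?b)\<^sup>2" using norm_triangle_ineq[of "v - ?b" ?b] by (intro power_mono) auto
      also have "\<dots> \<le> 2 * (norm (v - ?b))\<^sup>2 + 2 * (norm ?b)\<^sup>2"
        using zero_le_power2[of "norm (v - ?b) - norm ?b"] by (simp add: power2_eq_square algebra_simps)
      finally have "s\<^sup>2 * (norm v)\<^sup>2 \<le> s\<^sup>2 * (2 * (norm (v - ?b))\<^sup>2 + 2 * (norm ?b)\<^sup>2)" by (rule mult_left_mono) simp
      moreover have "Re (\<Sum>j\<in>UNIV. (complex_of_real s * (complex_of_real (v $ j) + complex_of_real (- ?b $ j)))\<^sup>2) = s\<^sup>2 * (norm (v - ?b))\<^sup>2"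
        using Re_sum_square_component[of "s *\<^sub>R (v - ?b)"] by (simp add: power_mult_distrib)
      ultimately show "s\<^sup>2 / 2 * (norm v)\<^sup>2 \<le>
        Re (\<Sum>j\<in>UNIV. (complex_of_real s * (complex_of_real (v $ j) + complex_of_real (- ?b $ j)))\<^sup>2) + s\<^sup>2 * (norm ?b)\<^sup>2"
        by (simp only:) (simp add: algebra_simps)
      show "tempered (\<lambda>t' (v :: 'n rn) y'. complex_of_real s * (complex_of_real (v $ j) + complex_of_real (- ?b $ j)))" for j
        by (rule tempered_cmult[OF tempered_add[OF tempered_component tempered_const]])
      show "tempered (\<lambda>t' (v :: 'n rn) y'. \<i> * (complex_of_real t * (complex_of_real (v $ ?n) + complex_of_real (- ?b $ ?n))))"
        by (rule tempered_cmult[OF tempered_cmult[OF tempered_add[OF tempered_component tempered_const]]])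
    qed (use s in auto)
    from schwartz_rapid[OF this, of 1] show ?thesis by (simp add: u_def[abs_def])
  qed
  have uc: "continuous_on UNIV u" using us unfolding schwartz_def by (auto intro!: pd1_continuous smooth_pd1)
  have kc: "continuous_on UNIV \<kappa>" by (intro pd1_continuous smooth_pd1 kappa_facts)
  have ukc: "continuous_on UNIV (u \<circ> \<kappa>)" using continuous_on_compose[OF kc] uc by (metis continuous_on_subset subset_UNIV)
  have pc: "continuous_on UNIV (p x)" "continuous_on UNIV (p_tilde x)" for x by (auto intro!: pd1_continuous smooth_pd1 p pt)
  have ex: "exp (\<i> * complex_of_real x) = cis x" for x by (simp add: cis_conv_exp)
  have 1: "cis (- (w \<bullet> ((1 * t) *\<^sub>R axis ?n 1)) / s) * u (?b + inverse s *\<^sub>R w) = model_fun G M t w y" for w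
  proof -
    have e: "cis (- (w \<bullet> ((1 * t) *\<^sub>R axis ?n 1)) / s) * exp (\<i> * complex_of_real (t * (inverse s *\<^sub>R w) $ ?n)) = 1"
      unfolding ex cis_mult by (simp add: inner_axis divide_inverse mult_ac)
    have "s * (inverse s *\<^sub>R w + ?b - ?b) $ j = w $ j" for j using s by simp
    moreover have "inverse s *\<^sub>R w + ?b - ?b = inverse s *\<^sub>R w" by simp
    ultimately show ?thesis unfolding u_def model_fun_def test_fun_def add.commute[of ?b]
      using e e[unfolded mult.commute[of "cis _"]] by (simp only: mult.left_commute[of "cis _"] mult.assoc) (simp add: mult.assoc[symmetric])
  qed
  have 2: "cis (- (w \<bullet> ((normal_slope y * t) *\<^sub>R axis ?n 1)) / s) * (u \<circ> \<kappa>) (base_point y + inverse s *\<^sub>R w) = pulled_fun G M t w y" for w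
  proof -
    let ?z = "inverse s *\<^sub>R w"
    have d: "complex_of_real ((\<kappa> (?z + base_point y) - ?b) $ j) = disp j ?z y" for j
      unfolding disp_def kappa_c_def kappa_base_point[symmetric] by simp
    \<comment> \<open>The frequency a(y) t was chosen so that its phase removes exactly the linear
      part of t \<kappa>_n.\<close>
    have "\<i> * complex_of_real (- (w \<bullet> ((normal_slope y * t) *\<^sub>R axis ?n 1)) / s) + \<i> * complex_of_real (t * (\<kappa> (?z + base_point y) - ?b) $ ?n) =
        \<i> * complex_of_real t * bend ?z y"
      unfolding of_real_mult[of t] d bend_def by (simp add: inner_axis divide_inverse algebra_simps)
    then have e: "cis (- (w \<bullet> ((normal_slope y * t) *\<^sub>R axis ?n 1)) / s) * exp (\<i> * complex_of_real (t * (\<kappa> (?z + base_point y) - ?b) $ ?n)) =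
        exp (\<i> * complex_of_real t * bend ?z y)"
      unfolding cis_conv_exp exp_add[symmetric] by (simp only:)
    show ?thesis unfolding add.commute[of "base_point y"] o_def u_def pulled_fun_def test_fun_def s_def[symmetric]
      unfolding of_real_mult[of s] d e[symmetric] by (simp only: mult_ac)
  qed
  have "psdo p_tilde u ?b = psdo p (u \<circ> \<kappa>) (base_point y)" using op[OF us] unfolding base_point_def by simp
  then show ?thesis
    unfolding psdo_rescaled[where x = ?b and \<eta> = "(1 * t) *\<^sub>R axis ?n 1", OF pc(2) uc s]
      psdo_rescaled[where x = "base_point y" and \<eta> = "(normal_slope y * t) *\<^sub>R axis ?n 1", OF pc(1) ukc s] 1 2
    unfolding s_def by simp
qed

end

lemma smooth_prod_list:
  fixes f :: "'a \<Rightarrow> 'n::finite rn \<Rightarrow> complex"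
  shows "(\<And>i. i \<in> set G \<Longrightarrow> smooth (f i)) \<Longrightarrow> smooth (\<lambda>x. prod_list (map (\<lambda>i. f i x) G))"
  by (induction G) (auto intro: smooth_mult smooth_const)

lemma prod_list_monom_list: "prod_list (map (\<lambda>j. complex_of_real (w $ j)) G) = complex_of_real (monom_list G w)"
  by (induction G) auto

lemma prod_list_cmult: "prod_list (map (\<lambda>j. c * f j) G) = c ^ length G * (prod_list (map f G) :: complex)"
  by (induction G) (auto simp: mult_ac)

lemma smooth_scaleR_arg: "smooth f \<Longrightarrow> smooth (\<lambda>w. f (c *\<^sub>R w))"
proof -
  assume f: "smooth f"
  show "smooth (\<lambda>w. f (c *\<^sub>R w))"
  proof (rule smooth_coinduct[where R = "\<lambda>g. \<exists>L a. g = (\<lambda>w. a *\<^sub>R pds L f (c *\<^sub>R w))"])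
    show "\<exists>L a. (\<lambda>w. f (c *\<^sub>R w)) = (\<lambda>w. a *\<^sub>R pds L f (c *\<^sub>R w))"
      by (rule exI[of _ "[]"], rule exI[of _ 1]) simp
    fix g assume "\<exists>L a. g = (\<lambda>w. a *\<^sub>R pds L f (c *\<^sub>R w))"
    then obtain L a where g: "g = (\<lambda>w. a *\<^sub>R pds L f (c *\<^sub>R w))" by blast
    have d: "pdiffable_at i (pds L f) x" for i x by (intro smooth_pdiffable smooth_pds f)
    have c: "continuous_on UNIV (pds L f)" by (intro pd1_continuous smooth_pd1 smooth_pds f)
    have "continuous_on UNIV (\<lambda>w. pds L f (c *\<^sub>R w))"
      by (rule continuous_on_compose2[OF c]) (auto intro!: continuous_intros)
    then have "continuous_on UNIV g" unfolding g by (intro continuous_intros)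
    moreover have "pdiffable_at i g x" for i x
      unfolding g by (intro pdiffable_linear[OF bounded_linear_scaleR_right] pdiff_scaleR(1) d)
    moreover have "pdiff i g = (\<lambda>w. (a * c) *\<^sub>R pds (i # L) f (c *\<^sub>R w))" for i
      unfolding g pdiff_linear[OF bounded_linear_scaleR_right pdiff_scaleR(1)[OF d]] pdiff_scaleR(2)[OF d] by (simp add: fun_eq_iff pdiff_linear[OF bounded_linear_scaleR_right pdiff_scaleR(1)[OF d]] pdiff_scaleR(2)[OF d])
    ultimately show "continuous_on UNIV g \<and> (\<forall>i. (\<forall>x. pdiffable_at i g x) \<and> (\<exists>L a. pdiff i g = (\<lambda>w. a *\<^sub>R pds L f (c *\<^sub>R w))))"
      by blast
  qed
qed

lemma pds_cmult:
  fixes f :: "'n::finite rn \<Rightarrow> complex"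
  assumes "smooth f" shows "pds L (\<lambda>w. c * f w) x = c * pds L f x"
  using fun_cong[OF pds_linear[OF bounded_linear_mult_right assms], of L c x] .

context holder_class
begin

lemma symbol_family_pds:
  assumes "symbol_family m q"
  shows "symbol_family (m - int (length L)) (\<lambda>\<xi> y. pds L (\<lambda>\<xi>. q \<xi> y) \<xi>)"
  unfolding symbol_family_def
proof (intro conjI allI)
  show "smooth (pds L (\<lambda>\<xi>. q \<xi> y))" for y using assms unfolding symbol_family_def by (intro smooth_pds) blast
  fix L'
  have e: "of_int (m - int (length L)) - real (length L') = of_int m - real (length (L' @ L))" by simp
  show "\<exists>C. \<forall>\<xi>. hol r sg (C * jap \<xi> powr (of_int (m - int (length L)) - real (length L'))) (\<lambda>y. pds L' (pds L (\<lambda>\<xi>. q \<xi> y)) \<xi>)"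
    unfolding e pds_append[symmetric] using assms unfolding symbol_family_def by blast
qed

end

section \<open>Derivatives of the test functions at the origin and comparison of both sides\<close>

context half_space_diffeo
begin

lemma smooth_bend: "smooth (\<lambda>z. bend z y)"
  using tempered_smooth[OF tempered_bend, of 1 y] by simp

text \<open>The pullback of the test function before dilation and without its cutoff, which does not
  affect the derivatives at 0 that are compared.\<close>

definition jet :: "'n list \<Rightarrow> real \<Rightarrow> 'n rn \<Rightarrow> 'n rn \<Rightarrow> complex" where
  "jet G t z y = prod_list (map (\<lambda>j. disp j z y) G) * exp (\<i> * complex_of_real t * bend z y)"

lemma smooth_jet: "smooth (\<lambda>z. jet G t z y)"
  unfolding jet_def by (intro smooth_mult smooth_prod_list smooth_exp smooth_const smooth_disp smooth_bend)

text \<open>Each derivative extracts at most one factor \<open>t\<close> from the exponent, so a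
  word \<open>L\<close> gives a polynomial in \<open>t\<close> of degree at most its length. At z =
  0 the exponential is 1 because \<open>bend\<close> vanishes there.\<close>

lemma pds_jet:
  "\<exists>h. (\<forall>i. hol_bdd (h i)) \<and> (\<forall>t y. pds L (\<lambda>z. jet G t z y) 0 = (\<Sum>i\<le>length L. complex_of_real t ^ i * h i y))"
proof -
  have "\<exists>h. (\<forall>i. tempered (\<lambda>t. h i)) \<and> (\<forall>t y. pds L (\<lambda>z. jet G t z y) =
    (\<lambda>z. (\<Sum>i\<le>length L. complex_of_real t ^ i * h i z y) * exp (\<i> * complex_of_real t * bend z y)))"
  proof (induction L)
    case Nil
    show ?case
      by (rule exI[of _ "\<lambda>i z y. prod_list (map (\<lambda>j. disp j z y) G)"])
        (auto simp: jet_def intro!: tempered_prod_list tempered_disp)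
  next
    case (Cons a L)
    then obtain h where h: "\<forall>i. tempered (\<lambda>t. h i)" and e: "\<forall>t y. pds L (\<lambda>z. jet G t z y) =
      (\<lambda>z. (\<Sum>i\<le>length L. complex_of_real t ^ i * h i z y) * exp (\<i> * complex_of_real t * bend z y))" by (elim exE conjE)
    let ?n = "length L"
    define h' where "h' i z y = (if i \<le> ?n then pdiff a (\<lambda>z. h i z y) z else 0) +
      (if i = 0 then 0 else \<i> * (h (i - 1) z y * pdiff a (\<lambda>z. bend z y) z))" for i z y
    have "tempered (\<lambda>t. h' i)" for i
    proof -
      have "tempered (\<lambda>t z y. if i \<le> ?n then pdiff a (\<lambda>z. h i z y) z else 0)"
        using tempered_pdiff[OF h[rule_format, of i], of a] tempered_const[of 0] by (cases "i \<le> ?n") simp_all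
      moreover have "tempered (\<lambda>t z y. if i = 0 then 0 else \<i> * (h (i - 1) z y * pdiff a (\<lambda>z. bend z y) z))"
        using tempered_cmult[OF tempered_mult[OF h[rule_format] tempered_pdiff[OF tempered_bend, of a]], of \<i> "i - 1"] tempered_const[of 0]
        by (cases "i = 0") auto
      ultimately show ?thesis unfolding h'_def by (rule tempered_add)
    qed
    moreover have "pds (a # L) (\<lambda>z. jet G t z y) z = (\<Sum>i\<le>length (a # L). complex_of_real t ^ i * h' i z y) * exp (\<i> * complex_of_real t * bend z y)" for t y z
    proof -
      let ?E = "exp (\<i> * complex_of_real t * bend z y)"
      have dh: "pdiffable_at a (\<lambda>z. h i z y) z" for i
        using temperedD(2)[OF h[rule_format], of 1] by simp
      have db: "pdiffable_at a (\<lambda>z. bend z y) z" by (rule smooth_pdiffable[OF smooth_bend])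
      have l: "bounded_linear (\<lambda>x :: complex. c * x)" for c by (rule bounded_linear_mult_right)
      have dS: "pdiffable_at a (\<lambda>z. \<Sum>i\<le>?n. complex_of_real t ^ i * h i z y) z"
        by (intro pdiffable_sum pdiffable_linear[OF l] dh)
      have pS: "pdiff a (\<lambda>z. \<Sum>i\<le>?n. complex_of_real t ^ i * h i z y) z = (\<Sum>i\<le>?n. complex_of_real t ^ i * pdiff a (\<lambda>z. h i z y) z)"
        by (subst pdiff_sum) (auto intro: pdiffable_linear[OF l] dh simp: pdiff_linear[OF l dh])
      have dE: "pdiffable_at a (\<lambda>z. \<i> * complex_of_real t * bend z y) z" by (intro pdiffable_linear[OF l] db)
      have "pds (a # L) (\<lambda>z. jet G t z y) z = (\<Sum>i\<le>?n. complex_of_real t ^ i * h i z y) * (\<i> * complex_of_real t * pdiff a (\<lambda>z. bend z y) z * ?E) +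
          (\<Sum>i\<le>?n. complex_of_real t ^ i * pdiff a (\<lambda>z. h i z y) z) * ?E"
        unfolding foldr.simps o_apply e[rule_format] pdiff_mult[OF dS pdiffable_exp[OF dE]] pdiff_exp[OF dE] pdiff_linear[OF l db] pS ..
      also have "\<dots> = ((\<Sum>i\<le>?n. complex_of_real t ^ i * pdiff a (\<lambda>z. h i z y) z) +
          (\<Sum>i\<le>?n. complex_of_real t ^ Suc i * (\<i> * (h i z y * pdiff a (\<lambda>z. bend z y) z)))) * ?E"
        by (simp add: algebra_simps sum_distrib_left sum_distrib_right)
      also have "(\<Sum>i\<le>?n. complex_of_real t ^ i * pdiff a (\<lambda>z. h i z y) z) =
          (\<Sum>i\<le>Suc ?n. complex_of_real t ^ i * (if i \<le> ?n then pdiff a (\<lambda>z. h i z y) z else 0))"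
        by simp
      also have "(\<Sum>i\<le>?n. complex_of_real t ^ Suc i * (\<i> * (h i z y * pdiff a (\<lambda>z. bend z y) z))) =
          (\<Sum>i\<le>Suc ?n. complex_of_real t ^ i * (if i = 0 then 0 else \<i> * (h (i - 1) z y * pdiff a (\<lambda>z. bend z y) z)))"
        unfolding sum.atMost_Suc_shift by simp
      finally show ?thesis unfolding h'_def by (simp add: distrib_left sum.distrib)
    qed
    ultimately show ?case by (intro exI[of _ h'] conjI allI ext)
  qed
  then obtain h where h: "\<forall>i. tempered (\<lambda>t. h i)" and e: "\<forall>t y. pds L (\<lambda>z. jet G t z y) =
      (\<lambda>z. (\<Sum>i\<le>length L. complex_of_real t ^ i * h i z y) * exp (\<i> * complex_of_real t * bend z y))" by (elim exE conjE)
  have "hol_bdd (h i 0)" for i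
  proof -
    obtain C d where "\<forall>z. hol r sg (C * (1 + norm z) ^ d) (h i z)" by (rule tempered_hol[OF h[rule_format, of i]])
    from this[rule_format, of 0] show ?thesis unfolding hol_bdd_def by blast
  qed
  then show ?thesis using e by (intro exI[of _ "\<lambda>i. h i 0"]) simp
qed

lemma pds_model_fun:
  assumes "length L < M"
  shows "pds L (\<lambda>w. model_fun G M t w y) 0 = pds L (\<lambda>w. complex_of_real (monom_list G w)) 0"
proof -
  have "model_fun G M t w y = complex_of_real (monom_list G w) * cutoff M ((1 / 2) * (\<Sum>j\<in>UNIV. (complex_of_real (w $ j))\<^sup>2))" for w
    unfolding model_fun_def test_fun_def prod_list_monom_list by simp
  moreover have "smooth (\<lambda>w :: 'n rn. (1 / 2) * (\<Sum>j\<in>UNIV. (complex_of_real (w $ j))\<^sup>2))"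
    by (intro smooth_mult smooth_const smooth_sum smooth_power smooth_component)
  ultimately show ?thesis
    using pds_mult_cutoff_eq[OF smooth_monom_list _ _ assms, of "\<lambda>w. (1 / 2) * (\<Sum>j\<in>UNIV. (complex_of_real (w $ j))\<^sup>2)" 0 G] by simp
qed

text \<open>The cutoff drops out by flatness and the rest is a dilation. The factor belonging to
  \<open>length L\<close> later cancels the power of sqrt |t| in \<open>fourier_expansion\<close>,
  so that apart from a common prefactor no half-integer powers of |t| remain.\<close>

lemma pds_pulled_fun:
  assumes "length L < M" "1 \<le> \<bar>t\<bar>"
  shows "pds L (\<lambda>w. pulled_fun G M t w y) 0 =
    complex_of_real (sqrt \<bar>t\<bar> ^ length G) * complex_of_real (inverse (sqrt \<bar>t\<bar>) ^ length L) * pds L (\<lambda>z. jet G t z y) 0"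
proof -
  define s where "s = sqrt \<bar>t\<bar>"
  define g where "g w = complex_of_real s ^ length G * jet G t (inverse s *\<^sub>R w) y" for w
  define V where "V w = (1 / 2) * (\<Sum>j\<in>UNIV. (complex_of_real s * disp j (inverse s *\<^sub>R w) y)\<^sup>2)" for w
  have e: "pulled_fun G M t w y = g w * cutoff M (V w)" for w
    unfolding pulled_fun_def test_fun_def g_def jet_def V_def s_def prod_list_cmult by simp
  have sg: "smooth g" unfolding g_def
    by (rule smooth_mult[OF smooth_const smooth_scaleR_arg[OF smooth_jet]])
  have sV: "smooth V" unfolding V_def
    by (rule smooth_mult[OF smooth_const smooth_sum[OF smooth_power[OF smooth_mult[OF smooth_const smooth_scaleR_arg[OF smooth_disp]]]]])
  have "pds L (\<lambda>w. pulled_fun G M t w y) 0 = pds L g 0"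
    unfolding e by (rule pds_mult_cutoff_eq[OF sg sV _ assms(1)]) (simp add: V_def)
  also have "\<dots> = complex_of_real s ^ length G * (inverse s ^ length L *\<^sub>R pds L (\<lambda>z. jet G t z y) 0)"
    unfolding g_def pds_cmult[OF smooth_scaleR_arg[OF smooth_jet]] pds_scaleR[OF smooth_jet] by simp
  finally show ?thesis unfolding s_def by (simp add: scaleR_conv_of_real[of _ "_ :: complex"])
qed

text \<open>On the left \<open>sum_pds_monom_list\<close> keeps only the derivative along
  \<open>G\<close>; on the right \<open>pds_pulled_fun\<close> and \<open>pds_jet\<close> leave the
  finite sum \<open>T\<close>. Each term of \<open>T\<close> has an expansion by
  \<open>ray_expansion_subst\<close>, taken to an order that allows for its power of
  \<open>t\<close>.\<close>

lemma ray_expansion_transformed: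
  fixes p p_tilde :: "'n rn \<Rightarrow> 'n rn \<Rightarrow> complex"
  assumes op: "\<And>u. u \<in> schwartz \<Longrightarrow> psdo p_tilde u = psdo p (u \<circ> \<kappa>) \<circ> inv \<kappa>"
    and p: "\<And>x. smooth (p x)" and pt: "\<And>x. smooth (p_tilde x)"
    and q: "symbol_family m (\<lambda>\<xi> y. p (base_point y) \<xi>)"
    and qt: "symbol_family m (\<lambda>\<xi> y. p_tilde (proj tan_coords y) \<xi>)"
    and ex: "\<And>L l. \<exists>S c C. finite S \<and> S \<subseteq> {..m - int (length L)} \<and> (\<forall>k. hol_bdd (c k)) \<and> (\<forall>t. 1 \<le> \<bar>t\<bar> \<longrightarrow>
      hol r sg (C * inverse (\<bar>t\<bar> ^ l)) (\<lambda>y. pds L (p (base_point y)) (t *\<^sub>R axis last_coord 1) -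
        (\<Sum>k\<in>S. c k y * complex_of_real t powi k)))"
  shows "ray_expansion l (\<lambda>t y. pds G (p_tilde (proj tan_coords y)) (t *\<^sub>R axis last_coord 1))"
proof -
  let ?n = "last_coord :: 'n" and ?e = "axis last_coord 1 :: 'n rn"
  obtain c0 c1 A where "holder_scale sg r normal_slope c0 c1 A" using normal_slope_scale by blast
  then interpret hs: holder_scale sg r normal_slope c0 c1 A .
  \<comment> \<open>With N = 2 K the error exponent is Suc r - (N - m) + K = Suc r + m - K, which is
    at most -l. An even \<open>N\<close> makes the power of sqrt |t| integral;
    \<open>length G + 1\<close> ensures that the derivative along \<open>G\<close> occurs.\<close>
  define K where "K = Suc r + l + nat \<bar>m\<bar> + length G + 1"
  define N where "N = 2 * K"
  have N: "m \<le> int N" "0 < N" "length G < N" unfolding N_def K_def by auto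
  define R where "R t = \<bar>t\<bar> ^ Suc r * inverse (\<bar>t\<bar> ^ nat (int N - m)) * sqrt \<bar>t\<bar> ^ N" for t :: real
  have R: "R t \<le> inverse (\<bar>t\<bar> ^ l)" if t: "1 \<le> \<bar>t\<bar>" for t
  proof -
    have "\<bar>t\<bar> ^ (Suc r + K + l) \<le> \<bar>t\<bar> ^ nat (int N - m)"
      using t by (intro power_increasing) (auto simp: N_def K_def)
    moreover have "sqrt \<bar>t\<bar> ^ N = \<bar>t\<bar> ^ K" unfolding N_def power_mult by simp
    moreover have "0 < \<bar>t\<bar> ^ l" "0 < \<bar>t\<bar> ^ nat (int N - m)" using t by (auto intro!: zero_less_power)
    ultimately show ?thesis unfolding R_def by (simp add: field_simps power_add)
  qed
  define I1 where "I1 t y = (\<integral>\<omega>. p_tilde (proj tan_coords y) ((1 * t) *\<^sub>R ?e + sqrt \<bar>t\<bar> *\<^sub>R \<omega>) * fourier (\<lambda>w. model_fun G N t w y) \<omega> \<partial>lborel)" for t y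
  define I2 where "I2 t y = (\<integral>\<omega>. p (base_point y) ((normal_slope y * t) *\<^sub>R ?e + sqrt \<bar>t\<bar> *\<^sub>R \<omega>) * fourier (\<lambda>w. pulled_fun G N t w y) \<omega> \<partial>lborel)" for t y
  have I: "I1 t y = I2 t y" if "1 \<le> \<bar>t\<bar>" for t y
    unfolding I1_def I2_def by (rule operator_identity[OF op p pt that])
  define S1 where "S1 t y = (\<Sum>j<N. (\<Sum>L | length L = j. complex_of_real (sqrt \<bar>t\<bar> ^ j) * (- \<i>) ^ j *
          pds L (p_tilde (proj tan_coords y)) ((1 * t) *\<^sub>R ?e) * pds L (\<lambda>w. model_fun G N t w y) 0) / fact j)" for t y
  define S2 where "S2 t y = (\<Sum>j<N. (\<Sum>L | length L = j. complex_of_real (sqrt \<bar>t\<bar> ^ j) * (- \<i>) ^ j *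
          pds L (p (base_point y)) ((normal_slope y * t) *\<^sub>R ?e) * pds L (\<lambda>w. pulled_fun G N t w y) 0) / fact j)" for t y
  \<comment> \<open>On the left the frequency does not depend on \<open>y\<close>: slope 1, with
    derivative bounded by 0.\<close>
  have "\<exists>C\<ge>0. \<forall>t. 1 \<le> \<bar>t\<bar> \<longrightarrow> hol r sg (C * \<bar>t\<bar> ^ Suc r * inverse (\<bar>t\<bar> ^ nat (int N - m)) * sqrt \<bar>t\<bar> ^ N)
      (\<lambda>y. I1 t y - (2 * pi) ^ CARD('n) * S1 t y)"
    unfolding I1_def S1_def
    by (rule fourier_expansion[where a = "\<lambda>y. 1" and A = 0, OF qt N(1,2) zero_less_one _ _ _ rapid_model_fun])
      (use hol_const[of r sg 0] in \<open>auto simp: pdiff_const\<close>)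
  then obtain C1 where C1: "C1 \<ge> 0" "\<forall>t. 1 \<le> \<bar>t\<bar> \<longrightarrow> hol r sg (C1 * \<bar>t\<bar> ^ Suc r * inverse (\<bar>t\<bar> ^ nat (int N - m)) * sqrt \<bar>t\<bar> ^ N)
      (\<lambda>y. I1 t y - (2 * pi) ^ CARD('n) * S1 t y)" by (elim exE conjE)
  have "\<exists>C\<ge>0. \<forall>t. 1 \<le> \<bar>t\<bar> \<longrightarrow> hol r sg (C * \<bar>t\<bar> ^ Suc r * inverse (\<bar>t\<bar> ^ nat (int N - m)) * sqrt \<bar>t\<bar> ^ N)
      (\<lambda>y. I2 t y - (2 * pi) ^ CARD('n) * S2 t y)"
    unfolding I2_def S2_def
    by (rule fourier_expansion[where a = normal_slope, OF q N(1,2) hs.c0 hs.a rapid_pulled_fun])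
  then obtain C2 where C2: "C2 \<ge> 0" "\<forall>t. 1 \<le> \<bar>t\<bar> \<longrightarrow> hol r sg (C2 * \<bar>t\<bar> ^ Suc r * inverse (\<bar>t\<bar> ^ nat (int N - m)) * sqrt \<bar>t\<bar> ^ N)
      (\<lambda>y. I2 t y - (2 * pi) ^ CARD('n) * S2 t y)" by (elim exE conjE)
  have "\<forall>L. \<exists>h. (\<forall>i. hol_bdd (h i)) \<and> (\<forall>t y. pds L (\<lambda>z. jet G t z y) 0 = (\<Sum>i\<le>length L. complex_of_real t ^ i * h i y))"
    using pds_jet by blast
  from choice[OF this] obtain h where h: "\<forall>L. (\<forall>i. hol_bdd (h L i)) \<and> (\<forall>t y. pds L (\<lambda>z. jet G t z y) 0 = (\<Sum>i\<le>length L. complex_of_real t ^ i * h L i y))"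
    by (elim exE)
  \<comment> \<open>The factor \<open>\<i> ^ length G\<close> cancels the power of
    \<open>- \<i>\<close> on the left, so that \<open>T\<close> is compared directly with the
    derivative of \<open>p_tilde\<close>.\<close>
  define T where "T t y = (\<Sum>j<N. \<Sum>L | length L = j. \<Sum>i\<le>j. complex_of_real t ^ i * ((\<i> ^ length G * (- \<i>) ^ j / fact j) * h L i y) *
    pds L (p (base_point y)) ((normal_slope y * t) *\<^sub>R ?e))" for t y
  have S1: "S1 t y = complex_of_real (sqrt \<bar>t\<bar> ^ length G) * (- \<i>) ^ length G * pds G (p_tilde (proj tan_coords y)) (t *\<^sub>R ?e)" for t y
  proof -
    let ?c = "\<lambda>L. pds L (p_tilde (proj tan_coords y)) ((1 * t) *\<^sub>R ?e)"
    have sy: "symm_coeff ?c"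
      unfolding symm_coeff_def
    proof (intro allI impI)
      fix L L' :: "'n list" assume "mset L = mset L'"
      from smooth_pds_perm[OF pt this] show "?c L = ?c L'" by simp
    qed
    have "(\<Sum>L | length L = j. complex_of_real (sqrt \<bar>t\<bar> ^ j) * (- \<i>) ^ j * ?c L * pds L (\<lambda>w. model_fun G N t w y) 0) / fact j =
        (if j = length G then complex_of_real (sqrt \<bar>t\<bar> ^ j) * (- \<i>) ^ j * ?c G else 0)" if "j < N" for j
    proof -
      have "(\<Sum>L | length L = j. complex_of_real (sqrt \<bar>t\<bar> ^ j) * (- \<i>) ^ j * ?c L * pds L (\<lambda>w. model_fun G N t w y) 0) =
        (\<Sum>L | length L = j. complex_of_real (sqrt \<bar>t\<bar> ^ j) * (- \<i>) ^ j * (?c L * pds L (\<lambda>w. complex_of_real (monom_list G w)) 0))"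
        using that by (intro sum.cong) (auto simp: pds_model_fun)
      also have "\<dots> = complex_of_real (sqrt \<bar>t\<bar> ^ j) * (- \<i>) ^ j * (if j = length G then fact j * ?c G else 0)"
        unfolding sum_distrib_left[symmetric] sum_pds_monom_list[OF sy] ..
      finally show ?thesis by simp
    qed
    then have "S1 t y = (\<Sum>j<N. if j = length G then complex_of_real (sqrt \<bar>t\<bar> ^ j) * (- \<i>) ^ j * ?c G else 0)"
      unfolding S1_def by (intro sum.cong) auto
    then show ?thesis using N(3) by simp
  qed
  have S2: "\<i> ^ length G * S2 t y = complex_of_real (sqrt \<bar>t\<bar> ^ length G) * T t y" if t: "1 \<le> \<bar>t\<bar>" for t y
  proof -
    let ?c = "\<lambda>L. pds L (p (base_point y)) ((normal_slope y * t) *\<^sub>R ?e)"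
    have "\<i> ^ length G * ((\<Sum>L | length L = j. complex_of_real (sqrt \<bar>t\<bar> ^ j) * (- \<i>) ^ j * ?c L * pds L (\<lambda>w. pulled_fun G N t w y) 0) / fact j) =
        complex_of_real (sqrt \<bar>t\<bar> ^ length G) * (\<Sum>L | length L = j. \<Sum>i\<le>j. complex_of_real t ^ i * ((\<i> ^ length G * (- \<i>) ^ j / fact j) * h L i y) * ?c L)" if "j < N" for j
      unfolding sum_divide_distrib sum_distrib_left
    proof (rule sum.cong)
      fix L assume "L \<in> {L :: 'n list. length L = j}"
      then have L: "length L = j" by simp
      have a: "length L < N" using L \<open>j < N\<close> by simp
      have "complex_of_real (sqrt \<bar>t\<bar> ^ j) * complex_of_real (inverse (sqrt \<bar>t\<bar>) ^ j) = 1"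
        using t unfolding of_real_mult[symmetric] power_mult_distrib[symmetric] by simp
      then have "\<i> ^ length G * (complex_of_real (sqrt \<bar>t\<bar> ^ j) * (- \<i>) ^ j * ?c L * (complex_of_real (sqrt \<bar>t\<bar> ^ length G) * complex_of_real (inverse (sqrt \<bar>t\<bar>) ^ j) * X) / fact j) =
         complex_of_real (sqrt \<bar>t\<bar> ^ length G) * (X * ((\<i> ^ length G * (- \<i>) ^ j / fact j) * ?c L))" for X
        by (simp add: divide_inverse mult_ac)
      from this[of "pds L (\<lambda>z. jet G t z y) 0"]
      show "\<i> ^ length G * (complex_of_real (sqrt \<bar>t\<bar> ^ j) * (- \<i>) ^ j * ?c L * pds L (\<lambda>w. pulled_fun G N t w y) 0 / fact j) =
          (\<Sum>i\<le>j. complex_of_real (sqrt \<bar>t\<bar> ^ length G) * (complex_of_real t ^ i * ((\<i> ^ length G * (- \<i>) ^ j / fact j) * h L i y) * ?c L))"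
        using L \<open>j < N\<close> unfolding pds_pulled_fun[OF a t] L h[THEN spec, THEN conjunct2, rule_format]
        by (simp only: sum_distrib_left sum_distrib_right mult_ac)
    qed simp
    then show ?thesis unfolding S2_def T_def sum_distrib_left by (intro sum.cong) (auto simp: sum_distrib_left)
  qed
  have diff: "hol r sg ((C1 + C2) * inverse (\<bar>t\<bar> ^ l)) (\<lambda>y. pds G (p_tilde (proj tan_coords y)) (t *\<^sub>R ?e) - T t y)" if t: "1 \<le> \<bar>t\<bar>" for t
  proof -
    \<comment> \<open>The prefactor common to both sides; it is at least 1, so dividing by it does
      not enlarge the error.\<close>
    define X where "X = (2 * pi) ^ CARD('n) * sqrt \<bar>t\<bar> ^ length G"
    define c where "c = inverse X"
    have "1 \<le> X"
      using t pi_ge_two mult_mono[OF one_le_power[of "2 * pi" "CARD('n)"] one_le_power[of "sqrt \<bar>t\<bar>" "length G"]]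
      unfolding X_def by simp
    then have c: "0 < c" "c \<le> 1" unfolding c_def by (auto intro: inverse_le_1_iff[THEN iffD2])
    have "complex_of_real c * complex_of_real X = 1" using \<open>1 \<le> X\<close> unfolding c_def by simp
    then have cc: "complex_of_real c * ((2 * pi) ^ CARD('n) * complex_of_real (sqrt \<bar>t\<bar> ^ length G)) = 1"
      unfolding X_def by simp
    have ii: "\<i> ^ length G * (- \<i>) ^ length G = 1" by (simp flip: power_mult_distrib)
    have "hol r sg ((C1 + C2) * R t) (\<lambda>y. (I2 t y - (2 * pi) ^ CARD('n) * S2 t y) - (I1 t y - (2 * pi) ^ CARD('n) * S1 t y))"
      using hol_diff[OF C2(2)[rule_format, OF t] C1(2)[rule_format, OF t]] unfolding R_def by (simp add: distrib_right mult.assoc add.commute)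
    from hol_cmult[OF this, of "complex_of_real c * \<i> ^ length G"]
    have "hol r sg (cmod (complex_of_real c * \<i> ^ length G) * ((C1 + C2) * R t)) (\<lambda>y. pds G (p_tilde (proj tan_coords y)) (t *\<^sub>R ?e) - T t y)"
    proof (rule arg_cong[of _ _ "hol r sg _", THEN iffD1, rotated])
      have "complex_of_real c * \<i> ^ length G * ((I2 t y - (2 * pi) ^ CARD('n) * S2 t y) - (I1 t y - (2 * pi) ^ CARD('n) * S1 t y)) =
          complex_of_real c * (2 * pi) ^ CARD('n) * (\<i> ^ length G * S1 t y - \<i> ^ length G * S2 t y)" for y
        unfolding I[OF t] by (simp add: algebra_simps)
      also have "\<dots> y = complex_of_real c * (2 * pi) ^ CARD('n) * (complex_of_real (sqrt \<bar>t\<bar> ^ length G) * ((\<i> ^ length G * (- \<i>) ^ length G) * pds G (p_tilde (proj tan_coords y)) (t *\<^sub>R ?e)) -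
          complex_of_real (sqrt \<bar>t\<bar> ^ length G) * T t y)" for y
        unfolding S2[OF t] S1 by (simp only: mult_ac)
      also have "\<dots> y = (complex_of_real c * ((2 * pi) ^ CARD('n) * complex_of_real (sqrt \<bar>t\<bar> ^ length G))) * (pds G (p_tilde (proj tan_coords y)) (t *\<^sub>R ?e) - T t y)" for y
        unfolding ii by (simp add: algebra_simps)
      finally show "(\<lambda>y. complex_of_real c * \<i> ^ length G * ((I2 t y - (2 * pi) ^ CARD('n) * S2 t y) - (I1 t y - (2 * pi) ^ CARD('n) * S1 t y))) =
          (\<lambda>y. pds G (p_tilde (proj tan_coords y)) (t *\<^sub>R ?e) - T t y)"
        unfolding cc by (simp add: fun_eq_iff)
    qed
    moreover have "cmod (complex_of_real c * \<i> ^ length G) * ((C1 + C2) * R t) \<le> 1 * ((C1 + C2) * inverse (\<bar>t\<bar> ^ l))"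
      using c R[OF t] C1(1) C2(1) by (intro mult_mono mult_nonneg_nonneg) (auto simp: norm_mult norm_power R_def)
    ultimately show ?thesis by (auto intro: hol_mono)
  qed
  have "ray_expansion l T"
    unfolding T_def
  proof (intro ray_expansion_sum ray_expansion_mult_power)
    fix j i :: nat and L :: "'n list"
    show "hol_bdd (\<lambda>y. (\<i> ^ length G * (- \<i>) ^ j / fact j) * h L i y)"
      using h by (intro hol_bdd_mult hol_bdd_const) blast
    show "ray_expansion (l + i) (\<lambda>t y. pds L (p (base_point y)) ((normal_slope y * t) *\<^sub>R ?e))"
      by (rule hs.ray_expansion_subst[where q = "\<lambda>\<xi> y. pds L (p (base_point y)) \<xi>", OF symbol_family_pds[OF q] ex])
  qed
  from ray_expansion_add[OF this ray_expansion_small[OF diff]]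
  have "ray_expansion l (\<lambda>t y. T t y + (pds G (p_tilde (proj tan_coords y)) (t *\<^sub>R ?e) - T t y))" .
  moreover have "T t y + (x - T t y) = x" for t y x by simp
  ultimately show ?thesis by (simp only:)
qed

end

section \<open>Expansions and the transmission condition\<close>

lemma powi_tendsto_0:
  assumes "k < 0" shows "((\<lambda>t :: real. t powi k) \<longlongrightarrow> 0) at_top"
proof -
  have "filterlim (\<lambda>t :: real. t ^ nat (- k)) at_top at_top"
    using assms by (intro filterlim_pow_at_top filterlim_ident) auto
  then have "((\<lambda>t :: real. inverse (t ^ nat (- k))) \<longlongrightarrow> 0) at_top" by (rule tendsto_inverse_0_at_top)
  then show ?thesis using assms by (simp add: power_int_def power_inverse)
qed

text \<open>After division by the highest power with nonzero coefficient the sum tends to that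
  coefficient as t \<rightarrow> \<infinity>, while the bound tends to 0.\<close>

lemma powi_coeff_unique:
  fixes d :: "int \<Rightarrow> complex"
  assumes S: "finite S" and bd: "\<And>t. 1 \<le> t \<Longrightarrow> cmod (\<Sum>k\<in>S. d k * complex_of_real t powi k) \<le> C * t powi a"
    and k: "k \<in> S" "a < k"
  shows "d k = 0"
proof (rule ccontr)
  assume dk: "d k \<noteq> 0"
  define S' where "S' = {k \<in> S. d k \<noteq> 0}"
  have S': "finite S'" "k \<in> S'" unfolding S'_def using S k dk by auto
  define k0 where "k0 = Max S'"
  have k0: "k0 \<in> S'" "\<And>j. j \<in> S' \<Longrightarrow> j \<le> k0" unfolding k0_def using S' by (auto intro: Max_in)
  then have ak: "a < k0" using k0(2)[OF S'(2)] k(2) by linarith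
  define h where "h t = (\<Sum>k\<in>S'. d k * complex_of_real (t powi (k - k0)))" for t
  have "((\<lambda>t. d k * complex_of_real (t powi (k - k0))) \<longlongrightarrow> (if k = k0 then d k0 else 0)) at_top" if "k \<in> S'" for k
  proof (cases "k = k0")
    case False
    then have "((\<lambda>t. d k * complex_of_real (t powi (k - k0))) \<longlongrightarrow> d k * complex_of_real 0) at_top"
      using k0(2)[OF that] by (intro tendsto_intros powi_tendsto_0) auto
    then show ?thesis using False by simp
  qed auto
  then have "(h \<longlongrightarrow> (\<Sum>k\<in>S'. if k = k0 then d k0 else 0)) at_top" unfolding h_def by (intro tendsto_sum)
  then have l1: "(h \<longlongrightarrow> d k0) at_top" using k0(1) S'(1) by simp
  have "((\<lambda>t. C * t powi (a - k0)) \<longlongrightarrow> C * 0) at_top" using ak by (intro tendsto_intros powi_tendsto_0) auto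
  then have l2: "((\<lambda>t. C * t powi (a - k0)) \<longlongrightarrow> 0) at_top" by simp
  have "cmod (h t) \<le> C * t powi (a - k0)" if t: "1 \<le> t" for t
  proof -
    have "h t = complex_of_real (t powi (- k0)) * (\<Sum>k\<in>S'. d k * complex_of_real t powi k)"
      unfolding h_def sum_distrib_left using t by (intro sum.cong) (auto simp: power_int_add power_int_diff power_int_minus field_simps)
    also have "(\<Sum>k\<in>S'. d k * complex_of_real t powi k) = (\<Sum>k\<in>S. d k * complex_of_real t powi k)"
      unfolding S'_def using S by (intro sum.mono_neutral_left) auto
    finally have "cmod (h t) = t powi (- k0) * cmod (\<Sum>k\<in>S. d k * complex_of_real t powi k)"
      using t by (simp add: norm_mult norm_power_int)
    also have "\<dots> \<le> t powi (- k0) * (C * t powi a)" using t by (intro mult_left_mono bd) auto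
    also have "\<dots> = C * t powi (a - k0)" using t by (simp add: power_int_diff power_int_minus field_simps)
    finally show ?thesis .
  qed
  then have "(h \<longlongrightarrow> 0) at_top"
    by (intro Lim_null_comparison[OF _ l2] eventually_at_top_linorderI[of 1]) auto
  then have "d k0 = 0" using l1 tendsto_unique[OF trivial_limit_at_top_linorder] by blast
  then show False using k0(1) unfolding S'_def by simp
qed

context holder_class
begin

text \<open>The coefficients found for different orders agree by uniqueness wherever both orders
  determine them, and the growth bound excludes exponents above \<open>m\<close>. The remainder has
  order \<open>Suc l\<close> because the terms down to t^(-l) are kept.\<close>

lemma ray_expansion_coherent:
  fixes f :: "real \<Rightarrow> 'n::finite rn \<Rightarrow> complex"
  assumes f: "\<And>l. ray_expansion l f" and fb: "\<And>t y. 1 \<le> \<bar>t\<bar> \<Longrightarrow> cmod (f t y) \<le> B * \<bar>t\<bar> powi m"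
  shows "\<exists>c. (\<forall>k. hol_bdd (c k)) \<and> (\<forall>k>m. c k = (\<lambda>y. 0)) \<and> (\<forall>l. \<exists>C. \<forall>t. 1 \<le> \<bar>t\<bar> \<longrightarrow>
    hol r sg (C * inverse (\<bar>t\<bar> ^ Suc l)) (\<lambda>y. f t y - (\<Sum>k = - int l..m. c k y * complex_of_real t powi k)))"
proof -
  have "\<forall>l. \<exists>ScC. finite (fst ScC) \<and> (\<forall>k. hol_bdd (fst (snd ScC) k)) \<and> (\<forall>t. 1 \<le> \<bar>t\<bar> \<longrightarrow>
    hol r sg (snd (snd ScC) * inverse (\<bar>t\<bar> ^ l)) (\<lambda>y. f t y - (\<Sum>k\<in>fst ScC. fst (snd ScC) k y * complex_of_real t powi k)))"
    using f unfolding ray_expansion_def by simp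
  from choice[OF this] obtain Q where Q: "\<forall>l. finite (fst (Q l)) \<and> (\<forall>k. hol_bdd (fst (snd (Q l)) k)) \<and> (\<forall>t. 1 \<le> \<bar>t\<bar> \<longrightarrow>
    hol r sg (snd (snd (Q l)) * inverse (\<bar>t\<bar> ^ l)) (\<lambda>y. f t y - (\<Sum>k\<in>fst (Q l). fst (snd (Q l)) k y * complex_of_real t powi k)))" ..
  define S where "S l = fst (Q l)" for l
  define C where "C l = snd (snd (Q l))" for l
  define c where "c l k = (if k \<in> S l then fst (snd (Q l)) k else (\<lambda>y. 0))" for l k
  have S: "finite (S l)" for l using Q unfolding S_def by blast
  have c: "hol_bdd (c l k)" for l k using Q hol_bdd_const[of 0] unfolding c_def by auto
  have e: "hol r sg (C l * inverse (\<bar>t\<bar> ^ l)) (\<lambda>y. f t y - (\<Sum>k\<in>T. c l k y * complex_of_real t powi k))"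
    if t: "1 \<le> \<bar>t\<bar>" and T: "finite T" "S l \<subseteq> T" for l t T
  proof -
    have "(\<Sum>k\<in>T. c l k y * complex_of_real t powi k) = (\<Sum>k\<in>S l. c l k y * complex_of_real t powi k)" for y
      using T by (intro sum.mono_neutral_right) (auto simp: c_def)
    also have "\<dots> y = (\<Sum>k\<in>fst (Q l). fst (snd (Q l)) k y * complex_of_real t powi k)" for y
      unfolding c_def S_def by (intro sum.cong) auto
    finally show ?thesis using Q[rule_format, of l] t unfolding C_def by simp
  qed
  have pw: "inverse (t ^ l) \<le> t powi a" if "1 \<le> t" "- int l \<le> a" for t :: real and l a
  proof -
    have "inverse (t ^ l) = t powi (- int l)" by (simp add: power_int_minus)
    then show ?thesis using power_int_increasing[OF that(2,1)] by simp
  qed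
  have same: "c l k y = c l' k y" if k: "- int l < k" "- int l' < k" for l l' k y
  proof -
    let ?T = "S l \<union> S l' \<union> {k}"
    have C0: "0 \<le> C l" for l using hol_nonneg[OF e[of 1 "S l" l]] S by simp
    have "c l k y - c l' k y = 0"
    proof (rule powi_coeff_unique[of ?T "\<lambda>k. c l k y - c l' k y" "C l + C l'" "max (- int l) (- int l')" k])
      fix t :: real assume t: "1 \<le> t"
      have X: "cmod (f t y - (\<Sum>k\<in>?T. c l k y * complex_of_real t powi k)) \<le> C l * inverse (\<bar>t\<bar> ^ l)"
        if "S l \<subseteq> ?T" for l using hol_bound[OF e[of t ?T l]] t S that by simp
      have
        "cmod ((f t y - (\<Sum>k\<in>?T. c l' k y * complex_of_real t powi k)) - (f t y - (\<Sum>k\<in>?T. c l k y * complex_of_real t powi k))) \<le> C l' * inverse (\<bar>t\<bar> ^ l') + C l * inverse (\<bar>t\<bar> ^ l)"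
        by (rule order_trans[OF norm_triangle_ineq4 add_mono[OF X X]]) auto
      also have "\<dots> \<le> C l' * t powi max (- int l) (- int l') + C l * t powi max (- int l) (- int l')"
        using t C0 by (intro add_mono mult_left_mono) (auto intro!: pw)
      finally show "cmod (\<Sum>k\<in>?T. (c l k y - c l' k y) * complex_of_real t powi k) \<le> (C l + C l') * t powi max (- int l) (- int l')"
        by (simp add: sum_subtractf left_diff_distrib distrib_right add.commute)
    qed (use S k in auto)
    then show ?thesis by simp
  qed
  \<comment> \<open>Taken from an expansion whose order exceeds -k, where the k-th coefficient is
    already determined.\<close>
  define c' where "c' k = c (nat (- k) + 1) k" for k
  have cc': "c l k = c' k" if "- int l < k" for l k
    unfolding c'_def using same[OF that, of "nat (- k) + 1"] by auto
  have hi: "c' k = (\<lambda>y. 0)" if k: "m < k" for k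
  proof
    fix y
    define l where "l = nat (- k) + 1"
    have l: "- int l < k" unfolding l_def by linarith
    have C0: "0 \<le> C l" using hol_nonneg[OF e[of 1 "S l" l]] S by simp
    have B0: "0 \<le> B" using order_trans[OF norm_ge_zero fb[of 1 y]] by simp
    have "c l k y = 0"
    proof (rule powi_coeff_unique[of "insert k (S l)" "\<lambda>k. c l k y" "C l + B" "max (- int l) m" k])
      fix t :: real assume t: "1 \<le> t"
      have "cmod (f t y - (\<Sum>k\<in>insert k (S l). c l k y * complex_of_real t powi k)) \<le> C l * inverse (\<bar>t\<bar> ^ l)"
        using hol_bound[OF e[of t "insert k (S l)" l]] t S by auto
      moreover have "cmod (f t y) \<le> B * t powi m" using fb[of t y] t by simp
      ultimately have "cmod (\<Sum>k\<in>insert k (S l). c l k y * complex_of_real t powi k) \<le> C l * inverse (\<bar>t\<bar> ^ l) + B * t powi m"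
        using norm_triangle_ineq4[of "f t y" "f t y - (\<Sum>k\<in>insert k (S l). c l k y * complex_of_real t powi k)"] by simp
      also have "\<dots> \<le> C l * t powi max (- int l) m + B * t powi max (- int l) m"
        using t C0 B0 by (intro add_mono mult_left_mono) (auto intro!: pw power_int_increasing)
      finally show "cmod (\<Sum>k\<in>insert k (S l). c l k y * complex_of_real t powi k) \<le> (C l + B) * t powi max (- int l) m"
        by (simp add: distrib_right)
    qed (use S k l in auto)
    then show "c' k y = 0" unfolding c'_def l_def .
  qed
  have main: "\<exists>D. \<forall>t. 1 \<le> \<bar>t\<bar> \<longrightarrow> hol r sg (D * inverse (\<bar>t\<bar> ^ Suc l)) (\<lambda>y. f t y - (\<Sum>k = - int l..m. c' k y * complex_of_real t powi k))" for l
  proof -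
    let ?l = "Suc l"
    have "\<forall>k. \<exists>A. hol r sg A (c ?l k)" using c unfolding hol_bdd_def by blast
    from choice[OF this] obtain A where A: "\<forall>k. hol r sg (A k) (c ?l k)" ..
    \<comment> \<open>Exponents below -l go into the remainder. The set \<open>U\<close> adds to the
      expansion the missing exponents, with coefficient 0, so that the full range down to -l
      appears.\<close>
    define T where "T = S ?l \<inter> {..< - int l}"
    define U where "U = T \<union> (S ?l \<union> {- int l..m}) \<inter> {- int l..}"
    have fin: "finite U" "finite T" unfolding T_def U_def using S by auto
    have SU: "S ?l \<subseteq> U" unfolding U_def T_def by auto
    have "hol r sg ((C ?l + (\<Sum>k\<in>T. A k)) * inverse (\<bar>t\<bar> ^ Suc l)) (\<lambda>y. f t y - (\<Sum>k = - int l..m. c' k y * complex_of_real t powi k))"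
      if t: "1 \<le> \<bar>t\<bar>" for t
    proof -
      have "hol r sg (\<Sum>k\<in>T. A k * inverse (\<bar>t\<bar> ^ Suc l)) (\<lambda>y. \<Sum>k\<in>T. c ?l k y * complex_of_real t powi k)"
      proof (rule hol_sum)
        fix k assume "k \<in> T"
        then have k: "k \<le> - int (Suc l)" unfolding T_def by auto
        have "cmod (complex_of_real t powi k) = \<bar>t\<bar> powi k" by (simp add: norm_power_int)
        also have "\<dots> \<le> \<bar>t\<bar> powi (- int (Suc l))" using k t by (intro power_int_increasing) auto
        also have "\<dots> = inverse (\<bar>t\<bar> ^ Suc l)" by (simp only: power_int_minus power_int_of_nat)
        finally have "cmod (complex_of_real t powi k) * A k \<le> inverse (\<bar>t\<bar> ^ Suc l) * A k"
          using hol_nonneg[OF A[rule_format]] by (rule mult_right_mono)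
        from hol_mono[OF hol_cmult[OF A[rule_format]] this]
        show "hol r sg (A k * inverse (\<bar>t\<bar> ^ Suc l)) (\<lambda>y. c ?l k y * complex_of_real t powi k)" by (simp only: mult.commute)
      qed
      from hol_add[OF e[OF t fin(1) SU] this]
      have "hol r sg ((C ?l + (\<Sum>k\<in>T. A k)) * inverse (\<bar>t\<bar> ^ Suc l))
        (\<lambda>y. f t y - (\<Sum>k\<in>U. c ?l k y * complex_of_real t powi k) + (\<Sum>k\<in>T. c ?l k y * complex_of_real t powi k))"
        unfolding sum_distrib_right distrib_right .
      moreover have "f t y - (\<Sum>k\<in>U. c ?l k y * complex_of_real t powi k) + (\<Sum>k\<in>T. c ?l k y * complex_of_real t powi k) =
          f t y - (\<Sum>k = - int l..m. c' k y * complex_of_real t powi k)" for y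
      proof -
        have "(\<Sum>k\<in>U. c ?l k y * complex_of_real t powi k) = (\<Sum>k\<in>T. c ?l k y * complex_of_real t powi k) +
            (\<Sum>k\<in>(S ?l \<union> {- int l..m}) \<inter> {- int l..}. c ?l k y * complex_of_real t powi k)"
          unfolding U_def by (rule sum.union_disjoint) (use S in \<open>auto simp: T_def\<close>)
        also have "(\<Sum>k\<in>(S ?l \<union> {- int l..m}) \<inter> {- int l..}. c ?l k y * complex_of_real t powi k) = (\<Sum>k = - int l..m. c ?l k y * complex_of_real t powi k)"
        proof (rule sum.mono_neutral_right)
          show "\<forall>k\<in>(S ?l \<union> {- int l..m}) \<inter> {- int l..} - {- int l..m}. c ?l k y * complex_of_real t powi k = 0"
          proof
            fix k assume "k \<in> (S ?l \<union> {- int l..m}) \<inter> {- int l..} - {- int l..m}"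
            then have "m < k" "- int ?l < k" by auto
            then show "c ?l k y * complex_of_real t powi k = 0" using cc'[of ?l k] hi[of k] by simp
          qed
        qed (use S in auto)
        also have "\<dots> = (\<Sum>k = - int l..m. c' k y * complex_of_real t powi k)"
        proof (rule sum.cong)
          fix k assume "k \<in> {- int l..m}"
          then have "- int ?l < k" by auto
          then show "c ?l k y * complex_of_real t powi k = c' k y * complex_of_real t powi k" using cc'[of ?l k] by simp
        qed simp
        finally show ?thesis by simp
      qed
      ultimately show ?thesis by (simp only:)
    qed
    then show ?thesis by blast
  qed
  show ?thesis using c hi main by (intro exI[of _ c']) (auto simp: c'_def)
qed

end

lemma proj_proj [simp]: "proj I (proj I x) = proj I x"
  by (simp add: vec_eq_iff)

lemma proj_0 [simp]: "proj I 0 = 0"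
  by (simp add: vec_eq_iff)

lemma norm_proj_le: "norm (proj I x) \<le> norm x"
  using norm_proj_diff_le[of I x 0] by simp

lemma jap_mono: "norm x \<le> norm y \<Longrightarrow> jap x \<le> jap y"
  unfolding jap_def by (auto intro!: power_mono)

lemma proj_tan_scaleR_axis [simp]: "proj tan_coords (t *\<^sub>R axis last_coord 1) = 0"
  by (auto simp: vec_eq_iff axis_def)

lemma decompose_last: "\<xi> = (\<xi> $ last_coord) *\<^sub>R axis last_coord 1 + proj tan_coords \<xi>"
  by (auto simp: vec_eq_iff axis_def)

lemma abs_last_le_jap: "\<bar>\<xi> $ last_coord\<bar> \<le> jap \<xi>"
  using component_le_norm_cart[of \<xi> last_coord] jap_ge_norm[of \<xi>] by linarith

text \<open>On the ray the bracket is comparable with |t|, so symbol bounds with real powers become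
  bounds with integer powers, whatever the sign of the exponent.\<close>

lemma powr_int_bound:
  fixes s X :: real
  assumes "1 \<le> s" "s \<le> X" "X \<le> 2 * s"
  shows "X powr of_int k \<le> 2 ^ nat \<bar>k\<bar> * s powi k"
proof -
  have X: "X powr of_int k = X powi k" using assms by (intro powr_real_of_int'[of X]) auto
  show ?thesis
  proof (cases "k \<ge> 0")
    case True
    have "X ^ nat k \<le> (2 * s) ^ nat k" using assms by (intro power_mono) auto
    then show ?thesis using True unfolding X by (simp add: power_int_def power_mult_distrib)
  next
    case False
    have "inverse (X ^ nat (- k)) \<le> inverse (s ^ nat (- k))" using assms by (intro le_imp_inverse_le power_mono zero_less_power) auto
    moreover have "1 * inverse (s ^ nat (- k)) \<le> 2 ^ nat \<bar>k\<bar> * inverse (s ^ nat (- k))" using assms by (intro mult_right_mono) auto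
    ultimately show ?thesis using False unfolding X by (simp add: power_int_def power_inverse)
  qed
qed

lemma smooth_monom_list_proj: "smooth (\<lambda>\<xi> :: 'n::finite rn. complex_of_real (monom_list L (proj I \<xi>)))"
proof (induction L)
  case (Cons i L)
  have "smooth (\<lambda>\<xi> :: 'n rn. complex_of_real (proj I \<xi> $ i))"
    by (cases "i \<in> I") (simp_all add: smooth_component smooth_const)
  from smooth_mult[OF this Cons] show ?case by simp
qed (simp add: smooth_const)

section \<open>From the transmission condition to expansions on the ray and back\<close>

context holder_class
begin

lemma symbol_family_of_class:
  fixes p :: "'n::{finite,linorder} rn \<Rightarrow> 'n rn \<Rightarrow> complex"
  assumes p: "p \<in> symbol_class \<tau> (of_int m)" and \<tau>: "r = nat \<lfloor>\<tau>\<rfloor>" "sg = \<tau> - real r"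
    and g: "\<exists>C>0. \<forall>B f. hol r sg B f \<longrightarrow> hol r sg (C * B) (\<lambda>y. f (g y))"
  shows "symbol_family m (\<lambda>\<xi> y. p (g y) \<xi>)"
  unfolding symbol_family_def
proof (intro conjI allI)
  have sm: "smooth (p x)" for x using p unfolding symbol_class_def by blast
  then show "smooth (p (g y))" for y .
  fix L
  obtain C where C: "\<forall>\<xi>. holder_norm UNIV \<tau> (\<lambda>x. mdiff (list_mi L) (p x) \<xi>) \<le> ennreal (C * jap \<xi> powr (of_int m - real (mi_order (list_mi L))))"
    using p unfolding symbol_class_def by blast
  obtain D where D: "D > 0" "\<forall>B f. hol r sg B f \<longrightarrow> hol r sg (D * B) (\<lambda>y. f (g y))" using g by (elim exE conjE)
  have "hol r sg (D * max 0 C * jap \<xi> powr (of_int m - real (length L))) (\<lambda>y. pds L (p (g y)) \<xi>)" for \<xi>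
  proof -
    let ?J = "jap \<xi> powr (of_int m - real (length L))"
    have "mdiff (list_mi L) (p x) = pds L (p x)" for x using sm unfolding smooth_Ck by (intro mdiff_list_mi) blast
    then have "holder_norm UNIV \<tau> (\<lambda>x. pds L (p x) \<xi>) \<le> ennreal (C * ?J)" using C by (simp add: mi_order_list_mi)
    also have "\<dots> \<le> ennreal (max 0 C * ?J)" by (intro ennreal_leI mult_right_mono) auto
    finally have "hol r sg (max 0 C * ?J) (\<lambda>x. pds L (p x) \<xi>)"
      using hol_of_holder_norm[of UNIV \<tau> "\<lambda>x. pds L (p x) \<xi>" "max 0 C * ?J"] \<tau> by simp
    from D(2)[rule_format, OF this] show ?thesis by (simp add: mult.assoc)
  qed
  then show "\<exists>C. \<forall>\<xi>. hol r sg (C * jap \<xi> powr (of_int m - real (length L))) (\<lambda>y. pds L (p (g y)) \<xi>)" by blast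
qed

lemma hol_bdd_of_holder_space:
  fixes f :: "'n::{finite,linorder} rn \<Rightarrow> complex"
  assumes "f \<in> holder_space I \<tau>" "r = nat \<lfloor>\<tau>\<rfloor>" "sg = \<tau> - real r"
  shows "hol_bdd (\<lambda>x. f (proj I x))"
proof -
  have "holder_norm I \<tau> f < top" using assms(1) unfolding holder_space_def by simp
  then obtain B where "0 \<le> B" "holder_norm I \<tau> f = ennreal B" unfolding less_top_ennreal by blast
  then show ?thesis unfolding hol_bdd_def using hol_of_holder_norm[of I \<tau> f B] assms(2,3) by auto
qed

lemma hol_comp_proj: "\<exists>C>0. \<forall>B f. hol r sg B f \<longrightarrow> hol r sg (C * B) (\<lambda>x :: 'n::finite rn. f (proj I x))"
  by (rule hol_comp[OF bdm_proj])

text \<open>At \<xi>' = 0 the bracket equals 1, so the condition applies for all |t| \<ge> 1;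
  dividing by t^l gives an expansion. The map \<open>g\<close> transports it to boundary points
  depending on \<open>y\<close>.\<close>

lemma transmission_expansion:
  fixes p :: "'n::{finite,linorder} rn \<Rightarrow> 'n rn \<Rightarrow> complex"
  assumes tc: "transmission_condition \<tau> m p" and sm: "\<And>x. smooth (p x)"
    and \<tau>: "r = nat \<lfloor>\<tau>\<rfloor>" "sg = \<tau> - real r"
    and g: "\<exists>C>0. \<forall>B f. hol r sg B f \<longrightarrow> hol r sg (C * B) (\<lambda>y. f (g y))" and gp: "\<And>y. proj tan_coords (g y) = g y"
  shows "\<exists>S c C. finite S \<and> S \<subseteq> {..m - int (length L)} \<and> (\<forall>k. hol_bdd (c k)) \<and> (\<forall>t. 1 \<le> \<bar>t\<bar> \<longrightarrow>
      hol r sg (C * inverse (\<bar>t\<bar> ^ l)) (\<lambda>y. pds L (p (g y)) (t *\<^sub>R axis last_coord 1) -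
        (\<Sum>k\<in>S. c k y * complex_of_real t powi k)))"
proof -
  let ?a = "length L" and ?e = "axis last_coord 1 :: 'n rn"
  let ?K = "{- int l..m - int (length L)}"
  obtain s :: "int \<Rightarrow> 'n multiindex \<Rightarrow> 'n rn \<Rightarrow> 'n rn \<Rightarrow> complex" where
    s1: "\<forall>k \<alpha>. \<forall>\<xi>'\<in>coord_space tan_coords. (\<lambda>x'. s k \<alpha> x' \<xi>') \<in> holder_space tan_coords \<tau>"
    and s2: "\<forall>\<alpha> (l::nat). \<exists>C. \<forall>\<xi>. \<bar>\<xi> $ last_coord\<bar> \<ge> jap (tan_part \<xi>) \<longrightarrow>
          holder_norm tan_coords \<tau>
            (\<lambda>x'. of_real (\<xi> $ last_coord) ^ l * D_mdiff \<alpha> (p x') \<xi>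
               - (\<Sum>k = - int l..m - int (mi_order \<alpha>).
                    s k \<alpha> x' (tan_part \<xi>) * of_real (\<xi> $ last_coord) powi (k + int l)))
          \<le> ennreal (C * jap (tan_part \<xi>) powi (m + int l + 1 - int (mi_order \<alpha>))
                       * inverse \<bar>\<xi> $ last_coord\<bar>)"
    using tc unfolding transmission_condition_def by blast
  obtain D where D: "D > 0" "\<forall>B f. hol r sg B f \<longrightarrow> hol r sg (D * B) (\<lambda>y. f (g y))" using g by (elim exE conjE)
  \<comment> \<open>The power of \<open>\<i>\<close> undoes the factor in \<open>D_mdiff\<close>,
    since \<open>pds\<close> uses derivatives without that factor.\<close>
  define c where "c k y = \<i> ^ ?a * s k (list_mi L) (g y) 0" for k y
  have "hol_bdd (c k)" for k
  proof -
    have "(\<lambda>x'. s k (list_mi L) x' 0) \<in> holder_space tan_coords \<tau>" using s1 by (simp add: coord_space_def)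
    from hol_bdd_of_holder_space[OF this \<tau>] obtain B where "hol r sg B (\<lambda>x. s k (list_mi L) (proj tan_coords x) 0)"
      unfolding hol_bdd_def by blast
    from D(2)[rule_format, OF this] have "hol_bdd (\<lambda>y. s k (list_mi L) (g y) 0)" unfolding hol_bdd_def gp by blast
    then show ?thesis unfolding c_def by (intro hol_bdd_mult hol_bdd_const)
  qed
  moreover obtain C where C: "\<forall>\<xi>. \<bar>\<xi> $ last_coord\<bar> \<ge> jap (tan_part \<xi>) \<longrightarrow>
          holder_norm tan_coords \<tau>
            (\<lambda>x'. of_real (\<xi> $ last_coord) ^ l * D_mdiff (list_mi L) (p x') \<xi>
               - (\<Sum>k = - int l..m - int (mi_order (list_mi L)).
                    s k (list_mi L) x' (tan_part \<xi>) * of_real (\<xi> $ last_coord) powi (k + int l)))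
          \<le> ennreal (C * jap (tan_part \<xi>) powi (m + int l + 1 - int (mi_order (list_mi L)))
                       * inverse \<bar>\<xi> $ last_coord\<bar>)" using s2 by blast
  have "hol r sg (D * max 0 C * inverse (\<bar>t\<bar> ^ l)) (\<lambda>y. pds L (p (g y)) (t *\<^sub>R ?e) - (\<Sum>k\<in>?K. c k y * complex_of_real t powi k))"
    if t: "1 \<le> \<bar>t\<bar>" for t
  proof -
    have t0: "t \<noteq> 0" using t by auto
    have md: "mdiff (list_mi L) (p x) = pds L (p x)" for x using sm unfolding smooth_Ck by (intro mdiff_list_mi) blast
    define H where "H x = complex_of_real t ^ l * ((- \<i>) ^ ?a * pds L (p x) (t *\<^sub>R ?e)) -
      (\<Sum>k\<in>?K. s k (list_mi L) x 0 * complex_of_real t powi (k + int l))" for x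
    have "holder_norm tan_coords \<tau> H \<le> ennreal (C * inverse \<bar>t\<bar>)"
      using C[rule_format, of "t *\<^sub>R ?e"] t
      unfolding tan_part_eq_proj D_mdiff_def mi_order_list_mi md H_def
      by (simp add: jap_def)
    also have "\<dots> \<le> ennreal (max 0 C * inverse \<bar>t\<bar>)" by (intro ennreal_leI mult_right_mono) auto
    finally have "hol r sg (max 0 C * inverse \<bar>t\<bar>) (\<lambda>x. H (proj tan_coords x))"
      using hol_of_holder_norm[of tan_coords \<tau> H "max 0 C * inverse \<bar>t\<bar>"] \<tau> by simp
    from D(2)[rule_format, OF this] have "hol r sg (D * (max 0 C * inverse \<bar>t\<bar>)) (\<lambda>y. H (g y))" unfolding gp .
    from hol_cmult[OF this, of "\<i> ^ ?a * inverse (complex_of_real t ^ l)"]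
    have "hol r sg (inverse (\<bar>t\<bar> ^ l) * (D * (max 0 C * inverse \<bar>t\<bar>))) (\<lambda>y. \<i> ^ ?a * inverse (complex_of_real t ^ l) * H (g y))"
      by (simp add: norm_mult norm_inverse norm_power)
    moreover have "inverse (\<bar>t\<bar> ^ l) * (D * (max 0 C * inverse \<bar>t\<bar>)) \<le> inverse (\<bar>t\<bar> ^ l) * (D * (max 0 C * 1))"
      using t D(1) by (intro mult_left_mono) (auto simp: inverse_le_1_iff)
    moreover have "\<i> ^ ?a * inverse (complex_of_real t ^ l) * H (g y) = pds L (p (g y)) (t *\<^sub>R ?e) - (\<Sum>k\<in>?K. c k y * complex_of_real t powi k)" for y
    proof -
      have "\<i> ^ ?a * (- \<i>) ^ ?a = 1" by (simp flip: power_mult_distrib)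
      moreover have "inverse (complex_of_real t ^ l) * complex_of_real t powi (k + int l) = complex_of_real t powi k" for k
        using t0 by (simp add: power_int_add)
      ultimately show ?thesis
        using t0 unfolding H_def c_def right_diff_distrib sum_distrib_left
        by (intro arg_cong2[of _ _ _ _ minus] sum.cong) (simp_all add: mult_ac, simp_all add: mult.assoc[symmetric])
    qed
    ultimately show ?thesis by (auto intro: hol_mono simp: mult_ac)
  qed
  moreover have "finite ?K" "?K \<subseteq> {..m - int (length L)}" by auto
  ultimately show ?thesis by (intro exI[of _ ?K] exI[of _ c] exI[of _ "D * max 0 C"]) blast
qed

lemma boundary_coefficients:
  fixes q :: "'n::{finite,linorder} rn \<Rightarrow> 'n rn \<Rightarrow> complex"
  assumes q: "symbol_family m (\<lambda>\<xi> y. q (proj tan_coords y) \<xi>)"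
    and as: "\<And>l. ray_expansion l (\<lambda>t y. pds G (q (proj tan_coords y)) (t *\<^sub>R axis last_coord 1))"
  shows "\<exists>d. (\<forall>k. hol_bdd (d k)) \<and> (\<forall>k>m - int (length G). d k = (\<lambda>y. 0)) \<and> (\<forall>k y. d k (proj tan_coords y) = d k y) \<and>
    (\<forall>l. \<exists>C. \<forall>t. 1 \<le> \<bar>t\<bar> \<longrightarrow> hol r sg (C * inverse (\<bar>t\<bar> ^ Suc l))
      (\<lambda>y. pds G (q (proj tan_coords y)) (t *\<^sub>R axis last_coord 1) - (\<Sum>k = - int l..m - int (length G). d k y * complex_of_real t powi k)))"
proof -
  let ?e = "axis last_coord 1 :: 'n rn" and ?m = "m - int (length G)"
  obtain B where B: "\<forall>\<xi>. hol r sg (B * jap \<xi> powr (of_int m - real (length G))) (\<lambda>y. pds G (q (proj tan_coords y)) \<xi>)"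
    using q unfolding symbol_family_def by blast
  have B0: "0 \<le> B" by (rule nonneg_of_mult_pos[OF hol_nonneg[OF B[rule_format, of 0]]]) (simp add: jap_pos[THEN less_imp_neq, symmetric])
  have fb: "cmod (pds G (q (proj tan_coords y)) (t *\<^sub>R ?e)) \<le> (B * 2 ^ nat \<bar>?m\<bar>) * \<bar>t\<bar> powi ?m" if t: "1 \<le> \<bar>t\<bar>" for t y
  proof -
    have n: "norm (t *\<^sub>R ?e) = \<bar>t\<bar>" by (simp add: norm_axis_1)
    have "jap (t *\<^sub>R ?e) powr of_int ?m \<le> 2 ^ nat \<bar>?m\<bar> * \<bar>t\<bar> powi ?m"
      using t jap_ge_norm[of "t *\<^sub>R ?e"] jap_le[of "t *\<^sub>R ?e"] unfolding n by (intro powr_int_bound) auto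
    from mult_left_mono[OF this B0] show ?thesis using hol_bound[OF B[rule_format, of "t *\<^sub>R ?e"], of y] by simp
  qed
  obtain c where c: "\<forall>k. hol_bdd (c k)" "\<forall>k>?m. c k = (\<lambda>y. 0)" and ce: "\<forall>l. \<exists>C. \<forall>t. 1 \<le> \<bar>t\<bar> \<longrightarrow>
    hol r sg (C * inverse (\<bar>t\<bar> ^ Suc l)) (\<lambda>y. pds G (q (proj tan_coords y)) (t *\<^sub>R ?e) - (\<Sum>k = - int l..?m. c k y * complex_of_real t powi k))"
    by (rule exE[OF ray_expansion_coherent[where f = "\<lambda>t y. pds G (q (proj tan_coords y)) (t *\<^sub>R ?e)", OF as fb]])
      (assumption, elim conjE, rule that)
  obtain D where D: "D > 0" "\<forall>B f. hol r sg B f \<longrightarrow> hol r sg (D * B) (\<lambda>y :: 'n rn. f (proj tan_coords y))" using hol_comp_proj[of tan_coords] by (elim exE conjE)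
  \<comment> \<open>The expanded function is invariant under the projection, so composing with it
    preserves the remainder estimates and makes the coefficients functions on the boundary.\<close>
  define d where "d k y = c k (proj tan_coords y)" for k y
  have "hol_bdd (d k)" for k using c(1) D(2) unfolding hol_bdd_def d_def by blast
  moreover have "\<exists>C. \<forall>t. 1 \<le> \<bar>t\<bar> \<longrightarrow> hol r sg (C * inverse (\<bar>t\<bar> ^ Suc l))
      (\<lambda>y. pds G (q (proj tan_coords y)) (t *\<^sub>R ?e) - (\<Sum>k = - int l..?m. d k y * complex_of_real t powi k))" for l
  proof -
    obtain C where C: "\<forall>t. 1 \<le> \<bar>t\<bar> \<longrightarrow>
      hol r sg (C * inverse (\<bar>t\<bar> ^ Suc l)) (\<lambda>y. pds G (q (proj tan_coords y)) (t *\<^sub>R ?e) - (\<Sum>k = - int l..?m. c k y * complex_of_real t powi k))"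
      using ce by blast
    have "hol r sg (D * C * inverse (\<bar>t\<bar> ^ Suc l)) (\<lambda>y. pds G (q (proj tan_coords y)) (t *\<^sub>R ?e) - (\<Sum>k = - int l..?m. d k y * complex_of_real t powi k))"
      if "1 \<le> \<bar>t\<bar>" for t
      using D(2)[rule_format, OF C[rule_format, OF that]] unfolding d_def proj_proj by (simp add: mult.assoc)
    then show ?thesis by blast
  qed
  ultimately show ?thesis using c(2) by (intro exI[of _ d]) (auto simp: d_def)
qed

text \<open>Taylor's formula in \<xi>' about the ray: the tangential derivatives of the symbol on
  the ray have expansions by assumption, and the terms are regrouped by powers of the normal
  frequency. In the region |\<xi>_n| \<ge> <\<xi>'> the powers of <\<xi>'> in the errors match those
  allowed by the condition.\<close>

lemma transmission_condition_of_asym: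
  fixes q :: "'n::{finite,linorder} rn \<Rightarrow> 'n rn \<Rightarrow> complex"
  assumes \<tau>: "r = nat \<lfloor>\<tau>\<rfloor>" "sg = \<tau> - real r"
    and q: "symbol_family m (\<lambda>\<xi> y. q (proj tan_coords y) \<xi>)"
    and as: "\<And>G l. ray_expansion l (\<lambda>t y. pds G (q (proj tan_coords y)) (t *\<^sub>R axis last_coord 1))"
  shows "transmission_condition \<tau> m q"
proof -
  let ?e = "axis last_coord 1 :: 'n rn" and ?P = "proj tan_coords :: 'n rn \<Rightarrow> 'n rn"
  have sm: "smooth (q (?P y))" for y using q unfolding symbol_family_def by blast
  have "\<forall>G. \<exists>d. (\<forall>k. hol_bdd (d k)) \<and> (\<forall>k>m - int (length G). d k = (\<lambda>y. 0)) \<and> (\<forall>k y. d k (?P y) = d k y) \<and>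
    (\<forall>l. \<exists>C. \<forall>t. 1 \<le> \<bar>t\<bar> \<longrightarrow> hol r sg (C * inverse (\<bar>t\<bar> ^ Suc l))
      (\<lambda>y. pds G (q (?P y)) (t *\<^sub>R ?e) - (\<Sum>k = - int l..m - int (length G). d k y * complex_of_real t powi k)))"
    using boundary_coefficients[OF q as] by (intro allI)
  from choice[OF this] obtain d where d: "\<forall>G. (\<forall>k. hol_bdd (d G k)) \<and> (\<forall>k>m - int (length G). d G k = (\<lambda>y. 0)) \<and> (\<forall>k y. d G k (?P y) = d G k y) \<and>
    (\<forall>l. \<exists>C. \<forall>t. 1 \<le> \<bar>t\<bar> \<longrightarrow> hol r sg (C * inverse (\<bar>t\<bar> ^ Suc l))
      (\<lambda>y. pds G (q (?P y)) (t *\<^sub>R ?e) - (\<Sum>k = - int l..m - int (length G). d G k y * complex_of_real t powi k)))" ..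
  have d1: "hol_bdd (d G k)" and d2: "m - int (length G) < k \<Longrightarrow> d G k = (\<lambda>y. 0)" and d3: "d G k (?P y) = d G k y" for G k y
    using d by blast+
  have d4: "\<exists>C. \<forall>t. 1 \<le> \<bar>t\<bar> \<longrightarrow> hol r sg (C * inverse (\<bar>t\<bar> ^ Suc l))
      (\<lambda>y. pds G (q (?P y)) (t *\<^sub>R ?e) - (\<Sum>k = - int l..m - int (length G). d G k y * complex_of_real t powi k))" for G l
    using d[rule_format, of G] by (elim conjE allE)
  define w where "w A v k j y = (\<Sum>L | length L = j. complex_of_real (monom_list L v) * d (L @ A) k y) / fact j" for A v k j y
  \<comment> \<open>Derivatives along \<open>L @ A\<close> have no terms above m - length A - j, so
    only j \<le> m - length A - k contributes. The sum is finite and does not depend on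
    \<open>l\<close>, as one family of coefficients requires.\<close>
  define W where "W A v k y = (\<Sum>j\<le>nat (m - int (length A) - k). w A v k j y)" for A v k y
  have w0: "w A v k j y = 0" if "m - int (length A) - int j < k" for A v k j y
  proof -
    have "d (L @ A) k y = 0" if "length L = j" for L
      using d2[of "L @ A" k] \<open>m - int (length A) - int j < k\<close> that by simp
    then show ?thesis unfolding w_def by simp
  qed
  obtain H where H: "H > 0" "\<forall>f B. hol r sg B (\<lambda>x. f (?P x)) \<longrightarrow> holder_norm tan_coords \<tau> f \<le> ennreal (H * B)"
    using holder_norm_of_hol[of \<tau> tan_coords] \<tau> by auto
  have core: "\<exists>C. \<forall>\<xi>. jap (?P \<xi>) \<le> \<bar>\<xi> $ last_coord\<bar> \<longrightarrow>
      hol r sg (C * jap (?P \<xi>) powi (m + int l + 1 - int (length A)) * inverse (\<bar>\<xi> $ last_coord\<bar> ^ Suc l))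
        (\<lambda>y. pds A (q (?P y)) \<xi> - (\<Sum>k = - int l..m - int (length A). W A (?P \<xi>) k y * complex_of_real (\<xi> $ last_coord) powi k))" for A l
  \<comment> \<open>In the first case no terms are subtracted, and the symbol estimate suffices: the
    exponent of the tangential bracket is not positive, and that bracket is dominated by the full
    one.\<close>
  proof (cases "m + int l + 1 - int (length A) \<le> 0")
    case True
    let ?x = "m + int l + 1 - int (length A)"
    obtain C where C: "\<forall>\<xi>. hol r sg (C * jap \<xi> powr (of_int m - real (length A))) (\<lambda>y. pds A (q (?P y)) \<xi>)"
      using q unfolding symbol_family_def by blast
    have C0: "0 \<le> C" by (rule nonneg_of_mult_pos[OF hol_nonneg[OF C[rule_format, of 0]]]) (simp add: jap_pos[THEN less_imp_neq, symmetric])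
    have "jap \<xi> powr (of_int m - real (length A)) \<le> jap (?P \<xi>) powi ?x * inverse (\<bar>\<xi> $ last_coord\<bar> ^ Suc l)"
      if "jap (?P \<xi>) \<le> \<bar>\<xi> $ last_coord\<bar>" for \<xi>
    proof -
      have pos: "0 < jap (?P \<xi>)" "0 < jap \<xi>" "0 < \<bar>\<xi> $ last_coord\<bar>" using jap_pos[of "?P \<xi>"] jap_pos[of \<xi>] that by linarith+
      have "jap \<xi> powr (of_int m - real (length A)) = jap \<xi> powi (m - int (length A))"
        using powr_real_of_int'[of "jap \<xi>" "m - int (length A)"] pos by simp
      also have "\<dots> = jap \<xi> powi (?x - int (Suc l))" by (rule arg_cong[of _ _ "power_int _"]) simp
      also have "\<dots> = inverse (jap \<xi> ^ nat (- ?x)) * inverse (jap \<xi> ^ Suc l)"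
      proof -
        have "jap \<xi> powi ?x = inverse (jap \<xi> ^ nat (- ?x))" using True pos by (auto simp: power_int_def power_inverse)
        then show ?thesis using pos unfolding power_int_diff[OF disjI1[OF less_imp_neq[OF pos(2), symmetric]]] power_int_of_nat by (simp add: divide_inverse)
      qed
      also have "\<dots> \<le> inverse (jap (?P \<xi>) ^ nat (- ?x)) * inverse (\<bar>\<xi> $ last_coord\<bar> ^ Suc l)"
        using pos abs_last_le_jap[of \<xi>] jap_mono[OF norm_proj_le[of tan_coords \<xi>]]
        by (intro mult_mono le_imp_inverse_le power_mono zero_less_power) auto
      also have "inverse (jap (?P \<xi>) ^ nat (- ?x)) = jap (?P \<xi>) powi ?x" using True pos by (auto simp: power_int_def power_inverse)
      finally show ?thesis .
    qed
    then have "hol r sg (C * (jap (?P \<xi>) powi ?x * inverse (\<bar>\<xi> $ last_coord\<bar> ^ Suc l))) (\<lambda>y. pds A (q (?P y)) \<xi>)"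
      if "jap (?P \<xi>) \<le> \<bar>\<xi> $ last_coord\<bar>" for \<xi>
      using that by (intro hol_mono[OF C[rule_format]] mult_left_mono C0) auto
    moreover have "{- int l..m - int (length A)} = {}" using True by auto
    ultimately show ?thesis by (intro exI[of _ C]) (simp add: mult.assoc)
  next
    case False
    let ?a = "length A"
    \<comment> \<open>The Taylor order for which m - length A - N = -(l + 1): the derivatives in the
      remainder then decay exactly as required.\<close>
    define N where "N = nat (m + int l + 1 - int ?a)"
    have N: "int N = m + int l + 1 - int ?a" "N > 0" using False unfolding N_def by auto
    have "\<forall>G. \<exists>C. \<forall>\<xi>. hol r sg (C * jap \<xi> powr (of_int m - real (length G))) (\<lambda>y. pds G (q (?P y)) \<xi>)"
      using q unfolding symbol_family_def by blast
    from choice[OF this] obtain B where B: "\<forall>G \<xi>. hol r sg (B G * jap \<xi> powr (of_int m - real (length G))) (\<lambda>y. pds G (q (?P y)) \<xi>)" ..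
    have B0: "0 \<le> B G" for G by (rule nonneg_of_mult_pos[OF hol_nonneg[OF B[rule_format, of G 0]]]) (simp add: jap_pos[THEN less_imp_neq, symmetric])
    have "\<forall>G. \<exists>C. \<forall>t. 1 \<le> \<bar>t\<bar> \<longrightarrow> hol r sg (C * inverse (\<bar>t\<bar> ^ Suc l))
      (\<lambda>y. pds G (q (?P y)) (t *\<^sub>R ?e) - (\<Sum>k = - int l..m - int (length G). d G k y * complex_of_real t powi k))"
      using d4 by blast
    from choice[OF this] obtain E where E: "\<forall>G t. 1 \<le> \<bar>t\<bar> \<longrightarrow> hol r sg (E G * inverse (\<bar>t\<bar> ^ Suc l))
      (\<lambda>y. pds G (q (?P y)) (t *\<^sub>R ?e) - (\<Sum>k = - int l..m - int (length G). d G k y * complex_of_real t powi k))" ..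
    have E0: "0 \<le> E G" for G using hol_nonneg[OF E[rule_format, of 1 G]] by simp
    define K1 where "K1 = (\<Sum>L | length L = N. B (L @ A))"
    define K2 where "K2 = (\<Sum>j<N. \<Sum>L | length L = j. E (L @ A))"
    have "hol r sg ((K1 + K2) * jap (?P \<xi>) powi (m + int l + 1 - int ?a) * inverse (\<bar>\<xi> $ last_coord\<bar> ^ Suc l))
        (\<lambda>y. pds A (q (?P y)) \<xi> - (\<Sum>k = - int l..m - int ?a. W A (?P \<xi>) k y * complex_of_real (\<xi> $ last_coord) powi k))"
      if le: "jap (?P \<xi>) \<le> \<bar>\<xi> $ last_coord\<bar>" for \<xi>
    proof -
      define t where "t = \<xi> $ last_coord"
      define v where "v = ?P \<xi>"
      define h where "h = jap v"
      have h: "1 \<le> h" "norm v \<le> h" unfolding h_def by (rule jap_ge_1, rule jap_ge_norm)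
      have t: "1 \<le> \<bar>t\<bar>" using le h(1) unfolding h_def v_def t_def by linarith
      have \<xi>: "\<xi> = t *\<^sub>R ?e + v" unfolding t_def v_def by (rule decompose_last)
      \<comment> \<open>All powers of \<xi>' up to \<open>N\<close> are absorbed by the N-th power
        of its bracket, which is the power in the condition.\<close>
      have vh: "norm v ^ j \<le> h ^ N" if "j \<le> N" for j
        using power_mono[OF h(2), of j] power_increasing[OF that h(1)] by simp
      define I where "I = inverse (\<bar>t\<bar> ^ Suc l)"
      have I0: "0 \<le> I" unfolding I_def by simp
      have r1: "hol r sg (norm v ^ N * (\<Sum>L | length L = N. B (L @ A) * I)) (\<lambda>y. pds A (q (?P y)) (t *\<^sub>R ?e + v) -
        (\<Sum>j<N. (\<Sum>L | length L = j. complex_of_real (monom_list L v) * pds L (pds A (q (?P y))) (t *\<^sub>R ?e)) / fact j))"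
      proof (rule hol_taylor_lists[where f = "\<lambda>y. pds A (q (?P y))" and b = "\<lambda>y. t *\<^sub>R ?e", OF N(2) smooth_pds[OF sm]])
        fix \<theta> :: real and L :: "'n list" assume L: "length L = N"
        let ?\<zeta> = "t *\<^sub>R ?e + \<theta> *\<^sub>R v"
        \<comment> \<open>A tangential shift leaves the normal component unchanged, so the bracket
          is at least |t| along the whole segment.\<close>
        have "?\<zeta> $ last_coord = t" unfolding v_def by (simp add: axis_def)
        then have tj: "\<bar>t\<bar> \<le> jap ?\<zeta>" using abs_last_le_jap[of ?\<zeta>] by (simp only:)
        have "jap ?\<zeta> powr (of_int m - real (length (L @ A))) = jap ?\<zeta> powi (- int (Suc l))"
        proof -
          have "of_int m - real (length (L @ A)) = of_int (- int (Suc l))" using L N(1) by simp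
          then show ?thesis using powr_real_of_int'[of "jap ?\<zeta>" "- int (Suc l)"] jap_pos[of ?\<zeta>] by simp
        qed
        also have "\<dots> = inverse (jap ?\<zeta> ^ Suc l)" by (simp only: power_int_minus power_int_of_nat)
        also have "\<dots> \<le> I" unfolding I_def using tj t by (intro le_imp_inverse_le power_mono zero_less_power) auto
        finally show "hol r sg (B (L @ A) * I) (\<lambda>y. pds L (pds A (q (?P y))) ?\<zeta>)"
          unfolding pds_append[symmetric] by (intro hol_mono[OF B[rule_format]] mult_left_mono B0)
      qed
      have r2: "hol r sg (\<Sum>j<N. \<Sum>L | length L = j. h ^ N * (E (L @ A) * I)) (\<lambda>y. \<Sum>j<N. \<Sum>L | length L = j. (complex_of_real (monom_list L v) / fact j) *
         (pds L (pds A (q (?P y))) (t *\<^sub>R ?e) - (\<Sum>k = - int l..m - int (length (L @ A)). d (L @ A) k y * complex_of_real t powi k)))"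
      proof (intro hol_sum)
        fix j and L :: "'n list" assume j: "j \<in> {..<N}" and "L \<in> {L. length L = j}"
        then have L: "length L = j" by simp
        have "\<bar>monom_list L v\<bar> \<le> h ^ N" using abs_monom_list_le[of L v] vh[of j] L j by simp
        moreover have "cmod (complex_of_real (monom_list L v) / fact j) \<le> \<bar>monom_list L v\<bar>"
          by (simp add: norm_divide divide_le_eq_1 mult_left_le fact_ge_1 divide_le_eq)
            (metis abs_ge_zero fact_ge_1 mult.right_neutral mult_left_mono)
        ultimately have "cmod (complex_of_real (monom_list L v) / fact j) * (E (L @ A) * I) \<le> h ^ N * (E (L @ A) * I)"
          using E0 I0 by (intro mult_right_mono mult_nonneg_nonneg) auto
        from hol_mono[OF hol_cmult[OF E[rule_format, OF t, of "L @ A", folded I_def]] this]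
        show "hol r sg (h ^ N * (E (L @ A) * I)) (\<lambda>y. (complex_of_real (monom_list L v) / fact j) *
         (pds L (pds A (q (?P y))) (t *\<^sub>R ?e) - (\<Sum>k = - int l..m - int (length (L @ A)). d (L @ A) k y * complex_of_real t powi k)))"
          unfolding pds_append .
      qed
      have sw: "(\<Sum>j<N. (\<Sum>L | length L = j. (complex_of_real (monom_list L v) / fact j) * (\<Sum>k = - int l..m - int (length (L @ A)). d (L @ A) k y * complex_of_real t powi k))) =
        (\<Sum>k = - int l..m - int ?a. W A v k y * complex_of_real t powi k)" for y
      proof -
        \<comment> \<open>The range of \<open>k\<close> is made independent of \<open>L\<close> by
          adding terms whose coefficients vanish, after which the sums can be interchanged.\<close>
        have e: "(\<Sum>k = - int l..m - int (length (L @ A)). d (L @ A) k y * complex_of_real t powi k) =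
           (\<Sum>k = - int l..m - int ?a. d (L @ A) k y * complex_of_real t powi k)" for L
        proof (rule sum.mono_neutral_left)
          show "\<forall>k\<in>{- int l..m - int ?a} - {- int l..m - int (length (L @ A))}. d (L @ A) k y * complex_of_real t powi k = 0"
            using d2[of "L @ A"] by auto
        qed auto
        have "(\<Sum>j<N. (\<Sum>L | length L = j. (complex_of_real (monom_list L v) / fact j) * (\<Sum>k = - int l..m - int (length (L @ A)). d (L @ A) k y * complex_of_real t powi k))) =
          (\<Sum>j<N. \<Sum>k = - int l..m - int ?a. w A v k j y * complex_of_real t powi k)"
          unfolding e w_def sum_distrib_left sum_distrib_right sum_divide_distrib
          by (intro sum.cong refl, subst sum.swap) (simp add: mult_ac divide_inverse)
        also have "\<dots> = (\<Sum>k = - int l..m - int ?a. \<Sum>j<N. w A v k j y * complex_of_real t powi k)" by (rule sum.swap)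
        also have "\<dots> = (\<Sum>k = - int l..m - int ?a. W A v k y * complex_of_real t powi k)"
        proof (rule sum.cong)
          fix k assume k: "k \<in> {- int l..m - int ?a}"
          \<comment> \<open>For k \<ge> -l the last index in \<open>W\<close> is below
            \<open>N\<close>; the remaining Taylor terms vanish by \<open>w0\<close>.\<close>
          have "(\<Sum>j<N. w A v k j y) = W A v k y"
            unfolding W_def
          proof (rule sum.mono_neutral_right)
            show "{..nat (m - int ?a - k)} \<subseteq> {..<N}" using k N(1) by auto
            show "\<forall>j\<in>{..<N} - {..nat (m - int ?a - k)}. w A v k j y = 0" by (auto intro!: w0)
          qed simp
          then show "(\<Sum>j<N. w A v k j y * complex_of_real t powi k) = W A v k y * complex_of_real t powi k"
            by (simp only: sum_distrib_right[symmetric])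
        qed simp
        finally show ?thesis .
      qed
      have "hol r sg (norm v ^ N * (\<Sum>L | length L = N. B (L @ A) * I) + (\<Sum>j<N. \<Sum>L | length L = j. h ^ N * (E (L @ A) * I)))
        (\<lambda>y. pds A (q (?P y)) (t *\<^sub>R ?e + v) - (\<Sum>k = - int l..m - int ?a. W A v k y * complex_of_real t powi k))"
        using hol_add[OF r1 r2] unfolding right_diff_distrib sum_subtractf sw sum_divide_distrib by simp
      moreover have "norm v ^ N * (\<Sum>L | length L = N. B (L @ A) * I) + (\<Sum>j<N. \<Sum>L | length L = j. h ^ N * (E (L @ A) * I)) \<le>
        h ^ N * (K1 * I) + h ^ N * (K2 * I)"
        unfolding K1_def K2_def sum_distrib_right[symmetric] sum_distrib_left[symmetric]
        using vh[of N] B0 E0 I0 by (intro add_mono mult_right_mono mult_nonneg_nonneg sum_nonneg) auto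
      moreover have "h ^ N * (K1 * I) + h ^ N * (K2 * I) = (K1 + K2) * h powi (m + int l + 1 - int ?a) * I"
        unfolding N(1)[symmetric] power_int_of_nat by (simp add: algebra_simps)
      ultimately have "hol r sg ((K1 + K2) * h powi (m + int l + 1 - int ?a) * I)
        (\<lambda>y. pds A (q (?P y)) (t *\<^sub>R ?e + v) - (\<Sum>k = - int l..m - int ?a. W A v k y * complex_of_real t powi k))"
        using hol_mono by (simp only:)
      then show ?thesis unfolding \<xi>[symmetric] unfolding I_def h_def v_def t_def .
    qed
    then show ?thesis by blast
  qed
  define s :: "int \<Rightarrow> 'n multiindex \<Rightarrow> 'n rn \<Rightarrow> 'n rn \<Rightarrow> complex" where
    "s k \<alpha> x \<xi> = (- \<i>) ^ mi_order \<alpha> * W (mi_list \<alpha>) \<xi> k x" for k \<alpha> x \<xi>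
  have s1: "smooth_on tan_coords (s k \<alpha> x)" for k \<alpha> x
  proof -
    have "smooth (\<lambda>\<xi>. s k \<alpha> x (?P \<xi>))"
      unfolding s_def W_def w_def divide_inverse
      by (intro smooth_mult smooth_sum smooth_const smooth_monom_list_proj)
    then show ?thesis unfolding smooth_Ck smooth_on_def[of tan_coords] Ck_comp_proj .
  qed
  have W3: "W A \<xi> k (?P y) = W A \<xi> k y" for A \<xi> k y unfolding W_def w_def d3 ..
  have s2: "(\<lambda>x. s k \<alpha> x \<xi>) \<in> holder_space tan_coords \<tau>" for k \<alpha> \<xi>
  proof -
    have "hol_bdd (\<lambda>x. s k \<alpha> (?P x) \<xi>)"
      unfolding s_def W3 unfolding W_def w_def divide_inverse by (intro hol_bdd_mult hol_bdd_sum hol_bdd_const d1)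
    then obtain B where "hol r sg B (\<lambda>x. s k \<alpha> (?P x) \<xi>)" unfolding hol_bdd_def by blast
    from H(2)[rule_format, of B "\<lambda>x. s k \<alpha> x \<xi>", OF this]
    show ?thesis unfolding holder_space_def by (auto intro: le_less_trans)
  qed
  have s3: "\<exists>C. \<forall>\<xi>. \<bar>\<xi> $ last_coord\<bar> \<ge> jap (tan_part \<xi>) \<longrightarrow>
          holder_norm tan_coords \<tau>
            (\<lambda>x'. of_real (\<xi> $ last_coord) ^ l * D_mdiff \<alpha> (q x') \<xi>
               - (\<Sum>k = - int l..m - int (mi_order \<alpha>).
                    s k \<alpha> x' (tan_part \<xi>) * of_real (\<xi> $ last_coord) powi (k + int l)))
          \<le> ennreal (C * jap (tan_part \<xi>) powi (m + int l + 1 - int (mi_order \<alpha>))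
                       * inverse \<bar>\<xi> $ last_coord\<bar>)" for \<alpha> l
  proof -
    let ?A = "mi_list \<alpha>" and ?a = "mi_order \<alpha>"
    obtain C where C: "\<forall>\<xi>. jap (?P \<xi>) \<le> \<bar>\<xi> $ last_coord\<bar> \<longrightarrow>
      hol r sg (C * jap (?P \<xi>) powi (m + int l + 1 - int (length ?A)) * inverse (\<bar>\<xi> $ last_coord\<bar> ^ Suc l))
        (\<lambda>y. pds ?A (q (?P y)) \<xi> - (\<Sum>k = - int l..m - int (length ?A). W ?A (?P \<xi>) k y * complex_of_real (\<xi> $ last_coord) powi k))"
      using core[of l ?A] ..
    have "holder_norm tan_coords \<tau>
            (\<lambda>x'. of_real (\<xi> $ last_coord) ^ l * D_mdiff \<alpha> (q x') \<xi>
               - (\<Sum>k = - int l..m - int ?a. s k \<alpha> x' (?P \<xi>) * of_real (\<xi> $ last_coord) powi (k + int l)))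
          \<le> ennreal (H * C * jap (?P \<xi>) powi (m + int l + 1 - int ?a) * inverse \<bar>\<xi> $ last_coord\<bar>)"
      if le: "jap (?P \<xi>) \<le> \<bar>\<xi> $ last_coord\<bar>" for \<xi>
    proof -
      define t where "t = \<xi> $ last_coord"
      have t: "1 \<le> \<bar>t\<bar>" using le jap_ge_1[of "?P \<xi>"] unfolding t_def by linarith
      then have t0: "t \<noteq> 0" by auto
      define J where "J = jap (?P \<xi>) powi (m + int l + 1 - int ?a)"
      let ?F = "\<lambda>x. complex_of_real t ^ l * D_mdiff \<alpha> (q x) \<xi> - (\<Sum>k = - int l..m - int ?a. s k \<alpha> x (?P \<xi>) * complex_of_real t powi (k + int l))"
      have "hol r sg (C * J * inverse (\<bar>t\<bar> ^ Suc l))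
        (\<lambda>y. pds ?A (q (?P y)) \<xi> - (\<Sum>k = - int l..m - int ?a. W ?A (?P \<xi>) k y * complex_of_real t powi k))"
        using C[rule_format, OF le] unfolding length_mi_list J_def t_def .
      from hol_cmult[OF this, of "complex_of_real t ^ l * (- \<i>) ^ ?a"]
      have "hol r sg (\<bar>t\<bar> ^ l * (C * J * inverse (\<bar>t\<bar> ^ Suc l))) (\<lambda>y. complex_of_real t ^ l * (- \<i>) ^ ?a *
        (pds ?A (q (?P y)) \<xi> - (\<Sum>k = - int l..m - int ?a. W ?A (?P \<xi>) k y * complex_of_real t powi k)))"
        by (simp add: norm_mult norm_power)
      moreover have "\<bar>t\<bar> ^ l * (C * J * inverse (\<bar>t\<bar> ^ Suc l)) = C * J * inverse \<bar>t\<bar>" using t0 by simp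
      moreover have "complex_of_real t ^ l * (- \<i>) ^ ?a *
        (pds ?A (q (?P y)) \<xi> - (\<Sum>k = - int l..m - int ?a. W ?A (?P \<xi>) k y * complex_of_real t powi k)) = ?F (?P y)" for y
      proof -
        have "complex_of_real t powi (k + int l) = complex_of_real t ^ l * complex_of_real t powi k" for k
          using t0 by (simp add: power_int_add)
        then show ?thesis unfolding D_mdiff_def mdiff_eq_pds s_def W3 right_diff_distrib sum_distrib_left by (simp add: mult_ac)
      qed
      ultimately have "hol r sg (C * J * inverse \<bar>t\<bar>) (\<lambda>y. ?F (?P y))" by (simp only:)
      from H(2)[rule_format, of "C * J * inverse \<bar>t\<bar>" ?F, OF this]
      show ?thesis unfolding J_def t_def by (simp only: mult.assoc)
    qed
    then show ?thesis unfolding tan_part_eq_proj by blast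
  qed
  show ?thesis
    unfolding transmission_condition_def
    by (rule exI[of _ s]) (intro conjI allI ballI s1 s2 s3)
qed

end

theorem theorem8p4:
  fixes \<kappa> :: "'n::{finite,linorder} rn \<Rightarrow> 'n rn"
    and m :: int and \<tau> :: real
    and p p_tilde :: "'n rn \<Rightarrow> 'n rn \<Rightarrow> complex"
  assumes "bounded_smooth_diffeo \<kappa>"
    and "\<kappa> ` {x. x $ last_coord = 0} = {x. x $ last_coord = 0}"
    and "\<kappa> ` {x. x $ last_coord > 0} = {x. x $ last_coord > 0}"
    and "\<tau> > 0" and "\<tau> \<notin> \<nat>"
    and "p \<in> symbol_class \<tau> (of_int m)"
    and "transmission_condition \<tau> m p"
    and "p_tilde \<in> symbol_class \<tau> (of_int m)"
    and "\<And>u. u \<in> schwartz \<Longrightarrow> psdo p_tilde u = psdo p (u \<circ> \<kappa>) \<circ> inv \<kappa>"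
  shows "transmission_condition \<tau> m p_tilde"
proof -
  define r where "r = nat \<lfloor>\<tau>\<rfloor>"
  define sg where "sg = \<tau> - real r"
  \<comment> \<open>Since \<tau> is positive and not a natural number, \<open>r\<close> is its
    integer part and the fractional part \<open>sg\<close> is strictly positive, as
    \<open>holder_exponent\<close> demands.\<close>
  have "real r \<noteq> \<tau>" using assms(5) by (auto simp: Nats_def)
  moreover have "real r = of_int \<lfloor>\<tau>\<rfloor>" unfolding r_def using assms(4) by simp
  ultimately have "0 < sg" "sg \<le> 1" unfolding sg_def by linarith+
  then interpret half_space_diffeo sg r \<kappa> using assms(1-3) by unfold_locales
  have sm: "smooth (p x)" "smooth (p_tilde x)" for x using assms(6,8) unfolding symbol_class_def by blast+
  have bp: "proj tan_coords (base_point y) = base_point y" for y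
    using base_point_last[of y] by (auto simp: vec_eq_iff)
  have qt: "symbol_family m (\<lambda>\<xi> y. p_tilde (proj tan_coords y) \<xi>)"
    by (rule symbol_family_of_class[OF assms(8) r_def sg_def hol_comp_proj])
  have "ray_expansion l (\<lambda>t y. pds G (p_tilde (proj tan_coords y)) (t *\<^sub>R axis last_coord 1))" for G l
    by (rule ray_expansion_transformed[OF assms(9) sm symbol_family_of_class[OF assms(6) r_def sg_def hol_base_point] qt
      transmission_expansion[OF assms(7) sm(1) r_def sg_def hol_base_point bp]])
  then show ?thesis by (rule transmission_condition_of_asym[OF r_def sg_def qt])
qed

end
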